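(* Let $M=M^\star+H\in\mathbb{R}^{n\times n}$, where $M^\star$ is symmetric of rank $r$ and $H$ is an (asymmetric) noise matrix with independent entries satisfying the noise conditions with parameters $\sigma_{\min},\sigma,L$, and let $M^{(1)}=M^\star+W_1$, $M^{(2)}=M^\star+W_2$ be two extra observations, where $W_1,W_2$ are symmetric noise matrices satisfying the noise conditions (independent entries on and above the diagonal) and $H,W_1,W_2$ are independent. Assume $\sigma\le L\le C_0\sigma\sqrt{n/(\bar\mu\log n)}$ for a universal constant $C_0>0$ and that, for a sufficiently large constant $C>0$, $$\lambda^\star_{\min}\ge C\max\{\sigma\sqrt{n\log^3n},\ L\log^3n\},\qquad \delta^\star_{\min}\ge C\kappa^3r^2\max\Bigl\{\frac{\bar\mu L\log^5n}{n},\ \sigma\log^{7/2}n\Bigr\}.$$ Let $U=(u_1,\dots,u_r)$ and $\Lambda=\mathrm{diag}(\lambda_1,\dots,\lambda_r)$ be the leading right eigenvectors and eigenvalues of $M$, and let $\widehat\Psi$ be the correction matrix built from $U,\Lambda,M^{(1)},M^{(2)}$. Then with probability at least $1-O(n^{-16})$, $$\bigl\|U\widehat\Psi\Lambda\widehat\Psi^\top U^\top-M^\star\bigr\|_\infty\lesssim\sigma\kappa^2r^2\sqrt{\frac{\bar\mu\log^7n}{n}}+\frac{\bar\mu}{n}\,\frac{\delta^\star_{\max}}{\delta^\star_{\min}}\,\sigma\kappa^3r^3\sqrt{\log^7n}.$$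
   Context: Asymptotic conventions: $n\to\infty$ and all other parameters may depend on $n$; $f\lesssim g$ (or $f=O(g)$) means $f\le C'g$ for all large $n$ with $C'$ not depending on the parameters. For matrices, $\|A\|_\infty=\max_{i,j}|A_{ij}|$. Noise conditions (for $H$: all $n^2$ entries independent; for $W_i$: symmetric with independent entries on and above the diagonal): each entry $X$ satisfies $0<\sigma_{\min}^2\le\mathbb{E}X^2\le\sigma^2$ with $\sigma^2/\sigma_{\min}^2$ bounded above and below by constants, $|X|\le L$ a.s., and $X,-X$ have the same distribution. Low-rank structure: $M^\star=U^\star\Lambda^\star U^{\star\top}$, $U^\star=(u_1^\star,\dots,u_r^\star)$ with orthonormal columns, $\Lambda^\star=\mathrm{diag}(\lambda_1^\star,\dots,\lambda_r^\star)$, $|\lambda_1^\star|\ge\dots\ge|\lambda_r^\star|>0$; $\lambda^\star_{\min}=|\lambda_r^\star|$, $\kappa=|\lambda_1^\star|/|\lambda_r^\star|$; $\bar\mu=\frac nr\max_i\|U^\star_{i,\cdot}\|_2^2$. Eigengaps: $\delta_l^\star=\min_{1\le k\le r,\,k\ne l}|\lambda_l^\star-\lambda_k^\star|$ if $r>1$ and $\delta_l^\star=\infty$ if $r=1$; $\delta^\star_{\min}=\min_{l\in[r]}\delta_l^\star$, $\delta^\star_{\max}=\max_{l\in[r]}\delta_l^\star$. Eigenvectors of $M$: $Mu_l=\lambda_lu_l$, $\|u_l\|_2=1$, where $\lambda_1,\dots,\lambda_r$ are the $r$ leading (in magnitude) eigenvalues of $M$, indexed in correspondence with $\lambda_1^\star,\dots,\lambda_r^\star$.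 Correction matrix: $G=\bigl(\Lambda^{-1}U^\top M^{(1)}M^{(2)}U\Lambda^{-1}\bigr)^{-1}$, $G_{\mathrm{symm}}=\frac12(G+G^\top)$ with spectral decomposition $G_{\mathrm{symm}}=\widehat\Gamma\widehat\Sigma^{-2}\widehat\Gamma^\top$ ($\widehat\Gamma$ orthogonal, $\widehat\Sigma$ diagonal with positive entries), and $\widehat\Psi=\widehat\Gamma\widehat\Sigma^{-1}\widehat\Gamma^\top$, i.e. $\widehat\Psi=G_{\mathrm{symm}}^{1/2}$. *)

theory Defs
  imports
    "HOL-Probability.Probability"
    "Jordan_Normal_Form.Matrix"
    "Jordan_Normal_Form.Char_Poly"
begin

text \<open>
  Matrices are those of \<open>Jordan_Normal_Form\<close>, since the dimension \<open>n\<close> tends to infinity inside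
  the statement. Rows, columns and the eigenpair index are counted from \<open>0\<close>, so the paper's
  \<open>\<lambda>\<^sub>1, \<dots>, \<lambda>\<^sub>r\<close> are \<open>lam 0, \<dots>, lam (r - 1)\<close>.
\<close>

definition vec_l2 :: "real Matrix.vec \<Rightarrow> real" where
  "vec_l2 v = sqrt (scalar_prod v v)"

definition mat_max :: "real Matrix.mat \<Rightarrow> real" where
  "mat_max A = Max (abs ` elements_mat A)"

subsection \<open>Noise\<close>

definition noise_entry ::
  "'a measure \<Rightarrow> real \<Rightarrow> real \<Rightarrow> real \<Rightarrow> ('a \<Rightarrow> real) \<Rightarrow> bool" where
  "noise_entry P \<sigma>min \<sigma> L X \<longleftrightarrow>
     X \<in> borel_measurable P \<and>
     \<sigma>min\<^sup>2 \<le> (\<integral>\<omega>. (X \<omega>)\<^sup>2 \<partial>P) \<and> (\<integral>\<omega>. (X \<omega>)\<^sup>2 \<partial>P) \<le> \<sigma>\<^sup>2 \<and>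
     (AE \<omega> in P. \<bar>X \<omega>\<bar> \<le> L) \<and>
     distr P borel X = distr P borel (\<lambda>\<omega>. - X \<omega>)"

definition asymmetric_noise ::
  "'a measure \<Rightarrow> nat \<Rightarrow> real \<Rightarrow> real \<Rightarrow> real \<Rightarrow> ('a \<Rightarrow> real Matrix.mat) \<Rightarrow> bool" where
  "asymmetric_noise P n \<sigma>min \<sigma> L H \<longleftrightarrow>
     (\<forall>\<omega>\<in>space P. H \<omega> \<in> carrier_mat n n) \<and>
     (\<forall>i<n. \<forall>j<n. noise_entry P \<sigma>min \<sigma> L (\<lambda>\<omega>. H \<omega> $$ (i, j))) \<and>
     prob_space.indep_vars P (\<lambda>_. borel) (\<lambda>p \<omega>. H \<omega> $$ p) {(i, j). i < n \<and> j < n}"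

definition symmetric_noise ::
  "'a measure \<Rightarrow> nat \<Rightarrow> real \<Rightarrow> real \<Rightarrow> real \<Rightarrow> ('a \<Rightarrow> real Matrix.mat) \<Rightarrow> bool" where
  "symmetric_noise P n \<sigma>min \<sigma> L W \<longleftrightarrow>
     (\<forall>\<omega>\<in>space P. W \<omega> \<in> carrier_mat n n \<and> transpose_mat (W \<omega>) = W \<omega>) \<and>
     (\<forall>i<n. \<forall>j<n. noise_entry P \<sigma>min \<sigma> L (\<lambda>\<omega>. W \<omega> $$ (i, j))) \<and>
     prob_space.indep_vars P (\<lambda>_. borel) (\<lambda>p \<omega>. W \<omega> $$ p) {(i, j). i \<le> j \<and> j < n}"

text \<open>Mutual independence of random matrices, each viewed as one random element of the product
  space of its \<open>n\<^sup>2\<close> entries.\<close>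

definition independent_matrices ::
  "'a measure \<Rightarrow> nat \<Rightarrow> ('a \<Rightarrow> real Matrix.mat) list \<Rightarrow> bool" where
  "independent_matrices P n Xs \<longleftrightarrow>
     prob_space.indep_vars P (\<lambda>_. PiM ({..<n} \<times> {..<n}) (\<lambda>_. borel))
       (\<lambda>k \<omega>. \<lambda>p\<in>{..<n} \<times> {..<n}. (Xs ! k) \<omega> $$ p) {..<length Xs}"

subsection \<open>Low-rank structure\<close>

definition low_rank_factors :: "nat \<Rightarrow> nat \<Rightarrow> real Matrix.mat \<Rightarrow> (nat \<Rightarrow> real) \<Rightarrow> bool" where
  "low_rank_factors n r U lam \<longleftrightarrow>
     1 \<le> r \<and> U \<in> carrier_mat n r \<and> transpose_mat U * U = 1\<^sub>m r \<and>
     (\<forall>k l. k \<le> l \<and> l < r \<longrightarrow> \<bar>lam l\<bar> \<le> \<bar>lam k\<bar>) \<and> 0 < \<bar>lam (r - 1)\<bar>"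

definition low_rank_mat :: "nat \<Rightarrow> real Matrix.mat \<Rightarrow> (nat \<Rightarrow> real) \<Rightarrow> real Matrix.mat" where
  "low_rank_mat r U lam = U * mat_diag r lam * transpose_mat U"

definition lam_min :: "nat \<Rightarrow> (nat \<Rightarrow> real) \<Rightarrow> real" where
  "lam_min r lam = \<bar>lam (r - 1)\<bar>"

definition cond_num :: "nat \<Rightarrow> (nat \<Rightarrow> real) \<Rightarrow> real" where
  "cond_num r lam = \<bar>lam 0\<bar> / \<bar>lam (r - 1)\<bar>"

definition incoherence :: "nat \<Rightarrow> nat \<Rightarrow> real Matrix.mat \<Rightarrow> real" where
  "incoherence n r U = real n / real r * Max ((\<lambda>i. (vec_l2 (Matrix.row U i))\<^sup>2) ` {..<n})"

definition eigengap :: "nat \<Rightarrow> (nat \<Rightarrow> real) \<Rightarrow> nat \<Rightarrow> ereal" where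
  "eigengap r lam l =
     (if r > 1 then ereal (Min ((\<lambda>k. \<bar>lam l - lam k\<bar>) ` ({..<r} - {l}))) else \<infinity>)"

definition gap_min :: "nat \<Rightarrow> (nat \<Rightarrow> real) \<Rightarrow> ereal" where
  "gap_min r lam = Min (eigengap r lam ` {..<r})"

definition gap_max :: "nat \<Rightarrow> (nat \<Rightarrow> real) \<Rightarrow> ereal" where
  "gap_max r lam = Max (eigengap r lam ` {..<r})"

text \<open>For \<open>r = 1\<close> both gaps are infinite and their quotient is read as \<open>1\<close>. Any other value in
  \<open>[0, 1]\<close> gives an equivalent error bound: then \<open>\<kappa> = 1\<close> and \<open>\<mu> \<le> n\<close>, so \<open>\<mu> / n \<le> sqrt (\<mu> / n)\<close>
  and the term carrying the quotient is dominated by the other term.\<close>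

definition gap_ratio :: "nat \<Rightarrow> (nat \<Rightarrow> real) \<Rightarrow> real" where
  "gap_ratio r lam = (if r > 1 then real_of_ereal (gap_max r lam / gap_min r lam) else 1)"

subsection \<open>Leading eigenpairs and the correction matrix\<close>

text \<open>
  \<open>M\<close> is not symmetric, so its spectrum is the multiset of complex roots of its characteristic
  polynomial, and "the \<open>r\<close> leading eigenvalues are \<open>lam 0, \<dots>, lam (r - 1)\<close>" includes that these
  are real. Their order is left free, as are the signs of the eigenvectors: permuting the
  eigenpairs or flipping signs of columns of \<open>U\<close> conjugates \<open>\<Lambda>\<close>, \<open>G\<close> and \<open>\<Psi>\<close> accordingly and
  leaves \<open>U \<Psi> \<Lambda> \<Psi>\<^sup>T U\<^sup>T\<close> unchanged. A claim about all orders thus covers every way of matching the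
  eigenvalues of \<open>M\<close> with those of the ground truth.
\<close>

definition leading_eigenpairs ::
  "nat \<Rightarrow> nat \<Rightarrow> real Matrix.mat \<Rightarrow> real Matrix.mat \<Rightarrow> (nat \<Rightarrow> real) \<Rightarrow> bool" where
  "leading_eigenpairs n r M U lam \<longleftrightarrow>
     U \<in> carrier_mat n r \<and>
     (\<forall>l<r. eigenvector M (Matrix.col U l) (lam l) \<and> vec_l2 (Matrix.col U l) = 1) \<and>
     (\<exists>rest :: complex list.
        char_poly (map_mat complex_of_real M) =
          (\<Prod>e\<leftarrow>map (\<lambda>l. complex_of_real (lam l)) [0..<r] @ rest. [:- e, 1:]) \<and>
        (\<forall>z\<in>set rest. \<forall>l<r. cmod z \<le> \<bar>lam l\<bar>))"

definition is_inverse_mat :: "nat \<Rightarrow> real Matrix.mat \<Rightarrow> real Matrix.mat \<Rightarrow> bool" where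
  "is_inverse_mat r A B \<longleftrightarrow>
     A \<in> carrier_mat r r \<and> B \<in> carrier_mat r r \<and> inverts_mat A B \<and> inverts_mat B A"

text \<open>A relation, because the two inverses and the positive spectral decomposition need not exist;
  \<open>\<Psi>\<close> is unique whenever they do.\<close>

definition is_correction ::
  "nat \<Rightarrow> real Matrix.mat \<Rightarrow> (nat \<Rightarrow> real) \<Rightarrow> real Matrix.mat \<Rightarrow> real Matrix.mat
     \<Rightarrow> real Matrix.mat \<Rightarrow> bool" where
  "is_correction r U lam M1 M2 \<Psi> \<longleftrightarrow>
     (\<exists>Linv G \<Gamma> s.
        is_inverse_mat r (mat_diag r lam) Linv \<and>
        is_inverse_mat r (Linv * transpose_mat U * M1 * M2 * U * Linv) G \<and>
        \<Gamma> \<in> carrier_mat r r \<and> transpose_mat \<Gamma> * \<Gamma> = 1\<^sub>m r \<and> (\<forall>l<r. 0 < s l) \<and>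
        (1 / 2) \<cdot>\<^sub>m (G + transpose_mat G)
          = \<Gamma> * mat_diag r (\<lambda>l. 1 / (s l)\<^sup>2) * transpose_mat \<Gamma> \<and>
        \<Psi> = \<Gamma> * mat_diag r (\<lambda>l. 1 / s l) * transpose_mat \<Gamma>)"

subsection \<open>Assumptions and error bound\<close>

definition observation_model ::
  "'a measure \<Rightarrow> nat \<Rightarrow> nat \<Rightarrow> real \<Rightarrow> real \<Rightarrow> real \<Rightarrow> real Matrix.mat \<Rightarrow> (nat \<Rightarrow> real)
     \<Rightarrow> ('a \<Rightarrow> real Matrix.mat) \<Rightarrow> ('a \<Rightarrow> real Matrix.mat) \<Rightarrow> ('a \<Rightarrow> real Matrix.mat) \<Rightarrow> bool" where
  "observation_model P n r \<sigma>min \<sigma> L U lam H W1 W2 \<longleftrightarrow>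
     prob_space P \<and> low_rank_factors n r U lam \<and> 0 < \<sigma>min \<and> 0 < \<sigma> \<and>
     asymmetric_noise P n \<sigma>min \<sigma> L H \<and>
     symmetric_noise P n \<sigma>min \<sigma> L W1 \<and> symmetric_noise P n \<sigma>min \<sigma> L W2 \<and>
     independent_matrices P n [H, W1, W2]"

definition error_bound ::
  "nat \<Rightarrow> nat \<Rightarrow> real \<Rightarrow> real Matrix.mat \<Rightarrow> (nat \<Rightarrow> real) \<Rightarrow> real" where
  "error_bound n r \<sigma> U lam =
     (let \<kappa> = cond_num r lam; \<mu> = incoherence n r U in
        \<sigma> * \<kappa>^2 * real r^2 * sqrt (\<mu> * ln (real n)^7 / real n) +
        \<mu> / real n * gap_ratio r lam * \<sigma> * \<kappa>^3 * real r^3 * sqrt (ln (real n)^7))"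

end

theory Submission
  imports Defs "HOL-Complex_Analysis.Complex_Analysis" "HOL-Real_Asymp.Real_Asymp"
    "Jordan_Normal_Form.Schur_Decomposition"
begin

text \<open>Three ideas drive the proof. First, the forms \<open>a\<^sup>T H\<^sup>s U\<^sup>\<star>\<close>, with \<open>a\<close> a unit vector or a column
 of \<open>U\<^sup>\<star>\<close>, are roots-of-unity averages of resolvent forms. Revealing \<open>H\<close> column by column, each
 resolvent changes by a rank-one update which is odd to first order in the new column, so on the event
 that all earlier updates were small an exponential of the deviation is almost a supermartingale.
 Operator norms are bounded by a trace moment recursion obtained from sign flips, and forms in \<open>W\<^sub>1\<close>,
 \<open>W\<^sub>2\<close> by Bernstein's inequality given the other matrices.

 Second, Rouche's theorem along \<open>M\<^sup>\<star> + t H\<close> puts exactly one eigenvalue of \<open>M\<close> near each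
 \<open>\<lambda>\<^sup>\<star>\<^sub>l\<close>, and the eigenvectors are Neumann series in \<open>H / \<lambda>\<^sub>l\<close> applied to \<open>U\<^sup>\<star> Z\<close>, where the eigengaps
 make \<open>Z\<close> almost orthogonal and almost commuting with the eigenvalues.

 Third, \<open>G\<^sup>-\<^sup>1 = Z\<^sup>T Z + N\<close> with \<open>N\<close> small. A commutator identity transfers the almost commutation
 from \<open>\<Psi>\<^sup>2\<close> to its square root \<open>\<Psi>\<close>, so \<open>Z \<Psi> \<Lambda> \<Psi> Z\<^sup>T\<close> is close to \<open>\<Lambda>\<^sup>\<star>\<close> in Frobenius norm;
 multiplying by the rows of \<open>U\<^sup>\<star>\<close> gives the entrywise bound.

 Notation: \<open>sg\<close> and \<open>ka\<close> are \<open>\<sigma>\<close> and \<open>\<kappa>\<close>, \<open>om\<close> is a sample point, \<open>rh / 8\<close> bounds the noise in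
 operator norm, \<open>e0\<close> is the size of its bilinear forms, and \<open>opb A c\<close> states that \<open>A\<close> has norm at
 most \<open>c\<close>.\<close>

text \<open>The obstacle is that \<open>M\<close> is not symmetric, so neither Weyl's inequality nor
  the Davis-Kahan theorem applies, and the eigengaps may be far smaller than the noise norm. What
  saves the argument is that noise between signal directions is much weaker than its norm: the
  entries of \<open>tr Us * H ^\<^sub>m Suc s * Us\<close> are at most \<open>e0 * rh ^ s\<close>,
  with \<open>e0\<close> of order \<open>sg * sqrt (r * ln n)\<close>, whereas \<open>rh\<close> is
  of order \<open>sg * sqrt (n * ln n ^ 3)\<close> or \<open>L * ln n ^ 3\<close>. Only
  \<open>e0\<close> is compared with the gaps. The deterministic part starts from a list of such
  bounds for every power \<open>s\<close> and sums them geometrically, since \<open>rh\<close> is at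
  most 1/64 of the least eigenvalue. High powers of \<open>H\<close> have strongly dependent
  factors; a resolvent on the circle of radius \<open>rh\<close> treats all powers together, and its
  updates have an explicit increment. The margin of 8 between \<open>rh\<close> and the norm leaves
  a truncation error of order \<open>8^-n\<close>, negligible against \<open>sg\<close>. At the
  level \<open>l = 20 * ln n\<close> each failure has probability about \<open>n^-20\<close>, and a
  union over about \<open>n^4\<close> of them leaves \<open>n^-16\<close>.\<close>

no_notation inner (infix "\<bullet>" 70)
no_notation Finite_Cartesian_Product.vec_nth (infixl "$" 90)
no_notation fps_nth (infixl "$" 75)

abbreviation (input) tr :: "'a mat \<Rightarrow> 'a mat" where "tr \<equiv> transpose_mat"
abbreviation (input) "mats \<equiv> carrier_mat"
lemmas matsD = carrier_matD
abbreviation (input) "vecs \<equiv> carrier_vec"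
abbreviation (input) "diag \<equiv> mat_diag"
abbreviation (input) cor :: "real \<Rightarrow> complex" where "cor \<equiv> complex_of_real"

text \<open>Versions of the ring laws whose side conditions are equations between dimensions, which the
 simplifier can discharge without guessing the inner dimensions.\<close>

lemma mat_dim_assoc: "\<lbrakk>dim_col A = dim_row B; dim_col B = dim_row C\<rbrakk> \<Longrightarrow>
  A * B * C = A * (B * (C :: 'a :: semiring_0 mat))" by (rule assoc_mult_mat[of _ "dim_row A" "dim_row B" _ "dim_row C" _ "dim_col C"]) auto

lemma mat_dim_transpose: "dim_col A = dim_row B \<Longrightarrow>
  tr (A * B) = tr B * tr (A :: 'a :: comm_semiring_0 mat)" by (rule transpose_mult[of _ "dim_row A" "dim_row B" _ "dim_col B"]) auto

lemma mat_dim_add_left: "\<lbrakk>dim_row A = dim_row B; dim_col A = dim_col B; dim_col A = dim_row C\<rbrakk> \<Longrightarrow>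
  (A + B) * C = A * C + B * (C :: 'a :: semiring_0 mat)" by (rule add_mult_distrib_mat[of _ "dim_row A" "dim_col A" _ _ "dim_col C"]) auto

lemma mat_dim_add_right: "\<lbrakk>dim_row B = dim_row C; dim_col B = dim_col C; dim_col A = dim_row B\<rbrakk> \<Longrightarrow>
  A * (B + C) = A * B + A * (C :: 'a :: semiring_0 mat)" by (rule mult_add_distrib_mat[of _ "dim_row A" "dim_row B" _ "dim_col B"]) auto

lemma mat_dim_minus_left: "\<lbrakk>dim_row A = dim_row B; dim_col A = dim_col B; dim_col A = dim_row C\<rbrakk> \<Longrightarrow>
  (A - B) * C = A * C - B * (C :: 'a :: ring mat)" by (rule minus_mult_distrib_mat[of _ "dim_row A" "dim_col A" _ _ "dim_col C"]) auto

lemma mat_dim_minus_right: "\<lbrakk>dim_row B = dim_row C; dim_col B = dim_col C; dim_col A = dim_row B\<rbrakk> \<Longrightarrow>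
  A * (B - C) = A * B - A * (C :: 'a :: ring mat)" by (rule mult_minus_distrib_mat[of _ "dim_row A" "dim_row B" _ "dim_col B"]) auto

lemma mat_dim_vec_assoc: "\<lbrakk>dim_col A = dim_row B; dim_col B = dim_vec v\<rbrakk> \<Longrightarrow>
  A * B *\<^sub>v v = A *\<^sub>v (B *\<^sub>v (v :: 'a :: semiring_0 Matrix.vec))"
 by (rule assoc_mult_mat_vec[of _ "dim_row A" "dim_row B" _ "dim_vec v"]) auto

lemma scalar_prod_commute: "dim_vec v = dim_vec w \<Longrightarrow> v \<bullet> w = w \<bullet> (v :: 'a :: comm_semiring_0 Matrix.vec)"
 by (rule comm_scalar_prod[of _ "dim_vec v"]) (auto intro: carrier_vecI)

lemma dim_mat_diag [simp]: "dim_row (diag n f) = n" "dim_col (diag n f) = n" by (simp_all add: mat_diag_def)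

lemma mat_diag_mult_vec_index:
 assumes "dim_vec v = n" "i < n" shows "(diag n f *\<^sub>v v) $ i = f i * (v $ i :: 'a :: comm_ring_1)"
  and "Matrix.row (diag n f) i \<bullet> v = f i * v $ i"
 using assms by (simp_all add: mat_diag_def scalar_prod_def if_distrib[of "\<lambda>x. x * _"] cong: if_cong)

lemma mat_mult_unit_vec: "k < dim_col A \<Longrightarrow> A *\<^sub>v unit_vec (dim_col A) k = (col A k :: 'a :: comm_ring_1 Matrix.vec)"
 by auto

lemma mult_mat_vec_in_carrier [simp]: "A *\<^sub>v v \<in> vecs n \<longleftrightarrow> dim_row A = n" unfolding carrier_vec_def by simp

lemma mult_mat_in_carrier [simp]: "A * B \<in> mats n m \<longleftrightarrow> dim_row A = n \<and> dim_col B = m"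
 unfolding carrier_mat_def by simp

lemma plus_mat_in_carrier [simp]: "A + B \<in> mats n m \<longleftrightarrow> dim_row B = n \<and> dim_col B = m"
 unfolding carrier_mat_def by simp

lemma minus_mat_in_carrier [simp]: "A - B \<in> mats n m \<longleftrightarrow> dim_row B = n \<and> dim_col B = m"
 unfolding carrier_mat_def by simp

context
 fixes A B C D :: "'a :: ab_group_add mat"
 assumes dims: "dim_row A = dim_row B" "dim_col A = dim_col B"
begin

lemma mat_minus_flip: "A - B = - (B - A)" using dims by auto

lemma mat_plus_minus_cancel: "A + (B - A) = B" using dims by auto

lemma mat_plus_minus_cancel': "A + B - A = B" using dims by auto

context
 assumes dims': "dim_row B = dim_row C" "dim_col B = dim_col C"
begin

lemma mat_telescope: "A - B + (B - C) = A - C" using dims' by auto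

lemma mat_minus_minus_cancel: "(A - C) - (B - C) = A - B" using dims' by auto

lemma mat_plus_minus_plus: "\<lbrakk>dim_row C = dim_row D; dim_col C = dim_col D\<rbrakk> \<Longrightarrow> (A + B) - (C + D) = (A - C) + (B - D)"
 using dims' by auto

end

end

lemma transpose_minus': "\<lbrakk>dim_row A = dim_row B; dim_col A = dim_col B\<rbrakk> \<Longrightarrow>
  tr (A - B) = tr A - tr (B :: 'a :: ab_group_add mat)" by auto

lemmas mat_dim_simps = mat_dim_assoc mat_dim_transpose mat_dim_add_left mat_dim_add_right
 mat_dim_minus_left mat_dim_minus_right

section \<open>Euclidean, operator and Frobenius norms\<close>

lemma vec_l2_L2_set: "vec_l2 v = L2_set (\<lambda>i. v $ i) {0..<dim_vec v}" by (simp add: vec_l2_def L2_set_def scalar_prod_def power2_eq_square)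

lemma vec_l2_nonneg [simp]: "0 \<le> vec_l2 v" by (simp add: vec_l2_L2_set)

lemma vec_l2_sq: "(vec_l2 v)^2 = v \<bullet> v"
proof -
 have "0 \<le> v \<bullet> v" by (auto simp: scalar_prod_def intro!: sum_nonneg)
 thus ?thesis by (simp add: vec_l2_def)
qed

lemma vec_l2_eq_0: "v \<in> vecs n \<Longrightarrow> vec_l2 v = 0 \<longleftrightarrow> v = 0\<^sub>v n"
 unfolding vec_l2_L2_set by (subst L2_set_eq_0_iff) (auto intro!: eq_vecI)

lemma vec_l2_zero [simp]: "vec_l2 (0\<^sub>v n) = 0" by (simp add: vec_l2_def)

lemma vec_l2_add: "\<lbrakk>v \<in> vecs n; w \<in> vecs n\<rbrakk> \<Longrightarrow> vec_l2 (v + w) \<le> vec_l2 v + vec_l2 w"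
 using L2_set_triangle_ineq[of "\<lambda>i. v $ i" "\<lambda>i. w $ i" "{0..<n}"]
  L2_set_cong[of "{0..<n}" "{0..<n}" "\<lambda>i. (v + w) $ i" "\<lambda>i. v $ i + w $ i"] by (simp add: vec_l2_L2_set)

lemma vec_l2_smult: "vec_l2 (c \<cdot>\<^sub>v v) = \<bar>c\<bar> * vec_l2 v" unfolding vec_l2_L2_set L2_set_def
 by (simp add: power_mult_distrib sum_distrib_left[symmetric] real_sqrt_mult)

lemma vec_l2_uminus: "vec_l2 (- v) = vec_l2 v" unfolding vec_l2_L2_set L2_set_def by simp

lemma vec_l2_minus: "\<lbrakk>v \<in> vecs n; w \<in> vecs n\<rbrakk> \<Longrightarrow> vec_l2 (v - w) \<le> vec_l2 v + vec_l2 w"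
 using vec_l2_add[of v n "- w"] minus_add_uminus_vec[of v n w] by (simp add: vec_l2_uminus)

lemma scalar_prod_abs_le:
 assumes "dim_vec v = dim_vec w" shows "\<bar>v \<bullet> w\<bar> \<le> vec_l2 v * vec_l2 w"
proof -
 have "\<bar>v \<bullet> w\<bar> \<le> (\<Sum>i\<in>{0..<dim_vec w}. \<bar>v $ i\<bar> * \<bar>w $ i\<bar>)"
  unfolding scalar_prod_def using sum_abs[of "\<lambda>i. v $ i * w $ i"] by (simp add: abs_mult)
 also have "... \<le> vec_l2 v * vec_l2 w" unfolding vec_l2_L2_set assms by (rule L2_set_mult_ineq)
 finally show ?thesis .
qed

lemma vec_index_le_l2: "i < dim_vec v \<Longrightarrow> \<bar>v $ i\<bar> \<le> vec_l2 v"
 unfolding vec_l2_L2_set L2_set_def by (intro real_le_rsqrt) (auto intro!: member_le_sum)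

text \<open>A predicate for upper bounds instead of the norm itself: only upper bounds are ever
  composed, so no supremum has to be formed.\<close>

definition opb :: "real mat \<Rightarrow> real \<Rightarrow> bool" where
 "opb A c \<longleftrightarrow> (\<forall>v\<in>vecs (dim_col A). vec_l2 (A *\<^sub>v v) \<le> c * vec_l2 v)"

lemma opbD: "\<lbrakk>opb A c; A \<in> mats n m; v \<in> vecs m\<rbrakk> \<Longrightarrow> vec_l2 (A *\<^sub>v v) \<le> c * vec_l2 v"
 by (auto simp: opb_def)

lemma opbI: "\<lbrakk>A \<in> mats n m; \<And>v. v \<in> vecs m \<Longrightarrow> vec_l2 (A *\<^sub>v v) \<le> c * vec_l2 v\<rbrakk> \<Longrightarrow> opb A c"
 by (auto simp: opb_def)

lemma opb_mono: "\<lbrakk>opb A c; c \<le> d\<rbrakk> \<Longrightarrow> opb A d"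
 unfolding opb_def by (meson mult_right_mono order_trans vec_l2_nonneg)

lemma opb_one: "opb (1\<^sub>m n) 1" by (rule opbI[of _ n n]) auto

lemma opb_mult:
 assumes "opb A a" "opb B b" "A \<in> mats n m" "B \<in> mats m k" "0 \<le> a" shows "opb (A * B) (a * b)"
proof (rule opbI)
 show "A * B \<in> mats n k" using assms by auto
 fix v :: "real Matrix.vec" assume v: "v \<in> vecs k"
 have "vec_l2 (A * B *\<^sub>v v) = vec_l2 (A *\<^sub>v (B *\<^sub>v v))" using assms v by simp
 also have "... \<le> a * vec_l2 (B *\<^sub>v v)" using assms by (intro opbD[of A a n m]) auto
 also have "... \<le> a * (b * vec_l2 v)" using assms v by (intro mult_left_mono opbD[of B b m k]) auto
 finally show "vec_l2 (A * B *\<^sub>v v) \<le> a * b * vec_l2 v" by simp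
qed

lemma opb_add:
 assumes "opb A a" "opb B b" "A \<in> mats n m" "B \<in> mats n m" shows "opb (A + B) (a + b)"
proof (rule opbI)
 show "A + B \<in> mats n m" using assms by auto
 fix v :: "real Matrix.vec" assume v: "v \<in> vecs m"
 have "vec_l2 ((A + B) *\<^sub>v v) = vec_l2 (A *\<^sub>v v + B *\<^sub>v v)" using assms v by (simp add: add_mult_distrib_mat_vec)
 also have "... \<le> vec_l2 (A *\<^sub>v v) + vec_l2 (B *\<^sub>v v)" using assms by (intro vec_l2_add[of _ n]) auto
 also have "... \<le> a * vec_l2 v + b * vec_l2 v" using assms v by (intro add_mono opbD) auto
 finally show "vec_l2 ((A + B) *\<^sub>v v) \<le> (a + b) * vec_l2 v" by (simp add: algebra_simps)
qed

lemma scalar_prod_mult_mat_vec: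
 assumes "A \<in> mats n m" "x \<in> vecs n" "(y :: 'a :: comm_semiring_0 Matrix.vec) \<in> vecs m"
 shows "x \<bullet> (A *\<^sub>v y) = (tr A *\<^sub>v x) \<bullet> y" using transpose_vec_mult_scalar[OF assms(1,3,2)] by simp

text \<open>With \<open>w = A^T v\<close> one has \<open>|w|^2 = v . A w\<close>, which is at most
  \<open>c |v| |w|\<close>; dividing by \<open>|w|\<close> gives the claim.\<close>

lemma opb_transpose:
 assumes "opb A c" "A \<in> mats n m" "0 \<le> c" shows "opb (tr A) c"
proof (rule opbI)
 show "tr A \<in> mats m n" using assms by auto
 fix v :: "real Matrix.vec" assume v: "v \<in> vecs n"
 define w where "w = tr A *\<^sub>v v"
 have w: "w \<in> vecs m" using assms by (auto simp: w_def)
 have "(vec_l2 w)^2 = w \<bullet> w" by (rule vec_l2_sq)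
 also have "... \<le> vec_l2 v * vec_l2 (A *\<^sub>v w)"
  using scalar_prod_mult_mat_vec[OF assms(2) v w] scalar_prod_abs_le[of v "A *\<^sub>v w"] v assms by (auto simp: w_def)
 also have "... \<le> vec_l2 v * (c * vec_l2 w)" using opbD[OF assms(1,2) w] by (intro mult_left_mono) auto
 finally have "vec_l2 w * vec_l2 w \<le> (c * vec_l2 v) * vec_l2 w" by (simp add: power2_eq_square mult_ac)
 hence "vec_l2 w \<le> c * vec_l2 v" using vec_l2_nonneg[of w] assms(3)
  by (cases "vec_l2 w = 0") (auto simp: order.order_iff_strict[of 0 "vec_l2 w"])
 thus "vec_l2 (tr A *\<^sub>v v) \<le> c * vec_l2 v" by (simp add: w_def)
qed

lemma opb_diag:
 assumes "\<And>i. i < n \<Longrightarrow> \<bar>f i\<bar> \<le> c" "0 \<le> c" shows "opb (diag n f) c"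
proof (rule opbI)
 show "diag n f \<in> mats n n" by auto
 fix v :: "real Matrix.vec" assume v: "v \<in> vecs n"
 have e: "(diag n f *\<^sub>v v) $ i = f i * v $ i" if "i < n" for i using v that by (simp add: mat_diag_mult_vec_index)
 have "vec_l2 (diag n f *\<^sub>v v) = L2_set (\<lambda>i. f i * v $ i) {0..<n}"
  unfolding vec_l2_L2_set using e by (intro L2_set_cong) (auto simp: mat_diag_def)
 also have "... \<le> L2_set (\<lambda>i. c * \<bar>v $ i\<bar>) {0..<n}" unfolding L2_set_def using assms
  by (intro real_sqrt_le_mono sum_mono) (auto simp: abs_le_square_iff[symmetric] abs_mult intro!: mult_right_mono)
 finally show "vec_l2 (diag n f *\<^sub>v v) \<le> c * vec_l2 v" unfolding vec_l2_L2_set using v assms(2) by (simp add: L2_set_def power_mult_distrib sum_distrib_left[symmetric] real_sqrt_mult)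
qed

lemma opb_quadratic:
 assumes "opb A c" "A \<in> mats n m" "x \<in> vecs n" "y \<in> vecs m"
 shows "\<bar>x \<bullet> (A *\<^sub>v y)\<bar> \<le> c * vec_l2 x * vec_l2 y"
proof -
 have "\<bar>x \<bullet> (A *\<^sub>v y)\<bar> \<le> vec_l2 x * vec_l2 (A *\<^sub>v y)" using assms by (intro scalar_prod_abs_le) auto
 also have "... \<le> vec_l2 x * (c * vec_l2 y)" using assms by (intro mult_left_mono opbD[of A c n m]) auto
 finally show ?thesis by (simp add: mult_ac)
qed

lemma opb_pow:
 assumes "opb A c" "A \<in> mats n n" "0 \<le> c" shows "opb (A ^\<^sub>m k) (c ^ k)"
proof (induction k)
 case 0 thus ?case using opb_one by simp
next
 case (Suc k)
 show ?case using opb_mult[OF Suc assms(1), of n n n] assms by (simp add: mult.commute)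
qed

text \<open>The Frobenius norm as the Euclidean norm of the column norms. In this form an operator
  bound on a left factor applies column by column, and the triangle inequality is that of
  \<open>L2_set\<close>.\<close>

definition fro :: "real mat \<Rightarrow> real" where
 "fro A = L2_set (\<lambda>j. vec_l2 (col A j)) {0..<dim_col A}"

lemma fro_nonneg [simp]: "0 \<le> fro A" by (simp add: fro_def)

lemma fro_sq: "(fro A)^2 = (\<Sum>j<dim_col A. \<Sum>i<dim_row A. (A $$ (i, j))^2)"
proof -
 have "(fro A)^2 = (\<Sum>j<dim_col A. (vec_l2 (col A j))^2)" by (simp add: fro_def L2_set_def sum_nonneg lessThan_atLeast0)
 also have "... = (\<Sum>j<dim_col A. \<Sum>i<dim_row A. (A $$ (i, j))^2)"
  by (intro sum.cong refl, subst vec_l2_sq) (auto simp: scalar_prod_def power2_eq_square lessThan_atLeast0)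
 finally show ?thesis .
qed

lemma fro_eqI: "(fro A)^2 = (fro B)^2 \<Longrightarrow> fro A = fro B" by simp

lemma fro_transpose [simp]: "fro (tr A) = fro A" by (rule fro_eqI, unfold fro_sq, subst sum.swap) simp

lemma fro_add:
 assumes "A \<in> mats n m" "B \<in> mats n m" shows "fro (A + B) \<le> fro A + fro B"
proof -
 have "fro (A + B) \<le> L2_set (\<lambda>j. vec_l2 (col A j) + vec_l2 (col B j)) {0..<m}"
  unfolding fro_def using assms by (auto intro!: L2_set_mono vec_l2_add[of _ n] simp: col_add)
 also have "... \<le> fro A + fro B" using L2_set_triangle_ineq[of "\<lambda>j. vec_l2 (col A j)" "\<lambda>j. vec_l2 (col B j)" "{0..<m}"] assms
  by (simp add: fro_def)
 finally show ?thesis .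
qed

lemma fro_smult: "fro (c \<cdot>\<^sub>m A) = \<bar>c\<bar> * fro A"
proof -
 have "(fro (c \<cdot>\<^sub>m A))^2 = (\<bar>c\<bar> * fro A)^2" by (simp add: fro_sq power_mult_distrib sum_distrib_left)
 thus ?thesis by simp
qed

lemma fro_uminus [simp]: "fro (- A) = fro A" by (rule fro_eqI) (simp add: fro_sq)

lemma fro_minus:
 assumes "A \<in> mats n m" "B \<in> mats n m" shows "fro (A - B) \<le> fro A + fro B"
 using fro_add[of A n m "- B"] assms minus_add_uminus_mat[of A n m B] by simp

lemma fro_mult_left:
 assumes "opb A c" "A \<in> mats n m" "B \<in> mats m k" "0 \<le> c" shows "fro (A * B) \<le> c * fro B"
proof -
 have "fro (A * B) \<le> L2_set (\<lambda>j. c * vec_l2 (col B j)) {0..<k}" unfolding fro_def using assms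
  by (auto intro!: L2_set_mono opbD[of A c n m] simp: col_mult2[of A n m B k] simp del: col_mult)
 also have "... = c * fro B" using assms by (simp add: fro_def L2_set_right_distrib)
 finally show ?thesis .
qed

lemma fro_mult_right:
 assumes "opb B c" "A \<in> mats n m" "B \<in> mats m k" "0 \<le> c" shows "fro (A * B) \<le> c * fro A"
proof -
 have "fro (A * B) = fro (tr B * tr A)" using assms fro_transpose[of "A * B"] by (simp add: transpose_mult[of A n m B k])
 also have "... \<le> c * fro (tr A)" using assms by (intro fro_mult_left[of _ c k m _ n] opb_transpose[of B c m k]) auto
 finally show ?thesis by simp
qed

text \<open>Cauchy-Schwarz in each row, after regrouping the Frobenius norm by rows.\<close>

lemma opb_fro: "opb A (fro A)"
proof (rule opbI[of A "dim_row A" "dim_col A"])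
 fix v :: "real Matrix.vec" assume v: "v \<in> vecs (dim_col A)"
 have "(fro A)^2 = (\<Sum>i<dim_row A. (vec_l2 (Matrix.row A i))^2)"
  unfolding fro_sq vec_l2_sq by (subst sum.swap) (intro sum.cong, auto simp: scalar_prod_def power2_eq_square lessThan_atLeast0)
 hence f: "fro A = L2_set (\<lambda>i. vec_l2 (Matrix.row A i)) {0..<dim_row A}" by (simp add: L2_set_def lessThan_atLeast0 real_sqrt_unique)
 have "vec_l2 (A *\<^sub>v v) = L2_set (\<lambda>i. \<bar>Matrix.row A i \<bullet> v\<bar>) {0..<dim_row A}"
  unfolding vec_l2_L2_set by (simp add: L2_set_def)
 also have "... \<le> L2_set (\<lambda>i. vec_l2 (Matrix.row A i) * vec_l2 v) {0..<dim_row A}"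
  using v by (intro L2_set_mono scalar_prod_abs_le) auto
 finally show "vec_l2 (A *\<^sub>v v) \<le> fro A * vec_l2 v" by (simp add: f L2_set_left_distrib)
qed auto

lemma fro_le_entries:
 assumes "A \<in> mats n m" "\<And>i j. \<lbrakk>i < n; j < m\<rbrakk> \<Longrightarrow> \<bar>A $$ (i, j)\<bar> \<le> c" "0 \<le> c"
 shows "fro A \<le> sqrt (real (n * m)) * c"
proof -
 have "(fro A)^2 \<le> (\<Sum>j<m. \<Sum>i<n. c^2)" unfolding fro_sq using assms(1,3) assms(2)[THEN power_mono[of _ _ 2]]
  by (auto simp del: sum_constant intro!: sum_mono)
 also have "... = (sqrt (real (n * m)) * c)^2" by (simp add: power_mult_distrib)
 finally show ?thesis using assms(3) by simp
qed

section \<open>The spectral theorem for real symmetric matrices\<close>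

lemma complex_eigenvector_parts:
 assumes A: "A \<in> mats n n" and v: "v \<in> vecs n" and ev: "map_mat cor A *\<^sub>v v = z \<cdot>\<^sub>v v"
 defines "a \<equiv> map_vec Re v" and "b \<equiv> map_vec Im v"
 shows "A *\<^sub>v a = Re z \<cdot>\<^sub>v a - Im z \<cdot>\<^sub>v b" "A *\<^sub>v b = Im z \<cdot>\<^sub>v a + Re z \<cdot>\<^sub>v b"
proof -
 have *: "(\<Sum>j<n. cor (A $$ (i, j)) * v $ j) = z * v $ i" if "i < n" for i using arg_cong[OF ev, of "\<lambda>w. w $ i"] that A v
  by (simp add: scalar_prod_def lessThan_atLeast0)
 show "A *\<^sub>v a = Re z \<cdot>\<^sub>v a - Im z \<cdot>\<^sub>v b" using A v arg_cong[OF *, of _ Re]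
  by (intro eq_vecI) (auto simp: a_def b_def scalar_prod_def lessThan_atLeast0)
 show "A *\<^sub>v b = Im z \<cdot>\<^sub>v a + Re z \<cdot>\<^sub>v b" using A v arg_cong[OF *, of _ Im]
  by (intro eq_vecI) (auto simp: a_def b_def scalar_prod_def lessThan_atLeast0)
qed

text \<open>The characteristic polynomial has a complex root \<open>z\<close>, with eigenvector
  \<open>a + i b\<close>. Symmetry equates \<open>b . A a\<close> with \<open>a . A b\<close>, which
  leaves \<open>Im z * (|a|^2 + |b|^2) = 0\<close>. So \<open>z\<close> is real, and whichever of
  \<open>a\<close>, \<open>b\<close> is nonzero is a real eigenvector.\<close>

lemma symmetric_real_eigenvector:
 assumes A: "A \<in> mats n n" and sym: "tr A = A" and n: "0 < n"
 shows "\<exists>v l. v \<in> vecs n \<and> vec_l2 v = 1 \<and> A *\<^sub>v v = l \<cdot>\<^sub>v (v :: real Matrix.vec)"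
proof -
 let ?A = "map_mat cor A"
 have A': "?A \<in> mats n n" using A by simp
 obtain as where as: "char_poly ?A = (\<Prod>a\<leftarrow>as. [:- a, 1:])" "length as = n" using char_poly_factorized[OF A'] by blast
 then obtain z as' where "as = z # as'" using n by (cases as) auto
 hence "eigenvalue ?A z" unfolding eigenvalue_root_char_poly[OF A'] as by simp
 then obtain v where v: "v \<in> vecs n" "v \<noteq> 0\<^sub>v n" "?A *\<^sub>v v = z \<cdot>\<^sub>v v"
  using A by (auto simp: eigenvalue_def eigenvector_def)
 define a b where "a = map_vec Re v" and "b = map_vec Im v"
 have ab: "a \<in> vecs n" "b \<in> vecs n" using v by (auto simp: a_def b_def)
 have Aa: "A *\<^sub>v a = Re z \<cdot>\<^sub>v a - Im z \<cdot>\<^sub>v b" and Ab: "A *\<^sub>v b = Im z \<cdot>\<^sub>v a + Re z \<cdot>\<^sub>v b"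
  using complex_eigenvector_parts[OF A v(1,3)] by (simp_all add: a_def b_def)
 have "b \<bullet> (A *\<^sub>v a) = a \<bullet> (A *\<^sub>v b)"
  using scalar_prod_mult_mat_vec[OF A ab(2,1)] scalar_prod_commute[of "A *\<^sub>v b" a] A ab sym by simp
 hence "Im z * (a \<bullet> a + b \<bullet> b) = 0" unfolding Aa Ab using ab
  by (simp add: scalar_prod_add_distrib[of _ n] scalar_prod_minus_distrib[of _ n]
    scalar_prod_commute[of b a] algebra_simps)
 moreover have ne: "a \<noteq> 0\<^sub>v n \<or> b \<noteq> 0\<^sub>v n"
 proof (rule ccontr)
  assume H: "\<not> ?thesis"
  have "v = 0\<^sub>v n"
  proof (rule eq_vecI)
   fix i assume i: "i < dim_vec (0\<^sub>v n :: complex Matrix.vec)"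
   have "a $ i = 0" "b $ i = 0" using H i by auto
   thus "v $ i = 0\<^sub>v n $ i" using i v by (simp add: a_def b_def complex_eq_iff)
  qed (use v in auto)
  thus False using v by simp
 qed
 ultimately have "A *\<^sub>v a = Re z \<cdot>\<^sub>v a" "A *\<^sub>v b = Re z \<cdot>\<^sub>v b"
  using vec_l2_eq_0 Aa Ab ab unfolding vec_l2_sq[symmetric] by auto
 then obtain w where w: "w \<in> vecs n" "w \<noteq> 0\<^sub>v n" "A *\<^sub>v w = Re z \<cdot>\<^sub>v w" using ne ab by blast
 hence "vec_l2 ((1 / vec_l2 w) \<cdot>\<^sub>v w) = 1" using vec_l2_eq_0 by (simp add: vec_l2_smult)
 moreover have "A *\<^sub>v ((1 / vec_l2 w) \<cdot>\<^sub>v w) = Re z \<cdot>\<^sub>v ((1 / vec_l2 w) \<cdot>\<^sub>v w)"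
  using w A by (simp add: mult_mat_vec smult_smult_assoc)
 ultimately show ?thesis using w(1) smult_carrier_vec by blast
qed

text \<open>A Householder reflection.\<close>

lemma orthogonal_with_first_col:
 assumes v: "(v :: real Matrix.vec) \<in> vecs n" and v1: "vec_l2 v = 1" and n: "0 < n"
 shows "\<exists>Q. Q \<in> mats n n \<and> tr Q = Q \<and> Q * Q = 1\<^sub>m n \<and> col Q 0 = v"
proof (cases "v = unit_vec n 0")
 case True
 thus ?thesis by (intro exI[of _ "1\<^sub>m n"]) auto
next
 case False
 define w where "w = v - unit_vec n 0"
 have w: "w \<in> vecs n" using v by (simp add: w_def)
 define c where "c = w \<bullet> w"
 have vv: "v \<bullet> v = 1" using vec_l2_sq[of v] v1 by simp
 have ww: "c = 2 - 2 * v $ 0" using v n vv unfolding w_def c_def by (simp add: scalar_prod_minus_distrib[of _ n] minus_scalar_prod_distrib[of _ n])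
 have "w \<noteq> 0\<^sub>v n"
 proof
  assume "w = 0\<^sub>v n"
  hence "v $ i = unit_vec n 0 $ i" if "i < n" for i using that arg_cong[OF \<open>w = 0\<^sub>v n\<close>, of "\<lambda>x. x $ i"] unfolding w_def
   by (subst (asm) index_minus_vec) auto
  thus False using False v by auto
 qed
 hence c: "c \<noteq> 0" unfolding c_def vec_l2_sq[symmetric] using vec_l2_eq_0[OF w] by simp
 define Q where "Q = Matrix.mat n n (\<lambda>(i, j). (if i = j then 1 else 0) - 2 / c * w $ i * w $ j)"
 have Q: "Q \<in> mats n n" by (simp add: Q_def)
 have "Q * Q = 1\<^sub>m n"
 proof (rule eq_matI)
  fix i j assume "i < dim_row (1\<^sub>m n :: real mat)" "j < dim_col (1\<^sub>m n :: real mat)"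
  hence ij: "i < n" "j < n" by auto
  have "(Q * Q) $$ (i, j) = (\<Sum>k\<in>{0..<n}. ((if i = k then 1 else 0) - 2 / c * w $ i * w $ k) *
    ((if k = j then 1 else 0) - 2 / c * w $ k * w $ j))" using ij by (simp add: Q_def scalar_prod_def)
  also have "... = (\<Sum>k\<in>{0..<n}. (if i = k then (if k = j then 1 else 0) else 0)
    - (if i = k then 2 / c * w $ k * w $ j else 0) - (if k = j then 2 / c * w $ i * w $ k else 0)
    + (2 / c * w $ i) * (2 / c * w $ j) * (w $ k * w $ k))" by (intro sum.cong) (auto simp: algebra_simps)
  finally show "(Q * Q) $$ (i, j) = 1\<^sub>m n $$ (i, j)" using w ij unfolding sum.distrib sum_subtractf sum_distrib_left[symmetric] by (simp add: c_def scalar_prod_def)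
 qed (use Q in auto)
 moreover have "tr Q = Q" by (rule eq_matI) (auto simp: Q_def)
 moreover have "col Q 0 = v"
 proof (rule eq_vecI)
  fix i assume "i < dim_vec v"
  hence i: "i < n" using v by simp
  have w0: "w $ 0 = - c / 2" using n ww by (simp add: w_def)
  thus "col Q 0 $ i = v $ i" using c i by (simp add: w_def Q_def)
 qed (use Q v in auto)
 ultimately show ?thesis using Q by blast
qed

lemma mat_diag_four_block:
 "diag (Suc m) (case_nat l d) = four_block_mat (diag 1 (\<lambda>_. l)) (0\<^sub>m 1 m) (0\<^sub>m m 1) (diag m d)"
 by (rule eq_matI) (auto simp: mat_diag_def split: nat.split)

text \<open>Deflation by induction on the dimension: a reflection \<open>Q\<close> that maps the
  first basis vector to a unit eigenvector turns \<open>A\<close> into a block matrix with the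
  eigenvalue in the corner and a smaller symmetric block, to which the induction hypothesis
  applies.\<close>

theorem real_spectral_theorem:
 assumes "A \<in> mats n n" and "tr A = (A :: real mat)" shows "\<exists>Ga d. Ga \<in> mats n n \<and> tr Ga * Ga = 1\<^sub>m n \<and>
     A = Ga * diag n d * tr Ga" using assms
proof (induction n arbitrary: A)
 case 0
 thus ?case by (intro exI[of _ "1\<^sub>m 0"] exI) (auto intro!: eq_matI)
next
 case (Suc m A)
 let ?n = "Suc m"
 obtain v l where v: "v \<in> vecs ?n" "vec_l2 v = 1" "A *\<^sub>v v = l \<cdot>\<^sub>v v"
  using symmetric_real_eigenvector[OF Suc.prems] by auto
 obtain Q where Q: "Q \<in> mats ?n ?n" "tr Q = Q" "Q * Q = 1\<^sub>m ?n" "col Q 0 = v" using orthogonal_with_first_col[OF v(1,2)] by auto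
 define B where "B = Q * A * Q"
 have B: "B \<in> mats ?n ?n" using Q by (simp add: B_def)
 have Bsym: "tr B = B" using Q(1,2) Suc.prems unfolding B_def by (simp add: mat_dim_simps)
 have Qv: "Q *\<^sub>v v = unit_vec ?n 0"
 proof -
  have "Q *\<^sub>v v = col (Q * Q) 0" using Q by (subst col_mult2[of Q ?n ?n Q ?n]) auto
  thus ?thesis using Q(3) by simp
 qed
 have "col B 0 = B *\<^sub>v unit_vec ?n 0" using B by auto
 also have "... = Q *\<^sub>v (A *\<^sub>v (Q *\<^sub>v unit_vec ?n 0))" unfolding B_def using Q Suc.prems by simp
 also have "Q *\<^sub>v unit_vec ?n 0 = v" using Q by auto
 finally have col0: "col B 0 = l \<cdot>\<^sub>v unit_vec ?n 0" using v Q Qv by (simp add: mult_mat_vec)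
 have Bi0: "B $$ (i, 0) = (if i = 0 then l else 0)" if "i < ?n" for i using arg_cong[OF col0, of "\<lambda>x. x $ i"] that B by auto
 have B0i: "B $$ (0, i) = (if i = 0 then l else 0)" if "i < ?n" for i
  using arg_cong[OF Bsym, of "\<lambda>M. M $$ (0, i)"] Bi0[OF that] that B by auto
 define C where "C = Matrix.mat m m (\<lambda>(i, j). B $$ (Suc i, Suc j))"
 have C: "C \<in> mats m m" by (simp add: C_def)
 have Csym: "tr C = C"
 proof (rule eq_matI)
  fix i j assume "i < dim_row C" "j < dim_col C"
  hence ij: "i < m" "j < m" by (auto simp: C_def)
  show "tr C $$ (i, j) = C $$ (i, j)" using arg_cong[OF Bsym, of "\<lambda>M. M $$ (Suc i, Suc j)"] ij B by (simp add: C_def)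
 qed (simp_all add: C_def)
 obtain G d where G: "G \<in> mats m m" "tr G * G = 1\<^sub>m m" and Cd: "C = G * diag m d * tr G" using Suc.IH[OF C Csym] by blast
 define K where "K = four_block_mat (1\<^sub>m 1) (0\<^sub>m 1 m) (0\<^sub>m m 1) G"
 have K: "K \<in> mats ?n ?n" using four_block_carrier_mat[of "1\<^sub>m 1" 1 1 G m m "0\<^sub>m 1 m" "0\<^sub>m m 1"] G by (simp add: K_def)
 have KT: "tr K = four_block_mat (1\<^sub>m 1) (0\<^sub>m 1 m) (0\<^sub>m m 1) (tr G)"
  using transpose_four_block_mat[of "1\<^sub>m 1" 1 1 "0\<^sub>m 1 m" m "0\<^sub>m m 1" m G] G unfolding K_def by simp
 have BK: "B = K * diag ?n (case_nat l d) * tr K"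
 proof -
  have "B = four_block_mat (diag 1 (\<lambda>_. l)) (0\<^sub>m 1 m) (0\<^sub>m m 1) C"
   using B Bi0 B0i by (intro eq_matI) (auto simp: C_def mat_diag_def)
  moreover have "K * diag ?n (case_nat l d) * tr K
    = four_block_mat (diag 1 (\<lambda>_. l)) (0\<^sub>m 1 m) (0\<^sub>m m 1) C"
  proof -
   have D: "diag 1 (\<lambda>_. l) \<in> mats 1 1" "diag m d \<in> mats m m" by auto
   have "K * diag ?n (case_nat l d) = four_block_mat (diag 1 (\<lambda>_. l)) (0\<^sub>m 1 m) (0\<^sub>m m 1) (G * diag m d)"
    unfolding K_def mat_diag_four_block
    by (subst mult_four_block_mat[of _ 1 1 _ m _ m _ _ 1 _ m]) (use G D left_mult_one_mat[OF D(1)] left_mult_zero_mat[OF D(1), of m] left_mult_zero_mat[OF D(2), of 1] in auto)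
   thus ?thesis unfolding KT Cd
    by (simp, subst mult_four_block_mat[of _ 1 1 _ m _ m _ _ 1 _ m]) (use G D right_mult_one_mat[OF D(1)] right_mult_zero_mat[OF D(1), of m]
      right_mult_zero_mat[OF mult_carrier_mat[OF G(1) D(2)], of 1]
      left_add_zero_mat[of "G * diag m d * tr G" m m] in auto)
  qed
  ultimately show ?thesis by simp
 qed
 have KK: "tr K * K = 1\<^sub>m ?n" unfolding KT unfolding K_def by (subst mult_four_block_mat[of _ 1 1 _ m _ m _ _ 1 _ m]) (use G in auto)
 show ?case
 proof (intro exI conjI)
  show "Q * K \<in> mats ?n ?n" using Q K by auto
  have "tr (Q * K) * (Q * K) = tr K * (Q * Q) * K" using Q(1,2) K by (simp add: mat_dim_simps)
  thus "tr (Q * K) * (Q * K) = 1\<^sub>m ?n" using Q KK K by simp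
  have "A = (Q * Q) * A * (Q * Q)" using Q Suc.prems by simp
  also have "... = Q * B * Q" using Q(1) Suc.prems by (simp add: B_def)
  finally show "A = (Q * K) * diag ?n (case_nat l d) * tr (Q * K)" using Q(1,2) K by (simp add: BK mat_dim_simps)
 qed
qed

section \<open>Perturbation of the corrected eigendecomposition\<close>

text \<open>The trace inner product \<open>trace (A^T B)\<close>, summed by columns.\<close>

definition mip :: "real mat \<Rightarrow> real mat \<Rightarrow> real" where
 "mip A B = (\<Sum>j\<in>{0..<dim_col A}. col A j \<bullet> col B j)"

lemma mip_le: "\<lbrakk>A \<in> mats n m; B \<in> mats n m\<rbrakk> \<Longrightarrow> mip A B \<le> fro A * fro B"
proof -
 assume AB: "A \<in> mats n m" "B \<in> mats n m"
 have "mip A B \<le> (\<Sum>j\<in>{0..<m}. \<bar>vec_l2 (col A j)\<bar> * \<bar>vec_l2 (col B j)\<bar>)"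
  unfolding mip_def using AB scalar_prod_abs_le[of "col A _" "col B _"] by (simp, intro sum_mono) (meson abs_le_D1)
 also have "... \<le> fro A * fro B"
  unfolding fro_def using AB L2_set_mult_ineq[of "\<lambda>j. vec_l2 (col A j)" "\<lambda>j. vec_l2 (col B j)" "{0..<m}"] by simp
 finally show ?thesis .
qed

lemma mip_transpose:
 "\<lbrakk>A \<in> mats n m; B \<in> mats n m\<rbrakk> \<Longrightarrow> mip (tr A) (tr B) = mip A B"
 unfolding mip_def by (simp add: scalar_prod_def) (rule sum.swap)

lemma mip_add:
 "\<lbrakk>A \<in> mats n m; B \<in> mats n m; C \<in> mats n m\<rbrakk> \<Longrightarrow> mip A (B + C) = mip A B + mip A C"
 unfolding mip_def by (simp add: scalar_prod_add_distrib[of _ n])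

lemma mip_mult_ge:
 assumes "\<And>x. x \<in> vecs n \<Longrightarrow> c * (vec_l2 x)^2 \<le> x \<bullet> (P *\<^sub>v x)"
  and "P \<in> mats n n" "S \<in> mats n m" shows "c * (fro S)^2 \<le> mip S (P * S)"
proof -
 have "c * (fro S)^2 = (\<Sum>j\<in>{0..<m}. c * (vec_l2 (col S j))^2)" using assms by (simp add: fro_def L2_set_def sum_nonneg sum_distrib_left)
 also have "... \<le> (\<Sum>j\<in>{0..<m}. col S j \<bullet> (P *\<^sub>v col S j))" using assms by (intro sum_mono assms(1)) auto
 also have "... = mip S (P * S)" unfolding mip_def using assms by (intro sum.cong) (auto simp: col_mult2[of P n n S m] simp del: col_mult)
 finally show ?thesis .
qed

text \<open>Pairing the commutator \<open>S = [P, L]\<close> with \<open>P S + S P = [P\<^sup>2, L]\<close> in the trace inner product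
 shows that a positive definite matrix commutes with \<open>L\<close> as well as its square does.\<close>

lemma commutator_square_root:
 assumes P: "P \<in> mats n n" and L: "L \<in> mats n n" and sym: "tr P = P" and c: "0 < c"
  and pos: "\<And>x. x \<in> vecs n \<Longrightarrow> c * (vec_l2 x)^2 \<le> x \<bullet> (P *\<^sub>v x)"
 shows "fro (P * L - L * P) \<le> fro (P * P * L - L * (P * P)) / (2 * c)"
proof -
 define S where "S = P * L - L * P"
 have S: "S \<in> mats n n" using P L unfolding S_def by auto
 have Y: "P * S + S * P = P * P * L - L * (P * P)" unfolding S_def using P L by (simp add: mat_dim_simps mat_telescope)
 \<comment> \<open>Positivity is applied to the columns of \<open>S\<close> and to those of its
   transpose; transposing turns \<open>P * tr S\<close> into \<open>S * P\<close>, so both halves of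
   the anticommutator appear.\<close>
 have "2 * c * (fro S)^2 \<le> mip S (P * S) + mip (tr S) (P * tr S)" using mip_mult_ge[OF pos P S] mip_mult_ge[OF pos P, of "tr S" n] S by simp
 also have "mip (tr S) (P * tr S) = mip S (S * P)" using mip_transpose[of S n n "S * P"] S P sym by (simp add: mat_dim_simps)
 also have "mip S (P * S) + mip S (S * P) = mip S (P * S + S * P)" using S P by (subst mip_add[of S n n]) auto
 also have "... \<le> fro S * fro (P * S + S * P)" using S P by (intro mip_le) auto
 finally have *: "fro S * (2 * c * fro S) \<le> fro S * fro (P * S + S * P)" by (simp add: power2_eq_square mult_ac)
 have "2 * c * fro S \<le> fro (P * S + S * P)"
 proof (cases "fro S = 0")
  case False
  hence "0 < fro S" using fro_nonneg[of S] by linarith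
  thus ?thesis using * by simp
 qed simp
 thus ?thesis unfolding Y unfolding S_def using c by (simp add: field_simps)
qed

text \<open>The lower bound makes \<open>A\<close> injective, hence its determinant nonzero, and at
  the same time bounds the inverse.\<close>

lemma square_inverse_exists:
 assumes A: "(A :: real mat) \<in> mats n n"
  and c: "0 < c" and lower: "\<And>x. x \<in> vecs n \<Longrightarrow> c * vec_l2 x \<le> vec_l2 (A *\<^sub>v x)"
 obtains B where "B \<in> mats n n" "A * B = 1\<^sub>m n" "B * A = 1\<^sub>m n" "opb B (1 / c)"
proof -
 have "Determinant.det A \<noteq> 0"
 proof
  assume "Determinant.det A = 0"
  then obtain v where v: "v \<in> vecs n" "v \<noteq> 0\<^sub>v n" "A *\<^sub>v v = 0\<^sub>v n"
   using det_0_iff_vec_prod_zero_field[OF A] by blast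
  have "0 < c * vec_l2 v" using v vec_l2_eq_0 c by (simp add: order.strict_iff_order)
  with lower[OF v(1)] v(3) show False by simp
 qed
 hence "A \<in> Units (ring_mat TYPE(real) n undefined)" by (rule det_non_zero_imp_unit[OF A])
 then obtain B where B: "B \<in> mats n n" "A * B = 1\<^sub>m n" "B * A = 1\<^sub>m n" by (auto simp: Units_def ring_mat_def)
 have "opb B (1 / c)"
 proof (rule opbI[OF B(1)])
  fix v :: "real Matrix.vec" assume v: "v \<in> vecs n"
  have "c * vec_l2 (B *\<^sub>v v) \<le> vec_l2 (A *\<^sub>v (B *\<^sub>v v))" using B by (intro lower) auto
  also have "A *\<^sub>v (B *\<^sub>v v) = v" using B v by (simp flip: assoc_mult_mat_vec[OF A B(1) v])
  finally show "vec_l2 (B *\<^sub>v v) \<le> 1 / c * vec_l2 v" using c by (simp add: field_simps)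
 qed
 thus ?thesis using that B by blast
qed

lemma orthogonal_commute:
 assumes "(Ga :: real mat) \<in> mats n n" "tr Ga * Ga = 1\<^sub>m n" shows "Ga * tr Ga = 1\<^sub>m n"
 using mat_mult_left_right_inverse[OF _ assms(1,2)] assms(1) by simp

lemma mat_diag_mult: "diag n f * diag n g = diag n (\<lambda>i. f i * g i :: 'a :: comm_ring_1)" by simp

lemma mat_diag_transpose [simp]: "tr (diag n f) = diag n f" by (rule eq_matI) (auto simp: mat_diag_def)

lemma quadratic_conjugate_diag:
 assumes Ga: "Ga \<in> mats n n" and x: "x \<in> vecs n" shows "x \<bullet> ((Ga * diag n f * tr Ga) *\<^sub>v x)
   = (\<Sum>i<n. f i * ((tr Ga *\<^sub>v x) $ i)^2 :: real)"
proof -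
 define y where "y = tr Ga *\<^sub>v x"
 have y: "y \<in> vecs n" using matsD[OF Ga] by (simp add: y_def)
 have "x \<bullet> ((Ga * diag n f * tr Ga) *\<^sub>v x) = y \<bullet> (diag n f *\<^sub>v y)"
  using scalar_prod_mult_mat_vec[OF Ga x, of "diag n f *\<^sub>v y"] Ga x by (simp add: mat_dim_vec_assoc y_def)
 also have "... = (\<Sum>i<n. f i * (y $ i)^2)" using y unfolding scalar_prod_def
  by (intro sum.cong) (auto simp: mat_diag_def scalar_prod_def power2_eq_square
    if_distrib[of "\<lambda>x. x * _"] sum.delta cong: if_cong)
 finally show ?thesis by (simp add: y_def)
qed

lemma orthogonal_norm:
 assumes "(Ga :: real mat) \<in> mats n n" "tr Ga * Ga = 1\<^sub>m n" "x \<in> vecs n"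
 shows "(\<Sum>i<n. ((tr Ga *\<^sub>v x) $ i)^2) = (vec_l2 x)^2" using assms orthogonal_commute[OF assms(1,2)] quadratic_conjugate_diag[OF assms(1,3), of "\<lambda>_. 1"] by (simp add: vec_l2_sq)

text \<open>The correction \<open>\<Psi>\<close> is the square root of the symmetrised inverse \<open>G\<close> of a perturbed Gram
 matrix \<open>K = Z\<^sup>T Z + N\<close>.\<close>

lemma matrix_split:
 assumes "dim_row B = dim_row A" "dim_col B = dim_col A" "dim_row C = dim_row A" "dim_col C = dim_col A"
  "dim_row D = dim_row A" "dim_col D = dim_col A" shows "A - B = C + D + (A - (B + C + (D :: 'a :: ab_group_add mat)))" using assms by auto

text \<open>The singular values of \<open>Z\<close> lie between 1/2 and 2, and \<open>N\<close> is
  small compared with the resulting lower bound 1/4 for \<open>tr Z * Z\<close>. \<open>N\<close> is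
  not assumed symmetric, so neither \<open>K\<close> nor its inverse \<open>G\<close> has to
  be.\<close>

locale correction_setting =
 fixes r :: nat and Z N K G :: "real mat" and \<nu> :: real
 assumes Z: "Z \<in> mats r r" and N: "N \<in> mats r r"
  and Z_upper: "opb Z 2" and Z_lower: "\<And>x. x \<in> vecs r \<Longrightarrow> 1 / 2 * vec_l2 x \<le> vec_l2 (Z *\<^sub>v x)"
  and N_fro: "fro N \<le> \<nu>" and \<nu>_small: "\<nu> \<le> 1 / 16" and K_def: "K = tr Z * Z + N"
  and G: "G \<in> mats r r" "K * G = 1\<^sub>m r" "G * K = 1\<^sub>m r"
begin

lemma K: "K \<in> mats r r" using N by (simp add: K_def)

lemma \<nu>_nonneg: "0 \<le> \<nu>" using N_fro fro_nonneg[of N] by linarith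

text \<open>The constant is 1/4 from \<open>Z\<close> less 1/16 from \<open>N\<close>.\<close>

lemma K_quadratic:
 assumes y: "y \<in> vecs r" shows "3 / 16 * (vec_l2 y)^2 \<le> y \<bullet> (K *\<^sub>v y)"
proof -
 have "y \<bullet> (K *\<^sub>v y) = y \<bullet> (tr Z *\<^sub>v (Z *\<^sub>v y)) + y \<bullet> (N *\<^sub>v y)" using Z N y unfolding K_def
  by (simp add: add_mult_distrib_mat_vec[of _ r r] scalar_prod_add_distrib[of _ r])
 also have "y \<bullet> (tr Z *\<^sub>v (Z *\<^sub>v y)) = (vec_l2 (Z *\<^sub>v y))^2"
  using scalar_prod_mult_mat_vec[of "tr Z" r r y "Z *\<^sub>v y"] Z y by (simp add: vec_l2_sq)
 also have "y \<bullet> (N *\<^sub>v y) \<ge> - (1 / 16 * vec_l2 y * vec_l2 y)"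
  using opb_quadratic[OF opb_mono[OF opb_fro, of N "1 / 16"] N y y] N_fro \<nu>_small by linarith
 moreover have "(1 / 2 * vec_l2 y)^2 \<le> (vec_l2 (Z *\<^sub>v y))^2" using Z_lower[OF y] by simp
 ultimately show ?thesis by (simp add: power2_eq_square)
qed

lemma K_upper: "opb K 5" unfolding K_def
 using opb_add[OF opb_mult[OF opb_transpose[OF Z_upper Z] Z_upper, of r r r] opb_mono[OF opb_fro, of N 1], of r r] Z N N_fro \<nu>_small by auto

lemma G_inverse_vec: "x \<in> vecs r \<Longrightarrow> K *\<^sub>v (G *\<^sub>v x) = x"
 using G K by (simp flip: assoc_mult_mat_vec[of _ r r _ r])

lemma G_upper: "opb G 6"
proof (rule opbI[OF G(1)])
 fix x :: "real Matrix.vec" assume x: "x \<in> vecs r"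
 define y where "y = G *\<^sub>v x"
 have y: "y \<in> vecs r" using G by (simp add: y_def)
 have "3 / 16 * (vec_l2 y)^2 \<le> y \<bullet> x" using K_quadratic[OF y] G_inverse_vec[OF x] by (simp add: y_def)
 also have "... \<le> vec_l2 y * vec_l2 x" using scalar_prod_abs_le[of y x] x y by auto
 finally have "vec_l2 y * (3 / 16 * vec_l2 y) \<le> vec_l2 y * vec_l2 x" by (simp add: power2_eq_square)
 hence "3 / 16 * vec_l2 y \<le> vec_l2 x" using vec_l2_nonneg[of y] vec_l2_nonneg[of x] mult_le_cancel_left_pos[of "vec_l2 y"]
  by (metis mult_zero_right order.strict_iff_order)
 thus "vec_l2 (G *\<^sub>v x) \<le> 6 * vec_l2 x" using vec_l2_nonneg[of x] unfolding y_def by linarith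
qed

definition "Gs = (1 / 2) \<cdot>\<^sub>m (G + tr G)"

lemma Gs: "Gs \<in> mats r r" "tr Gs = Gs" using G unfolding Gs_def by auto

lemma Gs_quadratic_eq:
 assumes x: "x \<in> vecs r" shows "x \<bullet> (Gs *\<^sub>v x) = x \<bullet> (G *\<^sub>v x)"
proof -
 have "x \<bullet> (tr G *\<^sub>v x) = x \<bullet> (G *\<^sub>v x)"
  using scalar_prod_mult_mat_vec[of "tr G" r r x x] scalar_prod_commute[of "G *\<^sub>v x" x] G x by simp
 moreover have "Gs *\<^sub>v x = (1 / 2) \<cdot>\<^sub>v (G *\<^sub>v x + tr G *\<^sub>v x)"
  using G x by (intro eq_vecI) (auto simp: Gs_def scalar_prod_def algebra_simps sum.distrib sum_distrib_left
   sum_divide_distrib add_divide_distrib)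
 ultimately show ?thesis using G x by (simp add: scalar_prod_add_distrib[of _ r])
qed

text \<open>With \<open>y = G x\<close> the form equals \<open>y . K y\<close>, which is at least
  \<open>3/16 |y|^2\<close>, while \<open>|x|\<close> is at most \<open>5 |y|\<close>. The constants
  are relaxed to the squares of 1/12 and 3, because it is the square root of \<open>Gs\<close> that
  is needed later.\<close>

lemma Gs_quadratic:
 assumes x: "x \<in> vecs r"
 shows "1 / 144 * (vec_l2 x)^2 \<le> x \<bullet> (Gs *\<^sub>v x)" "x \<bullet> (Gs *\<^sub>v x) \<le> 9 * (vec_l2 x)^2"
proof -
 define y where "y = G *\<^sub>v x"
 have y: "y \<in> vecs r" using G by (simp add: y_def)
 have "vec_l2 x \<le> 5 * vec_l2 y" using opbD[OF K_upper K y] G_inverse_vec[OF x] by (simp add: y_def)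
 hence "(vec_l2 x)^2 \<le> (5 * vec_l2 y)^2" by (intro power_mono) auto
 hence "(vec_l2 x)^2 \<le> 25 * (vec_l2 y)^2" by simp
 moreover have "3 / 16 * (vec_l2 y)^2 \<le> y \<bullet> x" using K_quadratic[OF y] G_inverse_vec[OF x] by (simp add: y_def)
 moreover have "y \<bullet> x = x \<bullet> (Gs *\<^sub>v x)" using scalar_prod_commute[of y x] x y by (simp add: Gs_quadratic_eq[OF x] y_def)
 ultimately show "1 / 144 * (vec_l2 x)^2 \<le> x \<bullet> (Gs *\<^sub>v x)" using zero_le_power2[of "vec_l2 y"] by linarith
 have "x \<bullet> (Gs *\<^sub>v x) \<le> 6 * vec_l2 x * vec_l2 x" using opb_quadratic[OF G_upper G(1) x x] by (simp add: Gs_quadratic_eq[OF x])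
 thus "x \<bullet> (Gs *\<^sub>v x) \<le> 9 * (vec_l2 x)^2" using zero_le_power2[of "vec_l2 x"] unfolding power2_eq_square by linarith
qed

text \<open>Evaluating the form of \<open>Gs\<close> at the columns of \<open>Ga\<close> shows that
  its eigenvalues are positive, so they can be written as \<open>1 / (s l)^2\<close>.\<close>

lemma correction_exists:
 "\<exists>Ga s. Ga \<in> mats r r \<and> tr Ga * Ga = 1\<^sub>m r \<and> (\<forall>l<r. 0 < (s l :: real)) \<and>
  Gs = Ga * diag r (\<lambda>l. 1 / (s l)^2) * tr Ga"
proof -
 obtain Ga d where Ga: "Ga \<in> mats r r" "tr Ga * Ga = 1\<^sub>m r" and d: "Gs = Ga * diag r d * tr Ga"
  using real_spectral_theorem[OF Gs] by blast
 have pos: "0 < d l" if l: "l < r" for l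
 proof -
  define x where "x = Ga *\<^sub>v unit_vec r l"
  have x: "x \<in> vecs r" using Ga by (simp add: x_def)
  have e: "tr Ga *\<^sub>v x = unit_vec r l" unfolding x_def using Ga by (simp flip: assoc_mult_mat_vec[of _ r r _ r])
  have "x \<bullet> (Gs *\<^sub>v x) = (\<Sum>i<r. d i * (unit_vec r l $ i)^2)" unfolding d quadratic_conjugate_diag[OF Ga(1) x] e ..
  also have "... = (\<Sum>i<r. if i = l then d i else 0)" by (intro sum.cong) (auto simp: unit_vec_def)
  also have "... = d l" using l by simp
  have "(vec_l2 x)^2 = (\<Sum>i<r. (unit_vec r l $ i)^2)" using orthogonal_norm[OF Ga x] e by simp
  moreover have "... = (\<Sum>i<r. if i = l then 1 else (0::real))" by (intro sum.cong) (auto simp: unit_vec_def)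
  ultimately show ?thesis using Gs_quadratic(1)[OF x] l by simp
 qed
 define s where "s l = 1 / sqrt (d l)" for l
 have "diag r (\<lambda>l. 1 / (s l)^2) = diag r d" using pos by (intro eq_matI) (auto simp: mat_diag_def s_def power_divide less_imp_le)
 thus ?thesis using Ga d pos by (intro exI[of _ Ga] exI[of _ s]) (auto simp: s_def)
qed

end

text \<open>\<open>lam\<close> are the perturbed and \<open>ls\<close> the true eigenvalues;
  \<open>\<epsilon>\<close> measures how far \<open>Z\<close> is from intertwining the two diagonal
  matrices.\<close>

locale correction_bound = correction_setting +
 fixes Ga \<Psi> :: "real mat" and s lam ls :: "nat \<Rightarrow> real" and lmax \<epsilon> :: real
 assumes Ga: "Ga \<in> mats r r" "tr Ga * Ga = 1\<^sub>m r" and s_pos: "\<And>l. l < r \<Longrightarrow> 0 < s l"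
  and Gs_spectral: "Gs = Ga * diag r (\<lambda>l. 1 / (s l)^2) * tr Ga" and \<Psi>_def: "\<Psi> = Ga * diag r (\<lambda>l. 1 / s l) * tr Ga"
  and lam: "\<And>l. l < r \<Longrightarrow> \<bar>lam l\<bar> \<le> 2 * lmax" and ls: "\<And>l. l < r \<Longrightarrow> \<bar>ls l\<bar> \<le> lmax" and lmax: "0 \<le> lmax"
  and E_fro: "fro (Z * diag r lam - diag r ls * Z) \<le> \<epsilon>"
begin

lemma \<Psi>: "\<Psi> \<in> mats r r" "tr \<Psi> = \<Psi>" "\<Psi> * \<Psi> = Gs"
proof -
 show "\<Psi> \<in> mats r r" "tr \<Psi> = \<Psi>" using Ga(1) by (simp_all add: \<Psi>_def mat_dim_simps)
 have "\<Psi> * \<Psi> = Ga * (diag r (\<lambda>l. 1 / s l) * ((tr Ga * Ga) * (diag r (\<lambda>l. 1 / s l) * tr Ga)))"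
  using matsD[OF Ga(1)] by (simp add: \<Psi>_def mat_dim_simps)
 also have "... = Ga * (diag r (\<lambda>l. 1 / s l) * diag r (\<lambda>l. 1 / s l) * tr Ga)"
  unfolding Ga(2) using matsD[OF Ga(1)] by (simp only: mat_dim_assoc dim_mat_diag index_transpose_mat) simp
 finally show "\<Psi> * \<Psi> = Gs" using matsD[OF Ga(1)] unfolding Gs_spectral power2_eq_square by (simp add: mat_dim_assoc)
qed

lemma s_bounds: assumes l: "l < r" shows "1 / 12 \<le> 1 / s l"
proof -
 define x where "x = Ga *\<^sub>v unit_vec r l"
 have x: "x \<in> vecs r" using Ga by (simp add: x_def)
 have e: "tr Ga *\<^sub>v x = unit_vec r l" unfolding x_def using Ga by (simp flip: assoc_mult_mat_vec[of _ r r _ r])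
 have "x \<bullet> (Gs *\<^sub>v x) = (\<Sum>i<r. 1 / (s i)^2 * (unit_vec r l $ i)^2)"
  unfolding Gs_spectral quadratic_conjugate_diag[OF Ga(1) x] e ..
 also have "... = (\<Sum>i<r. if i = l then 1 / (s i)^2 else 0)" by (intro sum.cong) (auto simp: unit_vec_def)
 also have "... = 1 / (s l)^2" using l by simp
 have "(vec_l2 x)^2 = (\<Sum>i<r. (unit_vec r l $ i)^2)" using orthogonal_norm[OF Ga x] e by simp
 moreover have "... = (\<Sum>i<r. if i = l then 1 else (0::real))" by (intro sum.cong) (auto simp: unit_vec_def)
 ultimately show ?thesis using Gs_quadratic(1)[OF x] l s_pos[OF l] power2_le_imp_le[of "1 / 12" "1 / s l"] by (simp add: power_divide)
qed

lemma \<Psi>_quadratic: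
 assumes x: "x \<in> vecs r" shows "1 / 12 * (vec_l2 x)^2 \<le> x \<bullet> (\<Psi> *\<^sub>v x)"
 unfolding \<Psi>_def quadratic_conjugate_diag[OF Ga(1) x] orthogonal_norm[OF Ga x, symmetric] sum_distrib_left
 using s_bounds by (intro sum_mono mult_right_mono) auto

lemma \<Psi>_upper: "opb \<Psi> 3"
proof (rule opbI[OF \<Psi>(1)])
 fix x :: "real Matrix.vec" assume x: "x \<in> vecs r"
 have "(vec_l2 (\<Psi> *\<^sub>v x))^2 = x \<bullet> (\<Psi> *\<^sub>v (\<Psi> *\<^sub>v x))"
  using scalar_prod_mult_mat_vec[OF \<Psi>(1) x, of "\<Psi> *\<^sub>v x"] \<Psi> by (simp add: vec_l2_sq)
 also have "... = x \<bullet> (Gs *\<^sub>v x)" using \<Psi> x by (simp flip: assoc_mult_mat_vec[of _ r r _ r])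
 also have "... \<le> (3 * vec_l2 x)^2" using Gs_quadratic(2)[OF x] by simp
 finally show "vec_l2 (\<Psi> *\<^sub>v x) \<le> 3 * vec_l2 x" by (rule power2_le_imp_le) simp
qed

text \<open>If \<open>N\<close> and the intertwining error both vanished, \<open>\<Psi>\<close>
  would be the inverse square root of \<open>tr Z * Z\<close> and would commute with the diagonal
  matrix of \<open>lam\<close>, and the product would be exactly \<open>diag r ls\<close>. The
  actual error splits into the deviation of \<open>Gs\<close> from the inverse of
  \<open>tr Z * Z\<close>, the intertwining error, and the commutator of
  \<open>\<Psi>\<close>.\<close>

theorem corrected_error: "fro (Z * \<Psi> * diag r lam * \<Psi> * tr Z - diag r ls) \<le> 8000 * (\<epsilon> + lmax * \<nu>)"
proof -
 define La Ls where "La = diag r lam" and "Ls = diag r ls"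
 have D: "La \<in> mats r r" "Ls \<in> mats r r" "tr La = La" "tr Ls = Ls" by (simp_all add: La_def Ls_def)
 have oLa: "opb La (2 * lmax)" and oLs: "opb Ls lmax" using lam ls lmax by (auto simp: La_def Ls_def intro!: opb_diag)
 define E where "E = Z * La - Ls * Z"
 have E: "E \<in> mats r r" "fro E \<le> \<epsilon>" using Z E_fro by (simp_all add: E_def La_def Ls_def)
 have \<epsilon>0: "0 \<le> \<epsilon>" using E(2) fro_nonneg[of E] by linarith
 obtain Y where Y: "Y \<in> mats r r" "Z * Y = 1\<^sub>m r" "Y * Z = 1\<^sub>m r" "opb Y 2"
  using square_inverse_exists[OF Z, of "1/2"] Z_lower by auto
 note dims = Z N G(1) K \<Psi>(1) Gs(1) D(1,2) E(1) Y(1)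
 note dimD = dims[THEN matsD(1)] dims[THEN matsD(2)]
 have YT: "tr Y * tr Z = 1\<^sub>m r" "tr Z * tr Y = 1\<^sub>m r" using arg_cong[OF Y(2), of tr] arg_cong[OF Y(3), of tr] Y(1) Z
  by (simp_all add: mat_dim_simps)
 \<comment> \<open>The inverse of \<open>tr Z * Z\<close>, which is the value of \<open>Gs\<close>
   for \<open>N = 0\<close>.\<close>
 define P where "P = Y * tr Y"
 have P: "P \<in> mats r r" "tr P = P" by (simp_all add: P_def mat_dim_simps dimD)
 have oP: "opb P 4" using opb_mult[OF Y(4) opb_transpose[OF Y(4,1)], of r r r] Y(1) by (simp add: P_def)
 note dimD = dimD matsD[OF P(1)]
 have ZZP: "tr Z * Z * P = 1\<^sub>m r"
 proof -
  have "tr Z * Z * P = tr Z * ((Z * Y) * tr Y)" by (simp add: P_def mat_dim_simps dimD)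
  thus ?thesis using Y(1) YT(2) unfolding Y(2) by simp
 qed
 have PZZ: "P * (tr Z * Z) = 1\<^sub>m r" using arg_cong[OF ZZP, of tr] P by (simp add: mat_dim_simps dimD)
 have ZPZ: "Z * P * tr Z = 1\<^sub>m r" using YT(1) Y(2) by (simp add: P_def mat_dim_simps dimD)
 have GP: "P - G = G * N * P"
 proof -
  have "K - tr Z * Z = N" unfolding K_def by (rule mat_plus_minus_cancel') (simp_all add: dimD)
  hence "G * N * P = G * ((K - tr Z * Z) * P)" by (simp add: mat_dim_assoc dimD)
  also have "... = G * K * P - G * (tr Z * Z * P)" by (simp add: mat_dim_simps dimD)
  finally show ?thesis using G P by (simp add: ZZP)
 qed
 have fGP: "fro (P - G) \<le> 24 * \<nu>" using fro_mult_right[OF oP, of "G * N" r r r] fro_mult_left[OF G_upper G(1) N] G N P N_fro by (auto simp: GP)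
 define Df where "Df = Gs - P"
 have Df: "Df \<in> mats r r" using P by (simp add: Df_def)
 have "Df = (- 1 / 2) \<cdot>\<^sub>m ((P - G) + tr (P - G))"
 proof -
  have "P $$ (j, i) = P $$ (i, j)" if "i < r" "j < r" for i j using arg_cong[OF P(2), of "\<lambda>A. A $$ (i, j)"] that by (simp add: dimD)
  thus ?thesis by (intro eq_matI) (auto simp: Df_def Gs_def dimD field_simps)
 qed
 hence fDf: "fro Df \<le> 24 * \<nu>"
  using fro_add[of "P - G" r r "tr (P - G)"] fGP G by (simp add: fro_smult fro_transpose[of "P - G"] del: fro_transpose)
 note dimD = dimD matsD[OF Df]
 \<comment> \<open>The cross term \<open>tr Z * Ls * Z\<close> is symmetric, so it drops out of the
   difference on the right.\<close>
 have comZ: "tr Z * Z * La - La * (tr Z * Z) = tr Z * E - tr E * Z"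
 proof -
  have "tr Z * E = tr Z * Z * La - tr Z * (Ls * Z)" by (simp add: E_def mat_dim_simps dimD)
  moreover have "tr E * Z = La * (tr Z * Z) - tr Z * (Ls * Z)" by (simp add: E_def mat_dim_simps dimD D transpose_minus')
  ultimately show ?thesis by (simp only:) (rule mat_minus_minus_cancel[symmetric], simp_all add: dimD)
 qed
 have fcomZ: "fro (tr Z * Z * La - La * (tr Z * Z)) \<le> 4 * \<epsilon>"
 proof -
  have "fro (tr Z * E - tr E * Z) \<le> fro (tr Z * E) + fro (tr E * Z)" using Z E by (intro fro_minus[of _ r r]) auto
  also have "... \<le> 2 * fro E + 2 * fro (tr E)"
   using Z E by (intro add_mono fro_mult_left[of _ _ r r _ r] fro_mult_right[of _ _ _ r r r] opb_transpose[OF Z_upper Z] Z_upper) auto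
  finally show ?thesis using E(2) by (simp add: comZ)
 qed
 \<comment> \<open>The commutator with an inverse:
   \<open>[P, La] = - P [P^-1, La] P\<close>.\<close>
 have comP: "P * La - La * P = - (P * (tr Z * Z * La - La * (tr Z * Z)) * P)"
 proof -
  have "P * (tr Z * Z * La - La * (tr Z * Z)) * P
   = (P * (tr Z * Z)) * (La * P) - (P * La) * (tr Z * Z * P)" by (simp add: mat_dim_simps dimD)
  also have "... = La * P - P * La" using D by (simp add: PZZ ZZP)
  finally show ?thesis by (simp only:) (rule mat_minus_flip, simp_all add: dimD)
 qed
 have fcomP: "fro (P * La - La * P) \<le> 64 * \<epsilon>"
 proof -
  let ?C = "tr Z * Z * La - La * (tr Z * Z)"
  have "fro (P * ?C * P) \<le> 4 * fro (P * ?C)" by (rule fro_mult_right[OF oP, of _ r r r]) (simp_all add: carrier_matI dimD)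
  moreover have "fro (P * ?C) \<le> 4 * fro ?C" by (rule fro_mult_left[OF oP, of r r _ r]) (simp_all add: carrier_matI dimD)
  ultimately show ?thesis using fcomZ by (simp only: comP fro_uminus)
 qed
 have fcomDf: "fro (Df * La - La * Df) \<le> 96 * lmax * \<nu>"
 proof -
  have "fro (Df * La - La * Df) \<le> fro (Df * La) + fro (La * Df)" using Df D by (intro fro_minus[of _ r r]) auto
  also have "... \<le> 2 * lmax * fro Df + 2 * lmax * fro Df"
   using Df D lmax by (intro add_mono fro_mult_left[OF oLa, of r r _ r] fro_mult_right[OF oLa, of _ r r r]) auto
  also have "... = 4 * lmax * fro Df" by simp
  also have "... \<le> 4 * lmax * (24 * \<nu>)" using fDf lmax by (intro mult_left_mono) auto
  finally show ?thesis by simp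
 qed
 have Gs_split: "Gs = P + Df" unfolding Df_def by (rule mat_plus_minus_cancel[symmetric]) (simp_all add: dimD)
 define S where "S = \<Psi> * La - La * \<Psi>"
 have S: "S \<in> mats r r" using \<Psi> D by (simp add: S_def)
 note dimD = dimD matsD[OF S]
 have fS: "fro S \<le> 384 * \<epsilon> + 576 * lmax * \<nu>"
 proof -
  have "fro S \<le> fro (\<Psi> * \<Psi> * La - La * (\<Psi> * \<Psi>)) / (2 * (1 / 12))"
   unfolding S_def using \<Psi> D \<Psi>_quadratic by (intro commutator_square_root[of _ r]) auto
  also have "\<Psi> * \<Psi> * La - La * (\<Psi> * \<Psi>) = (P * La - La * P) + (Df * La - La * Df)"
   unfolding \<Psi>(3) Gs_split by (simp add: mat_dim_simps dimD mat_plus_minus_plus)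
  finally show ?thesis using fro_add[of "P * La - La * P" r r "Df * La - La * Df"] fcomP fcomDf P Df D by auto
 qed
 \<comment> \<open>Moving one \<open>\<Psi>\<close> past \<open>La\<close> costs \<open>S\<close>
   and leaves \<open>Z * La * Gs * tr Z\<close>; then \<open>Z * La = Ls * Z + E\<close>,
   \<open>Gs = P + Df\<close> and \<open>Z * P * tr Z = 1\<close> produce \<open>Ls\<close> and the
   other two terms.\<close>
 have split: "Z * \<Psi> * La * \<Psi> * tr Z - Ls
   = Ls * (Z * Df * tr Z) + E * Gs * tr Z + Z * S * \<Psi> * tr Z"
 proof -
  have "Z * S * \<Psi> * tr Z = Z * \<Psi> * La * \<Psi> * tr Z - Z * La * (\<Psi> * \<Psi>) * tr Z" by (simp add: S_def mat_dim_simps dimD)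
  moreover have "Z * La = Ls * Z + E" unfolding E_def by (rule mat_plus_minus_cancel[symmetric]) (simp_all add: dimD)
  hence "Z * La * (\<Psi> * \<Psi>) * tr Z = Ls * (Z * Gs * tr Z) + E * Gs * tr Z" unfolding \<Psi>(3) by (simp add: mat_dim_simps dimD)
  moreover have "Ls * (Z * Gs * tr Z) = Ls * (Z * P * tr Z) + Ls * (Z * Df * tr Z)" unfolding Gs_split by (simp add: mat_dim_simps dimD)
  moreover have "Ls * (Z * P * tr Z) = Ls" unfolding ZPZ using D by simp
  ultimately show ?thesis by (simp only:) (rule matrix_split, simp_all add: dimD)
 qed
 have "fro (Ls * (Z * Df * tr Z)) \<le> lmax * fro (Z * Df * tr Z)"
  using lmax by (intro fro_mult_left[OF oLs, of r r _ r]) (simp_all add: carrier_matI dimD)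
 also have "fro (Z * Df * tr Z) \<le> 2 * fro (Z * Df)"
  by (rule fro_mult_right[OF opb_transpose[OF Z_upper Z], of _ r r r]) (simp_all add: carrier_matI dimD)
 also have "fro (Z * Df) \<le> 2 * fro Df" by (rule fro_mult_left[OF Z_upper, of r r _ r]) (simp_all add: carrier_matI dimD)
 finally have "fro (Ls * (Z * Df * tr Z)) \<le> lmax * (2 * (2 * fro Df))" using lmax by (simp add: mult_left_mono)
 also have "... \<le> lmax * (2 * (2 * (24 * \<nu>)))" using fDf lmax by (intro mult_left_mono) auto
 finally have t1: "fro (Ls * (Z * Df * tr Z)) \<le> 96 * lmax * \<nu>" by simp
 have oGs: "opb Gs 9" using opb_mult[OF \<Psi>_upper \<Psi>_upper \<Psi>(1) \<Psi>(1)] \<Psi>(3) by simp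
 have "fro (E * Gs * tr Z) \<le> 2 * fro (E * Gs)"
  by (rule fro_mult_right[OF opb_transpose[OF Z_upper Z], of _ r r r]) (simp_all add: carrier_matI dimD)
 moreover have "fro (E * Gs) \<le> 9 * fro E" by (rule fro_mult_right[OF oGs, of _ r r r]) (simp_all add: carrier_matI dimD)
 ultimately have t2: "fro (E * Gs * tr Z) \<le> 18 * \<epsilon>" using E by linarith
 have "fro (Z * S * \<Psi> * tr Z) \<le> 2 * fro (Z * S * \<Psi>)"
  using Z \<Psi> by (intro fro_mult_right[of _ _ _ r r r] opb_transpose[OF Z_upper Z]) auto
 moreover have "fro (Z * S * \<Psi>) \<le> 3 * fro (Z * S)" using Z S \<Psi> by (intro fro_mult_right[of _ _ _ r r r] \<Psi>_upper) auto
 moreover have "fro (Z * S) \<le> 2 * fro S" using Z S by (intro fro_mult_left[of _ _ r r _ r] Z_upper) auto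
 ultimately have t3: "fro (Z * S * \<Psi> * tr Z) \<le> 4608 * \<epsilon> + 6912 * lmax * \<nu>" using fS by linarith
 have "fro (Z * \<Psi> * La * \<Psi> * tr Z - Ls)
  \<le> fro (Ls * (Z * Df * tr Z) + E * Gs * tr Z) + fro (Z * S * \<Psi> * tr Z)"
  unfolding split by (rule fro_add[of _ r r]) (simp_all add: carrier_matI dimD)
 also have "fro (Ls * (Z * Df * tr Z) + E * Gs * tr Z) \<le> fro (Ls * (Z * Df * tr Z)) + fro (E * Gs * tr Z)"
  by (rule fro_add[of _ r r]) (simp_all add: carrier_matI dimD)
 finally show ?thesis using t1 t2 t3 \<epsilon>0 mult_nonneg_nonneg[OF lmax \<nu>_nonneg] by (simp add: La_def Ls_def)
qed

end

section \<open>Eigenvector blocks as Neumann series\<close>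

text \<open>A convergent series is summed without being formed: the recursion is unrolled
  \<open>J\<close> times and the remainder tends to zero. The constant \<open>K\<close> does not
  enter the conclusion, so tails may be estimated crudely.\<close>

lemma geometric_bound:
 fixes t :: "nat \<Rightarrow> real"
 assumes step: "\<And>j. t j \<le> c * (1 / 2) ^ j + t (Suc j)" and tail: "\<And>j. t j \<le> K * (1 / 2) ^ j" shows "t 0 \<le> 2 * c"
proof -
 have partial: "t 0 \<le> c * (\<Sum>j<J. (1 / 2) ^ j) + t J" for J
  by (induction J) (use step in \<open>auto simp: algebra_simps intro: order_trans\<close>)
 have "t 0 \<le> 2 * c + (K - 2 * c) * (1 / 2) ^ J" for J using partial[of J] tail[of J] by (simp add: geometric_sum algebra_simps)
 moreover have "(\<lambda>J. 2 * c + (K - 2 * c) * (1 / 2) ^ J) \<longlonglongrightarrow> 2 * c + (K - 2 * c) * 0"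
  by (intro tendsto_intros LIMSEQ_power_zero) auto
 ultimately show ?thesis using LIMSEQ_le_const by fastforce
qed

lemma pow_mat_Suc_left:
 assumes A: "A \<in> mats n n" shows "A ^\<^sub>m Suc k = A * A ^\<^sub>m k"
proof (induction k)
 case 0
 show ?case using A by simp
next
 case (Suc k)
 have "A ^\<^sub>m Suc (Suc k) = (A * A ^\<^sub>m k) * A" using Suc by simp
 also have "... = A * A ^\<^sub>m Suc k" using A by (simp add: mat_dim_assoc)
 finally show ?case .
qed

text \<open>Iterating the fixed point equation gives the series with terms
  \<open>H^j Us Z L^j\<close>. Two rates are kept apart: the terms, seen through \<open>B\<close>,
  decay at a rate governed by \<open>rh\<close>, while the operator norm \<open>h\<close> of
  \<open>H\<close> only makes the remainder vanish.\<close>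

lemma fro_neumann:
 assumes Us: "Us \<in> mats n r" and U: "U \<in> mats n m" and Z: "Z \<in> mats r m"
  and L: "L \<in> mats m m" and H: "H \<in> mats n n" and B: "B \<in> mats q n" and eq: "U = Us * Z + H * U * L"
  and oL: "opb L \<tau>" and oH: "opb H h" and oZ: "opb Z z"
  and nonneg: "0 \<le> \<tau>" "0 \<le> h" "0 \<le> z" and small: "rh * \<tau> \<le> 1 / 2" "h * \<tau> \<le> 1 / 2" and rh: "0 \<le> rh"
  and bound: "\<And>j. fro (B * H ^\<^sub>m j * Us) \<le> c * rh ^ j" shows "fro (B * U) \<le> 2 * (c * z)"
proof -
 define T where "T j = B * H ^\<^sub>m j * U * L ^\<^sub>m j" for j
 have Hj: "H ^\<^sub>m j \<in> mats n n" for j using H by simp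
 have Lj: "L ^\<^sub>m j \<in> mats m m" for j using L by simp
 note dims = Us U Z L H B Hj Lj
 note dimD = dims[THEN matsD(1)] dims[THEN matsD(2)]
 have c0: "0 \<le> c" using bound[of 0] fro_nonneg[of "B * H ^\<^sub>m 0 * Us"] by (simp del: fro_nonneg)
 have T_Suc: "T j = B * H ^\<^sub>m j * Us * (Z * L ^\<^sub>m j) + T (Suc j)" for j
 proof -
  note LS = pow_mat_Suc_left[OF L, of j]
  have "T j = B * H ^\<^sub>m j * (Us * Z + H * U * L) * L ^\<^sub>m j" using eq by (simp add: T_def)
  also have "... = B * H ^\<^sub>m j * Us * (Z * L ^\<^sub>m j) + B * (H ^\<^sub>m j * H) * U * (L * L ^\<^sub>m j)"
   by (simp add: mat_dim_simps dimD)
  also have "H ^\<^sub>m j * H = H ^\<^sub>m Suc j" by simp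
  finally show ?thesis by (simp only: T_def LS)
 qed
 have term_le: "fro (B * H ^\<^sub>m j * Us * (Z * L ^\<^sub>m j)) \<le> c * z * (1 / 2) ^ j" for j
 proof -
  have "fro (B * H ^\<^sub>m j * Us * (Z * L ^\<^sub>m j)) \<le> (z * \<tau> ^ j) * fro (B * H ^\<^sub>m j * Us)"
   using opb_mult[OF oZ opb_pow[OF oL L nonneg(1)] Z Lj] nonneg by (intro fro_mult_right[of _ _ _ q r m]) (simp_all add: carrier_matI dimD)
  also have "... \<le> (z * \<tau> ^ j) * (c * rh ^ j)" using nonneg bound by (intro mult_left_mono) auto
  also have "... = c * z * (rh * \<tau>) ^ j" by (simp add: power_mult_distrib)
  also have "... \<le> c * z * (1 / 2) ^ j" using nonneg small rh c0 by (intro mult_left_mono power_mono) auto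
  finally show ?thesis .
 qed
 have "fro (B * U) = fro (T 0)" by (simp add: T_def dimD)
 also have "... \<le> 2 * (c * z)"
 proof (rule geometric_bound[where K = "fro B * fro U"])
  show "fro (T j) \<le> c * z * (1 / 2) ^ j + fro (T (Suc j))" for j
  proof -
   have "fro (T j) \<le> fro (B * H ^\<^sub>m j * Us * (Z * L ^\<^sub>m j)) + fro (T (Suc j))"
    unfolding T_Suc[of j] by (rule fro_add[of _ q m]) (simp_all add: T_def carrier_matI dimD)
   thus ?thesis using term_le[of j] by linarith
  qed
  show "fro (T j) \<le> fro B * fro U * (1 / 2) ^ j" for j
  proof -
   have "fro (T j) \<le> \<tau> ^ j * fro (B * H ^\<^sub>m j * U)" unfolding T_def using nonneg opb_pow[OF oL L nonneg(1)]
    by (intro fro_mult_right[of _ _ _ q m m]) (simp_all add: carrier_matI dimD)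
   moreover have "fro (B * H ^\<^sub>m j * U) \<le> fro (B * H ^\<^sub>m j) * fro U"
    by (intro fro_mult_left[of _ _ q n _ m] opb_fro) (simp_all add: carrier_matI dimD)
   moreover have "fro (B * H ^\<^sub>m j) \<le> h ^ j * fro B" using nonneg opb_pow[OF oH H nonneg(2)]
    by (intro fro_mult_right[of _ _ _ q n n]) (simp_all add: carrier_matI dimD)
   ultimately have "fro (T j) \<le> \<tau> ^ j * (h ^ j * fro B * fro U)"
    using nonneg by (meson fro_nonneg mult_left_mono mult_right_mono order_trans zero_le_power)
   also have "... = fro B * fro U * (h * \<tau>) ^ j" by (simp add: power_mult_distrib)
   also have "... \<le> fro B * fro U * (1 / 2) ^ j" using nonneg small by (intro mult_left_mono power_mono) auto
   finally show ?thesis .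
  qed
 qed
 finally show ?thesis .
qed

lemma fro_single_row: "A \<in> mats 1 m \<Longrightarrow> fro A = vec_l2 (Matrix.row A 0)" by (rule power2_eq_imp_eq, unfold fro_sq vec_l2_sq)
  (auto simp: scalar_prod_def power2_eq_square lessThan_atLeast0)

lemma fro_mono:
 assumes "A \<in> mats n m" "B \<in> mats n m" "0 \<le> c"
  "\<And>i j. \<lbrakk>i < n; j < m\<rbrakk> \<Longrightarrow> \<bar>A $$ (i, j)\<bar> \<le> c * \<bar>B $$ (i, j)\<bar>"
 shows "fro A \<le> c * fro B"
proof -
 have "(A $$ (i, j))^2 \<le> c^2 * (B $$ (i, j))^2" if "i < n" "j < m" for i j
  using power_mono[OF assms(4)[OF that], of 2] by (simp add: power_mult_distrib)
 hence "(fro A)^2 \<le> (c * fro B)^2" unfolding power_mult_distrib fro_sq sum_distrib_left using assms(1,2) by (auto intro!: sum_mono)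
 thus ?thesis using assms(3) by simp
qed

lemma fro_single_col: "A \<in> mats n 1 \<Longrightarrow> fro A = vec_l2 (col A 0)" unfolding fro_def by auto

lemma opb_diag_lower:
 assumes "\<And>i. i < n \<Longrightarrow> c \<le> \<bar>f i\<bar>" "0 \<le> c" "v \<in> vecs n"
 shows "c * vec_l2 v \<le> vec_l2 (diag n f *\<^sub>v v)"
proof -
 have e: "(diag n f *\<^sub>v v) $ i = f i * v $ i" if "i < n" for i using assms that by (simp add: mat_diag_mult_vec_index)
 have "c * vec_l2 v = L2_set (\<lambda>i. c * \<bar>v $ i\<bar>) {0..<n}"
  unfolding vec_l2_L2_set using assms by (simp add: L2_set_def power_mult_distrib sum_distrib_left[symmetric] real_sqrt_mult)
 also have "... \<le> L2_set (\<lambda>i. \<bar>(diag n f *\<^sub>v v) $ i\<bar>) {0..<n}"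
  using assms e by (intro L2_set_mono) (auto simp: abs_mult intro!: mult_right_mono)
 finally show ?thesis unfolding vec_l2_L2_set by (simp add: L2_set_def)
qed

lemma sandwich_index:
 assumes "U \<in> mats n r" "A \<in> mats r m" "V \<in> mats k m" "i < n" "j < k"
 shows "(U * A * tr V) $$ (i, j) = Matrix.row U i \<bullet> (A *\<^sub>v Matrix.row V j)"
proof -
 have "(U * A * tr V) $$ (i, j) = Matrix.row U i \<bullet> col (A * tr V) j" using assms by simp
 also have "col (A * tr V) j = A *\<^sub>v col (tr V) j" using assms by auto
 finally show ?thesis using assms by simp
qed

lemma row_mult_transpose: "\<lbrakk>A \<in> mats n m; B \<in> mats m k; i < n\<rbrakk> \<Longrightarrow>
  Matrix.row (A * (B :: 'a :: comm_semiring_0 mat)) i = tr B *\<^sub>v Matrix.row A i" by (rule eq_vecI) (auto simp: scalar_prod_def mult.commute)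

section \<open>The deterministic error bound\<close>

text \<open>In \<open>bilinear\<close> the first factor of \<open>H\<close> between two signal
  vectors costs \<open>e0\<close> and every further factor costs \<open>rh\<close>. The operator
  norm bound serves mainly to make remainders vanish; comparisons with the gaps go through
  \<open>e0\<close>.\<close>

locale noise_bounds =
 fixes n r :: nat and Us H :: "real mat" and ls :: "nat \<Rightarrow> real" and rh e0 lmin lmax :: real
 assumes r: "0 < r" and Us: "Us \<in> mats n r" "tr Us * Us = 1\<^sub>m r" and H: "H \<in> mats n n"
  and ls_lower: "\<And>k. k < r \<Longrightarrow> lmin \<le> \<bar>ls k\<bar>" and ls_upper: "\<And>k. k < r \<Longrightarrow> \<bar>ls k\<bar> \<le> lmax"
  and rh: "0 < rh" "64 * rh \<le> lmin" and e0: "0 < e0" and oH: "opb H (rh / 8)"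
  and bilinear: "\<And>s m k. \<lbrakk>m < r; k < r\<rbrakk> \<Longrightarrow> \<bar>(tr Us * H ^\<^sub>m Suc s * Us) $$ (m, k)\<bar> \<le> e0 * rh ^ s"
  and e0_small: "10000 * (lmax / lmin) * (real r * sqrt (real r)) * e0 \<le> lmin"
begin

definition "ka = lmax / lmin"

lemma lmin: "0 < lmin" using rh by linarith

lemma ka: "1 \<le> ka" using ls_lower[OF r] ls_upper[OF r] lmin by (simp add: ka_def)

lemma lmax: "lmax = ka * lmin" using lmin by (simp add: ka_def)

lemma lmax_pos: "0 < lmax" using ka lmin by (simp add: ka_def)

lemma sqrt_r: "1 \<le> sqrt (real r)" "1 \<le> real r" using r by auto

lemma e0_small': "10000 * real r * e0 \<le> lmin" "10000 * ka * real r * e0 \<le> lmin"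
proof -
 have "10000 * ka * real r * e0 = 10000 * ka * (real r * 1) * e0" by simp
 also have "... \<le> 10000 * ka * (real r * sqrt (real r)) * e0" using sqrt_r ka e0 by simp
 finally show *: "10000 * ka * real r * e0 \<le> lmin" using e0_small by (simp add: ka_def)
 have "10000 * 1 * real r * e0 \<le> 10000 * ka * real r * e0" using ka e0 by (intro mult_right_mono mult_left_mono) auto
 thus "10000 * real r * e0 \<le> lmin" using * by simp
qed

lemma fro_bilinear: "fro (tr Us * H * H ^\<^sub>m s * Us) \<le> (real r * e0) * rh ^ s"
proof -
 note HS = pow_mat_Suc_left[OF H, of s]
 have "fro (tr Us * H ^\<^sub>m Suc s * Us) \<le> sqrt (real (r * r)) * (e0 * rh ^ s)" using Us bilinear e0 rh by (intro fro_le_entries) auto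
 also have "tr Us * H ^\<^sub>m Suc s * Us = tr Us * H * H ^\<^sub>m s * Us" unfolding HS using Us H by (simp add: mat_dim_assoc)
 finally show ?thesis by simp
qed

lemma Us_norm: assumes v: "v \<in> vecs r" shows "vec_l2 (Us *\<^sub>v v) = vec_l2 v"
proof -
 have "(vec_l2 (Us *\<^sub>v v))^2 = v \<bullet> ((tr Us * Us) *\<^sub>v v)"
  using scalar_prod_mult_mat_vec[of "tr Us" r n v "Us *\<^sub>v v"] Us(1) v by (simp add: vec_l2_sq)
 hence "(vec_l2 (Us *\<^sub>v v))^2 = (vec_l2 v)^2" using Us(2) v by (simp add: vec_l2_sq)
 thus ?thesis by simp
qed

definition "Ms = Us * diag r ls * tr Us"

lemma Ms: "Ms \<in> mats n n" "tr Ms = Ms" using matsD[OF Us(1)] by (simp_all add: Ms_def mat_dim_simps)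

end

text \<open>In \<open>quadratic\<close> one of the two matrices \<open>W1\<close>, \<open>W2\<close>
  costs \<open>e0\<close> and the other \<open>rh\<close>, hence the exponent
  \<open>s + t + 1\<close>.\<close>

locale paired_noise = noise_bounds +
 fixes W1 W2 :: "real mat" and b :: real
 assumes W1: "W1 \<in> mats n n" "tr W1 = W1" and W2: "W2 \<in> mats n n" "tr W2 = W2"
  and entrywise: "\<And>s i k. \<lbrakk>i < n; k < r\<rbrakk> \<Longrightarrow> \<bar>(H ^\<^sub>m Suc s * Us) $$ (i, k)\<bar> \<le> e0 * rh ^ s"
  and linear1: "\<And>s m k. \<lbrakk>m < r; k < r\<rbrakk> \<Longrightarrow> \<bar>(tr (H ^\<^sub>m s * Us) * W1 * Us) $$ (m, k)\<bar> \<le> e0 * rh ^ s"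
  and linear2: "\<And>s m k. \<lbrakk>m < r; k < r\<rbrakk> \<Longrightarrow> \<bar>(tr (H ^\<^sub>m s * Us) * W2 * Us) $$ (m, k)\<bar> \<le> e0 * rh ^ s"
  and quadratic: "\<And>s t m k. \<lbrakk>m < r; k < r\<rbrakk> \<Longrightarrow>
   \<bar>(tr (H ^\<^sub>m s * Us) * W1 * W2 * (H ^\<^sub>m t * Us)) $$ (m, k)\<bar> \<le> e0 * rh ^ (s + t + 1)"
  and incoherent: "\<And>i. i < n \<Longrightarrow> vec_l2 (Matrix.row Us i) \<le> b"

locale eigen_block = noise_bounds +
 fixes U :: "real mat" and lam :: "nat \<Rightarrow> real" and \<delta> :: real
 assumes U: "U \<in> mats n r" and eigen: "\<And>l. l < r \<Longrightarrow> (Ms + H) *\<^sub>v col U l = lam l \<cdot>\<^sub>v col U l"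
  and unit: "\<And>l. l < r \<Longrightarrow> vec_l2 (col U l) = 1"
  and lam_lower: "\<And>l. l < r \<Longrightarrow> lmin / 2 \<le> \<bar>lam l\<bar>" and lam_upper: "\<And>l. l < r \<Longrightarrow> \<bar>lam l\<bar> \<le> 2 * lmax"
  and lam_gap: "\<And>k l. \<lbrakk>k < r; l < r; k \<noteq> l\<rbrakk> \<Longrightarrow> \<delta> / 2 \<le> \<bar>lam l - ls k\<bar>"
  and \<delta>: "0 < \<delta>" and \<delta>_large: "1000 * ka * (real r * sqrt (real r)) * e0 \<le> \<delta>"
begin

definition "Li = diag r (\<lambda>l. 1 / lam l)"
text \<open>Chosen so that \<open>Us * Z = Ms * U * Li\<close>, the part of the eigenvector equation
  lying in the signal space. As a product it is \<open>diag r ls * (tr Us * U) * Li\<close>.\<close>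

definition "Z = Matrix.mat r r (\<lambda>(k, l). ls k * (tr Us * U) $$ (k, l) / lam l)"

lemma dims: "Z \<in> mats r r" "Li \<in> mats r r" by (simp_all add: Z_def Li_def)

lemmas dimD = matsD[OF Us(1)] matsD[OF H] matsD[OF U] matsD[OF Ms(1)]
 matsD[OF dims(1)] matsD[OF dims(2)]

lemma lam_ne: "l < r \<Longrightarrow> lam l \<noteq> 0" using lam_lower[of l] lmin by auto

lemma oLi: "opb Li (2 / lmin)" unfolding Li_def
proof (rule opb_diag)
 fix l assume l: "l < r"
 have "1 / \<bar>lam l\<bar> \<le> 1 / (lmin / 2)" using lam_lower[OF l] lmin by (intro divide_left_mono) auto
 thus "\<bar>1 / lam l\<bar> \<le> 2 / lmin" by simp
qed (use lmin in simp)

lemma MsU: "Ms * U * Li = Us * Z"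
proof -
 have UU: "tr Us * U \<in> mats r r" by (simp add: dimD)
 have "diag r ls * (tr Us * U) * Li
   = Matrix.mat r r (\<lambda>(k, l). (diag r ls * (tr Us * U)) $$ (k, l) * (1 / lam l))"
  unfolding Li_def by (rule mat_diag_mult_right) (simp add: dimD)
 also have "... = Z" unfolding mat_diag_mult_left[OF UU] by (rule eq_matI) (simp_all add: Z_def)
 finally show ?thesis by (simp add: Ms_def mat_dim_assoc dimD)
qed

lemma MU: "(Ms + H) * U = U * diag r lam"
proof (rule eq_matI)
 fix i l assume "i < dim_row (U * diag r lam)" "l < dim_col (U * diag r lam)"
 hence il: "i < n" "l < r" by (simp_all add: dimD)
 have "((Ms + H) * U) $$ (i, l) = ((Ms + H) *\<^sub>v col U l) $ i" using il by (simp add: dimD)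
 also have "... = U $$ (i, l) * lam l" using eigen[OF il(2)] il by (simp add: dimD)
 finally show "((Ms + H) * U) $$ (i, l) = (U * diag r lam) $$ (i, l)" using il by (subst mat_diag_mult_right[OF U]) simp_all
qed (simp_all add: dimD)

lemma U_eq: "U = Us * Z + H * U * Li"
proof -
 have "(Ms + H) * U * Li = U * (diag r lam * Li)" unfolding MU by (simp add: mat_dim_assoc dimD)
 also have "diag r lam * Li = 1\<^sub>m r" unfolding Li_def mat_diag_mult using lam_ne by (intro eq_matI) (auto simp: mat_diag_def)
 finally show ?thesis unfolding MsU[symmetric] by (simp add: mat_dim_simps dimD)
qed

lemma rho_small: "rh * (2 / lmin) \<le> 1 / 2" "rh / 8 * (2 / lmin) \<le> 1 / 2" using rh by simp_all

text \<open>Column \<open>l\<close> of \<open>Z\<close> is almost a unit vector because \<open>u\<^sub>l = U\<^sup>\<star> z\<^sub>l + H u\<^sub>l / \<lambda>\<^sub>l\<close>.\<close>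

lemma Z_col_norm:
 assumes l: "l < r" shows "\<bar>vec_l2 (col Z l) - 1\<bar> \<le> 1 / 32"
proof -
 have "col U l = col (Us * Z) l + col (H * U * Li) l" by (subst U_eq, subst col_add) (use l in \<open>simp_all add: dimD\<close>)
 also have "col (Us * Z) l = Us *\<^sub>v col Z l" using l by (intro col_mult2[OF Us(1) dims(1)])
 also have "col (H * U * Li) l = (1 / lam l) \<cdot>\<^sub>v (H *\<^sub>v col U l)"
 proof -
  have "H * U * Li = Matrix.mat n r (\<lambda>(i, j). (H * U) $$ (i, j) * (1 / lam j))"
   unfolding Li_def by (rule mat_diag_mult_right) (simp add: dimD)
  thus ?thesis using l by (intro eq_vecI) (auto simp: dimD)
 qed
 finally have e: "col U l = Us *\<^sub>v col Z l + (1 / lam l) \<cdot>\<^sub>v (H *\<^sub>v col U l)" .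
 have c: "col U l \<in> vecs n" "col Z l \<in> vecs r" "H *\<^sub>v col U l \<in> vecs n" by (simp_all add: dimD carrier_vecI)
 have "vec_l2 (H *\<^sub>v col U l) \<le> rh / 8 * vec_l2 (col U l)" by (rule opbD[OF oH H c(1)])
 hence "\<bar>1 / lam l\<bar> * vec_l2 (H *\<^sub>v col U l) \<le> 2 / lmin * (rh / 8)"
  using lam_lower[OF l] lmin unit[OF l] by (intro mult_mono) (auto simp: field_simps)
 also have "... \<le> 1 / 32" using rh by simp
 finally have s: "vec_l2 ((1 / lam l) \<cdot>\<^sub>v (H *\<^sub>v col U l)) \<le> 1 / 32" by (simp add: vec_l2_smult)
 have "vec_l2 (col U l) \<le> vec_l2 (Us *\<^sub>v col Z l) + vec_l2 ((1 / lam l) \<cdot>\<^sub>v (H *\<^sub>v col U l))"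
  by (subst e, rule vec_l2_add[of _ n]) (use c in \<open>simp_all add: dimD\<close>)
 moreover have "vec_l2 (Us *\<^sub>v col Z l) \<le> vec_l2 (col U l) + vec_l2 ((1 / lam l) \<cdot>\<^sub>v (H *\<^sub>v col U l))"
 proof -
  have "Us *\<^sub>v col Z l = col U l - (1 / lam l) \<cdot>\<^sub>v (H *\<^sub>v col U l)"
   by (subst (1) e) (use c l in \<open>auto intro!: eq_vecI simp: dimD\<close>)
  thus ?thesis using vec_l2_minus[of "col U l" n "(1 / lam l) \<cdot>\<^sub>v (H *\<^sub>v col U l)"] c by simp
 qed
 ultimately show ?thesis using s Us_norm[OF c(2)] unit[OF l] by linarith
qed

definition "E = tr Us * H * U"

lemma E: "E \<in> mats r r" by (simp add: E_def dimD)

text \<open>One column at a time, because the Neumann estimate needs a bound on its coefficient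
  block and at this stage only the columns of \<open>Z\<close> are controlled; the operator bound on
  \<open>Z\<close> is itself derived from this estimate.\<close>

lemma fro_E_col:
 assumes l: "l < r" shows "vec_l2 (col E l) \<le> 4 * real r * e0"
proof -
 define u where "u = Matrix.mat n 1 (\<lambda>(i, _). U $$ (i, l))"
 define z where "z = Matrix.mat r 1 (\<lambda>(i, _). Z $$ (i, l))"
 define L where "L = diag 1 (\<lambda>_. 1 / lam l)"
 have c: "u \<in> mats n 1" "z \<in> mats r 1" "L \<in> mats 1 1" by (simp_all add: u_def z_def L_def)
 note cD = c[THEN matsD(1)] c[THEN matsD(2)]
 have cols: "col u 0 = col U l" "col z 0 = col Z l" by (auto simp: u_def z_def dimD l intro!: eq_vecI)
 have HUL: "H * U * Li = Matrix.mat n r (\<lambda>(i, j). (H * U) $$ (i, j) * (1 / lam j))"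
  unfolding Li_def by (rule mat_diag_mult_right) (simp add: dimD)
 have HuL: "H * u * L = Matrix.mat n 1 (\<lambda>(i, j). (H * u) $$ (i, j) * (1 / lam l))"
  unfolding L_def by (rule mat_diag_mult_right) (simp add: dimD cD)
 have eq: "u = Us * z + H * u * L"
 proof (rule eq_matI)
  fix i j assume "i < dim_row (Us * z + H * u * L)" "j < dim_col (Us * z + H * u * L)"
  hence ij: "i < n" "j = 0" by (simp_all add: dimD cD)
  have "u $$ (i, j) = (Us * Z + H * U * Li) $$ (i, l)" using ij U_eq by (simp add: u_def)
  also have "... = (Us * z + H * u * L) $$ (i, j)" unfolding HUL HuL using ij l by (simp add: dimD cD cols del: One_nat_def)
  finally show "u $$ (i, j) = (Us * z + H * u * L) $$ (i, j)" .
 qed (simp_all add: dimD cD)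
 have oL: "opb L (2 / lmin)" unfolding L_def
 proof (rule opb_diag)
  have "1 / \<bar>lam l\<bar> \<le> 1 / (lmin / 2)" using lam_lower[OF l] lmin by (intro divide_left_mono) auto
  thus "\<bar>1 / lam l\<bar> \<le> 2 / lmin" by simp
 qed (use lmin in simp)
 have "vec_l2 (col Z l) \<le> 2" using Z_col_norm[OF l] by linarith
 hence oz: "opb z 2" using opb_mono[OF opb_fro[of z], of 2] fro_single_col[OF c(2)] by (simp add: cols)
 have "fro (tr Us * H * u) \<le> 2 * (real r * e0 * 2)" using rh
  by (intro fro_neumann[OF Us(1) c(1,2,3) H _ eq oL oH oz _ _ _ rho_small _ fro_bilinear]) (simp_all add: dimD)
 moreover have "fro (tr Us * H * u) = vec_l2 (col E l)"
 proof -
  have "tr Us * H * u \<in> mats r 1" by (simp add: dimD cD)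
  moreover have "col (tr Us * H * u) 0 = col E l"
  proof -
   have "col (tr Us * H * u) 0 = tr Us * H *\<^sub>v col u 0" by (rule col_mult2[of _ r n _ 1]) (simp_all add: dimD c del: One_nat_def)
   moreover have "col E l = tr Us * H *\<^sub>v col U l" unfolding E_def by (rule col_mult2[of _ r n _ r]) (simp_all add: dimD U l)
   ultimately show ?thesis using cols by simp
  qed
  ultimately show ?thesis by (simp add: fro_single_col)
 qed
 ultimately show ?thesis by simp
qed

lemma fro_E0: "fro E \<le> sqrt (real r) * (4 * real r * e0)"
proof -
 have "fro E \<le> L2_set (\<lambda>_. 4 * real r * e0) {0..<r}" unfolding fro_def using fro_E_col E by (auto intro!: L2_set_mono)
 also have "... = sqrt (real r) * (4 * real r * e0)" using e0 by (simp add: L2_set_def real_sqrt_mult)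
 finally show ?thesis .
qed

text \<open>The eigenvector equation multiplied by \<open>tr Us\<close>: it expresses the overlap of
  each eigenvector with each signal vector through \<open>E\<close>, up to division by an eigenvalue
  difference.\<close>

lemma R_E: "\<lbrakk>k < r; l < r\<rbrakk> \<Longrightarrow> (lam l - ls k) * (tr Us * U) $$ (k, l) = E $$ (k, l)"
proof -
 assume kl: "k < r" "l < r"
 have "tr Us * (Ms * U) = diag r ls * (tr Us * U)"
 proof -
  have "tr Us * (Ms * U) = (tr Us * Us) * (diag r ls * (tr Us * U))" by (simp add: Ms_def mat_dim_assoc dimD)
  thus ?thesis unfolding Us(2) by simp
 qed
 hence e: "(tr Us * U) * diag r lam = diag r ls * (tr Us * U) + E"
  using arg_cong[OF MU, of "\<lambda>X. tr Us * X"] by (simp add: mat_dim_simps dimD E_def)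
 have UU: "tr Us * U \<in> mats r r" by (simp add: dimD)
 show ?thesis using arg_cong[OF e[unfolded mat_diag_mult_left[OF UU] mat_diag_mult_right[OF UU]], of "\<lambda>X. X $$ (k, l)"] kl E
  by (simp add: algebra_simps)
qed

definition "D = diag r (\<lambda>l. Z $$ (l, l))"
definition "Off = Z - D"

lemma D_Off: "D \<in> mats r r" "Off \<in> mats r r" "Z = D + Off" using dims by (auto simp: D_def Off_def intro!: eq_matI)

lemma Off_index: "\<lbrakk>k < r; l < r\<rbrakk> \<Longrightarrow> Off $$ (k, l) = (if k = l then 0 else Z $$ (k, l))"
 by (auto simp: Off_def D_def mat_diag_def)

text \<open>An off-diagonal entry of \<open>Z\<close> is \<open>ls k / lam l\<close> times an entry
  of \<open>E\<close> divided by \<open>lam l - ls k\<close>. The two quotients contribute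
  \<open>2 * ka\<close> and \<open>2 / \<delta>\<close>; combining \<open>r\<close> columns of size
  \<open>r * e0\<close> produces the power 3/2 of \<open>r\<close> in
  \<open>\<delta>_large\<close>.\<close>

lemma fro_Off: "fro Off \<le> 1 / 32"
proof -
 have "fro Off \<le> (4 * ka / \<delta>) * fro E"
 proof (rule fro_mono[OF D_Off(2) E])
  show "0 \<le> 4 * ka / \<delta>" using ka \<delta> by simp
  fix k l assume kl: "k < r" "l < r"
  show "\<bar>Off $$ (k, l)\<bar> \<le> 4 * ka / \<delta> * \<bar>E $$ (k, l)\<bar>"
  proof (cases "k = l")
   case True thus ?thesis using kl ka \<delta> by (simp add: Off_index)
  next
   case False
   define x where "x = \<bar>(tr Us * U) $$ (k, l)\<bar>"
   have "\<delta> / 2 * x \<le> \<bar>lam l - ls k\<bar> * x" using lam_gap[OF kl False] by (intro mult_right_mono) (auto simp: x_def)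
   also have "... = \<bar>E $$ (k, l)\<bar>" using R_E[OF kl] by (simp add: x_def flip: abs_mult)
   finally have x: "x \<le> 2 / \<delta> * \<bar>E $$ (k, l)\<bar>" using \<delta> by (simp add: field_simps)
   have "\<bar>Off $$ (k, l)\<bar> = \<bar>ls k\<bar> / \<bar>lam l\<bar> * x"
    using kl False by (simp add: Off_index) (simp add: Z_def x_def abs_mult)
   also have "... \<le> lmax / (lmin / 2) * x"
    using ls_upper[OF kl(1)] lam_lower[OF kl(2)] lmin by (intro mult_right_mono frac_le) (auto simp: x_def)
   also have "... \<le> lmax / (lmin / 2) * (2 / \<delta> * \<bar>E $$ (k, l)\<bar>)" using x lmax_pos lmin by (intro mult_left_mono) simp_all
   finally show ?thesis by (simp add: ka_def)
  qed
 qed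
 also have "... \<le> (4 * ka / \<delta>) * (sqrt (real r) * (4 * real r * e0))" using fro_E0 ka \<delta> by (intro mult_left_mono) auto
 also have "... = 16 / 1000 * (1000 * ka * (real r * sqrt (real r)) * e0) / \<delta>" by simp
 also have "... \<le> 16 / 1000 * \<delta> / \<delta>" using \<delta>_large \<delta> by (intro divide_right_mono mult_left_mono) auto
 finally show ?thesis using \<delta> by simp
qed

text \<open>The columns of \<open>Z\<close> have norm close to one and their off-diagonal part is
  small, so the diagonal entries are close to one in absolute value.\<close>

lemma Z_diag: assumes l: "l < r" shows "\<bar>Z $$ (l, l)\<bar> \<le> 3 / 2" "3 / 4 \<le> \<bar>Z $$ (l, l)\<bar>"
proof -
 have "\<bar>Z $$ (l, l)\<bar> \<le> vec_l2 (col Z l)" using vec_index_le_l2[of l "col Z l"] l by (simp add: dimD)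
 thus "\<bar>Z $$ (l, l)\<bar> \<le> 3 / 2" using Z_col_norm[OF l] by linarith
 have "col Z l = Z $$ (l, l) \<cdot>\<^sub>v unit_vec r l + Off *\<^sub>v unit_vec r l"
  using l by (subst (1) D_Off(3)) (auto intro!: eq_vecI simp: dimD Off_index matsD[OF D_Off(2)] D_def mat_diag_def)
 hence "vec_l2 (col Z l) \<le> vec_l2 (Z $$ (l, l) \<cdot>\<^sub>v unit_vec r l) + vec_l2 (Off *\<^sub>v unit_vec r l)"
  using vec_l2_add[of "Z $$ (l, l) \<cdot>\<^sub>v unit_vec r l" r "Off *\<^sub>v unit_vec r l"] D_Off by simp
 moreover have u: "vec_l2 (unit_vec r l) = 1" using l by (simp add: vec_l2_def)
 moreover have "vec_l2 (Off *\<^sub>v unit_vec r l) \<le> 1 / 32 * vec_l2 (unit_vec r l)"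
  using opbD[OF opb_mono[OF opb_fro fro_Off] D_Off(2)] by simp
 moreover have "vec_l2 (Z $$ (l, l) \<cdot>\<^sub>v unit_vec r l) = \<bar>Z $$ (l, l)\<bar>" by (simp add: vec_l2_smult u)
 ultimately show "3 / 4 \<le> \<bar>Z $$ (l, l)\<bar>" using Z_col_norm[OF l] by linarith
qed

lemma Z_upper: "opb Z 2"
proof -
 have "opb D (3 / 2)" unfolding D_def using Z_diag(1) by (intro opb_diag) auto
 hence "opb (D + Off) (3 / 2 + 1 / 32)" using opb_mono[OF opb_fro fro_Off] D_Off by (intro opb_add) auto
 thus ?thesis using D_Off(3) by (auto intro: opb_mono)
qed

lemma Z_lower: assumes x: "x \<in> vecs r" shows "1 / 2 * vec_l2 x \<le> vec_l2 (Z *\<^sub>v x)"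
proof -
 have "D *\<^sub>v x = Z *\<^sub>v x - Off *\<^sub>v x"
  using D_Off x by (subst D_Off(3)) (auto simp: add_mult_distrib_mat_vec[of _ r r] matsD intro!: eq_vecI)
 hence "vec_l2 (D *\<^sub>v x) \<le> vec_l2 (Z *\<^sub>v x) + vec_l2 (Off *\<^sub>v x)"
  using vec_l2_minus[of "Z *\<^sub>v x" r "Off *\<^sub>v x"] D_Off by simp
 moreover have "3 / 4 * vec_l2 x \<le> vec_l2 (D *\<^sub>v x)" unfolding D_def using Z_diag(2) x by (intro opb_diag_lower) auto
 moreover have "vec_l2 (Off *\<^sub>v x) \<le> 1 / 32 * vec_l2 x" by (rule opbD[OF opb_mono[OF opb_fro fro_Off] D_Off(2) x])
 ultimately show ?thesis using vec_l2_nonneg[of x] by linarith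
qed

text \<open>The factor 4 is 2 from the geometric series times the bound 2 on
  \<open>Z\<close>.\<close>

lemma neumann_block:
 assumes B: "B \<in> mats q n" and bound: "\<And>j. fro (B * H ^\<^sub>m j * Us) \<le> c * rh ^ j" shows "fro (B * U) \<le> 4 * c"
 using fro_neumann[OF Us(1) U dims(1,2) H B U_eq oLi oH Z_upper _ _ _ rho_small _ bound] rh by simp

text \<open>With \<open>Z_upper\<close> available the whole block is expanded at once, which removes
  the factor \<open>sqrt (real r)\<close> of \<open>fro_E0\<close>.\<close>

lemma fro_E: "fro E \<le> 4 * (real r * e0)" unfolding E_def using fro_bilinear by (intro neumann_block[of _ r]) (simp_all add: dimD)

text \<open>By \<open>R_E\<close> the difference equals \<open>diag r ls * E * Li\<close>: the
  eigenvalue differences cancel, so no gap appears in the bound.\<close>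

lemma Z_commutator: "fro (Z * diag r lam - diag r ls * Z) \<le> 8 * ka * (real r * e0)"
proof -
 have "Z * diag r lam - diag r ls * Z = diag r ls * E * Li"
 proof (rule eq_matI)
  fix k l assume "k < dim_row (diag r ls * E * Li)" "l < dim_col (diag r ls * E * Li)"
  hence kl: "k < r" "l < r" by (simp_all add: dimD)
  show "(Z * diag r lam - diag r ls * Z) $$ (k, l) = (diag r ls * E * Li) $$ (k, l)"
   unfolding Li_def mat_diag_mult_left[OF E] mat_diag_mult_left[OF dims(1)] mat_diag_mult_right[OF dims(1)]
   by (subst mat_diag_mult_right[of _ r r])
    (use kl R_E[OF kl] lam_ne[OF kl(2)] in \<open>simp_all add: Z_def field_simps flip: R_E\<close>)
 qed (use E in \<open>simp_all add: dimD\<close>)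
 also have "fro ... \<le> (2 / lmin) * fro (diag r ls * E)"
  using lmin E by (intro fro_mult_right[OF oLi, of _ r r r]) (simp_all add: dimD matsD dims)
 also have "... \<le> (2 / lmin) * (lmax * fro E)"
  using ls_upper lmax_pos lmin E by (intro mult_left_mono fro_mult_left[of _ _ r r _ r] opb_diag) auto
 finally show ?thesis using lmin lmax_pos mult_left_mono[OF mult_left_mono[OF fro_E, of lmax], of "2 / lmin"] by (simp add: ka_def)
qed

end

section \<open>The correction built from the two further observations\<close>

locale debiasing = eigen_block + paired_noise
begin

lemma Hs: "H ^\<^sub>m s \<in> mats n n" using H by simp

lemmas dimW = dimD matsD[OF W1(1)] matsD[OF W2(1)] matsD[OF Hs]

lemma Li_transpose: "tr Li = Li" by (simp add: Li_def)

lemma fro_entries_rr: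
 assumes "A \<in> mats r r" "\<And>m k. \<lbrakk>m < r; k < r\<rbrakk> \<Longrightarrow> \<bar>A $$ (m, k)\<bar> \<le> e0 * c" "0 \<le> c"
 shows "fro A \<le> (real r * e0) * c"
proof -
 have "fro A \<le> sqrt (real (r * r)) * (e0 * c)" using assms e0 by (intro fro_le_entries) auto
 thus ?thesis by simp
qed

lemma fro_linear1: "fro (tr Us * W1 * U) \<le> 4 * (real r * e0)"
proof (rule neumann_block[of _ r])
 fix j
 have "fro (tr (H ^\<^sub>m j * Us) * W1 * Us) \<le> (real r * e0) * rh ^ j" using linear1 rh by (intro fro_entries_rr) (simp_all add: dimW)
 moreover have "tr (tr (H ^\<^sub>m j * Us) * W1 * Us) = tr Us * W1 * H ^\<^sub>m j * Us" by (simp add: mat_dim_simps dimW W1)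
 ultimately show "fro (tr Us * W1 * H ^\<^sub>m j * Us) \<le> (real r * e0) * rh ^ j" by (metis fro_transpose)
qed (simp add: dimW)

lemma fro_linear2: "fro (tr Us * W2 * U) \<le> 4 * (real r * e0)"
proof (rule neumann_block[of _ r])
 fix j
 have "fro (tr (H ^\<^sub>m j * Us) * W2 * Us) \<le> (real r * e0) * rh ^ j" using linear2 rh by (intro fro_entries_rr) (simp_all add: dimW)
 moreover have "tr (tr (H ^\<^sub>m j * Us) * W2 * Us) = tr Us * W2 * H ^\<^sub>m j * Us" by (simp add: mat_dim_simps dimW W2)
 ultimately show "fro (tr Us * W2 * H ^\<^sub>m j * Us) \<le> (real r * e0) * rh ^ j" by (metis fro_transpose)
qed (simp add: dimW)

text \<open>Two Neumann expansions, one on each side: the right factor is expanded with the power on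
  the left held fixed, then the result is transposed and the other factor is expanded.\<close>

lemma fro_quadratic: "fro (tr U * W1 * W2 * U) \<le> 16 * (real r * e0) * rh"
proof -
 have half: "fro (tr (H ^\<^sub>m s * Us) * W1 * W2 * U) \<le> 4 * (real r * e0 * rh * rh ^ s)" for s
 proof (rule neumann_block[of _ r])
  fix t
  have "fro (tr (H ^\<^sub>m s * Us) * W1 * W2 * (H ^\<^sub>m t * Us)) \<le> (real r * e0) * rh ^ (s + t + 1)"
   using quadratic rh by (intro fro_entries_rr) (simp_all add: dimW)
  thus "fro (tr (H ^\<^sub>m s * Us) * W1 * W2 * H ^\<^sub>m t * Us) \<le> real r * e0 * rh * rh ^ s * rh ^ t"
   by (simp add: mat_dim_assoc dimW power_add)
 qed (simp add: dimW)
 have "fro (tr U * W2 * W1 * U) \<le> 4 * (4 * (real r * e0 * rh))"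
 proof (rule neumann_block[of _ r])
  fix s
  have "tr (tr (H ^\<^sub>m s * Us) * W1 * W2 * U) = tr U * W2 * W1 * H ^\<^sub>m s * Us" by (simp add: mat_dim_simps dimW W1 W2)
  thus "fro (tr U * W2 * W1 * H ^\<^sub>m s * Us) \<le> 4 * (real r * e0 * rh) * rh ^ s" using half[of s] by (metis fro_transpose mult.assoc)
 qed (simp add: dimW)
 moreover have "tr (tr U * W2 * W1 * U) = tr U * W1 * W2 * U" by (simp add: mat_dim_simps dimW W1 W2)
 ultimately show ?thesis by (metis fro_transpose mult.assoc numeral_times_numeral semiring_norm(13) semiring_norm(12))
qed

text \<open>The noise terms left when the product of the two observations is expanded;
  \<open>Ms * U * Li = Us * Z\<close> turns the noise-free term into
  \<open>tr Z * Z\<close>.\<close>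

definition "N = Li * (tr U * W1 * Us) * Z + tr Z * (tr Us * W2 * U) * Li
 + Li * (tr U * W1 * W2 * U) * Li"

lemma N: "N \<in> mats r r" by (simp add: N_def dimW)

lemma Gram_eq: "Li * tr U * (Ms + W1) * (Ms + W2) * U * Li = tr Z * Z + N"
proof -
 have MV: "Ms * (U * Li) = Us * Z" using MsU by (simp add: mat_dim_assoc dimW)
 have VM: "Li * (tr U * Ms) = tr Z * tr Us" using arg_cong[OF MsU, of tr] by (simp add: mat_dim_simps dimW Li_transpose Ms)
 have VM': "Li * (tr U * (Ms * X)) = tr Z * (tr Us * X)" if "dim_row X = n" for X
  using arg_cong[OF VM, of "\<lambda>Y. Y * X"] that by (simp add: mat_dim_assoc dimW)
 have ZZ: "tr Z * (tr Us * (Us * Z)) = tr Z * Z"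
 proof -
  have "tr Us * (Us * Z) = (tr Us * Us) * Z" by (simp add: mat_dim_assoc dimW)
  also have "... = Z" unfolding Us(2) using dims by simp
  finally show ?thesis by simp
 qed
 have "Li * tr U * (Ms + W1) * (Ms + W2) * U * Li
   = tr Z * Z + Li * (tr U * W1 * Us) * Z
    + (tr Z * (tr Us * W2 * U) * Li + Li * (tr U * W1 * W2 * U) * Li)" by (simp add: mat_dim_simps dimW MV VM' ZZ)
 also have "... = tr Z * Z + N" unfolding N_def by (subst assoc_add_mat[of _ r r])
   (simp_all add: dimW carrier_matI assoc_add_mat[of _ r r])
 finally show ?thesis .
qed

definition "\<nu> = 40 * real r * e0 / lmin"

lemma \<nu>_small: "\<nu> \<le> 1 / 16" using e0_small'(1) lmin by (simp add: \<nu>_def)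

lemma fro_N: "fro N \<le> \<nu>"
proof -
 have "fro (Li * (tr U * W1 * Us) * Z) \<le> 2 * fro (Li * (tr U * W1 * Us))"
  by (rule fro_mult_right[OF Z_upper, of _ r r r]) (simp_all add: dimW dims)
 moreover have "fro (Li * (tr U * W1 * Us)) \<le> 2 / lmin * fro (tr U * W1 * Us)"
  using lmin by (intro fro_mult_left[OF oLi, of r r _ r]) (simp_all add: dimW dims)
 moreover have "fro (tr U * W1 * Us) \<le> 4 * (real r * e0)"
 proof -
  have "tr (tr Us * W1 * U) = tr U * W1 * Us" by (simp add: mat_dim_simps dimW W1)
  thus ?thesis using fro_linear1 by (metis fro_transpose)
 qed
 ultimately have 1: "fro (Li * (tr U * W1 * Us) * Z) \<le> 2 * (2 / lmin * (4 * (real r * e0)))"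
  using lmin by (smt (verit) divide_nonneg_nonneg mult_left_mono)
 have "fro (tr Z * (tr Us * W2 * U) * Li) \<le> 2 / lmin * fro (tr Z * (tr Us * W2 * U))"
  using lmin by (intro fro_mult_right[OF oLi, of _ r r r]) (simp_all add: dimW dims)
 moreover have "fro (tr Z * (tr Us * W2 * U)) \<le> 2 * fro (tr Us * W2 * U)"
  by (rule fro_mult_left[OF opb_transpose[OF Z_upper dims(1)], of r r _ r]) (simp_all add: dimW dims)
 ultimately have 2: "fro (tr Z * (tr Us * W2 * U) * Li) \<le> 2 / lmin * (2 * (4 * (real r * e0)))"
  using lmin fro_linear2 by (smt (verit) divide_nonneg_nonneg mult_left_mono)
 have "fro (Li * (tr U * W1 * W2 * U) * Li) \<le> 2 / lmin * fro (Li * (tr U * W1 * W2 * U))"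
  using lmin by (intro fro_mult_right[OF oLi, of _ r r r]) (simp_all add: dimW dims)
 moreover have "fro (Li * (tr U * W1 * W2 * U)) \<le> 2 / lmin * fro (tr U * W1 * W2 * U)"
  using lmin by (intro fro_mult_left[OF oLi, of r r _ r]) (simp_all add: dimW dims)
 ultimately have "fro (Li * (tr U * W1 * W2 * U) * Li) \<le> 2 / lmin * (2 / lmin * (16 * (real r * e0) * rh))"
  using lmin fro_quadratic by (smt (verit) divide_nonneg_nonneg mult_left_mono)
 also have "... = 64 * rh * (real r * e0) / lmin / lmin" by simp
 \<comment> \<open>The product of both noises is of higher order: its extra factor \<open>rh\<close>
   is absorbed by \<open>64 * rh \<le> lmin\<close>.\<close>
 also have "... \<le> lmin * (real r * e0) / lmin / lmin" using rh e0 by (intro divide_right_mono mult_right_mono) auto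
 finally have 3: "fro (Li * (tr U * W1 * W2 * U) * Li) \<le> real r * e0 / lmin" using lmin by simp
 have "fro N \<le> fro (Li * (tr U * W1 * Us) * Z + tr Z * (tr Us * W2 * U) * Li)
   + fro (Li * (tr U * W1 * W2 * U) * Li)" unfolding N_def by (rule fro_add[of _ r r]) (simp_all add: dimW)
 moreover have "fro (Li * (tr U * W1 * Us) * Z + tr Z * (tr Us * W2 * U) * Li)
  \<le> fro (Li * (tr U * W1 * Us) * Z) + fro (tr Z * (tr Us * W2 * U) * Li)" by (rule fro_add[of _ r r]) (simp_all add: dimW)
 moreover have "2 * (2 / lmin * (4 * (real r * e0))) = 16 * (real r * e0 / lmin)"
  "2 / lmin * (2 * (4 * (real r * e0))) = 16 * (real r * e0 / lmin)" by simp_all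
 ultimately have "fro N \<le> 33 * (real r * e0 / lmin)" using 1 2 3 by linarith
 also have "... \<le> \<nu>" using e0 lmin by (simp add: \<nu>_def divide_right_mono)
 finally show ?thesis .
qed

lemma Li_inverse: "is_inverse_mat r (diag r lam) Li"
proof -
 have "diag r lam * Li = 1\<^sub>m r" "Li * diag r lam = 1\<^sub>m r"
  unfolding Li_def mat_diag_mult using lam_ne by (auto intro!: eq_matI simp: mat_diag_def)
 thus ?thesis by (simp add: is_inverse_mat_def inverts_mat_def Li_def)
qed

lemma Li_unique: "is_inverse_mat r (diag r lam) L \<Longrightarrow> L = Li"
proof -
 assume "is_inverse_mat r (diag r lam) L"
 hence L: "L \<in> mats r r" "diag r lam * L = 1\<^sub>m r" by (auto simp: is_inverse_mat_def inverts_mat_def)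
 have "L = (Li * diag r lam) * L" using Li_inverse L by (simp add: is_inverse_mat_def inverts_mat_def dimW)
 also have "... = Li * (diag r lam * L)" using L by (simp add: mat_dim_assoc dimW)
 finally show ?thesis using L dims by simp
qed

definition "K = tr Z * Z + N"

lemma K_eq: "Li * tr U * (Ms + W1) * (Ms + W2) * U * Li = K" by (simp add: K_def Gram_eq)

lemma correction_settingI:
 assumes "is_inverse_mat r K G" shows "correction_setting r Z N K G \<nu>"
 by unfold_locales (use assms dims N Z_upper Z_lower fro_N \<nu>_small in \<open>auto simp: K_def is_inverse_mat_def inverts_mat_def dimW matsD[OF N]\<close>)

text \<open>Coercivity of \<open>K\<close> is derived here directly, because
  \<open>correction_setting\<close> presupposes that \<open>K\<close> has an inverse.\<close>

lemma K_inverse_exists: "\<exists>G. is_inverse_mat r K G"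
proof -
 have K: "K \<in> mats r r" by (simp add: K_def matsD[OF N])
 have "1 / 4 * vec_l2 x \<le> 3 / 2 * vec_l2 (K *\<^sub>v x)" if x: "x \<in> vecs r" for x
 proof -
  have "(1 / 2 * vec_l2 x)^2 \<le> (vec_l2 (Z *\<^sub>v x))^2" using Z_lower[OF x] by simp
  also have "... = x \<bullet> (K *\<^sub>v x) - x \<bullet> (N *\<^sub>v x)"
   using scalar_prod_mult_mat_vec[of "tr Z" r r x "Z *\<^sub>v x"] dims N x unfolding K_def
   by (simp add: add_mult_distrib_mat_vec[of _ r r] scalar_prod_add_distrib[of _ r] vec_l2_sq)
  also have "... \<le> vec_l2 x * vec_l2 (K *\<^sub>v x) + 1 / 16 * vec_l2 x * vec_l2 x"
  proof -
   have "opb N (1 / 16)" by (rule opb_mono[OF opb_fro]) (use fro_N \<nu>_small in linarith)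
   from opb_quadratic[OF this N x x] show ?thesis using scalar_prod_abs_le[of x "K *\<^sub>v x"] x K by simp
  qed
  finally have *: "vec_l2 x * (3 / 16 * vec_l2 x) \<le> vec_l2 x * vec_l2 (K *\<^sub>v x)" by (simp add: power2_eq_square)
  show ?thesis
  proof (cases "vec_l2 x = 0")
   case False
   hence "3 / 16 * vec_l2 x \<le> vec_l2 (K *\<^sub>v x)" using vec_l2_nonneg[of x] * by (simp only: mult_le_cancel_left_pos)
   thus ?thesis using vec_l2_nonneg[of x] by linarith
  qed simp
 qed
 hence "1 / 6 * vec_l2 x \<le> vec_l2 (K *\<^sub>v x)" if "x \<in> vecs r" for x using that by fastforce
 then obtain G where "G \<in> mats r r" "K * G = 1\<^sub>m r" "G * K = 1\<^sub>m r" using square_inverse_exists[OF K, of "1 / 6"] by auto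
 thus ?thesis using K by (auto simp: is_inverse_mat_def inverts_mat_def)
qed

text \<open>The inverse of the diagonal matrix is unique, so the Gram matrix in the definition of
  the correction is always \<open>K\<close>.\<close>

lemma is_correction_iff:
 "is_correction r U lam (Ms + W1) (Ms + W2) \<Psi> \<longleftrightarrow> (\<exists>G Ga s. is_inverse_mat r K G \<and>
  Ga \<in> mats r r \<and> tr Ga * Ga = 1\<^sub>m r \<and> (\<forall>l<r. 0 < s l) \<and>
  (1 / 2) \<cdot>\<^sub>m (G + tr G) = Ga * diag r (\<lambda>l. 1 / (s l)^2) * tr Ga \<and>
  \<Psi> = Ga * diag r (\<lambda>l. 1 / s l) * tr Ga)"
proof
 assume "is_correction r U lam (Ms + W1) (Ms + W2) \<Psi>"
 then obtain L G Ga s where L: "is_inverse_mat r (diag r lam) L" and "is_inverse_mat r (L * tr U * (Ms + W1) * (Ms + W2) * U * L) G \<and>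
  Ga \<in> mats r r \<and> tr Ga * Ga = 1\<^sub>m r \<and> (\<forall>l<r. 0 < s l) \<and>
  (1 / 2) \<cdot>\<^sub>m (G + tr G) = Ga * diag r (\<lambda>l. 1 / (s l)^2) * tr Ga \<and>
  \<Psi> = Ga * diag r (\<lambda>l. 1 / s l) * tr Ga" unfolding is_correction_def by blast
 thus "\<exists>G Ga s. is_inverse_mat r K G \<and>
  Ga \<in> mats r r \<and> tr Ga * Ga = 1\<^sub>m r \<and> (\<forall>l<r. 0 < s l) \<and>
  (1 / 2) \<cdot>\<^sub>m (G + tr G) = Ga * diag r (\<lambda>l. 1 / (s l)^2) * tr Ga \<and>
  \<Psi> = Ga * diag r (\<lambda>l. 1 / s l) * tr Ga" unfolding Li_unique[OF L] K_eq by blast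
next
 assume "\<exists>G Ga s. is_inverse_mat r K G \<and>
  Ga \<in> mats r r \<and> tr Ga * Ga = 1\<^sub>m r \<and> (\<forall>l<r. 0 < s l) \<and>
  (1 / 2) \<cdot>\<^sub>m (G + tr G) = Ga * diag r (\<lambda>l. 1 / (s l)^2) * tr Ga \<and>
  \<Psi> = Ga * diag r (\<lambda>l. 1 / s l) * tr Ga"
 thus "is_correction r U lam (Ms + W1) (Ms + W2) \<Psi>" unfolding is_correction_def using Li_inverse K_eq by metis
qed

theorem correction_exists: "\<exists>\<Psi>. is_correction r U lam (Ms + W1) (Ms + W2) \<Psi>"
proof -
 obtain G where inv: "is_inverse_mat r K G" using K_inverse_exists by blast
 interpret correction_setting r Z N K G \<nu> by (rule correction_settingI[OF inv])
 show ?thesis unfolding is_correction_iff using correction_exists inv unfolding Gs_def by blast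
qed

text \<open>The Neumann expansion with row \<open>i\<close> of \<open>H\<close> as the test matrix;
  its terms are rows of \<open>H ^\<^sub>m Suc j * Us\<close>, which \<open>entrywise\<close>
  controls.\<close>

lemma fro_row_F: assumes i: "i < n" shows "vec_l2 (Matrix.row (H * U * Li) i) \<le> 8 * sqrt (real r) * e0 / lmin"
proof -
 define B where "B = Matrix.mat 1 n (\<lambda>(_, j). H $$ (i, j))"
 have B: "B \<in> mats 1 n" by (simp add: B_def)
 have rowB: "Matrix.row B 0 = Matrix.row H i" using i by (auto simp: B_def dimW intro!: eq_vecI)
 have "fro (B * U) \<le> 4 * (sqrt (real r) * e0)"
 proof (rule neumann_block[OF B])
  fix j
  have "B * H ^\<^sub>m j * Us = B * (H ^\<^sub>m j * Us)" by (simp add: mat_dim_assoc dimW matsD[OF B])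
  moreover have "(B * (H ^\<^sub>m j * Us)) $$ (0, k) = (H ^\<^sub>m Suc j * Us) $$ (i, k)" if k: "k < r" for k
  proof -
   note HS = pow_mat_Suc_left[OF H, of j]
   have "(B * (H ^\<^sub>m j * Us)) $$ (0, k) = Matrix.row H i \<bullet> col (H ^\<^sub>m j * Us) k"
    using k rowB by (subst index_mult_mat) (simp_all add: dimW matsD[OF B])
   also have "... = (H * (H ^\<^sub>m j * Us)) $$ (i, k)" using k i by (subst index_mult_mat) (simp_all add: dimW)
   finally show ?thesis unfolding HS by (simp add: mat_dim_assoc dimW)
  qed
  ultimately have "\<bar>(B * H ^\<^sub>m j * Us) $$ (p, k)\<bar> \<le> e0 * rh ^ j" if "p < 1" "k < r" for p k
   using entrywise[OF i that(2), of j] that by simp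
  moreover have "B * H ^\<^sub>m j * Us \<in> mats 1 r" by (simp add: dimW matsD[OF B])
  ultimately have "fro (B * H ^\<^sub>m j * Us) \<le> sqrt (real (1 * r)) * (e0 * rh ^ j)" by (intro fro_le_entries) (use e0 rh in auto)
  thus "fro (B * H ^\<^sub>m j * Us) \<le> sqrt (real r) * e0 * rh ^ j" by simp
 qed
 moreover have "fro (B * U) = vec_l2 (Matrix.row (H * U) i)"
 proof -
  have "Matrix.row (B * U) 0 = Matrix.row (H * U) i" using i rowB by (intro eq_vecI) (simp_all add: dimW matsD[OF B])
  thus ?thesis by (simp add: fro_single_row matsD[OF B])
 qed
 moreover have "vec_l2 (Matrix.row (H * U * Li) i) \<le> 2 / lmin * vec_l2 (Matrix.row (H * U) i)"
 proof -
  have "Matrix.row (H * U * Li) i = tr Li *\<^sub>v Matrix.row (H * U) i"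
   using i by (intro row_mult_transpose[of _ n r _ r]) (simp_all add: dimW dims)
  moreover have "Matrix.row (H * U) i \<in> vecs r" by (rule carrier_vecI) (simp add: dimW)
  ultimately show ?thesis unfolding Li_transpose using opbD[OF oLi dims(2)] by metis
 qed
 moreover have "2 / lmin * fro (B * U) \<le> 2 / lmin * (4 * (sqrt (real r) * e0))" using calculation(1) lmin by (intro mult_left_mono) auto
 ultimately show ?thesis by simp
qed

text \<open>Row \<open>i\<close> of \<open>U\<close> is \<open>x + f\<close>, with \<open>x\<close>
  coming from a row of \<open>Us\<close> and \<open>f\<close> from \<open>H * U * Li\<close>.
  Expanding the bilinear form gives a main term, in which the Frobenius error is sandwiched between
  two rows of norm at most \<open>b\<close>, two mixed terms, and a product of two small rows. These
  are the three summands of the bound.\<close>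

theorem correction_error:
 assumes \<Psi>: "is_correction r U lam (Ms + W1) (Ms + W2) \<Psi>" and ij: "i < n" "j < n"
 shows "\<bar>(U * \<Psi> * diag r lam * tr \<Psi> * tr U - Ms) $$ (i, j)\<bar>
  \<le> 400000 * (b^2 * (ka * real r * e0) + b * (ka * sqrt (real r) * e0) + ka * real r * e0^2 / lmin)"
proof -
 obtain G Ga s where inv: "is_inverse_mat r K G" and Ga: "Ga \<in> mats r r" "tr Ga * Ga = 1\<^sub>m r" and s: "\<forall>l<r. 0 < s l"
  and G_sym: "(1 / 2) \<cdot>\<^sub>m (G + tr G) = Ga * diag r (\<lambda>l. 1 / (s l)^2) * tr Ga"
  and \<Psi>_eq: "\<Psi> = Ga * diag r (\<lambda>l. 1 / s l) * tr Ga" using \<Psi> unfolding is_correction_iff by blast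
 interpret correction_setting r Z N K G \<nu> by (rule correction_settingI[OF inv])
 interpret correction_bound r Z N K G \<nu> Ga \<Psi> s lam ls lmax "8 * ka * (real r * e0)"
  by unfold_locales (use Ga s G_sym \<Psi>_eq ls_upper lmax_pos lam_upper Z_commutator in \<open>auto simp: Gs_def\<close>)
 define A where "A = \<Psi> * diag r lam * \<Psi>"
 have A: "A \<in> mats r r" using \<Psi> by (simp add: A_def)
 have oA: "opb A (18 * lmax)"
 proof -
  have "opb (diag r lam) (2 * lmax)" using lam_upper lmax_pos by (intro opb_diag) auto
  hence "opb (\<Psi> * diag r lam * \<Psi>) (3 * (2 * lmax) * 3)"
   using \<Psi> lmax_pos by (intro opb_mult[of _ _ _ _ r r r] \<Psi>_upper) (auto simp: matsD)
  thus ?thesis by (simp add: A_def)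
 qed
 define x y f g where "x = tr Z *\<^sub>v Matrix.row Us i" and "y = tr Z *\<^sub>v Matrix.row Us j"
  and "f = Matrix.row (H * U * Li) i" and "g = Matrix.row (H * U * Li) j"
 have c: "x \<in> vecs r" "y \<in> vecs r" "f \<in> vecs r" "g \<in> vecs r" by (simp_all add: x_def y_def f_def g_def dimW carrier_vecI)
 have rows: "Matrix.row U i = x + f" "Matrix.row U j = y + g"
 proof -
  have "Matrix.row U k = tr Z *\<^sub>v Matrix.row Us k + Matrix.row (H * U * Li) k" if k: "k < n" for k using row_mult_transpose[OF Us(1) dims(1) k] by (subst U_eq, subst row_add) (use k in \<open>simp_all add: dimW\<close>)
  thus "Matrix.row U i = x + f" "Matrix.row U j = y + g" using ij by (simp_all add: x_def y_def f_def g_def)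
 qed
 define ph where "ph = 8 * sqrt (real r) * e0 / lmin"
 have ph: "vec_l2 f \<le> ph" "vec_l2 g \<le> ph" using fro_row_F ij by (simp_all add: f_def g_def ph_def)
 have rUs: "Matrix.row Us i \<in> vecs r" "Matrix.row Us j \<in> vecs r" using Us by auto
 have b: "vec_l2 (Matrix.row Us i) \<le> b" "vec_l2 (Matrix.row Us j) \<le> b" using ij incoherent by auto
 have b0: "0 \<le> b" using b vec_l2_nonneg[of "Matrix.row Us i"] by linarith
 have xb: "vec_l2 x \<le> 2 * b" "vec_l2 y \<le> 2 * b"
  using opbD[OF opb_transpose[OF Z_upper dims(1)], of r r] rUs b dims by (force simp: x_def y_def)+
 have ph0: "0 \<le> ph" using e0 lmin by (simp add: ph_def)
 have e1: "(U * \<Psi> * diag r lam * tr \<Psi> * tr U) $$ (i, j) = (x + f) \<bullet> (A *\<^sub>v (y + g))" using \<Psi> sandwich_index[OF U A U ij] by (simp add: rows A_def mat_dim_assoc dimW)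
 have e2: "Ms $$ (i, j) = Matrix.row Us i \<bullet> (diag r ls *\<^sub>v Matrix.row Us j)"
  unfolding Ms_def using ij by (intro sandwich_index[OF Us(1) _ Us(1)]) auto
 define X where "X = Z * A * tr Z - diag r ls"
 have X: "X \<in> mats r r" by (simp add: X_def)
 have "fro X \<le> 8000 * (8 * ka * (real r * e0) + lmax * \<nu>)" using \<Psi> corrected_error by (simp add: X_def A_def mat_dim_assoc dimW)
 \<comment> \<open>Together with the intertwining error this gives
   \<open>8000 * (8 + 40) = 384000\<close>.\<close>
 also have "lmax * \<nu> = 40 * ka * (real r * e0)" by (simp add: ka_def \<nu>_def)
 finally have fX: "fro X \<le> 384000 * (ka * real r * e0)" by (simp add: algebra_simps)
 have e3: "x \<bullet> (A *\<^sub>v y) - Ms $$ (i, j) = Matrix.row Us i \<bullet> (X *\<^sub>v Matrix.row Us j)"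
 proof -
  have "x \<bullet> (A *\<^sub>v y) = Matrix.row Us i \<bullet> (Z *\<^sub>v (A *\<^sub>v y))"
   using scalar_prod_mult_mat_vec[OF dims(1) rUs(1), of "A *\<^sub>v y"] A by (simp add: x_def)
  also have "Z *\<^sub>v (A *\<^sub>v y) = (Z * A * tr Z) *\<^sub>v Matrix.row Us j" using A by (simp add: y_def mat_dim_vec_assoc dimW)
  moreover have "X *\<^sub>v Matrix.row Us j = (Z * A * tr Z) *\<^sub>v Matrix.row Us j - diag r ls *\<^sub>v Matrix.row Us j"
   unfolding X_def using rUs by (intro minus_mult_distrib_mat_vec[of _ r r]) (simp_all add: dimW)
  ultimately show ?thesis unfolding e2 using rUs by (simp add: scalar_prod_minus_distrib[of _ r] dimW)
 qed
 have t0: "\<bar>Matrix.row Us i \<bullet> (X *\<^sub>v Matrix.row Us j)\<bar> \<le> 384000 * (ka * real r * e0) * b * b"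
 proof -
  have "\<bar>Matrix.row Us i \<bullet> (X *\<^sub>v Matrix.row Us j)\<bar> \<le> 384000 * (ka * real r * e0) * vec_l2 (Matrix.row Us i) * vec_l2 (Matrix.row Us j)"
   by (rule opb_quadratic[OF opb_mono[OF opb_fro fX] X rUs])
  also have "... \<le> 384000 * (ka * real r * e0) * b * b" using b b0 ka e0 by (intro mult_mono) auto
  finally show ?thesis .
 qed
 have quad: "\<bar>u \<bullet> (A *\<^sub>v v)\<bar> \<le> 18 * lmax * (p * q)"
  if "u \<in> vecs r" "v \<in> vecs r" "vec_l2 u \<le> p" "vec_l2 v \<le> q" "0 \<le> p" for u v p q
 proof -
  have "\<bar>u \<bullet> (A *\<^sub>v v)\<bar> \<le> 18 * lmax * vec_l2 u * vec_l2 v" by (rule opb_quadratic[OF oA A that(1,2)])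
  also have "... \<le> 18 * lmax * p * q" using that lmax_pos by (intro mult_mono) auto
  finally show ?thesis by simp
 qed
 have "\<bar>(U * \<Psi> * diag r lam * tr \<Psi> * tr U - Ms) $$ (i, j)\<bar>
  = \<bar>Matrix.row Us i \<bullet> (X *\<^sub>v Matrix.row Us j) + x \<bullet> (A *\<^sub>v g) + f \<bullet> (A *\<^sub>v y) + f \<bullet> (A *\<^sub>v g)\<bar>"
  using A c ij e1 e3 Ms(1) by (simp add: mult_add_distrib_mat_vec[of _ r r] scalar_prod_add_distrib[of _ r] add_scalar_prod_distrib[of _ r])
 also have "... \<le> 384000 * (ka * real r * e0) * b * b + 18 * lmax * (2 * b * ph) + 18 * lmax * (ph * (2 * b)) + 18 * lmax * (ph * ph)"
  using t0 quad[OF c(1,4) xb(1) ph(2)] quad[OF c(3,2) ph(1) xb(2) ph0] quad[OF c(3,4) ph ph0] b0 by linarith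
 moreover have "18 * lmax * (2 * b * ph) + 18 * lmax * (ph * (2 * b)) = 576 * (b * (ka * sqrt (real r) * e0))" by (simp add: ph_def ka_def)
 ultimately have "\<bar>(U * \<Psi> * diag r lam * tr \<Psi> * tr U - Ms) $$ (i, j)\<bar>
  \<le> 384000 * (ka * real r * e0) * b * b + 576 * (b * (ka * sqrt (real r) * e0)) + 18 * lmax * (ph * ph)" by linarith
 moreover have "18 * lmax * (ph * ph) = 1152 * (ka * real r * e0^2 / lmin)" by (simp add: ph_def ka_def power2_eq_square)
 moreover have "0 \<le> ka * real r * e0 * b * b" "0 \<le> b * (ka * sqrt (real r) * e0)" "0 \<le> ka * real r * e0^2 / lmin"
  using ka e0 b0 lmin by auto
 ultimately show ?thesis by (simp add: power2_eq_square algebra_simps)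
qed

end

section \<open>Roots of a homotopy of polynomials\<close>

definition ball_roots :: "complex poly \<Rightarrow> complex \<Rightarrow> real \<Rightarrow> nat" where
 "ball_roots p c d = (\<Sum>a | poly p a = 0 \<and> a \<in> ball c d. Polynomial.order a p)"

text \<open>Translates the order of vanishing used in Rouche's theorem into the multiplicity of a
  polynomial root.\<close>

lemma zorder_poly:
 assumes "(p :: complex poly) \<noteq> 0" shows "zorder (poly p) a = int (Polynomial.order a p)"
proof -
 obtain q where q: "p = [:- a, 1:] ^ Polynomial.order a p * q" "\<not> [:- a, 1:] dvd q" using order_decomp[OF assms] by blast
 show ?thesis
 proof (rule zorder_eqI[of UNIV a "poly q"])
  show "poly q a \<noteq> 0" using q(2) by (simp add: poly_eq_0_iff_dvd)
  fix w assume "w \<in> UNIV" "w \<noteq> a"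
  have "poly p w = poly ([:- a, 1:] ^ Polynomial.order a p * q) w" using q(1) by simp
  thus "poly p w = poly q w * (w - a) powi int (Polynomial.order a p)" by simp
 qed (auto intro: holomorphic_intros)
qed

lemma winding_number_sum_roots:
 assumes p: "p \<noteq> 0" and d: "0 < d" and nz: "\<And>z. z \<in> sphere c d \<Longrightarrow> poly p z \<noteq> 0"
 shows "(\<Sum>a\<in>{a\<in>UNIV. poly p a = 0}. winding_number (circlepath c d) a * zorder (poly p) a) = of_nat (ball_roots p c d)"
proof -
 have fin: "finite {a. poly p a = 0}" using poly_roots_finite[OF p] .
 have "winding_number (circlepath c d) a = (if a \<in> ball c d then 1 else 0)" if "poly p a = 0" for a
 proof (cases "a \<in> ball c d")
  case True
  thus ?thesis by (simp add: winding_number_circlepath dist_norm norm_minus_commute)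
 next
  case False
  hence "winding_number (circlepath c d) a = 0"
   using nz[of a] that d by (intro winding_number_zero_outside[of _ "cball c d"]) (auto simp: dist_norm)
  thus ?thesis using False by simp
 qed
 hence "(\<Sum>a\<in>{a\<in>UNIV. poly p a = 0}. winding_number (circlepath c d) a * zorder (poly p) a)
   = (\<Sum>a | poly p a = 0. if a \<in> ball c d then of_nat (Polynomial.order a p) else 0)" using p by (intro sum.cong) (auto simp: zorder_poly)
 also have "... = of_nat (ball_roots p c d)" unfolding ball_roots_def using fin by (simp add: sum.If_cases Int_def)
 finally show ?thesis .
qed

lemma ball_roots_Rouche:
 assumes "p \<noteq> 0" "q \<noteq> 0" "0 < d" and less: "\<And>z. z \<in> sphere c d \<Longrightarrow> cmod (poly q z - poly p z) < cmod (poly p z)"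
 shows "ball_roots q c d = ball_roots p c d"
proof -
 have nzp: "poly p z \<noteq> 0" if "z \<in> sphere c d" for z using less[OF that] by auto
 have nzq: "poly q z \<noteq> 0" if "z \<in> sphere c d" for z using less[OF that] by auto
 have "(\<Sum>a\<in>{a\<in>UNIV. poly p a + (poly q a - poly p a) = 0}. winding_number (circlepath c d) a * zorder (\<lambda>z. poly p z + (poly q z - poly p z)) a)
   = (\<Sum>a\<in>{a\<in>UNIV. poly p a = 0}. winding_number (circlepath c d) a * zorder (poly p) a)"
  using assms poly_roots_finite[OF assms(1)] poly_roots_finite[OF assms(2)] by (intro Rouche_theorem) (auto intro!: holomorphic_intros)
 thus ?thesis using winding_number_sum_roots[OF assms(1,3) nzp] winding_number_sum_roots[OF assms(2,3) nzq] by simp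
qed

text \<open>On the compact set of parameters and boundary points the modulus has a positive minimum
  \<open>m\<close> and the map is uniformly continuous. Sufficiently fine steps in \<open>t\<close>
  therefore change it by less than \<open>m\<close>, and Rouche's theorem applies to each
  step.\<close>

lemma ball_roots_homotopy:
 fixes F :: "real \<Rightarrow> complex poly"
 assumes cont: "continuous_on ({0..1} \<times> sphere c d) (\<lambda>(t, z). poly (F t) z)" and ne: "\<And>t. F t \<noteq> 0" and d: "0 < d"
  and nz: "\<And>t z. \<lbrakk>t \<in> {0..1}; z \<in> sphere c d\<rbrakk> \<Longrightarrow> poly (F t) z \<noteq> 0"
 shows "ball_roots (F 1) c d = ball_roots (F 0) c d"
proof -
 let ?K = "{0..1::real} \<times> sphere c d"
 have K: "compact ?K" by (intro compact_Times) auto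
 have Kne: "?K \<noteq> {}" using d by auto
 have "continuous_on ?K (\<lambda>x. cmod ((\<lambda>(t, z). poly (F t) z) x))" by (intro continuous_on_norm cont)
 then obtain x0 where x0: "x0 \<in> ?K" "\<And>x. x \<in> ?K \<Longrightarrow> cmod ((\<lambda>(t, z). poly (F t) z) x0) \<le> cmod ((\<lambda>(t, z). poly (F t) z) x)"
  using continuous_attains_inf[OF K Kne] by metis
 define m where "m = cmod ((\<lambda>(t, z). poly (F t) z) x0)"
 have m: "0 < m" using x0(1) nz by (auto simp: m_def)
 have mle: "m \<le> cmod (poly (F t) z)" if "t \<in> {0..1}" "z \<in> sphere c d" for t z using x0(2)[of "(t, z)"] that by (simp add: m_def)
 have "uniformly_continuous_on ?K (\<lambda>(t, z). poly (F t) z)" by (rule compact_uniformly_continuous[OF cont K])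
 then obtain \<eta> where \<eta>: "0 < \<eta>" and close: "\<And>x y. \<lbrakk>x \<in> ?K; y \<in> ?K; dist y x < \<eta>\<rbrakk> \<Longrightarrow>
   dist ((\<lambda>(t, z). poly (F t) z) y) ((\<lambda>(t, z). poly (F t) z) x) < m" unfolding uniformly_continuous_on_def using m by metis
 have local: "ball_roots (F t) c d = ball_roots (F s) c d" if "t \<in> {0..1}" "s \<in> {0..1}" "\<bar>t - s\<bar> < \<eta>" for s t
 proof (rule ball_roots_Rouche[OF ne ne d])
  fix z assume z: "z \<in> sphere c d"
  have "dist ((\<lambda>(t, z). poly (F t) z) (t, z)) ((\<lambda>(t, z). poly (F t) z) (s, z)) < m"
   by (rule close) (use that z in \<open>auto simp: dist_Pair_Pair dist_real_def\<close>)
  thus "cmod (poly (F t) z - poly (F s) z) < cmod (poly (F s) z)" using mle[OF that(2) z] by (simp add: dist_norm)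
 qed
 obtain N :: nat where N: "1 / \<eta> < real N" using reals_Archimedean2 by blast
 have N0: "0 < N" using \<eta> N by (auto intro!: gr0I)
 have "ball_roots (F (real k / real N)) c d = ball_roots (F 0) c d" if "k \<le> N" for k using that
 proof (induction k)
  case (Suc k)
  have "ball_roots (F (real (Suc k) / real N)) c d = ball_roots (F (real k / real N)) c d"
   using N \<eta> Suc.prems by (intro local) (auto simp: field_simps)
  thus ?case using Suc by simp
 qed simp
 from this[of N] N0 show ?thesis by simp
qed

lemma order_linear_factor: "Polynomial.order a [:- b, 1:] = (if a = b then 1 else (0 :: nat))" for a b :: complex
proof (cases "a = b")
 case True
 thus ?thesis by simp
qed (simp add: order_0I)

lemma order_prod_linear: "Polynomial.order a (\<Prod>b\<leftarrow>bs. [:- b, 1:]) = count_list bs (a :: complex)"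
proof (induction bs)
 case (Cons b bs)
 have "(\<Prod>b\<leftarrow>bs. [:- b, 1:]) \<noteq> (0 :: complex poly)" by auto
 hence "Polynomial.order a ([:- b, 1:] * (\<Prod>b\<leftarrow>bs. [:- b, 1:])) = Polynomial.order a [:- b, 1:] + Polynomial.order a (\<Prod>b\<leftarrow>bs. [:- b, 1:])"
  by (intro order_mult) (simp only: mult_eq_0_iff, simp)
 thus ?case using Cons by (simp add: order_linear_factor)
qed (simp add: order_0I)

lemma count_list_filter: "count_list (filter P xs) a = (if P a then count_list xs a else 0)" by (induction xs) auto

lemma ball_roots_prod_linear: "ball_roots (\<Prod>b\<leftarrow>bs. [:- b, 1:]) c d = length (filter (\<lambda>b. b \<in> ball c d) bs)"
proof -
 have roots: "{a. poly (\<Prod>b\<leftarrow>bs. [:- b, 1:]) a = 0 \<and> a \<in> ball c d} = set (filter (\<lambda>b. b \<in> ball c d) bs)"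
  by (auto simp: poly_prod_list)
 have "ball_roots (\<Prod>b\<leftarrow>bs. [:- b, 1:]) c d = (\<Sum>a\<in>set (filter (\<lambda>b. b \<in> ball c d) bs). count_list (filter (\<lambda>b. b \<in> ball c d) bs) a)"
  unfolding ball_roots_def roots order_prod_linear by (intro sum.cong refl) (auto simp: count_list_filter)
 thus ?thesis by (simp add: sum_count_set)
qed

lemma continuous_on_det:
 fixes A :: "'a :: topological_space \<Rightarrow> complex mat"
 assumes "\<And>x. x \<in> S \<Longrightarrow> A x \<in> mats n n"
  and "\<And>i j. \<lbrakk>i < n; j < n\<rbrakk> \<Longrightarrow> continuous_on S (\<lambda>x. A x $$ (i, j))"
 shows "continuous_on S (\<lambda>x. Determinant.det (A x))"
proof -
 have "continuous_on S (\<lambda>x. \<Sum>p | p permutes {0..<n}. signof p * (\<Prod>i = 0..<n. A x $$ (i, p i)))"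
  using assms(2) by (intro continuous_intros) (auto dest: permutes_in_image)
 thus ?thesis using assms(1) by (subst continuous_on_cong[OF refl det_def']) auto
qed

text \<open>The characteristic polynomial is a determinant whose entries are continuous in
  \<open>(t, z)\<close>, and it has no zero on the circle as long as no eigenvalue meets it.\<close>

lemma char_poly_homotopy:
 fixes A B :: "complex mat"
 assumes A: "A \<in> mats n n" and B: "B \<in> mats n n" and d: "0 < d"
  and nz: "\<And>t z. \<lbrakk>t \<in> {0..1}; z \<in> sphere c d\<rbrakk> \<Longrightarrow> \<not> eigenvalue (A + cor t \<cdot>\<^sub>m B) z"
 shows "ball_roots (char_poly (A + B)) c d = ball_roots (char_poly A) c d"
proof -
 let ?F = "\<lambda>t. char_poly (A + cor t \<cdot>\<^sub>m B)"
 have C: "A + cor t \<cdot>\<^sub>m B \<in> mats n n" for t using B by auto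
 have "ball_roots (?F 1) c d = ball_roots (?F 0) c d"
 proof (rule ball_roots_homotopy[OF _ _ d])
  show "?F t \<noteq> 0" for t using degree_monic_char_poly[OF C[of t]] by auto
  show "poly (?F t) z \<noteq> 0" if "t \<in> {0..1}" "z \<in> sphere c d" for t z using nz[OF that] eigenvalue_root_char_poly[OF C] by blast
  have "continuous_on ({0..1} \<times> sphere c d) (\<lambda>x. Determinant.det (- char_matrix (A + cor (fst x) \<cdot>\<^sub>m B) (snd x)))"
  proof (rule continuous_on_det[of _ _ n])
   fix i j assume ij: "i < n" "j < n"
   hence "(- char_matrix (A + cor (fst x) \<cdot>\<^sub>m B) (snd x)) $$ (i, j)
    = (if i = j then snd x else 0) - (A $$ (i, j) + cor (fst x) * B $$ (i, j))" for x :: "real \<times> complex"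
    using B by (auto simp: char_matrix_def)
   thus "continuous_on ({0..1} \<times> sphere c d) (\<lambda>x. (- char_matrix (A + cor (fst x) \<cdot>\<^sub>m B) (snd x)) $$ (i, j))"
    by (simp only:) (cases "i = j"; simp; intro continuous_intros)
  qed (use C in auto)
  thus "continuous_on ({0..1} \<times> sphere c d) (\<lambda>(t, z). poly (?F t) z)" by (simp add: case_prod_unfold char_poly_matrix[OF C])
 qed
 moreover have "A + cor 1 \<cdot>\<^sub>m B = A + B" "A + cor 0 \<cdot>\<^sub>m B = A" using A B by auto
 ultimately show ?thesis by simp
qed

section \<open>Location of the leading eigenvalues\<close>

text \<open>A bilinear pairing, without conjugation: the eigenvector is complex because the
  eigenvalue is not yet known to be real, while all test vectors are real, so moving a real matrix
  across only transposes it.\<close>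

definition cdot :: "real Matrix.vec \<Rightarrow> complex Matrix.vec \<Rightarrow> complex" where
 "cdot w v = (\<Sum>i<dim_vec w. cor (w $ i) * v $ i)"

lemma cdot_bound: "cmod (cdot w v) \<le> vec_l2 w * (\<Sum>i<dim_vec w. cmod (v $ i))"
proof -
 have "cmod (cdot w v) \<le> (\<Sum>i<dim_vec w. cmod (cor (w $ i) * v $ i))" unfolding cdot_def by (rule norm_sum)
 also have "... \<le> (\<Sum>i<dim_vec w. vec_l2 w * cmod (v $ i))"
  by (intro sum_mono) (auto simp: norm_mult intro!: mult_right_mono vec_index_le_l2)
 finally show ?thesis by (simp add: sum_distrib_left)
qed

lemma cdot_mult_mat:
 assumes "A \<in> mats n m" "w \<in> vecs n" "v \<in> vecs m"
 shows "cdot (tr A *\<^sub>v w) v = (\<Sum>i<n. cor (w $ i) * (map_mat cor A *\<^sub>v v) $ i)"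
proof -
 have "cdot (tr A *\<^sub>v w) v = (\<Sum>j<m. \<Sum>i<n. cor (A $$ (i, j)) * cor (w $ i) * v $ j)"
  using assms by (simp add: cdot_def scalar_prod_def lessThan_atLeast0 sum_distrib_right)
 also have "... = (\<Sum>i<n. \<Sum>j<m. cor (A $$ (i, j)) * cor (w $ i) * v $ j)" by (rule sum.swap)
 also have "... = (\<Sum>i<n. cor (w $ i) * (map_mat cor A *\<^sub>v v) $ i)"
  using assms by (intro sum.cong refl) (simp add: scalar_prod_def lessThan_atLeast0 sum_distrib_left mult_ac)
 finally show ?thesis .
qed

context noise_bounds
begin

text \<open>Twice the constant \<open>4 * ka * real r * e0\<close> that arises in
  \<open>eigenvalue_in_disc\<close>, so that the argument there closes with a factor 1/2.\<close>

definition "disc_radius = 8 * ka * real r * e0"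

lemma disc_radius: "0 < disc_radius" "disc_radius \<le> lmin / 1000"
proof -
 have "0 < ka * real r * e0" using e0 ka sqrt_r by simp
 thus "0 < disc_radius" "disc_radius \<le> lmin / 1000" using e0_small'(2) by (simp_all add: disc_radius_def mult.assoc)
qed

text \<open>Let \<open>R k\<close> be the overlap of an eigenvector \<open>v\<close> with signal
  vector \<open>k\<close>, and \<open>S\<close> the sum of the \<open>|ls k| |R k|\<close>. Then
  \<open>(z - ls k) R k\<close> is \<open>t\<close> times a noise form in \<open>v\<close>, whose
  Neumann expansion involves only the overlaps again and is at most \<open>2 e0 S / |z|\<close>. If
  \<open>z\<close> were far from all \<open>ls k\<close>, then \<open>S\<close> would be at most
  \<open>S / 2\<close>, so all overlaps would vanish and \<open>v\<close> would be an eigenvector of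
  \<open>t H\<close> with an eigenvalue exceeding the norm.\<close>

lemma eigenvalue_in_disc:
 assumes t: "t \<in> {0..1}" and z: "lmin / 2 \<le> cmod z" and ev: "eigenvalue (map_mat cor Ms + cor t \<cdot>\<^sub>m map_mat cor H) z"
 shows "\<exists>k<r. cmod (z - cor (ls k)) < disc_radius"
proof (rule ccontr)
 assume "\<not> ?thesis"
 hence far: "disc_radius \<le> cmod (z - cor (ls k))" if "k < r" for k using that by force
 have z0: "0 < cmod z" "z \<noteq> 0" using z lmin by auto
 obtain v where v: "v \<in> vecs n" "v \<noteq> 0\<^sub>v n"
  and Mv: "(map_mat cor Ms + cor t \<cdot>\<^sub>m map_mat cor H) *\<^sub>v v = z \<cdot>\<^sub>v v"
  using ev H by (auto simp: eigenvalue_def eigenvector_def)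
 have Mv_i: "(map_mat cor Ms *\<^sub>v v) $ i + t * (map_mat cor H *\<^sub>v v) $ i = z * v $ i" if "i < n" for i
  using arg_cong[OF Mv, of "\<lambda>x. x $ i"] that v Ms H by (simp add: algebra_simps)
 define c where "c w = cdot w v" for w
 have step: "z * c w = c (Ms *\<^sub>v w) + t * c (tr H *\<^sub>v w)" if w: "w \<in> vecs n" for w
 proof -
  have "c (Ms *\<^sub>v w) + t * c (tr H *\<^sub>v w)
   = (\<Sum>i<n. cor (w $ i) * ((map_mat cor Ms *\<^sub>v v) $ i + t * (map_mat cor H *\<^sub>v v) $ i))"
   using cdot_mult_mat[OF Ms(1) w v(1)] cdot_mult_mat[OF H w v(1)] Ms(2) by (simp add: c_def sum_distrib_left algebra_simps)
  also have "... = z * c w" using w by (simp add: Mv_i c_def cdot_def sum_distrib_left mult_ac)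
  finally show ?thesis by simp
 qed
 define R where "R k = c (col Us k)" for k
 have c_Ms: "c (Ms *\<^sub>v w) = (\<Sum>k<r. cor (ls k) * cor (col Us k \<bullet> w) * R k)" if w: "w \<in> vecs n" for w
 proof -
  have e: "(Ms *\<^sub>v w) $ i = (\<Sum>k<r. Us $$ (i, k) * (ls k * (col Us k \<bullet> w)))" if i: "i < n" for i
  proof -
   show ?thesis
    using i w matsD[OF Us(1)] unfolding Ms_def by (simp add: scalar_prod_def[of "Matrix.row Us i"] lessThan_atLeast0 mat_diag_mult_vec_index mat_dim_vec_assoc)
  qed
  have "c (Ms *\<^sub>v w) = (\<Sum>i<n. \<Sum>k<r. cor (Us $$ (i, k)) * (cor (ls k) * cor (col Us k \<bullet> w)) * v $ i)"
  proof -
   have "c (Ms *\<^sub>v w) = (\<Sum>i<n. cor ((Ms *\<^sub>v w) $ i) * v $ i)" unfolding c_def cdot_def using Ms(1) by simp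
   also have "... = (\<Sum>i<n. cor (\<Sum>k<r. Us $$ (i, k) * (ls k * (col Us k \<bullet> w))) * v $ i)"
    by (intro sum.cong refl) (simp only: e lessThan_iff)
   finally show ?thesis by (simp add: sum_distrib_right)
  qed
  also have "... = (\<Sum>k<r. \<Sum>i<n. cor (Us $$ (i, k)) * (cor (ls k) * cor (col Us k \<bullet> w)) * v $ i)" by (rule sum.swap)
  also have "... = (\<Sum>k<r. cor (ls k) * cor (col Us k \<bullet> w) * R k)"
   using Us(1) by (intro sum.cong refl) (simp add: R_def c_def cdot_def sum_distrib_left mult_ac)
  finally show ?thesis .
 qed
 define w where "w j k = tr (H ^\<^sub>m j) *\<^sub>v col Us k" for j k
 have Hj: "H ^\<^sub>m j \<in> mats n n" for j using H by simp
 have w: "w j k \<in> vecs n" for j k using matsD[OF H] by (simp add: w_def)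
 have w_Suc: "tr H *\<^sub>v w j k = w (Suc j) k" for j k using matsD[OF H] matsD[OF Us(1)]
  by (simp add: w_def mat_dim_transpose mat_dim_vec_assoc)
 have w_0: "w 0 k = col Us k" if "k < r" for k using matsD[OF H] Us(1) that by (simp add: w_def)
 have gram: "col Us m \<bullet> w j k = (tr Us * H ^\<^sub>m j * Us) $$ (k, m)" if "k < r" "m < r" for j k m
 proof -
  have "(tr Us * H ^\<^sub>m j * tr (tr Us)) $$ (k, m)
    = Matrix.row (tr Us) k \<bullet> (H ^\<^sub>m j *\<^sub>v Matrix.row (tr Us) m)"
   using that Us(1) Hj by (intro sandwich_index[of _ r n _ n _ r]) auto
  also have "... = w j k \<bullet> col Us m" using scalar_prod_mult_mat_vec[OF Hj, of "col Us k" "col Us m" j] that Us(1) by (simp add: w_def)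
  finally show ?thesis using w[of j k] Us(1) scalar_prod_commute[of "col Us m" "w j k"] by simp
 qed
 define S where "S = (\<Sum>k<r. \<bar>ls k\<bar> * cmod (R k))"
 have c_bound: "cmod (c (w j k)) \<le> (rh / 8) ^ j * (vec_l2 (col Us k) * (\<Sum>i<n. cmod (v $ i)))" if "k < r" for j k
 proof -
  have "vec_l2 (w j k) \<le> (rh / 8) ^ j * vec_l2 (col Us k)" unfolding w_def using opb_transpose[OF opb_pow[OF oH H, of j] Hj] rh Us(1) Hj
   by (intro opbD[of _ _ n n]) auto
  hence "cmod (c (w j k)) \<le> ((rh / 8) ^ j * vec_l2 (col Us k)) * (\<Sum>i<n. cmod (v $ i))"
   unfolding c_def using cdot_bound[of "w j k" v] w[of j k] by (simp add: carrier_vecD) (meson mult_right_mono norm_ge_zero order_trans sum_nonneg)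
  thus ?thesis by simp
 qed
 have rz: "rh / cmod z \<le> 1 / 2"
 proof -
  have "rh / cmod z \<le> rh / (lmin / 2)" using z z0 rh by (intro divide_left_mono) auto
  also have "... \<le> 1 / 2" using rh by simp
  finally show ?thesis .
 qed
 \<comment> \<open>All powers of \<open>H\<close> are moved onto the test vector, so each step of
   the recursion replaces \<open>w j k\<close> by \<open>w (Suc j) k\<close> and adds one term in
   the overlaps.\<close>
 have E_bound: "cmod (t * c (w 1 k)) \<le> 2 * (e0 * S / cmod z)" if k: "k < r" for k
 proof -
  define a where "a j = cmod (c (w (Suc j) k)) * (t / cmod z) ^ j" for j
  have tz: "0 \<le> t / cmod z" using t by simp
  have "a 0 \<le> 2 * (e0 * S / cmod z)"
  proof (rule geometric_bound)
   fix j
   have "z * c (w (Suc j) k) = c (Ms *\<^sub>v w (Suc j) k) + t * c (w (Suc (Suc j)) k)" using step[OF w[of "Suc j" k]] by (simp only: w_Suc)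
   hence "cmod z * cmod (c (w (Suc j) k)) \<le> cmod (c (Ms *\<^sub>v w (Suc j) k)) + t * cmod (c (w (Suc (Suc j)) k))"
    using t by (metis norm_mult norm_triangle_ineq norm_of_real abs_of_nonneg atLeastAtMost_iff)
   also have "cmod (c (Ms *\<^sub>v w (Suc j) k)) \<le> e0 * rh ^ j * S"
   proof -
    have "cmod (c (Ms *\<^sub>v w (Suc j) k)) \<le> (\<Sum>m<r. cmod (cor (ls m) * cor (col Us m \<bullet> w (Suc j) k) * R m))"
     unfolding c_Ms[OF w] by (rule norm_sum)
    also have "... \<le> (\<Sum>m<r. e0 * rh ^ j * (\<bar>ls m\<bar> * cmod (R m)))"
    proof (rule sum_mono)
     fix m assume "m \<in> {..<r}"
     hence "\<bar>col Us m \<bullet> w (Suc j) k\<bar> * (\<bar>ls m\<bar> * cmod (R m)) \<le> e0 * rh ^ j * (\<bar>ls m\<bar> * cmod (R m))"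
      using gram[OF k] bilinear[OF k, of m j] by (intro mult_right_mono) auto
     thus "cmod (cor (ls m) * cor (col Us m \<bullet> w (Suc j) k) * R m) \<le> e0 * rh ^ j * (\<bar>ls m\<bar> * cmod (R m))"
      by (simp add: norm_mult mult_ac)
    qed
    finally show ?thesis by (simp add: S_def sum_distrib_left)
   qed
   finally have "cmod (c (w (Suc j) k)) \<le> (e0 * rh ^ j * S) / cmod z + t / cmod z * cmod (c (w (Suc (Suc j)) k))"
    using z0 by (simp add: field_simps)
   hence "a j \<le> ((e0 * rh ^ j * S) / cmod z + t / cmod z * cmod (c (w (Suc (Suc j)) k))) * (t / cmod z) ^ j"
    unfolding a_def using tz by (intro mult_right_mono) auto
   also have "... = e0 * S / cmod z * (t * (rh / cmod z)) ^ j + a (Suc j)" by (simp add: a_def power_divide algebra_simps)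
   also have "e0 * S / cmod z * (t * (rh / cmod z)) ^ j \<le> e0 * S / cmod z * (1 / 2) ^ j"
   proof (intro mult_left_mono power_mono)
    have "t * (rh / cmod z) \<le> 1 * (rh / cmod z)" using t rh by (intro mult_right_mono) auto
    thus "t * (rh / cmod z) \<le> 1 / 2" using rz by linarith
   qed (use t rh z0 e0 in \<open>auto simp: S_def sum_nonneg\<close>)
   finally show "a j \<le> e0 * S / cmod z * (1 / 2) ^ j + a (Suc j)" by simp
  next
   fix j
   define C where "C = vec_l2 (col Us k) * (\<Sum>i<n. cmod (v $ i))"
   have C0: "0 \<le> C" by (simp add: C_def sum_nonneg)
   have "a j \<le> ((rh / 8) ^ Suc j * C) * (t / cmod z) ^ j" unfolding a_def C_def using tz by (intro mult_right_mono c_bound[OF k]) auto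
   also have "... = (rh / 8 * C) * (t / 8 * (rh / cmod z)) ^ j" by (simp add: power_mult_distrib power_divide mult_ac)
   also have "... \<le> (rh / 8 * C) * (1 / 2) ^ j"
   proof (intro mult_left_mono power_mono)
    have "t / 8 * (rh / cmod z) \<le> 1 * (rh / cmod z)" using t rh by (intro mult_right_mono) auto
    thus "t / 8 * (rh / cmod z) \<le> 1 / 2" using rz by linarith
   qed (use t rh z0 C0 in auto)
   finally show "a j \<le> rh / 8 * C * (1 / 2) ^ j" .
  qed
  hence "cmod (c (w 1 k)) \<le> 2 * (e0 * S / cmod z)" by (simp add: a_def)
  moreover have "cmod (t * c (w 1 k)) \<le> 1 * cmod (c (w 1 k))" using t unfolding norm_mult by (intro mult_right_mono) auto
  ultimately show ?thesis by simp
 qed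
 have R_bound: "disc_radius * cmod (R k) \<le> 2 * (e0 * S / cmod z)" if k: "k < r" for k
 proof -
  have ck: "col Us k \<in> vecs n" using Us(1) by auto
  have orth: "col Us m \<bullet> col Us k = (if m = k then 1 else 0)" if "m < r" for m
   using arg_cong[OF Us(2), of "\<lambda>A. A $$ (m, k)"] that k Us(1) by auto
  have "z * R k = c (Ms *\<^sub>v col Us k) + t * c (w 1 k)" using step[OF ck] w_Suc[of 0 k] w_0[OF k] by (simp add: R_def)
  also have "c (Ms *\<^sub>v col Us k) = (\<Sum>m<r. if m = k then cor (ls m) * R m else 0)"
   unfolding c_Ms[OF ck] by (intro sum.cong) (auto simp: orth)
  finally have "(z - cor (ls k)) * R k = t * c (w 1 k)" using k by (simp add: algebra_simps)
  hence "cmod (z - cor (ls k)) * cmod (R k) = cmod (t * c (w 1 k))" by (metis norm_mult)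
  moreover have "disc_radius * cmod (R k) \<le> cmod (z - cor (ls k)) * cmod (R k)" using far[OF k] by (intro mult_right_mono) auto
  ultimately show ?thesis using E_bound[OF k] by linarith
 qed
 have "disc_radius * S = (\<Sum>k<r. \<bar>ls k\<bar> * (disc_radius * cmod (R k)))" by (simp add: S_def sum_distrib_left mult_ac)
 also have "... \<le> (\<Sum>k<r. lmax * (2 * (e0 * S / cmod z)))"
 proof (intro sum_mono)
  fix k assume "k \<in> {..<r}"
  thus "\<bar>ls k\<bar> * (disc_radius * cmod (R k)) \<le> lmax * (2 * (e0 * S / cmod z))"
   using mult_mono[OF ls_upper[of k] R_bound[of k]] lmax_pos less_imp_le[OF disc_radius(1)] by simp
 qed
 also have "... = real r * lmax * 2 * e0 * S / cmod z" by simp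
 also have "... \<le> real r * lmax * 2 * e0 * S / (lmin / 2)"
  using z z0 lmin lmax_pos e0 by (intro divide_left_mono) (auto simp: S_def sum_nonneg)
 also have "... = disc_radius / 2 * S" by (simp add: disc_radius_def ka_def)
 finally have "(\<Sum>k<r. \<bar>ls k\<bar> * cmod (R k)) = 0" using disc_radius(1) by (simp add: S_def sum_nonneg antisym)
 hence R0: "R k = 0" if "k < r" for k using sum_nonneg_eq_0_iff[of "{..<r}" "\<lambda>k. \<bar>ls k\<bar> * cmod (R k)"] that ls_lower[OF that] lmin by force
 hence step': "z * c x = t * c (tr H *\<^sub>v x)" if "x \<in> vecs n" for x using step[OF that] unfolding c_Ms[OF that] by simp
 \<comment> \<open>\<open>z^j\<close> times the coordinate \<open>i\<close> of \<open>v\<close>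
   equals \<open>t^j\<close> times that of \<open>H^j v\<close>, which grows at most like
   \<open>(rh / 8) ^ j\<close>.\<close>
 have "v $ i = 0" if i: "i < n" for i
 proof -
  define x where "x j = tr (H ^\<^sub>m j) *\<^sub>v unit_vec n i" for j
  have x: "x j \<in> vecs n" for j using matsD[OF H] by (simp add: x_def)
  have x_Suc: "tr H *\<^sub>v x j = x (Suc j)" for j using matsD[OF H] by (simp add: x_def mat_dim_transpose mat_dim_vec_assoc)
  define C where "C = (\<Sum>i<n. cmod (v $ i))"
  have C0: "0 \<le> C" by (simp add: C_def sum_nonneg)
  have cx: "cmod (c (x j)) \<le> (rh / 8) ^ j * C" for j
  proof -
   have "vec_l2 (x j) \<le> (rh / 8) ^ j * vec_l2 (unit_vec n i)" unfolding x_def using opb_transpose[OF opb_pow[OF oH H, of j] Hj] rh Hj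
    by (intro opbD[of _ _ n n]) auto
   moreover have "vec_l2 (unit_vec n i) = 1" using i by (simp add: vec_l2_def)
   ultimately have "vec_l2 (x j) * C \<le> (rh / 8) ^ j * C" using C0 by (intro mult_right_mono) auto
   thus ?thesis unfolding c_def using cdot_bound[of "x j" v] x[of j] by (simp add: C_def)
  qed
  have iter: "z ^ j * c (x 0) = cor t ^ j * c (x j)" for j
  proof (induction j)
   case (Suc j)
   have "z ^ Suc j * c (x 0) = cor t ^ j * (z * c (x j))" using Suc by simp
   also have "... = cor t ^ Suc j * c (x (Suc j))" using step'[OF x[of j]] by (simp only: x_Suc) simp
   finally show ?case .
  qed simp
  have bnd: "cmod (c (x 0)) \<le> C * (1 / 2) ^ j" for j
  proof -
   have "cmod z ^ j * cmod (c (x 0)) = cmod (z ^ j * c (x 0))" by (simp add: norm_mult norm_power)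
   also have "... = \<bar>t\<bar> ^ j * cmod (c (x j))" unfolding iter by (simp add: norm_mult norm_power)
   also have "... \<le> 1 * ((rh / 8) ^ j * C)" using t cx[of j] by (intro mult_mono) (auto intro: power_le_one)
   finally have "cmod (c (x 0)) \<le> (rh / 8) ^ j * C / cmod z ^ j" using z0 by (simp add: field_simps)
   also have "... = C * ((rh / cmod z) / 8) ^ j" by (simp add: power_divide mult.commute)
   also have "... \<le> C * (1 / 2) ^ j" using C0 rz rh z0 by (intro mult_left_mono power_mono) auto
   finally show ?thesis .
  qed
  have "(\<lambda>j. C * (1 / 2) ^ j) \<longlonglongrightarrow> C * 0" by (intro tendsto_intros LIMSEQ_power_zero) auto
  hence "cmod (c (x 0)) \<le> 0" using bnd by (intro LIMSEQ_le_const) auto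
  moreover have "x 0 = unit_vec n i" using matsD[OF H] by (simp add: x_def)
  moreover have "c (unit_vec n i) = v $ i"
  proof -
   have "c (unit_vec n i) = (\<Sum>j<n. if j = i then v $ j else 0)" unfolding c_def cdot_def by (intro sum.cong) (auto simp: unit_vec_def)
   thus ?thesis using i by simp
  qed
  ultimately show ?thesis by simp
 qed
 thus False using v(1) v(2) by auto
qed

end

lemma map_poly_of_real_prod_linear:
 "map_poly cor (\<Prod>a\<leftarrow>as. [:- a, 1:]) = (\<Prod>b\<leftarrow>map cor as. [:- b, 1:])"
proof (induction as)
 case (Cons a as)
 have "map_poly cor (p * q) = map_poly cor p * map_poly cor q" for p q by (intro poly_eqI) (simp add: coeff_map_poly coeff_mult)
 from this[of "[:- a, 1:]"] show ?case using Cons by simp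
qed simp

lemma distinct_if_count_list_le_1: "(\<And>z. count_list xs z \<le> 1) \<Longrightarrow> distinct xs"
proof (induction xs)
 case (Cons x xs)
 have "count_list xs z \<le> 1" for z using Cons.prems[of z] by (simp split: if_splits)
 thus ?case using Cons.prems[of x] Cons.IH by (simp add: count_list_0_iff)
qed simp

locale gapped_noise_bounds = noise_bounds +
 fixes \<delta> :: real
 assumes gap: "\<And>k l. \<lbrakk>k < r; l < r; k \<noteq> l\<rbrakk> \<Longrightarrow> \<delta> \<le> \<bar>ls k - ls l\<bar>"
  and \<delta>: "0 < \<delta>" "1000 * ka * (real r * sqrt (real r)) * e0 \<le> \<delta>"
begin

text \<open>The factor 4 makes the closed discs disjoint and keeps an eigenvalue in one disc at
  distance at least \<open>\<delta> / 2\<close> from all other \<open>ls k\<close>.\<close>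

lemma disc_radius_gap: "4 * disc_radius \<le> \<delta>"
proof -
 have "1000 * ka * (real r * 1) * e0 \<le> 1000 * ka * (real r * sqrt (real r)) * e0" using sqrt_r ka e0 by simp
 moreover have "0 \<le> ka * real r * e0" using ka e0 by simp
 ultimately show ?thesis using \<delta>(2) by (simp_all add: disc_radius_def)
qed

abbreviation disc :: "nat \<Rightarrow> complex set" where
 "disc k \<equiv> ball (cor (ls k)) disc_radius"

lemma disc_unique:
 assumes "z \<in> cball (cor (ls k)) disc_radius" "z \<in> cball (cor (ls l)) disc_radius" "k < r" "l < r" shows "k = l"
proof (rule ccontr)
 assume ne: "k \<noteq> l"
 have "\<bar>ls k - ls l\<bar> = dist (cor (ls k)) (cor (ls l))" by (metis dist_norm norm_of_real of_real_diff)
 also have "... \<le> disc_radius + disc_radius" using dist_triangle2[of "cor (ls k)" "cor (ls l)" z] assms by simp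
 finally show False using gap[OF assms(3,4) ne] disc_radius_gap disc_radius(1) by simp
qed

lemma disc_large: "k < r \<Longrightarrow> z \<in> cball (cor (ls k)) disc_radius \<Longrightarrow> lmin * (9 / 10) \<le> cmod z"
proof -
 assume k: "k < r" and z: "z \<in> cball (cor (ls k)) disc_radius"
 have "cmod (cor (ls k)) \<le> cmod z + cmod (cor (ls k) - z)" by (metis add.commute norm_triangle_sub)
 thus ?thesis using z ls_lower[OF k] disc_radius(2) by (simp add: dist_norm)
qed

text \<open>The signal has exactly one eigenvalue in each disc: an eigenvector with nonzero eigenvalue lies
 in the span of the columns of \<open>Us\<close>.\<close>

lemma signal_ball_roots:
 assumes k: "k < r" shows "ball_roots (char_poly (map_mat cor Ms)) (cor (ls k)) disc_radius = 1"
proof -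
 obtain Ga d where Ga: "Ga \<in> mats n n" "tr Ga * Ga = 1\<^sub>m n" and Ms_eq: "Ms = Ga * diag n d * tr Ga"
  using real_spectral_theorem[OF Ms] by blast
 have "similar_mat Ms (diag n d)" by (rule similar_matI[of _ _ Ga "tr Ga" n]) (use Ga Ms orthogonal_commute[OF Ga] Ms_eq in auto)
 hence "char_poly Ms = char_poly (diag n d)" by (rule char_poly_similar)
 also have "... = (\<Prod>a\<leftarrow>diag_mat (diag n d). [:- a, 1:])"
  by (rule char_poly_upper_triangular[of _ n]) (auto simp: upper_triangular_def mat_diag_def)
 also have "diag_mat (diag n d) = map d [0..<n]" by (simp add: diag_mat_def mat_diag_def)
 finally have cp: "char_poly Ms = (\<Prod>a\<leftarrow>map d [0..<n]. [:- a, 1:])" .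
 have "char_poly (map_mat cor Ms) = map_poly cor (char_poly Ms)" by (rule of_real_hom.char_poly_hom[OF Ms(1)])
 also have "... = (\<Prod>b\<leftarrow>map (\<lambda>i. cor (d i)) [0..<n]. [:- b, 1:])"
  unfolding cp map_poly_of_real_prod_linear by (simp add: o_def)
 finally have "ball_roots (char_poly (map_mat cor Ms)) (cor (ls k)) disc_radius
   = length (filter (\<lambda>b. b \<in> disc k) (map (\<lambda>i. cor (d i)) [0..<n]))" by (simp only: ball_roots_prod_linear)
 also have "... = card {i. i < n \<and> cor (d i) \<in> disc k}" by (simp add: length_filter_conv_card) (rule arg_cong[of _ _ card], auto)
 finally have count: "ball_roots (char_poly (map_mat cor Ms)) (cor (ls k)) disc_radius
   = card {i. i < n \<and> cor (d i) \<in> disc k}" .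
 have Gacol: "col Ga i \<in> vecs n" for i using matsD(1)[OF Ga(1)] by auto
 have Gaorth: "col Ga i \<bullet> col Ga j = (if i = j then 1 else 0)" if "i < n" "j < n" for i j
  using arg_cong[OF Ga(2), of "\<lambda>A. A $$ (i, j)"] that Ga(1) by auto
 have Gaev: "Ms *\<^sub>v col Ga i = d i \<cdot>\<^sub>v col Ga i" if i: "i < n" for i
 proof -
  have "Ms * Ga = Ga * diag n d * (tr Ga * Ga)" unfolding Ms_eq using matsD[OF Ga(1)] by (simp add: mat_dim_assoc)
  also have "... = Matrix.mat n n (\<lambda>(i, j). Ga $$ (i, j) * d j)" unfolding Ga(2) by (simp add: mat_diag_mult_right[OF Ga(1)])
  finally have MG: "Ms * Ga = Matrix.mat n n (\<lambda>(i, j). Ga $$ (i, j) * d j)" .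
  have "Ms *\<^sub>v col Ga i = col (Ms * Ga) i" using col_mult2[OF Ms(1) Ga(1) i] by simp
  also have "... = d i \<cdot>\<^sub>v col Ga i" unfolding MG using i matsD[OF Ga(1)] by auto
  finally show ?thesis .
 qed
 define R where "R i m = col Us m \<bullet> col Ga i" for i m
 have Uscol: "col Us m \<in> vecs n" for m using matsD(1)[OF Us(1)] by auto
 have Us_ev: "Ms *\<^sub>v col Us m = ls m \<cdot>\<^sub>v col Us m" if m: "m < r" for m
 proof -
  have "Ms * Us = Us * diag r ls * (tr Us * Us)" unfolding Ms_def using matsD[OF Us(1)] by (simp add: mat_dim_assoc)
  also have "... = Matrix.mat n r (\<lambda>(i, j). Us $$ (i, j) * ls j)" unfolding Us(2) by (simp add: mat_diag_mult_right[OF Us(1)])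
  finally have MU: "Ms * Us = Matrix.mat n r (\<lambda>(i, j). Us $$ (i, j) * ls j)" .
  have "Ms *\<^sub>v col Us m = col (Ms * Us) m" using col_mult2[OF Ms(1) Us(1) m] by simp
  also have "... = ls m \<cdot>\<^sub>v col Us m" unfolding MU using m matsD[OF Us(1)] by auto
  finally show ?thesis .
 qed
 \<comment> \<open>Orthogonality of eigenvectors to different eigenvalues: a column of
   \<open>Ga\<close> overlaps only with signal vectors that share its eigenvalue.\<close>
 have R_eq: "(d i - ls m) * R i m = 0" if "i < n" "m < r" for i m
 proof -
  have "d i * R i m = col Us m \<bullet> (Ms *\<^sub>v col Ga i)" by (simp only: Gaev[OF that(1)] R_def scalar_prod_smult_distrib[OF Uscol Gacol])
  also have "... = ls m * R i m"
   using scalar_prod_mult_mat_vec[OF Ms(1) Uscol Gacol] Ms(2) by (simp only: Us_ev[OF that(2)] R_def smult_scalar_prod_distrib[OF Uscol Gacol])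
  finally show ?thesis by auto
 qed
 have expand: "d i \<cdot>\<^sub>v col Ga i = Us *\<^sub>v Matrix.vec r (\<lambda>m. ls m * R i m)" if i: "i < n" for i
 proof -
  have "Ms *\<^sub>v col Ga i = Us *\<^sub>v (diag r ls *\<^sub>v (tr Us *\<^sub>v col Ga i))"
   unfolding Ms_def using Ga(1) matsD[OF Us(1)] by (simp add: mat_dim_vec_assoc)
  also have "diag r ls *\<^sub>v (tr Us *\<^sub>v col Ga i) = Matrix.vec r (\<lambda>m. ls m * R i m)"
  proof (rule eq_vecI)
   fix m assume "m < dim_vec (Matrix.vec r (\<lambda>m. ls m * R i m))"
   hence m: "m < r" by simp
   hence "(diag r ls *\<^sub>v (tr Us *\<^sub>v col Ga i)) $ m = ls m * (tr Us *\<^sub>v col Ga i) $ m"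
    using matsD[OF Us(1)] by (intro mat_diag_mult_vec_index) simp_all
   also have "... = ls m * R i m" using m matsD[OF Us(1)] by (simp add: R_def)
   finally show "(diag r ls *\<^sub>v (tr Us *\<^sub>v col Ga i)) $ m = Matrix.vec r (\<lambda>m. ls m * R i m) $ m" using m by simp
  qed simp
  finally show ?thesis using Gaev[OF i] by simp
 qed
 have in_disc: "d i = ls k \<and> (\<exists>a. col Ga i = a \<cdot>\<^sub>v col Us k)" if i: "i < n" and di: "cor (d i) \<in> disc k" for i
 proof -
  have "lmin * (9 / 10) \<le> cmod (cor (d i))" by (rule disc_large[OF k]) (use di in simp)
  hence d0: "d i \<noteq> 0" using lmin by auto
  have other: "R i m = 0" if m: "m < r" "m \<noteq> k" for m
  proof (rule ccontr)
   assume "R i m \<noteq> 0"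
   hence "m = k" using R_eq[OF i m(1)] di m(1) k disc_radius(1) by (intro disc_unique[of "cor (ls m)"]) auto
   thus False using m by simp
  qed
  have vec: "Matrix.vec r (\<lambda>m. ls m * R i m) = (ls k * R i k) \<cdot>\<^sub>v unit_vec r k" using other k by auto
  have "d i \<cdot>\<^sub>v col Ga i = (ls k * R i k) \<cdot>\<^sub>v col Us k" unfolding expand[OF i] vec using k matsD[OF Us(1)] by auto
  hence "(1 / d i) \<cdot>\<^sub>v (d i \<cdot>\<^sub>v col Ga i) = (1 / d i) \<cdot>\<^sub>v ((ls k * R i k) \<cdot>\<^sub>v col Us k)" by simp
  hence e: "col Ga i = (ls k * R i k / d i) \<cdot>\<^sub>v col Us k" using d0 by (simp add: smult_smult_assoc)
  have "R i k \<noteq> 0"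
  proof
   assume "R i k = 0"
   hence "col Ga i \<bullet> col Ga i = 0" by (subst e, subst e) simp
   thus False using Gaorth[OF i i] by simp
  qed
  hence "d i = ls k" using R_eq[OF i k] by simp
  thus ?thesis using e by blast
 qed
 \<comment> \<open>Two orthonormal vectors cannot both be multiples of the same vector.\<close>
 have uniq: "i = j" if ij: "i < n" "j < n" "cor (d i) \<in> disc k" "cor (d j) \<in> disc k" for i j
 proof (rule ccontr)
  assume ne: "i \<noteq> j"
  obtain a b where a: "col Ga i = a \<cdot>\<^sub>v col Us k" and b: "col Ga j = b \<cdot>\<^sub>v col Us k"
   using in_disc[OF ij(1,3)] in_disc[OF ij(2,4)] by blast
  define q where "q = col Us k \<bullet> col Us k"
  have dot: "(c \<cdot>\<^sub>v col Us k) \<bullet> (c' \<cdot>\<^sub>v col Us k) = c * c' * q" for c c' by (simp add: q_def)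
  have "a * a * q = 1" "b * b * q = 1" "a * b * q = 0"
   using Gaorth[OF ij(1,1)] Gaorth[OF ij(2,2)] Gaorth[OF ij(1,2)] ne by (simp_all only: a b dot if_True if_False refl)
  thus False by auto
 qed
 have ex: "\<exists>i<n. cor (d i) \<in> disc k"
 proof (rule ccontr)
  assume none: "\<not> ?thesis"
  have R0: "R i k = 0" if i: "i < n" for i
  proof (rule ccontr)
   assume "R i k \<noteq> 0"
   thus False using R_eq[OF i k] none i disc_radius(1) by auto
  qed
  have "tr Ga *\<^sub>v col Us k = 0\<^sub>v n" using R0 Ga(1) comm_scalar_prod[OF Gacol Uscol] by (intro eq_vecI) (auto simp: R_def matsD)
  thus False using orthogonal_norm[OF Ga Uscol[of k]] arg_cong[OF Us(2), of "\<lambda>A. A $$ (k, k)"] k Us(1) by (auto simp: vec_l2_sq)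
 qed
 then obtain i where i: "i < n" "cor (d i) \<in> disc k" by blast
 hence "{i. i < n \<and> cor (d i) \<in> disc k} = {i}" using uniq by auto
 thus ?thesis unfolding count by simp
qed

definition "M = Ms + H"

lemma M: "M \<in> mats n n" using H by (simp add: M_def)

lemma cM: "map_mat cor M = map_mat cor Ms + map_mat cor H" using Ms H by (intro eq_matI) (auto simp: M_def)

text \<open>An eigenvalue on the circle would lie strictly inside some disc; as the closed discs are
  disjoint, that could only be the same disc, a contradiction.\<close>

lemma noisy_ball_roots:
 assumes k: "k < r" shows "ball_roots (char_poly (map_mat cor M)) (cor (ls k)) disc_radius = 1" unfolding cM signal_ball_roots[OF k, symmetric]
proof (rule char_poly_homotopy[of _ n])
 fix t z assume t: "t \<in> {0..1 :: real}" and z: "z \<in> sphere (cor (ls k)) disc_radius"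
 show "\<not> eigenvalue (map_mat cor Ms + cor t \<cdot>\<^sub>m map_mat cor H) z"
 proof
  assume ev: "eigenvalue (map_mat cor Ms + cor t \<cdot>\<^sub>m map_mat cor H) z"
  have "lmin / 2 \<le> cmod z" using disc_large[OF k, of z] z lmin by simp
  then obtain l where l: "l < r" "cmod (z - cor (ls l)) < disc_radius" using eigenvalue_in_disc[OF t _ ev] by blast
  hence "k = l" using z k by (intro disc_unique[of z]) (auto simp: dist_norm norm_minus_commute)
  thus False using l z by (simp add: dist_norm norm_minus_commute)
 qed
qed (use Ms H disc_radius(1) in auto)

text \<open>All roots of modulus at least \<open>lmin / 2\<close> lie in the discs, one in each, and
  they are real because the conjugate of a root in a disc is a root in the same disc. The equation
  of multisets also records that they are simple.\<close>

lemma noisy_spectrum: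
 obtains as x where "char_poly (map_mat cor M) = (\<Prod>a\<leftarrow>as. [:- a, 1:])"
  and "\<And>k. k < r \<Longrightarrow> \<bar>x k - ls k\<bar> < disc_radius"
  and "mset (filter (\<lambda>a. lmin / 2 \<le> cmod a) as) = mset (map (\<lambda>k. cor (x k)) [0..<r])"
  and "distinct (map (\<lambda>k. cor (x k)) [0..<r])"
proof -
 have cMc: "map_mat cor M \<in> mats n n" using M by simp
 obtain as where as: "char_poly (map_mat cor M) = (\<Prod>a\<leftarrow>as. [:- a, 1:])" using char_poly_factorized[OF cMc] by blast
 have one: "length (filter (\<lambda>b. b \<in> disc k) as) = 1" if "k < r" for k
  using noisy_ball_roots[OF that] unfolding as ball_roots_prod_linear .
 have "\<exists>a. filter (\<lambda>b. b \<in> disc k) as = [a]" if "k < r" for k using one[OF that] by (simp add: length_Suc_conv)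
 then obtain a where a: "\<And>k. k < r \<Longrightarrow> filter (\<lambda>b. b \<in> disc k) as = [a k]" by metis
 have in_disc: "z = a k" if "k < r" "z \<in> set as" "z \<in> disc k" for k z
 proof -
  have "z \<in> set (filter (\<lambda>b. b \<in> disc k) as)" using that by simp
  thus ?thesis unfolding a[OF that(1)] by simp
 qed
 have a_mem: "a k \<in> set as" "a k \<in> disc k" if "k < r" for k
 proof -
  have "a k \<in> set (filter (\<lambda>b. b \<in> disc k) as)" using a[OF that] by simp
  thus "a k \<in> set as" "a k \<in> disc k" by auto
 qed
 have root: "z \<in> set as \<longleftrightarrow> poly (char_poly (map_mat cor M)) z = 0" for z unfolding as by (auto simp: poly_prod_list)
 have real: "cnj (a k) = a k" if k: "k < r" for k
 proof (rule in_disc[OF k])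
  have "poly (char_poly (map_mat cor M)) (cnj (a k)) = 0" using root[of "a k"] a_mem(1)[OF k]
   unfolding of_real_hom.char_poly_hom[OF M] by (subst real_poly_cnj_root_iff) auto
  thus "cnj (a k) \<in> set as" by (simp add: root)
  have "dist (cor (ls k)) (cnj (a k)) = dist (cor (ls k)) (a k)" by (metis complex_cnj_complex_of_real complex_cnj_diff complex_mod_cnj dist_norm)
  thus "cnj (a k) \<in> disc k" using a_mem(2)[OF k] by simp
 qed
 define x where "x k = Re (a k)" for k
 have xa: "cor (x k) = a k" if "k < r" for k using real[OF that] by (simp add: x_def complex_eq_iff)
 have x_disc: "\<bar>x k - ls k\<bar> < disc_radius" if k: "k < r" for k
 proof -
  have "dist (cor (ls k)) (cor (x k)) < disc_radius" using a_mem(2)[OF k] xa[OF k] by simp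
  thus ?thesis by (metis dist_norm norm_minus_commute norm_of_real of_real_diff)
 qed
 have inj: "inj_on a {0..<r}"
 proof (rule inj_onI)
  fix k l assume kl: "k \<in> {0..<r}" "l \<in> {0..<r}" "a k = a l"
  thus "k = l" using a_mem(2)[of k] a_mem(2)[of l] by (intro disc_unique[of "a k"]) auto
 qed
 have map_eq: "map (\<lambda>k. cor (x k)) [0..<r] = map a [0..<r]" using xa by simp
 have dist: "distinct (map (\<lambda>k. cor (x k)) [0..<r])" unfolding map_eq using inj by (simp add: distinct_map)
 have large: "z \<in> a ` {0..<r}" if z: "z \<in> set as" "lmin / 2 \<le> cmod z" for z
 proof -
  have "eigenvalue (map_mat cor M) z" using z(1) root eigenvalue_root_char_poly[OF cMc] by blast
  moreover have "map_mat cor M = map_mat cor Ms + cor 1 \<cdot>\<^sub>m map_mat cor H" unfolding cM by auto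
  ultimately obtain k where k: "k < r" "cmod (z - cor (ls k)) < disc_radius" using eigenvalue_in_disc[of 1 z] z(2) by auto
  hence "z = a k" using z(1) by (intro in_disc) (auto simp: dist_norm norm_minus_commute)
  thus ?thesis using k by auto
 qed
 have "mset (filter (\<lambda>a. lmin / 2 \<le> cmod a) as) = mset (map a [0..<r])"
 proof -
  have "set (filter (\<lambda>a. lmin / 2 \<le> cmod a) as) = set (map a [0..<r])"
  proof (intro equalityI subsetI)
   fix z assume "z \<in> set (map a [0..<r])"
   then obtain k where k: "k < r" "z = a k" by auto
   thus "z \<in> set (filter (\<lambda>a. lmin / 2 \<le> cmod a) as)" using a_mem[OF k(1)] disc_large[OF k(1), of z] lmin by auto
  qed (use large in auto)
  moreover have "distinct (filter (\<lambda>a. lmin / 2 \<le> cmod a) as)"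
  proof -
   have "count_list (filter (\<lambda>a. lmin / 2 \<le> cmod a) as) z \<le> 1" for z
   proof (cases "z \<in> set (filter (\<lambda>a. lmin / 2 \<le> cmod a) as)")
    case True
    then obtain k where k: "k < r" "z = a k" using large[of z] by auto
    have "count_list (filter (\<lambda>b. b \<in> disc k) as) z = count_list as z" using a_mem(2)[OF k(1)] k(2) by (simp add: count_list_filter)
    moreover have "count_list (filter (\<lambda>b. b \<in> disc k) as) z \<le> 1" unfolding a[OF k(1)] by simp
    ultimately show ?thesis by (simp add: count_list_filter)
   qed simp
   thus ?thesis by (rule distinct_if_count_list_le_1)
  qed
  moreover have "distinct (map a [0..<r])" using dist map_eq by simp
  ultimately show ?thesis using set_eq_iff_mset_eq_distinct by blast
 qed
 thus ?thesis using that[OF as x_disc] dist map_eq by simp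
qed

end

context gapped_noise_bounds
begin

lemma leading_eigenpairs_exist: "\<exists>U lam. leading_eigenpairs n r M U lam"
proof -
 obtain as x where as: "char_poly (map_mat cor M) = (\<Prod>a\<leftarrow>as. [:- a, 1:])"
  and x: "\<And>k. k < r \<Longrightarrow> \<bar>x k - ls k\<bar> < disc_radius"
  and lead: "mset (filter (\<lambda>a. lmin / 2 \<le> cmod a) as) = mset (map (\<lambda>k. cor (x k)) [0..<r])" using noisy_spectrum by metis
 define rest where "rest = filter (\<lambda>a. \<not> lmin / 2 \<le> cmod a) as"
 have "mset as = mset (map (\<lambda>k. cor (x k)) [0..<r] @ rest)" unfolding rest_def by (simp add: lead[symmetric] del: mset_map)
 hence "mset (map (\<lambda>a. [:- a, 1:]) as) = mset (map (\<lambda>a. [:- a, 1:]) (map (\<lambda>k. cor (x k)) [0..<r] @ rest))"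
  by (simp only: mset_map)
 hence cp: "char_poly (map_mat cor M) = (\<Prod>e\<leftarrow>map (\<lambda>l. cor (x l)) [0..<r] @ rest. [:- e, 1:])"
  unfolding as by (metis prod_mset_prod_list)
 have ev: "\<exists>u. u \<in> vecs n \<and> vec_l2 u = 1 \<and> M *\<^sub>v u = x l \<cdot>\<^sub>v u" if l: "l < r" for l
 proof -
  have "poly (char_poly (map_mat cor M)) (cor (x l)) = 0" unfolding cp using l by (auto simp: poly_prod_list)
  then obtain v where v: "v \<in> vecs n" "v \<noteq> 0\<^sub>v n" "M *\<^sub>v v = x l \<cdot>\<^sub>v v"
   using eigenvalue_root_char_poly[OF M] M unfolding of_real_hom.char_poly_hom[OF M] by (auto simp: eigenvalue_def eigenvector_def)
  have "vec_l2 ((1 / vec_l2 v) \<cdot>\<^sub>v v) = 1" using v vec_l2_eq_0 by (simp add: vec_l2_smult)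
  moreover have "M *\<^sub>v ((1 / vec_l2 v) \<cdot>\<^sub>v v) = x l \<cdot>\<^sub>v ((1 / vec_l2 v) \<cdot>\<^sub>v v)"
   using v by (simp add: mult_mat_vec[OF M v(1)] smult_smult_assoc)
  ultimately show ?thesis using v(1) smult_carrier_vec by blast
 qed
 then obtain u where u: "\<And>l. l < r \<Longrightarrow> u l \<in> vecs n \<and> vec_l2 (u l) = 1 \<and> M *\<^sub>v u l = x l \<cdot>\<^sub>v u l" by metis
 define U where "U = Matrix.mat n r (\<lambda>(i, l). u l $ i)"
 have cols: "col U l = u l" if "l < r" for l using that u[OF that] by (auto simp: U_def intro!: eq_vecI)
 have "leading_eigenpairs n r M U x" unfolding leading_eigenpairs_def
 proof (intro conjI allI impI exI)
  show "U \<in> mats n r" by (simp add: U_def)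
  fix l assume l: "l < r"
  show "vec_l2 (col U l) = 1" using u[OF l] cols[OF l] by simp
  show "eigenvector M (col U l) (x l)" using u[OF l] cols[OF l] M by (auto simp: eigenvector_def)
 next
  show "char_poly (map_mat cor M) = (\<Prod>e\<leftarrow>map (\<lambda>l. cor (x l)) [0..<r] @ rest. [:- e, 1:])" by (rule cp)
  show "\<forall>z\<in>set rest. \<forall>l<r. cmod z \<le> \<bar>x l\<bar>"
  proof (intro ballI allI impI)
   fix z l assume z: "z \<in> set rest" and l: "l < r"
   have "cmod z < lmin / 2" using z by (simp add: rest_def)
   thus "cmod z \<le> \<bar>x l\<bar>" using x[OF l] ls_lower[OF l] disc_radius(2) by simp
  qed
 qed
 thus ?thesis by blast
qed

text \<open>If some \<open>lam l\<close> were below \<open>lmin / 2\<close> in modulus, so would be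
  every root in \<open>rest\<close>, and fewer than \<open>r\<close> large roots would be left.
  Hence the \<open>lam l\<close> are exactly the large roots, in some order
  \<open>\<pi>\<close>.\<close>

lemma leading_eigenpairs_match:
 assumes "leading_eigenpairs n r M U lam"
 shows "\<exists>\<pi>. bij_betw \<pi> {..<r} {..<r} \<and> (\<forall>l<r. \<bar>lam l - ls (\<pi> l)\<bar> < disc_radius)"
proof -
 obtain as x where as: "char_poly (map_mat cor M) = (\<Prod>a\<leftarrow>as. [:- a, 1:])"
  and x: "\<And>k. k < r \<Longrightarrow> \<bar>x k - ls k\<bar> < disc_radius"
  and lead: "mset (filter (\<lambda>a. lmin / 2 \<le> cmod a) as) = mset (map (\<lambda>k. cor (x k)) [0..<r])"
  and dist: "distinct (map (\<lambda>k. cor (x k)) [0..<r])" using noisy_spectrum by metis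
 let ?lam = "map (\<lambda>l. cor (lam l)) [0..<r]" and ?P = "\<lambda>a. lmin / 2 \<le> cmod a"
 obtain rest where cp: "char_poly (map_mat cor M) = (\<Prod>e\<leftarrow>?lam @ rest. [:- e, 1:])"
  and small: "\<And>z l. \<lbrakk>z \<in> set rest; l < r\<rbrakk> \<Longrightarrow> cmod z \<le> \<bar>lam l\<bar>"
  using assms unfolding leading_eigenpairs_def by blast
 define ys xs where "ys = ?lam" and "xs = map (\<lambda>k. cor (x k)) [0..<r]"
 have len: "length ys = r" "length xs = r" by (simp_all add: ys_def xs_def)
 have "count_list as z = count_list (ys @ rest) z" for z unfolding ys_def by (metis as cp order_prod_linear)
 hence "mset (filter ?P as) = mset (filter ?P ys) + mset (filter ?P rest)" by (intro multiset_eqI) (simp add: count_mset)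
 hence flt: "mset (filter ?P ys) + mset (filter ?P rest) = mset xs" using lead by (simp only: xs_def)
 have size: "length (filter ?P ys) + length (filter ?P rest) = r" using arg_cong[OF flt, of size] len by (simp only: size_union size_mset)
 have all: "?P (cor (lam l))" if l: "l < r" for l
 proof (rule ccontr)
  assume neg: "\<not> ?P (cor (lam l))"
  hence "\<not> ?P z" if "z \<in> set rest" for z using small[OF that l] by auto
  thus False using length_filter_less[of "cor (lam l)" ys ?P] l neg size by (simp add: ys_def)
 qed
 have fys: "filter ?P ys = ys"
 proof (rule filter_True)
  show "\<forall>z\<in>set ys. ?P z" using all by (auto simp only: ys_def set_map set_upt atLeastLessThan_iff)
 qed
 hence "filter ?P rest = []" using size len by simp
 hence "mset ys = mset xs" using flt fys by (metis add.right_neutral mset.simps(1))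
 hence eq: "mset ?lam = mset (map (\<lambda>k. cor (x k)) [0..<r])" by (simp only: ys_def xs_def)
 have "\<exists>k<r. lam l = x k" if l: "l < r" for l
 proof -
  have "cor (lam l) \<in> set ?lam" using l by simp
  hence "cor (lam l) \<in> set (map (\<lambda>k. cor (x k)) [0..<r])" using eq by (metis mset_eq_setD)
  thus ?thesis by auto
 qed
 then obtain \<pi> where \<pi>: "\<And>l. l < r \<Longrightarrow> \<pi> l < r \<and> lam l = x (\<pi> l)" by metis
 have "distinct ?lam" using eq dist mset_eq_imp_distinct_iff by blast
 hence "inj_on \<pi> {..<r}" using \<pi> by (auto simp: distinct_map inj_on_def)
 moreover have "\<pi> ` {..<r} \<subseteq> {..<r}" using \<pi> by auto
 ultimately have "bij_betw \<pi> {..<r} {..<r}" by (simp add: bij_betw_def endo_inj_surj)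
 moreover have "\<bar>lam l - ls (\<pi> l)\<bar> < disc_radius" if "l < r" for l using \<pi>[OF that] x[of "\<pi> l"] by simp
 ultimately show ?thesis by blast
qed

end

section \<open>Reduction to matched eigenvalues\<close>

locale noise_event = gapped_noise_bounds + paired_noise
begin

text \<open>The columns of \<open>Us\<close> are permuted so that the \<open>l\<close>-th eigenvalue of \<open>M\<close> is close to the
 \<open>l\<close>-th eigenvalue of the signal.\<close>

lemma permuted_debiasing:
 assumes lead: "leading_eigenpairs n r M U lam"
 obtains Us' ls' where "debiasing n r Us' H ls' rh e0 lmin lmax U lam \<delta> W1 W2 b" "noise_bounds.Ms r Us' ls' = Ms"
proof -
 obtain \<pi> where \<pi>: "bij_betw \<pi> {..<r} {..<r}" and close: "\<And>l. l < r \<Longrightarrow> \<bar>lam l - ls (\<pi> l)\<bar> < disc_radius"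
  using leading_eigenpairs_match[OF lead] by blast
 have \<pi>r: "\<pi> l < r" if "l < r" for l using \<pi> that by (auto simp: bij_betw_def)
 have \<pi>inj: "\<pi> k = \<pi> l \<longleftrightarrow> k = l" if "k < r" "l < r" for k l using \<pi> that by (auto simp: bij_betw_def inj_on_def)
 define Us' where "Us' = Matrix.mat n r (\<lambda>(i, l). Us $$ (i, \<pi> l))"
 define ls' where "ls' l = ls (\<pi> l)" for l
 have Us'c: "Us' \<in> mats n r" by (simp add: Us'_def)
 note dims = matsD[OF Us(1)] matsD[OF Us'c] matsD[OF H] matsD[OF W1(1)] matsD[OF W2(1)]
 have cols: "col Us' l = col Us (\<pi> l)" if "l < r" for l using that \<pi>r[OF that] dims by (auto simp: Us'_def intro!: eq_vecI)
 have Hj: "H ^\<^sub>m j \<in> mats n n" for j using H by simp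
 have right: "(A * Us') $$ (i, k) = (A * Us) $$ (i, \<pi> k)" if "dim_col A = n" "i < dim_row A" "k < r" for A i k
  using that \<pi>r[OF that(3)] dims by (simp add: cols)
 have col_r: "col (A * Us') k = col (A * Us) (\<pi> k)" if "dim_col A = n" "k < r" for A k
  using that \<pi>r[OF that(2)] dims right[OF that(1) _ that(2)] by (intro eq_vecI) simp_all
 have left: "(tr (A * Us') * B) $$ (m, j) = (tr (A * Us) * B) $$ (\<pi> m, j)"
  if "dim_col A = n" "dim_row B = dim_row A" "m < r" "j < dim_col B" for A B m j using that \<pi>r[OF that(3)] dims col_r[OF that(1,3)] by simp
 \<comment> \<open>In each assumed form \<open>Us\<close> stands at both ends, so a permutation of
   its columns merely renames entries and all bounds carry over.\<close>
 have both: "(tr (A * Us') * B * Us') $$ (m, k) = (tr (A * Us) * B * Us) $$ (\<pi> m, \<pi> k)"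
  if "dim_col A = n" "dim_row B = dim_row A" "dim_col B = n" "m < r" "k < r" for A B m k
 proof -
  have "(tr (A * Us') * B * Us') $$ (m, k) = (tr (A * Us') * (B * Us')) $$ (m, k)" using that dims by (simp add: mat_dim_assoc)
  also have "... = (tr (A * Us) * (B * Us')) $$ (\<pi> m, k)" using that dims by (intro left) simp_all
  also have "... = (tr (A * Us) * B * Us') $$ (\<pi> m, k)" using that dims by (simp add: mat_dim_assoc)
  also have "... = (tr (A * Us) * B * Us) $$ (\<pi> m, \<pi> k)" using that dims \<pi>r by (intro right) simp_all
  finally show ?thesis .
 qed
 have one: "1\<^sub>m n * Us = Us" "1\<^sub>m n * Us' = Us'" using Us(1) Us'c by simp_all
 have orth: "tr Us' * Us' = 1\<^sub>m r"
 proof (rule eq_matI)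
  fix k l assume "k < dim_row (1\<^sub>m r :: real mat)" "l < dim_col (1\<^sub>m r :: real mat)"
  hence kl: "k < r" "l < r" by auto
  have "(tr Us' * Us') $$ (k, l) = (tr Us * Us) $$ (\<pi> k, \<pi> l)" using kl \<pi>r dims cols by simp
  thus "(tr Us' * Us') $$ (k, l) = 1\<^sub>m r $$ (k, l)" unfolding Us(2) using kl \<pi>r \<pi>inj by simp
 qed (simp_all add: dims)
 have nb: "noise_bounds n r Us' H ls' rh e0 lmin lmax"
 proof unfold_locales
  show "lmin \<le> \<bar>ls' k\<bar>" "\<bar>ls' k\<bar> \<le> lmax" if "k < r" for k using that \<pi>r ls_lower ls_upper by (simp_all add: ls'_def)
  show "\<bar>(tr Us' * H ^\<^sub>m Suc s * Us') $$ (m, k)\<bar> \<le> e0 * rh ^ s" if "m < r" "k < r" for s m k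
   using both[of "1\<^sub>m n" "H ^\<^sub>m Suc s" m k] bilinear[of "\<pi> m" "\<pi> k" s] matsD[OF Hj[of "Suc s"]] that \<pi>r
   by (simp only: one) simp
 qed (use r Us'c orth H rh e0 oH e0_small in auto)
 interpret P: noise_bounds n r Us' H ls' rh e0 lmin lmax by (rule nb)
 have Ms_eq: "P.Ms = Ms"
 proof (rule eq_matI)
  fix i j assume "i < dim_row Ms" "j < dim_col Ms"
  hence ij: "i < n" "j < n" using Ms by auto
  have entry: "(V * diag r f * tr V) $$ (i, j) = (\<Sum>k<r. V $$ (i, k) * f k * V $$ (j, k))"
   if V: "V \<in> mats n r" for V f using ij matsD[OF V] unfolding mat_diag_mult_right[OF V]
   by (simp add: scalar_prod_def lessThan_atLeast0)
  have "P.Ms $$ (i, j) = (\<Sum>k<r. Us $$ (i, \<pi> k) * ls (\<pi> k) * Us $$ (j, \<pi> k))"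
   unfolding P.Ms_def entry[OF Us'c] using ij by (intro sum.cong) (auto simp: Us'_def ls'_def)
  also have "... = Ms $$ (i, j)" unfolding Ms_def entry[OF Us(1)] by (rule sum.reindex_bij_betw[OF \<pi>])
  finally show "P.Ms $$ (i, j) = Ms $$ (i, j)" .
 qed (use Ms P.Ms in auto)
 have U: "U \<in> mats n r" and ev: "\<And>l. l < r \<Longrightarrow> eigenvector M (col U l) (lam l) \<and> vec_l2 (col U l) = 1"
  using lead unfolding leading_eigenpairs_def by blast+
 have "debiasing n r Us' H ls' rh e0 lmin lmax U lam \<delta> W1 W2 b"
 proof unfold_locales
  show "U \<in> mats n r" by (rule U)
  fix l assume l: "l < r"
  show "(P.Ms + H) *\<^sub>v col U l = lam l \<cdot>\<^sub>v col U l" "vec_l2 (col U l) = 1"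
   using ev[OF l] by (simp_all add: Ms_eq M_def eigenvector_def)
  have c: "\<bar>lam l - ls (\<pi> l)\<bar> \<le> lmin / 1000" using close[OF l] disc_radius(2) by linarith
  show "lmin / 2 \<le> \<bar>lam l\<bar>" using c ls_lower[OF \<pi>r[OF l]] by linarith
  show "\<bar>lam l\<bar> \<le> 2 * lmax" using c ls_upper[OF \<pi>r[OF l]] ls_lower[OF \<pi>r[OF l]] by linarith
  show "\<delta> / 2 \<le> \<bar>lam l - ls' k\<bar>" if k: "k < r" "k \<noteq> l" for k using gap[OF \<pi>r[OF k(1)] \<pi>r[OF l]] \<pi>inj[OF k(1) l] k(2) close[OF l] disc_radius_gap unfolding ls'_def by linarith
 next
  show "0 < \<delta>" "1000 * P.ka * (real r * sqrt (real r)) * e0 \<le> \<delta>" by (rule \<delta>)+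
  show "W1 \<in> mats n n" "tr W1 = W1" "W2 \<in> mats n n" "tr W2 = W2" using W1 W2 by auto
  show "\<bar>(H ^\<^sub>m Suc s * Us') $$ (i, k)\<bar> \<le> e0 * rh ^ s" if "i < n" "k < r" for s i k
   using right[of "H ^\<^sub>m Suc s" i k] matsD[OF Hj[of "Suc s"]] entrywise[OF that(1) \<pi>r[OF that(2)], of s] that by simp
  show "\<bar>(tr (H ^\<^sub>m s * Us') * W1 * Us') $$ (m, k)\<bar> \<le> e0 * rh ^ s" if "m < r" "k < r" for s m k
   using both[of "H ^\<^sub>m s" W1 m k] linear1[of "\<pi> m" "\<pi> k" s] that \<pi>r dims by simp
  show "\<bar>(tr (H ^\<^sub>m s * Us') * W2 * Us') $$ (m, k)\<bar> \<le> e0 * rh ^ s" if "m < r" "k < r" for s m k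
   using both[of "H ^\<^sub>m s" W2 m k] linear2[of "\<pi> m" "\<pi> k" s] that \<pi>r dims by simp
  show "\<bar>(tr (H ^\<^sub>m s * Us') * W1 * W2 * (H ^\<^sub>m t * Us')) $$ (m, k)\<bar> \<le> e0 * rh ^ (s + t + 1)" if "m < r" "k < r" for s t m k
  proof -
   have a: "tr (H ^\<^sub>m s * V) * W1 * W2 * (H ^\<^sub>m t * V) = tr (H ^\<^sub>m s * V) * (W1 * W2 * H ^\<^sub>m t) * V"
    if "V \<in> mats n r" for V using matsD[OF that] dims by (simp add: mat_dim_assoc)
   show ?thesis
    using both[of "H ^\<^sub>m s" "W1 * W2 * H ^\<^sub>m t" m k] matsD[OF Hj[of t]] quadratic[of "\<pi> m" "\<pi> k" s t] that \<pi>r dims unfolding a[OF Us'c] a[OF Us(1)] by simp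
  qed
  show "vec_l2 (Matrix.row Us' i) \<le> b" if i: "i < n" for i
  proof -
   have "(vec_l2 (Matrix.row Us' i))^2 = (\<Sum>k<r. (Us $$ (i, \<pi> k))^2)"
    unfolding vec_l2_sq using i by (simp add: scalar_prod_def lessThan_atLeast0 Us'_def power2_eq_square)
   also have "... = (\<Sum>k<r. (Us $$ (i, k))^2)" by (rule sum.reindex_bij_betw[OF \<pi>])
   also have "... = (vec_l2 (Matrix.row Us i))^2"
    unfolding vec_l2_sq using i dims by (simp add: scalar_prod_def lessThan_atLeast0 power2_eq_square)
   finally show ?thesis using incoherent[OF i] by simp
  qed
 qed
 thus ?thesis using that Ms_eq by blast
qed

theorem corrected_estimator_error:
 assumes lead: "leading_eigenpairs n r M U lam" shows "\<exists>\<Psi>. is_correction r U lam (Ms + W1) (Ms + W2) \<Psi>"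
  and "\<lbrakk>is_correction r U lam (Ms + W1) (Ms + W2) \<Psi>; i < n; j < n\<rbrakk> \<Longrightarrow>
   \<bar>(U * \<Psi> * diag r lam * tr \<Psi> * tr U - Ms) $$ (i, j)\<bar>
   \<le> 400000 * (b^2 * (ka * real r * e0) + b * (ka * sqrt (real r) * e0) + ka * real r * e0^2 / lmin)"
proof -
 obtain Us' ls' where d: "debiasing n r Us' H ls' rh e0 lmin lmax U lam \<delta> W1 W2 b" and Ms': "noise_bounds.Ms r Us' ls' = Ms"
  using permuted_debiasing[OF lead] by blast
 interpret D: debiasing n r Us' H ls' rh e0 lmin lmax U lam \<delta> W1 W2 b by (rule d)
 show "\<exists>\<Psi>. is_correction r U lam (Ms + W1) (Ms + W2) \<Psi>" using D.correction_exists by (simp only: Ms')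
 show "\<lbrakk>is_correction r U lam (Ms + W1) (Ms + W2) \<Psi>; i < n; j < n\<rbrakk> \<Longrightarrow>
   \<bar>(U * \<Psi> * diag r lam * tr \<Psi> * tr U - Ms) $$ (i, j)\<bar>
   \<le> 400000 * (b^2 * (ka * real r * e0) + b * (ka * sqrt (real r) * e0) + ka * real r * e0^2 / lmin)"
  using D.correction_error[of \<Psi> i j] by (simp only: Ms')
qed

end

section \<open>Products of symmetric bounded laws\<close>

text \<open>For \<open>x = - u < 0\<close> the bound follows from
  \<open>(1 - u + u^2) (1 + u) = 1 + u^3\<close> and \<open>1 + u \<le> exp u\<close>.\<close>

lemma exp_le_quadratic:
 assumes "\<bar>x\<bar> \<le> (1::real)" shows "exp x \<le> 1 + x + x^2"
proof (cases "0 \<le> x")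
 case True thus ?thesis using exp_bound[of x] assms by simp
next
 case False
 define u where "u = - x"
 have u: "0 < u" using False by (simp add: u_def)
 have "1 \<le> (1 - u + u^2) * (1 + u)" using u by (simp add: power2_eq_square algebra_simps)
 also have "... \<le> (1 - u + u^2) * exp u"
 proof (rule mult_left_mono)
  show "1 + u \<le> exp u" by simp
  have "0 \<le> (1 - u)^2 + u" using u by simp
  thus "0 \<le> 1 - u + u^2" by (simp add: power2_eq_square algebra_simps)
 qed
 finally show ?thesis by (simp add: u_def exp_minus field_simps)
qed

lemma ennreal_exp_mult: "ennreal (exp a) * ennreal (exp b) = ennreal (exp (a + b))" by (simp add: exp_add ennreal_mult)

text \<open>A pointwise substitute for measurability with respect to the coordinates in
  \<open>K\<close>; it is what allows a factor to be pulled out of an inner integral.\<close>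

definition depends_on :: "'i set \<Rightarrow> (('i \<Rightarrow> real) \<Rightarrow> 'b) \<Rightarrow> bool" where
 "depends_on K f \<longleftrightarrow> (\<forall>om om'. (\<forall>i\<in>K. om i = om' i) \<longrightarrow> f om = f om')"

lemma depends_onD: "\<lbrakk>depends_on K f; \<And>i. i \<in> K \<Longrightarrow> om i = om' i\<rbrakk> \<Longrightarrow> f om = f om'"
 by (auto simp: depends_on_def)

lemma depends_on_mono: "\<lbrakk>depends_on K f; K \<subseteq> K'\<rbrakk> \<Longrightarrow> depends_on K' f" unfolding depends_on_def by auto

text \<open>The conditions on the laws are imposed at every index, also outside \<open>I\<close>,
  where a point mass at 0 can be taken.\<close>

locale symmetric_product =
 fixes I :: "'i set" and mu :: "'i \<Rightarrow> real measure" and sg L :: real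
 assumes finite_I: "finite I" and prob_mu: "\<And>i. prob_space (mu i)" and sets_mu [measurable_cong]: "\<And>i. sets (mu i) = sets borel"
  and symmetric_mu: "\<And>i. distr (mu i) borel uminus = mu i" and bounded_mu: "\<And>i. AE x in mu i. \<bar>x\<bar> \<le> L"
  and second_mu: "\<And>i. (\<integral>x. x^2 \<partial>mu i) \<le> sg^2" and sg: "0 < sg" "sg \<le> L"
begin

sublocale product_prob_space mu I using prob_mu by (intro product_prob_spaceI)

lemma L: "0 < L" using sg by linarith

abbreviation "N J \<equiv> PiM J mu"
abbreviation BM :: "(('i \<Rightarrow> real) \<Rightarrow> 'b :: topological_space) set" where "BM \<equiv> borel_measurable (N I)"

lemma prob_N: "prob_space (N J)" by (rule prob_space_PiM) (rule prob_mu)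

lemma measurable_coord [measurable]: "i \<in> J \<Longrightarrow> (\<lambda>om. om i) \<in> borel_measurable (N J)"
 using measurable_component_singleton[of i J mu] measurable_cong_sets[OF refl sets_mu] by blast

lemma space_N: "space (N J) = PiE J (\<lambda>_. UNIV)" using sets_eq_imp_space_eq[OF sets_mu] by (simp add: space_PiM)

lemma AE_bounded: "J \<subseteq> I \<Longrightarrow> AE om in N J. \<forall>i\<in>J. \<bar>om i\<bar> \<le> L"
proof -
 assume J: "J \<subseteq> I"
 hence fin: "finite J" using finite_I finite_subset by blast
 have "AE om in N J. \<bar>om i\<bar> \<le> L" if i: "i \<in> J" for i
  using AE_PiM_component[of J mu i "\<lambda>x. \<bar>x\<bar> \<le> L"] prob_mu bounded_mu i by simp
 thus ?thesis using fin by (simp add: AE_finite_all)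
qed

lemma integrable_mu: "f \<in> borel_measurable borel \<Longrightarrow> (\<And>x. \<bar>x\<bar> \<le> L \<Longrightarrow> \<bar>f x\<bar> \<le> C) \<Longrightarrow> integrable (mu i) (f :: real \<Rightarrow> real)"
proof -
 assume f: "f \<in> borel_measurable borel" and C: "\<And>x. \<bar>x\<bar> \<le> L \<Longrightarrow> \<bar>f x\<bar> \<le> C"
 have "f \<in> borel_measurable (mu i)" using f measurable_cong_sets[OF sets_mu refl] by blast
 moreover have "AE x in mu i. norm (f x) \<le> C" using bounded_mu[of i] by eventually_elim (simp add: C)
 ultimately show ?thesis using finite_measure.integrable_const_bound[OF prob_space.finite_measure[OF prob_mu]] by blast
qed

lemma integral_mu_uminus: "f \<in> borel_measurable borel \<Longrightarrow> (\<integral>x. f (- x) \<partial>mu i) = (\<integral>x. f x \<partial>mu i)" for f :: "real \<Rightarrow> real"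
proof -
 assume f: "f \<in> borel_measurable borel"
 have "uminus \<in> borel_measurable (mu i)" by (simp add: measurable_cong_sets[OF sets_mu refl])
 note m = this
 have "(\<integral>x. f x \<partial>mu i) = (\<integral>x. f x \<partial>distr (mu i) borel uminus)" by (simp add: symmetric_mu)
 also have "... = (\<integral>x. f (- x) \<partial>mu i)" using f m by (intro integral_distr)
 finally show ?thesis by simp
qed

lemma mean_mu: "(\<integral>x. x \<partial>mu i) = 0" using integral_mu_uminus[of "\<lambda>x. x" i] by simp

lemma nn_integral_mu_le:
 assumes f: "f \<in> borel_measurable borel" and g: "\<And>x. \<bar>x\<bar> \<le> L \<Longrightarrow> f x \<le> a + b * x + c * x^2" and f0: "\<And>x. 0 \<le> f x"
  and c: "0 \<le> c" shows "(\<integral>\<^sup>+x. ennreal (f x) \<partial>mu i) \<le> ennreal (a + c * sg^2)"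
proof -
 have ix: "integrable (mu i) (\<lambda>x. x)" by (rule integrable_mu[of _ L]) auto
 have ix2: "integrable (mu i) (\<lambda>x. x^2)"
  by (rule integrable_mu[of _ "L^2"]) (use L in \<open>auto intro: abs_le_square_iff[THEN iffD1]\<close>)
 have iq: "integrable (mu i) (\<lambda>x. a + b * x + c * x^2)" using ix ix2 by auto
 have "(\<integral>\<^sup>+x. ennreal (f x) \<partial>mu i) \<le> (\<integral>\<^sup>+x. ennreal (a + b * x + c * x^2) \<partial>mu i)"
  using bounded_mu[of i] by (intro nn_integral_mono_AE) (auto elim!: eventually_mono intro!: ennreal_leI g)
 also have "... = ennreal (\<integral>x. a + b * x + c * x^2 \<partial>mu i)"
  using bounded_mu[of i] by (intro nn_integral_eq_integral iq) (auto elim!: eventually_mono intro: order_trans[OF f0 g])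
 also have "(\<integral>x. a + b * x + c * x^2 \<partial>mu i) = a + c * (\<integral>x. x^2 \<partial>mu i)"
  using ix ix2 mean_mu[of i] prob_space.prob_space[OF prob_mu, of i] by simp
 also have "ennreal ... \<le> ennreal (a + c * sg^2)" using second_mu[of i] c by (intro ennreal_leI add_left_mono mult_left_mono)
 finally show ?thesis .
qed

lemma mgf_mu:
 assumes "\<bar>t\<bar> * L \<le> 1" shows "(\<integral>\<^sup>+x. ennreal (exp (t * x)) \<partial>mu i) \<le> ennreal (exp (t^2 * sg^2))"
proof -
 have "exp (t * x) \<le> 1 + t * x + t^2 * x^2" if x: "\<bar>x\<bar> \<le> L" for x
 proof -
  have "\<bar>t * x\<bar> \<le> \<bar>t\<bar> * L" unfolding abs_mult using x by (intro mult_left_mono) auto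
  thus ?thesis using exp_le_quadratic[of "t * x"] assms by (simp add: power_mult_distrib)
 qed
 hence "(\<integral>\<^sup>+x. ennreal (exp (t * x)) \<partial>mu i) \<le> ennreal (1 + t^2 * sg^2)"
  by (intro nn_integral_mu_le[where b = t]) auto
 also have "... \<le> ennreal (exp (t^2 * sg^2))" by (intro ennreal_leI exp_ge_add_one_self)
 finally show ?thesis .
qed

lemma mgf_square_mu:
 assumes "0 \<le> t" "t * L^2 \<le> 1" shows "(\<integral>\<^sup>+x. ennreal (exp (t * x^2)) \<partial>mu i) \<le> ennreal (exp (2 * t * sg^2))"
proof -
 have "exp (t * x^2) \<le> 1 + 0 * x + (2 * t) * x^2" if x: "\<bar>x\<bar> \<le> L" for x
 proof -
  have "x^2 \<le> L^2" using x by (intro abs_le_square_iff[THEN iffD1]) auto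
  hence le: "t * x^2 \<le> 1" using assms by (meson mult_left_mono order_trans)
  have nn: "0 \<le> t * x^2" using assms by simp
  show ?thesis using mult_left_mono[OF le nn] exp_le_quadratic[of "t * x^2"] le nn by (simp add: power2_eq_square)
 qed
 hence "(\<integral>\<^sup>+x. ennreal (exp (t * x^2)) \<partial>mu i) \<le> ennreal (1 + 2 * t * sg^2)"
  using assms by (intro nn_integral_mu_le[where b = 0]) auto
 also have "... \<le> ennreal (exp (2 * t * sg^2))" by simp
 finally show ?thesis .
qed

lemma product_mgf:
 assumes J: "finite J" and meas: "\<And>i. i \<in> J \<Longrightarrow> f i \<in> borel_measurable borel"
  and le: "\<And>i. i \<in> J \<Longrightarrow> (\<integral>\<^sup>+x. ennreal (exp (f i x)) \<partial>mu i) \<le> ennreal (exp (v i))"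
 shows "(\<integral>\<^sup>+y. ennreal (exp (\<Sum>i\<in>J. f i (y i))) \<partial>N J) \<le> ennreal (exp (\<Sum>i\<in>J. v i))"
proof -
 have "(\<integral>\<^sup>+y. ennreal (exp (\<Sum>i\<in>J. f i (y i))) \<partial>N J) = (\<integral>\<^sup>+y. (\<Prod>i\<in>J. ennreal (exp (f i (y i)))) \<partial>N J)"
  using J by (simp add: exp_sum prod_ennreal)
 also have "... = (\<Prod>i\<in>J. \<integral>\<^sup>+x. ennreal (exp (f i x)) \<partial>mu i)"
  using meas J by (intro product_nn_integral_prod) (auto simp: measurable_cong_sets[OF sets_mu refl])
 also have "... \<le> (\<Prod>i\<in>J. ennreal (exp (v i)))" using J le by (induction J rule: finite_induct) (auto intro!: mult_mono)
 finally show ?thesis using J by (simp add: exp_sum prod_ennreal)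
qed

lemma linear_mgf:
 assumes J: "finite J" and small: "\<And>i. i \<in> J \<Longrightarrow> \<bar>al i\<bar> * L \<le> 1"
 shows "(\<integral>\<^sup>+y. ennreal (exp (\<Sum>i\<in>J. al i * y i)) \<partial>N J) \<le> ennreal (exp (sg^2 * (\<Sum>i\<in>J. (al i)^2)))"
 unfolding sum_distrib_left mult.commute[of "sg^2"] using small by (intro product_mgf J mgf_mu) auto

text \<open>Fubini in the role of the tower property: \<open>f\<close> is fixed once the coordinates
  outside \<open>J\<close> are, so only the integral of \<open>g\<close> over the fresh coordinates
  in \<open>J\<close> has to be bounded.\<close>

lemma conditional_step:
 assumes J: "J \<subseteq> I" and f [measurable]: "f \<in> BM" and g [measurable]: "g \<in> BM" and dep: "depends_on (I - J) f"
  and le: "\<And>x. x \<in> space (N (I - J)) \<Longrightarrow> (\<integral>\<^sup>+y. g (merge (I - J) J (x, y)) \<partial>N J) \<le> C"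
 shows "(\<integral>\<^sup>+om. f om * g om \<partial>N I) \<le> C * (\<integral>\<^sup>+om. f om \<partial>N I)"
proof -
 have fin: "finite J" "finite (I - J)" using finite_I J finite_subset by blast+
 have Un: "(I - J) \<union> J = I" using J by auto
 have fold: "(\<integral>\<^sup>+om. h om \<partial>N I) = (\<integral>\<^sup>+x. \<integral>\<^sup>+y. h (merge (I - J) J (x, y)) \<partial>N J \<partial>N (I - J))"
  if "h \<in> BM" for h :: "('i \<Rightarrow> real) \<Rightarrow> ennreal"
  using product_nn_integral_fold[of "I - J" J h] fin that unfolding Un by auto
 interpret J: prob_space "N J" by (rule prob_N)
 define F where "F x = f (merge (I - J) J (x, \<lambda>_. 0))" for x
 have F: "f (merge (I - J) J (x, y)) = F x" for x y unfolding F_def by (rule depends_onD[OF dep]) (simp add: merge_def)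
 have "(\<integral>\<^sup>+om. f om * g om \<partial>N I) = (\<integral>\<^sup>+x. \<integral>\<^sup>+y. F x * g (merge (I - J) J (x, y)) \<partial>N J \<partial>N (I - J))"
  by (subst fold) (simp_all add: F)
 also have "... = (\<integral>\<^sup>+x. F x * (\<integral>\<^sup>+y. g (merge (I - J) J (x, y)) \<partial>N J) \<partial>N (I - J))"
 proof (intro nn_integral_cong nn_integral_cmult)
  fix x assume x: "x \<in> space (N (I - J))"
  have "(\<lambda>y. merge (I - J) J (x, y)) \<in> N J \<rightarrow>\<^sub>M N ((I - J) \<union> J)"
   by (rule measurable_compose[OF measurable_Pair1'[OF x] measurable_merge])
  thus "(\<lambda>y. g (merge (I - J) J (x, y))) \<in> borel_measurable (N J)" unfolding Un using measurable_compose[OF _ g] by blast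
 qed
 also have "... \<le> (\<integral>\<^sup>+x. F x * C \<partial>N (I - J))" using le by (intro nn_integral_mono mult_left_mono) auto
 also have "... = (\<integral>\<^sup>+x. \<integral>\<^sup>+y. C * f (merge (I - J) J (x, y)) \<partial>N J \<partial>N (I - J))"
  by (simp add: F J.emeasure_space_1 mult.commute)
 also have "... = (\<integral>\<^sup>+om. C * f om \<partial>N I)" by (subst fold) simp_all
 also have "... = C * (\<integral>\<^sup>+om. f om \<partial>N I)" by (rule nn_integral_cmult) simp
 finally show ?thesis .
qed

lemma conditional_prob:
 assumes J: "J \<subseteq> I" and A: "A \<in> sets (N I)"
  and le: "\<And>x. x \<in> space (N (I - J)) \<Longrightarrow> (\<integral>\<^sup>+y. indicator A (merge (I - J) J (x, y)) \<partial>N J) \<le> ennreal c" and c: "0 \<le> c"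
 shows "measure (N I) A \<le> c"
proof -
 have "(\<integral>\<^sup>+om. 1 * indicator A om \<partial>N I) \<le> ennreal c * (\<integral>\<^sup>+om. 1 \<partial>N I)"
  using A le by (intro conditional_step[OF J]) (auto simp: depends_on_def)
 hence "emeasure (N I) A \<le> ennreal c" using A by (simp add: emeasure_space_1)
 thus ?thesis using c by (simp add: emeasure_eq_measure)
qed

text \<open>The threshold that a sum of terms \<open>al i * X i\<close> exceeds with probability at
  most \<open>exp (- l)\<close>, if the squares of the coefficients sum to at most
  \<open>A^2\<close> and each is at most \<open>B\<close> in absolute value: a Gaussian part plus a
  part due to the range \<open>L\<close>.\<close>

definition bernstein :: "real \<Rightarrow> real \<Rightarrow> real \<Rightarrow> real" where
 "bernstein l A B = 2 * (sqrt l * sg * A + l * L * B)"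

text \<open>The coefficients may be random as long as they are determined by the coordinates outside
  \<open>J\<close>. So is \<open>Q\<close>, which carries the bounds on them: these bounds have to
  hold only on the event considered.\<close>

lemma linear_tail:
 assumes J: "J \<subseteq> I" and l: "0 < l" and A: "0 < A" and B: "0 \<le> B"
  and meas [measurable]: "\<And>i. i \<in> J \<Longrightarrow> al i \<in> BM" "Measurable.pred (N I) Q"
  and dep: "\<And>i. i \<in> J \<Longrightarrow> depends_on (I - J) (al i)" "depends_on (I - J) Q"
  and sq: "\<And>om. Q om \<Longrightarrow> (\<Sum>i\<in>J. (al i om)^2) \<le> A^2" and mx: "\<And>om i. \<lbrakk>Q om; i \<in> J\<rbrakk> \<Longrightarrow> \<bar>al i om\<bar> \<le> B"
 shows "measure (N I) {om \<in> space (N I). Q om \<and> bernstein l A B < (\<Sum>i\<in>J. al i om * om i)} \<le> exp (- l)"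
proof (rule conditional_prob[OF J])
 have fin: "finite J" using finite_I J finite_subset by blast
 have mc [measurable]: "i \<in> J \<Longrightarrow> (\<lambda>om. om i) \<in> BM" for i using J by auto
 show "{om \<in> space (N I). Q om \<and> bernstein l A B < (\<Sum>i\<in>J. al i om * om i)} \<in> sets (N I)" by measurable
 fix x assume x: "x \<in> space (N (I - J))"
 define w where "w = merge (I - J) J (x, \<lambda>_. 0)"
 let ?m = "\<lambda>y. merge (I - J) J (x, y)"
 have al: "al i (?m y) = al i w" if "i \<in> J" for i y unfolding w_def by (rule depends_onD[OF dep(1)[OF that]]) (simp add: merge_def)
 have Q: "Q (?m y) = Q w" for y unfolding w_def by (rule depends_onD[OF dep(2)]) (simp add: merge_def)
 define d where "d = sqrt l * sg * A + l * L * B"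
 have d: "0 < d" unfolding d_def using l sg A B by (intro add_pos_nonneg mult_pos_pos mult_nonneg_nonneg) auto
 \<comment> \<open>Twice \<open>d\<close> is the threshold, so \<open>th\<close> times the threshold
   is \<open>2 * l\<close>; the variance term costs at most \<open>l\<close>, and
   \<open>th * B * L \<le> 1\<close> keeps each summand in the range of the quadratic bound.\<close>
 define th where "th = l / d"
 have th: "0 < th" using d l by (simp add: th_def)
 show "(\<integral>\<^sup>+y. indicator {om \<in> space (N I). Q om \<and> bernstein l A B < (\<Sum>i\<in>J. al i om * om i)} (?m y) \<partial>N J) \<le> ennreal (exp (- l))"
 proof (cases "Q w")
  case False
  thus ?thesis by (simp add: Q)
 next
  case True
  have "(\<integral>\<^sup>+y. indicator {om \<in> space (N I). Q om \<and> bernstein l A B < (\<Sum>i\<in>J. al i om * om i)} (?m y) \<partial>N J)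
   \<le> (\<integral>\<^sup>+y. ennreal (exp (- (2 * l))) * ennreal (exp (\<Sum>i\<in>J. th * al i w * y i)) \<partial>N J)"
  proof (rule nn_integral_mono)
   fix y
   show "indicator {om \<in> space (N I). Q om \<and> bernstein l A B < (\<Sum>i\<in>J. al i om * om i)} (?m y)
    \<le> ennreal (exp (- (2 * l))) * ennreal (exp (\<Sum>i\<in>J. th * al i w * y i))"
   proof (cases "bernstein l A B < (\<Sum>i\<in>J. al i (?m y) * ?m y i)")
    case True
    also have "(\<Sum>i\<in>J. al i (?m y) * ?m y i) = (\<Sum>i\<in>J. al i w * y i)"
     by (intro sum.cong refl) (simp only: al, simp add: merge_def)
    finally have "th * bernstein l A B \<le> th * (\<Sum>i\<in>J. al i w * y i)" using th by simp
    moreover have "th * bernstein l A B = 2 * l" using d by (simp add: th_def bernstein_def flip: d_def)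
    ultimately have "1 \<le> exp (- (2 * l) + (\<Sum>i\<in>J. th * al i w * y i))" by (simp add: sum_distrib_left mult.assoc)
    hence "1 \<le> ennreal (exp (- (2 * l))) * ennreal (exp (\<Sum>i\<in>J. th * al i w * y i))" by (simp only: ennreal_exp_mult ennreal_ge_1)
    thus ?thesis by (simp add: indicator_def)
   qed simp
  qed
  also have "... = ennreal (exp (- (2 * l))) * (\<integral>\<^sup>+y. ennreal (exp (\<Sum>i\<in>J. th * al i w * y i)) \<partial>N J)"
   by (intro nn_integral_cmult) measurable
  also have "... \<le> ennreal (exp (- (2 * l))) * ennreal (exp (sg^2 * (\<Sum>i\<in>J. (th * al i w)^2)))"
  proof (intro mult_left_mono linear_mgf fin)
   fix i assume i: "i \<in> J"
   have "\<bar>th * al i w\<bar> * L \<le> th * B * L" unfolding abs_mult using mx[OF True i] th L by simp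
   also have "... \<le> 1" using d l sg A by (simp add: d_def th_def)
   finally show "\<bar>th * al i w\<bar> * L \<le> 1" .
  qed auto
  also have "... = ennreal (exp (- (2 * l) + sg^2 * (\<Sum>i\<in>J. (th * al i w)^2)))" by (rule ennreal_exp_mult)
  also have "... \<le> ennreal (exp (- l))"
  proof -
   have "sg^2 * (\<Sum>i\<in>J. (th * al i w)^2) = sg^2 * th^2 * (\<Sum>i\<in>J. (al i w)^2)"
    by (simp add: power_mult_distrib sum_distrib_left mult.assoc)
   also have "... \<le> sg^2 * th^2 * A^2" using sq[OF True] by (intro mult_left_mono) auto
   also have "... = l * (sqrt l * sg * A / d)^2" using l by (simp add: th_def power2_eq_square)
   also have "... \<le> l * 1\<^sup>2" using l d sg A B by (intro mult_left_mono power_mono) (auto simp: d_def)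
   finally show ?thesis by simp
  qed
  finally show ?thesis .
 qed
qed simp

lemma linear_tail_abs:
 assumes J: "J \<subseteq> I" and l: "0 < l" and A: "0 < A" and B: "0 \<le> B"
  and meas [measurable]: "\<And>i. i \<in> J \<Longrightarrow> al i \<in> BM" "Measurable.pred (N I) Q"
  and dep: "\<And>i. i \<in> J \<Longrightarrow> depends_on (I - J) (al i)" "depends_on (I - J) Q"
  and sq: "\<And>om. Q om \<Longrightarrow> (\<Sum>i\<in>J. (al i om)^2) \<le> A^2" and mx: "\<And>om i. \<lbrakk>Q om; i \<in> J\<rbrakk> \<Longrightarrow> \<bar>al i om\<bar> \<le> B"
 shows "measure (N I) {om \<in> space (N I). Q om \<and> bernstein l A B < \<bar>\<Sum>i\<in>J. al i om * om i\<bar>} \<le> 2 * exp (- l)"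
proof -
 have mc [measurable]: "i \<in> J \<Longrightarrow> (\<lambda>om. om i) \<in> BM" for i using J by auto
 let ?S = "\<lambda>s. {om \<in> space (N I). Q om \<and> bernstein l A B < (\<Sum>i\<in>J. (s * al i om) * om i)}"
 have tail: "prob (?S s) \<le> exp (- l)" if s: "s = 1 \<or> s = - 1" for s
 proof (rule linear_tail[OF J l A B])
  show "depends_on (I - J) (\<lambda>om. s * al i om)" if "i \<in> J" for i using dep(1)[OF that] by (fastforce simp: depends_on_def)
  show "(\<Sum>i\<in>J. (s * al i om)^2) \<le> A^2" if "Q om" for om using sq[OF that] s by auto
  show "\<bar>s * al i om\<bar> \<le> B" if "Q om" "i \<in> J" for om i using mx[OF that] s by auto
 qed (use dep(2) in auto)
 have "{om \<in> space (N I). Q om \<and> bernstein l A B < \<bar>\<Sum>i\<in>J. al i om * om i\<bar>} \<subseteq> ?S 1 \<union> ?S (- 1)"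
  by (auto simp: sum_negf abs_if split: if_splits)
 hence "prob {om \<in> space (N I). Q om \<and> bernstein l A B < \<bar>\<Sum>i\<in>J. al i om * om i\<bar>} \<le> prob (?S 1 \<union> ?S (- 1))"
  by (intro finite_measure_mono) auto
 also have "... \<le> prob (?S 1) + prob (?S (- 1))" by (intro measure_Un_le) auto
 finally show ?thesis using tail[of 1] tail[of "- 1"] by simp
qed

text \<open>Real and imaginary parts are bounded separately, and the doubled threshold covers their
  sum.\<close>

lemma linear_tail_complex:
 fixes al :: "'i \<Rightarrow> ('i \<Rightarrow> real) \<Rightarrow> complex"
 assumes J: "J \<subseteq> I" and l: "0 < l" and A: "0 < A" and B: "0 \<le> B"
  and meas [measurable]: "\<And>i. i \<in> J \<Longrightarrow> al i \<in> BM" "Measurable.pred (N I) Q"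
  and dep: "\<And>i. i \<in> J \<Longrightarrow> depends_on (I - J) (al i)" "depends_on (I - J) Q"
  and sq: "\<And>om. Q om \<Longrightarrow> (\<Sum>i\<in>J. (cmod (al i om))^2) \<le> A^2" and mx: "\<And>om i. \<lbrakk>Q om; i \<in> J\<rbrakk> \<Longrightarrow> cmod (al i om) \<le> B"
 shows "measure (N I) {om \<in> space (N I). Q om \<and> 2 * bernstein l A B < cmod (\<Sum>i\<in>J. al i om * cor (om i))} \<le> 4 * exp (- l)"
proof -
 have mc [measurable]: "i \<in> J \<Longrightarrow> (\<lambda>om. om i) \<in> BM" for i using J by auto
 let ?S = "\<lambda>F. {om \<in> space (N I). Q om \<and> bernstein l A B < \<bar>\<Sum>i\<in>J. F (al i om) * om i\<bar>}"
 have le: "(\<Sum>i\<in>J. (F (al i om))^2) \<le> A^2" if "Q om" "\<And>z. \<bar>F z\<bar> \<le> cmod z" for F :: "complex \<Rightarrow> real" and om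
 proof -
  have "(F (al i om))^2 \<le> (cmod (al i om))^2" for i using that(2)[of "al i om"] by (intro abs_le_square_iff[THEN iffD1]) simp
  thus ?thesis using sq[OF that(1)] by (meson order_trans sum_mono)
 qed
 have Re: "prob (?S Re) \<le> 2 * exp (- l)"
 proof (rule linear_tail_abs[OF J l A B])
  show "depends_on (I - J) (\<lambda>om. Re (al i om))" if "i \<in> J" for i using dep(1)[OF that] unfolding depends_on_def by metis
  show "(\<Sum>i\<in>J. (Re (al i om))^2) \<le> A^2" if "Q om" for om using le[OF that] abs_Re_le_cmod by blast
  show "\<bar>Re (al i om)\<bar> \<le> B" if "Q om" "i \<in> J" for om i using mx[OF that] abs_Re_le_cmod[of "al i om"] by linarith
 qed (use dep(2) in measurable)
 have Im: "prob (?S Im) \<le> 2 * exp (- l)"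
 proof (rule linear_tail_abs[OF J l A B])
  show "depends_on (I - J) (\<lambda>om. Im (al i om))" if "i \<in> J" for i using dep(1)[OF that] unfolding depends_on_def by metis
  show "(\<Sum>i\<in>J. (Im (al i om))^2) \<le> A^2" if "Q om" for om using le[OF that] abs_Im_le_cmod by blast
  show "\<bar>Im (al i om)\<bar> \<le> B" if "Q om" "i \<in> J" for om i using mx[OF that] abs_Im_le_cmod[of "al i om"] by linarith
 qed (use dep(2) in measurable)
 have "{om \<in> space (N I). Q om \<and> 2 * bernstein l A B < cmod (\<Sum>i\<in>J. al i om * cor (om i))} \<subseteq> ?S Re \<union> ?S Im"
 proof
  fix om assume om: "om \<in> {om \<in> space (N I). Q om \<and> 2 * bernstein l A B < cmod (\<Sum>i\<in>J. al i om * cor (om i))}"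
  let ?z = "\<Sum>i\<in>J. al i om * cor (om i)"
  show "om \<in> ?S Re \<union> ?S Im" using om cmod_le[of ?z] by auto
 qed
 hence "prob {om \<in> space (N I). Q om \<and> 2 * bernstein l A B < cmod (\<Sum>i\<in>J. al i om * cor (om i))} \<le> prob (?S Re \<union> ?S Im)"
  by (intro finite_measure_mono) auto
 also have "... \<le> prob (?S Re) + prob (?S Im)" by (intro measure_Un_le) auto
 finally show ?thesis using Re Im by linarith
qed

text \<open>The restriction to \<open>J\<close> makes the result a point of the product space
  again.\<close>

definition flip :: "('i \<Rightarrow> real) \<Rightarrow> 'i set \<Rightarrow> ('i \<Rightarrow> real) \<Rightarrow> 'i \<Rightarrow> real" where
 "flip s J om = (\<lambda>i\<in>J. s i * om i)"

lemma flip_measurable [measurable]: "flip s J \<in> N J \<rightarrow>\<^sub>M N J" unfolding flip_def by simp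

lemma distr_flip:
 assumes J: "finite J" and s: "\<And>i. s i \<in> {1, - 1}" shows "distr (N J) (N J) (flip s J) = N J"
proof (rule PiM_eqI[OF J])
 fix A assume A: "\<And>i. i \<in> J \<Longrightarrow> A i \<in> sets (mu i)"
 have A': "(\<lambda>x. s i * x) -` A i \<in> sets (mu i)" if "i \<in> J" for i
  using measurable_sets[of "\<lambda>x. s i * x" borel borel "A i"] A[OF that] by (simp add: sets_mu)
 have em: "emeasure (mu i) ((\<lambda>x. s i * x) -` A i) = emeasure (mu i) (A i)" if i: "i \<in> J" for i
 proof (cases "s i = 1")
  case False
  hence si: "s i = - 1" using s[of i] by auto
  have "emeasure (mu i) (A i) = emeasure (distr (mu i) borel uminus) (A i)" by (simp add: symmetric_mu)
  also have "... = emeasure (mu i) (uminus -` A i \<inter> space (mu i))"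
   using A[OF i] by (intro emeasure_distr) (auto simp: sets_mu measurable_cong_sets[OF sets_mu refl])
  finally show ?thesis using sets_eq_imp_space_eq[OF sets_mu[of i]] by (auto simp: si)
 qed simp
 have "emeasure (distr (N J) (N J) (flip s J)) (Pi\<^sub>E J A) = emeasure (N J) (flip s J -` Pi\<^sub>E J A \<inter> space (N J))"
  using A J by (intro emeasure_distr flip_measurable sets_PiM_I_finite) auto
 also have "flip s J -` Pi\<^sub>E J A \<inter> space (N J) = Pi\<^sub>E J (\<lambda>i. (\<lambda>x. s i * x) -` A i)"
  by (auto simp: flip_def space_N)
 also have "emeasure (N J) ... = (\<Prod>i\<in>J. emeasure (mu i) ((\<lambda>x. s i * x) -` A i))" using A' by (intro emeasure_PiM J) auto
 also have "... = (\<Prod>i\<in>J. emeasure (mu i) (A i))" by (intro prod.cong em refl)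
 finally show "emeasure (distr (N J) (N J) (flip s J)) (Pi\<^sub>E J A) = (\<Prod>i\<in>J. emeasure (mu i) (A i))" .
qed simp

lemma integral_flip:
 fixes f :: "('i \<Rightarrow> real) \<Rightarrow> real"
 assumes J: "finite J" and s: "\<And>i. s i \<in> {1, - 1}" and f: "f \<in> borel_measurable (N J)"
 shows "(\<integral>om. f (flip s J om) \<partial>N J) = (\<integral>om. f om \<partial>N J)"
proof -
 have "(\<integral>om. f om \<partial>N J) = (\<integral>om. f om \<partial>distr (N J) (N J) (flip s J))" by (simp add: distr_flip[OF J s])
 also have "... = (\<integral>om. f (flip s J om) \<partial>N J)" by (intro integral_distr f flip_measurable)
 finally show ?thesis by simp
qed

lemma integral_odd_eq_0:
 fixes f :: "('i \<Rightarrow> real) \<Rightarrow> real"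
 assumes J: "finite J" and s: "\<And>i. s i \<in> {1, - 1}" and f: "f \<in> borel_measurable (N J)"
  and odd: "\<And>om. om \<in> space (N J) \<Longrightarrow> f (flip s J om) = - f om" shows "(\<integral>om. f om \<partial>N J) = 0"
proof -
 have "(\<integral>om. f om \<partial>N J) = (\<integral>om. f (flip s J om) \<partial>N J)" by (rule integral_flip[OF J s f, symmetric])
 also have "... = (\<integral>om. - f om \<partial>N J)" by (intro Bochner_Integration.integral_cong refl odd)
 finally show ?thesis by simp
qed

end

section \<open>Operator norm of symmetric random matrices\<close>

text \<open>At the first index where the maximum is attained the left neighbour is strictly smaller;
  if that index were interior, this would contradict log-convexity.\<close>

lemma log_convex_le_endpoints:
 fixes g :: "nat \<Rightarrow> real"
 assumes nonneg: "\<And>j. 0 \<le> g j" and convex: "\<And>j. \<lbrakk>0 < j; j < k\<rbrakk> \<Longrightarrow> (g j)^2 \<le> g (j - 1) * g (j + 1)"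
  and j: "j \<le> k" shows "g j \<le> max (g 0) (g k)"
proof (rule ccontr)
 assume neg: "\<not> ?thesis"
 define m where "m = Max (g ` {..k})"
 have gm: "g i \<le> m" if "i \<le> k" for i unfolding m_def using that by simp
 have "m \<in> g ` {..k}" unfolding m_def by simp
 hence ex: "\<exists>i. i \<le> k \<and> g i = m" by auto
 define i where "i = (LEAST i. i \<le> k \<and> g i = m)"
 have i: "i \<le> k" "g i = m" using LeastI_ex[OF ex] by (auto simp: i_def)
 have mj: "max (g 0) (g k) < m" using neg gm[OF j] by linarith
 hence ik: "0 < i" "i < k" using i by (auto intro!: gr0I simp: le_less)
 have "g (i - 1) \<noteq> m" using not_less_Least[of "i - 1" "\<lambda>i. i \<le> k \<and> g i = m"] ik by (auto simp: i_def)
 hence lt: "g (i - 1) < m" using gm[of "i - 1"] ik by linarith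
 have m: "0 < m" using mj nonneg[of 0] by linarith
 have "g (i - 1) * g (i + 1) \<le> g (i - 1) * m" using gm[of "i + 1"] ik nonneg by (intro mult_left_mono) auto
 also have "... < m * m" using lt m by simp
 finally show False using convex[OF ik] i by (simp add: power2_eq_square)
qed

text \<open>For positive values this is \<open>(s 1 / s 0) ^ p \<le> s p / s 0\<close>, which holds
  because the ratios of consecutive terms increase. The form without division also covers
  zeros.\<close>

lemma log_convex_power_le:
 fixes s :: "nat \<Rightarrow> real"
 assumes nonneg: "\<And>j. 0 \<le> s j" and convex: "\<And>j. (s (Suc j))^2 \<le> s j * s (Suc (Suc j))"
 shows "s 1 ^ p * s 0 \<le> s p * s 0 ^ p"
proof (cases "s 0 = 0 \<or> s 1 = 0")
 case True
 thus ?thesis using nonneg by (cases p) auto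
next
 case False
 hence pos01: "0 < s 0" "0 < s 1" using nonneg by (auto simp: less_le)
 have pos: "0 < s j \<and> 0 < s (Suc j)" for j
 proof (induction j)
  case (Suc j)
  have "0 < s j * s (Suc (Suc j))" using convex[of j] Suc by (smt (verit) zero_less_power)
  thus ?case using Suc by (simp add: zero_less_mult_iff)
 qed (use pos01 in simp)
 have ratio: "s 1 / s 0 \<le> s (Suc j) / s j" for j
 proof (induction j)
  case (Suc j)
  have "s (Suc j) / s j \<le> s (Suc (Suc j)) / s (Suc j)" using convex[of j] pos[of j] by (simp add: divide_simps power2_eq_square mult_ac)
  thus ?case using Suc by linarith
 qed simp
 show ?thesis
 proof (induction p)
  case (Suc p)
  have "s 1 ^ Suc p * s 0 \<le> s 1 * (s p * s 0 ^ p)" using Suc pos01 by simp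
  also have "... = (s 1 * s p) * s 0 ^ p" by simp
  also have "s 1 * s p \<le> s (Suc p) * s 0" using ratio[of p] pos[of p] pos01 by (simp add: divide_simps)
  finally show ?case using pos01 by simp
 qed (use pos01 in simp)
qed

lemma fro_sq_mip: "(fro A)^2 = mip A A" by (simp add: mip_def fro_def L2_set_def sum_nonneg flip: vec_l2_sq)

lemma mip_eq_sum: "\<lbrakk>A \<in> mats n m; B \<in> mats n m\<rbrakk> \<Longrightarrow> mip A B = (\<Sum>i<n. \<Sum>j<m. A $$ (i, j) * B $$ (i, j))"
 unfolding mip_def by (subst sum.swap) (simp add: scalar_prod_def lessThan_atLeast0)

lemma mip_mult_left:
 assumes "A \<in> mats n m" "B \<in> mats m k" "C \<in> mats n k" shows "mip (A * B) C = mip B (tr A * C)"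
proof -
 have "mip (A * B) C = (\<Sum>j\<in>{0..<k}. (A *\<^sub>v col B j) \<bullet> col C j)"
  unfolding mip_def using assms by (intro sum.cong) (auto simp: col_mult2[of A n m B k] simp del: col_mult)
 also have "... = mip B (tr A * C)"
  unfolding mip_def using scalar_prod_mult_mat_vec[of "tr A" m n "col B _" "col C _"] assms by (intro sum.cong) (auto simp: col_mult2[of _ m n C k] simp del: col_mult)
 finally show ?thesis .
qed

lemma mip_mult_right:
 assumes "A \<in> mats n m" "B \<in> mats m k" "C \<in> mats n k" shows "mip (A * B) C = mip A (C * tr B)"
proof -
 have "mip (A * B) C = mip (tr A) (B * tr C)"
  using mip_transpose[of "A * B" n k C] mip_mult_left[of "tr B" k m "tr A" n "tr C"] assms by (simp add: mat_dim_transpose)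
 also have "... = mip A (C * tr B)" using mip_transpose[of A n m "C * tr B"] assms by (simp add: mat_dim_transpose)
 finally show ?thesis .
qed

lemma pow_mat_add': "A \<in> mats n n \<Longrightarrow> A ^\<^sub>m (i + j) = A ^\<^sub>m i * (A :: 'a :: semiring_1 mat) ^\<^sub>m j"
proof (induction j)
 case (Suc j)
 show ?case using Suc by (simp add: mat_dim_assoc)
qed (simp add: pow_carrier_mat)

lemma pow_mat_transpose:
 assumes "A \<in> mats n n" shows "tr (A ^\<^sub>m k) = tr (A :: 'a :: comm_semiring_1 mat) ^\<^sub>m k"
proof (induction k)
 case (Suc k)
 show ?case using Suc pow_mat_Suc_left[of "tr A" n k] assms by (simp add: mat_dim_transpose)
qed (use assms in \<open>simp add: matsD\<close>)

text \<open>Interpolation between the powers of \<open>Y\<close> and \<open>Z\<close>: the quantities \<open>\<parallel>Y\<^sup>j A Z\<^sup>k\<^sup>-\<^sup>j\<parallel>\<close> are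
 log-convex in \<open>j\<close> by the Cauchy-Schwarz inequality, hence largest at an endpoint.\<close>

lemma trace_interpolation:
 assumes A: "A \<in> mats n n" and Y: "Y \<in> mats n n" "tr Y = Y" and Z: "Z \<in> mats n n" "tr Z = Z" and q: "q \<le> 2 * k"
 shows "mip A (Y ^\<^sub>m q * A * Z ^\<^sub>m (2 * k - q)) \<le> (fro (A * Z ^\<^sub>m k))^2 + (fro (Y ^\<^sub>m k * A))^2"
proof -
 have Yc: "Y ^\<^sub>m j \<in> mats n n" and Zc: "Z ^\<^sub>m j \<in> mats n n" for j using Y Z by auto
 note dims = matsD[OF A] matsD[OF Yc] matsD[OF Zc] matsD[OF Y(1)] matsD[OF Z(1)]
 define P where "P j = Y ^\<^sub>m j * A * Z ^\<^sub>m (k - j)" for j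
 have P: "P j \<in> mats n n" for j by (simp add: P_def dims)
 have mipP: "mip (P i) (P j) = mip A (Y ^\<^sub>m (i + j) * A * Z ^\<^sub>m (2 * k - (i + j)))" if "i \<le> k" "j \<le> k" for i j
 proof -
  have "mip (P i) (P j) = mip A (Y ^\<^sub>m i * (P j * Z ^\<^sub>m (k - i)))"
   using mip_mult_right[of "Y ^\<^sub>m i * A" n n "Z ^\<^sub>m (k - i)" n "P j"] A Z mip_mult_left[of "Y ^\<^sub>m i" n n A n "P j * Z ^\<^sub>m (k - i)"] P[of j] A Y
   unfolding P_def[of i] by (simp add: pow_mat_transpose[OF Y(1)] pow_mat_transpose[OF Z(1)])
  also have "Y ^\<^sub>m i * (P j * Z ^\<^sub>m (k - i)) = (Y ^\<^sub>m i * Y ^\<^sub>m j) * A * (Z ^\<^sub>m (k - j) * Z ^\<^sub>m (k - i))"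
   by (simp add: P_def mat_dim_assoc dims)
  also have "Y ^\<^sub>m i * Y ^\<^sub>m j = Y ^\<^sub>m (i + j)" by (rule pow_mat_add'[OF Y(1), symmetric])
  also have "Z ^\<^sub>m (k - j) * Z ^\<^sub>m (k - i) = Z ^\<^sub>m (2 * k - (i + j))"
  proof -
   have "(k - j) + (k - i) = 2 * k - (i + j)" using that by simp
   thus ?thesis by (simp flip: pow_mat_add'[OF Z(1)])
  qed
  finally show ?thesis .
 qed
 define g where "g j = fro (P j)" for j
 have g0: "0 \<le> g j" for j by (simp add: g_def)
 have le: "mip (P i) (P j) \<le> g i * g j" for i j unfolding g_def by (rule mip_le[OF P P])
 have "g j \<le> max (g 0) (g k)" if "j \<le> k" for j
 proof (rule log_convex_le_endpoints[OF g0 _ that])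
  fix j assume j: "0 < j" "j < k"
  have "(g j)^2 = mip (P j) (P j)" by (simp add: g_def fro_sq_mip)
  also have "... = mip (P (j - 1)) (P (j + 1))" using j by (simp add: mipP)
  finally show "(g j)^2 \<le> g (j - 1) * g (j + 1)" using le[of "j - 1" "j + 1"] by simp
 qed
 note end_le = this
 \<comment> \<open>\<open>q\<close> may exceed \<open>k\<close>; it is split into two indices that
   are both at most \<open>k\<close>.\<close>
 define i where "i = min q k"
 have i: "i \<le> k" "q - i \<le> k" "i + (q - i) = q" using q by (auto simp: i_def)
 have "mip A (Y ^\<^sub>m q * A * Z ^\<^sub>m (2 * k - q)) = mip (P i) (P (q - i))" using mipP[OF i(1,2)] i(3) by simp
 also have "... \<le> g i * g (q - i)" by (rule le)
 also have "... \<le> max (g 0) (g k) * max (g 0) (g k)" using end_le i g0 by (intro mult_mono) (auto simp: le_max_iff_disj)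
 also have "... \<le> (g 0)^2 + (g k)^2" by (auto simp: max_def power2_eq_square)
 finally show ?thesis by (simp add: g_def P_def dims)
qed

text \<open>By symmetry the norms of \<open>X^j v\<close> are log-convex in \<open>j\<close>, so for
  a unit vector \<open>|X v|^p\<close> is at most \<open>|X^p v|\<close>, and the Frobenius norm of
  \<open>X^p\<close> bounds the latter.\<close>

lemma opb_from_power:
 assumes X: "X \<in> mats n n" "tr X = X" and p: "0 < p" and c: "0 \<le> c" and fro: "(fro (X ^\<^sub>m p))^2 \<le> c ^ (2 * p)"
 shows "opb X c"
proof (rule opbI[OF X(1)])
 fix v :: "real Matrix.vec" assume v: "v \<in> vecs n"
 have Xc: "X ^\<^sub>m j \<in> mats n n" for j using X by simp
 define s where "s j = vec_l2 (X ^\<^sub>m j *\<^sub>v v)" for j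
 have w: "X ^\<^sub>m j *\<^sub>v v \<in> vecs n" for j using matsD[OF Xc[of j]] by simp
 have Suc: "X ^\<^sub>m Suc j *\<^sub>v v = X *\<^sub>v (X ^\<^sub>m j *\<^sub>v v)" for j
  unfolding pow_mat_Suc_left[OF X(1)] using matsD[OF X(1)] v by (intro mat_dim_vec_assoc) auto
 have "s 1 ^ p * s 0 \<le> s p * s 0 ^ p"
 proof (rule log_convex_power_le)
  fix j
  have "(s (Suc j))^2 = (X *\<^sub>v (X ^\<^sub>m j *\<^sub>v v)) \<bullet> (X ^\<^sub>m Suc j *\<^sub>v v)"
   unfolding s_def vec_l2_sq by (simp only: Suc)
  also have "... = (X ^\<^sub>m j *\<^sub>v v) \<bullet> (X ^\<^sub>m Suc (Suc j) *\<^sub>v v)"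
   using scalar_prod_mult_mat_vec[OF X(1) w[of j] w[of "Suc j"]] X(2) by (simp only: Suc[of "Suc j"])
  finally show "(s (Suc j))^2 \<le> s j * s (Suc (Suc j))" using scalar_prod_abs_le[of "X ^\<^sub>m j *\<^sub>v v" "X ^\<^sub>m Suc (Suc j) *\<^sub>v v"] unfolding s_def by simp
 qed (simp add: s_def)
 moreover have s0: "s 0 = vec_l2 v" using v matsD[OF X(1)] by (simp add: s_def)
 moreover have s1: "s 1 = vec_l2 (X *\<^sub>v v)" by (simp add: s_def)
 moreover have "s p \<le> c ^ p * vec_l2 v"
 proof -
  have "(fro (X ^\<^sub>m p))^2 \<le> (c ^ p)^2" using fro by (simp add: power_mult[symmetric] mult.commute)
  hence "fro (X ^\<^sub>m p) \<le> c ^ p" using c by simp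
  thus ?thesis unfolding s_def using opbD[OF opb_mono[OF opb_fro] Xc v] by blast
 qed
 ultimately have "vec_l2 (X *\<^sub>v v) ^ p * vec_l2 v \<le> (c ^ p * vec_l2 v) * vec_l2 v ^ p"
  by (smt (verit) mult_right_mono vec_l2_nonneg zero_le_power)
 hence le: "vec_l2 (X *\<^sub>v v) ^ p * vec_l2 v \<le> (c * vec_l2 v) ^ p * vec_l2 v" by (simp add: power_mult_distrib mult_ac)
 show "vec_l2 (X *\<^sub>v v) \<le> c * vec_l2 v"
 proof (cases "vec_l2 v = 0")
  case True
  hence "v = 0\<^sub>v n" using vec_l2_eq_0[OF v] by simp
  moreover have "X *\<^sub>v 0\<^sub>v n = 0\<^sub>v n" using X(1) by auto
  ultimately show ?thesis by simp
 next
  case False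
  hence "0 < vec_l2 v" using vec_l2_nonneg[of v] by linarith
  thus ?thesis using le p c by simp
 qed
qed

text \<open>In the application \<open>Y\<close> arises from \<open>X\<close> by flipping the sign of
  one coordinate of value \<open>w\<close>. The difference of the odd powers telescopes into
  \<open>2 * k + 1\<close> terms \<open>Y^q A X^(2k-q)\<close>, each with a factor
  \<open>2 * w\<close>, and each trace is bounded by interpolation.\<close>

lemma flip_trace_le:
 assumes A: "A \<in> mats n n" "tr A = A" and X: "X \<in> mats n n" "tr X = X"
  and Y: "Y \<in> mats n n" "tr Y = Y" and XY: "X = Y + (2 * w) \<cdot>\<^sub>m A"
 shows "w * (mip A (X ^\<^sub>m (2 * k + 1)) - mip A (Y ^\<^sub>m (2 * k + 1)))
  \<le> 2 * w^2 * (2 * real k + 1) * ((fro (A * X ^\<^sub>m k))^2 + (fro (A * Y ^\<^sub>m k))^2)"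
proof -
 let ?m = "2 * k"
 have Xc: "X ^\<^sub>m j \<in> mats n n" and Yc: "Y ^\<^sub>m j \<in> mats n n" for j using X Y by auto
 note dims = matsD[OF A(1)] matsD[OF Xc] matsD[OF Yc] matsD[OF X(1)] matsD[OF Y(1)]
 define t where "t q = mip A (Y ^\<^sub>m q * X ^\<^sub>m (?m + 1 - q))" for q
 have step: "t q - t (Suc q) = (2 * w) * mip A (Y ^\<^sub>m q * A * X ^\<^sub>m (?m - q))" if "q \<le> ?m" for q
 proof -
  have "?m + 1 - q = Suc (?m - q)" using that by simp
  hence "Y ^\<^sub>m q * X ^\<^sub>m (?m + 1 - q) = Y ^\<^sub>m q * (X * X ^\<^sub>m (?m - q))"
   by (simp add: pow_mat_Suc_left[OF X(1)] del: pow_mat.simps)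
  also have "X * X ^\<^sub>m (?m - q) = (Y + (2 * w) \<cdot>\<^sub>m A) * X ^\<^sub>m (?m - q)" using XY by simp
  finally show ?thesis using add_mult_distrib_mat[of Y n n "(2 * w) \<cdot>\<^sub>m A" "X ^\<^sub>m (?m - q)" n] mult_smult_assoc_mat[OF A(1) Xc, of "2 * w" "?m - q"] Y Xc mult_add_distrib_mat[of "Y ^\<^sub>m q" n n "Y * X ^\<^sub>m (?m - q)" n "(2 * w) \<cdot>\<^sub>m (A * X ^\<^sub>m (?m - q))"] A by (simp add: t_def mip_eq_sum[of A n n] mat_dim_assoc dims sum_distrib_left algebra_simps)
 qed
 have "(\<Sum>q<Suc ?m. t q - t (Suc q)) = t 0 - t (Suc ?m)" by (rule sum_lessThan_telescope')
 also have "... = mip A (X ^\<^sub>m (?m + 1)) - mip A (Y ^\<^sub>m (?m + 1))" by (simp add: t_def dims del: pow_mat.simps(2))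
 finally have "w * (mip A (X ^\<^sub>m (?m + 1)) - mip A (Y ^\<^sub>m (?m + 1))) = w * (\<Sum>q<Suc ?m. t q - t (Suc q))" by simp
 also have "... = 2 * w^2 * (\<Sum>q<Suc ?m. mip A (Y ^\<^sub>m q * A * X ^\<^sub>m (?m - q)))"
  unfolding sum_distrib_left by (intro sum.cong refl) (simp add: step power2_eq_square)
 also have "... \<le> 2 * w^2 * (\<Sum>q<Suc ?m. (fro (A * X ^\<^sub>m k))^2 + (fro (A * Y ^\<^sub>m k))^2)"
 proof (intro mult_left_mono sum_mono)
  fix q assume "q \<in> {..<Suc ?m}"
  thus "mip A (Y ^\<^sub>m q * A * X ^\<^sub>m (?m - q)) \<le> (fro (A * X ^\<^sub>m k))^2 + (fro (A * Y ^\<^sub>m k))^2"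
   using fro_transpose[of "Y ^\<^sub>m k * A"] A(2) trace_interpolation[OF A(1) Y X, of q k] by (simp add: mat_dim_transpose dims pow_mat_transpose[OF Y(1)] Y(2))
 qed simp
 finally show ?thesis by (simp add: algebra_simps)
qed

section \<open>Almost surely bounded observables\<close>

context symmetric_product
begin

text \<open>A class closed under sums and products whose members are integrable, so that no explicit
  bounds for the entries of matrix powers have to be tracked.\<close>

definition ae_bounded :: "(('i \<Rightarrow> real) \<Rightarrow> real) \<Rightarrow> bool" where
 "ae_bounded f \<longleftrightarrow> f \<in> BM \<and> (\<exists>C. AE om in N I. \<bar>f om\<bar> \<le> C)"

lemma ae_boundedI: "\<lbrakk>f \<in> BM; AE om in N I. \<bar>f om\<bar> \<le> C\<rbrakk> \<Longrightarrow> ae_bounded f"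
 unfolding ae_bounded_def by blast

lemma ae_bounded_measurable: "ae_bounded f \<Longrightarrow> f \<in> BM" unfolding ae_bounded_def by blast

lemma ae_bounded_integrable: "ae_bounded f \<Longrightarrow> integrable (N I) f"
proof -
 assume f: "ae_bounded f"
 then obtain C where "AE om in N I. norm (f om) \<le> C" unfolding ae_bounded_def by auto
 thus ?thesis by (rule finite_measure.integrable_const_bound[OF prob_space.finite_measure[OF prob_N] _ ae_bounded_measurable[OF f]])
qed

lemma ae_bounded_const: "ae_bounded (\<lambda>_. c)" by (rule ae_boundedI[of _ "\<bar>c\<bar>"]) auto

lemma ae_bounded_coord: "i \<in> I \<Longrightarrow> ae_bounded (\<lambda>om. om i)" using AE_bounded[of I] by (intro ae_boundedI[of _ L]) auto

lemma ae_bounded_indicator: "Measurable.pred (N I) Q \<Longrightarrow> ae_bounded (\<lambda>om. of_bool (Q om))" by (rule ae_boundedI[of _ 1]) auto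

lemma ae_bounded_add: "\<lbrakk>ae_bounded f; ae_bounded g\<rbrakk> \<Longrightarrow> ae_bounded (\<lambda>om. f om + g om)"
proof -
 assume f: "ae_bounded f" and g: "ae_bounded g"
 obtain C D where "AE om in N I. \<bar>f om\<bar> \<le> C" "AE om in N I. \<bar>g om\<bar> \<le> D" using f g unfolding ae_bounded_def by blast
 hence "AE om in N I. \<bar>f om + g om\<bar> \<le> C + D" by auto
 thus ?thesis using f[THEN ae_bounded_measurable] g[THEN ae_bounded_measurable]
  by (intro ae_boundedI borel_measurable_add borel_measurable_times) auto
qed

lemma ae_bounded_mult: "\<lbrakk>ae_bounded f; ae_bounded g\<rbrakk> \<Longrightarrow> ae_bounded (\<lambda>om. f om * g om)"
proof -
 assume f: "ae_bounded f" and g: "ae_bounded g"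
 obtain C D where "AE om in N I. \<bar>f om\<bar> \<le> C" "AE om in N I. \<bar>g om\<bar> \<le> D" using f g unfolding ae_bounded_def by blast
 hence "AE om in N I. \<bar>f om * g om\<bar> \<le> C * D"
 proof eventually_elim
  case (elim om)
  thus ?case unfolding abs_mult by (intro mult_mono) auto
 qed
 thus ?thesis using f[THEN ae_bounded_measurable] g[THEN ae_bounded_measurable]
  by (intro ae_boundedI borel_measurable_add borel_measurable_times) auto
qed

lemma ae_bounded_power: "ae_bounded f \<Longrightarrow> ae_bounded (\<lambda>om. (f om) ^ k)"
 by (induction k) (simp_all add: ae_bounded_const ae_bounded_mult)

lemma ae_bounded_sum: "(\<And>x. x \<in> S \<Longrightarrow> ae_bounded (f x)) \<Longrightarrow> ae_bounded (\<lambda>om. \<Sum>x\<in>S. f x om)"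
 by (induction S rule: infinite_finite_induct) (simp_all add: ae_bounded_const ae_bounded_add)

definition ae_bounded_mat :: "nat \<Rightarrow> nat \<Rightarrow> (('i \<Rightarrow> real) \<Rightarrow> real mat) \<Rightarrow> bool" where
 "ae_bounded_mat n m F \<longleftrightarrow> (\<forall>om. F om \<in> mats n m) \<and> (\<forall>i<n. \<forall>j<m. ae_bounded (\<lambda>om. F om $$ (i, j)))"

lemma ae_bounded_mat_mult:
 assumes F: "ae_bounded_mat n m F" and G: "ae_bounded_mat m k G" shows "ae_bounded_mat n k (\<lambda>om. F om * G om)"
proof -
 have c: "F om \<in> mats n m" "G om \<in> mats m k" for om using F G by (auto simp: ae_bounded_mat_def)
 note d = matsD[OF c(1)] matsD[OF c(2)]
 hence entry: "(\<lambda>om. (F om * G om) $$ (i, j)) = (\<lambda>om. \<Sum>t<m. F om $$ (i, t) * G om $$ (t, j))" if "i < n" "j < k" for i j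
  using that by (simp add: scalar_prod_def lessThan_atLeast0)
 have "ae_bounded (\<lambda>om. (F om * G om) $$ (i, j))" if "i < n" "j < k" for i j
  unfolding entry[OF that] using F G that unfolding ae_bounded_mat_def by (intro ae_bounded_sum ae_bounded_mult) auto
 thus ?thesis using d unfolding ae_bounded_mat_def by simp
qed

lemma ae_bounded_mat_const: "A \<in> mats n m \<Longrightarrow> ae_bounded_mat n m (\<lambda>_. A)"
 unfolding ae_bounded_mat_def by (simp add: ae_bounded_const)

lemma ae_bounded_mat_pow: "ae_bounded_mat n n F \<Longrightarrow> ae_bounded_mat n n (\<lambda>om. F om ^\<^sub>m k)"
proof (induction k)
 case 0
 hence "F om ^\<^sub>m 0 = 1\<^sub>m n" for om using matsD[of "F om" n n] by (simp add: ae_bounded_mat_def)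
 thus ?case using ae_bounded_mat_const[of "1\<^sub>m n" n n] by simp
next
 case (Suc k)
 thus ?case using ae_bounded_mat_mult[of n n "\<lambda>om. F om ^\<^sub>m k" n F] by simp
qed

lemma ae_bounded_mip: "\<lbrakk>ae_bounded_mat n m F; ae_bounded_mat n m G\<rbrakk> \<Longrightarrow> ae_bounded (\<lambda>om. mip (F om) (G om))"
 by (subst mip_eq_sum[of _ n m]) (auto simp: ae_bounded_mat_def intro!: ae_bounded_sum ae_bounded_mult)

lemma ae_bounded_fro_sq: "ae_bounded_mat n m F \<Longrightarrow> ae_bounded (\<lambda>om. (fro (F om))^2)"
 unfolding fro_sq_mip by (rule ae_bounded_mip)

end

text \<open>\<open>ix a b\<close> names the coordinate at position \<open>(a, b)\<close>, with
  \<open>None\<close> for a zero entry. The pattern covers symmetric matrices as well as the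
  symmetric dilation of an asymmetric one. By \<open>ix_inj\<close> no coordinate occurs twice in a
  row.\<close>

locale random_symmetric_matrix = symmetric_product I mu sg L
 for I :: "'i set" and mu sg L +
 fixes d :: nat and ix :: "nat \<Rightarrow> nat \<Rightarrow> 'i option"
 assumes ix_sym: "\<And>a b. ix a b = ix b a" and ix_I: "\<And>a b e. \<lbrakk>a < d; b < d; ix a b = Some e\<rbrakk> \<Longrightarrow> e \<in> I"
  and ix_inj: "\<And>a b b' e. \<lbrakk>a < d; b < d; b' < d; ix a b = Some e; ix a b' = Some e\<rbrakk> \<Longrightarrow> b = b'"
begin

definition X :: "('i \<Rightarrow> real) \<Rightarrow> real mat" where
 "X om = mat d d (\<lambda>(a, b). case ix a b of None \<Rightarrow> 0 | Some e \<Rightarrow> om e)"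

text \<open>The positions of coordinate \<open>e\<close>, so that \<open>X\<close> is the sum of the
  \<open>om e\<close> times \<open>A e\<close>. Each \<open>A e\<close> is a partial permutation
  matrix.\<close>

definition A :: "'i \<Rightarrow> real mat" where
 "A e = mat d d (\<lambda>(a, b). of_bool (ix a b = Some e))"

lemma X: "X om \<in> mats d d" "tr (X om) = X om" by (auto simp: X_def ix_sym intro!: eq_matI)

lemma A: "A e \<in> mats d d" "tr (A e) = A e" by (auto simp: A_def ix_sym intro!: eq_matI)

lemma X_pow: "X om ^\<^sub>m k \<in> mats d d" using X by simp

lemma X_entry: "\<lbrakk>a < d; b < d\<rbrakk> \<Longrightarrow> X om $$ (a, b) = (\<Sum>e\<in>I. om e * A e $$ (a, b))"
 using finite_I ix_I[of a b] by (cases "ix a b") (auto simp: X_def A_def sum.If_cases if_distrib cong: if_cong)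

lemma ae_bounded_X: "ae_bounded_mat d d X" unfolding ae_bounded_mat_def using X
 by (auto simp: X_entry intro!: ae_bounded_sum ae_bounded_mult ae_bounded_coord ae_bounded_const)

lemma A_mult_sq:
 assumes B: "B \<in> mats d d" shows "(fro (A e * B))^2 = (\<Sum>a<d. \<Sum>b<d. of_bool (ix a b = Some e) * (\<Sum>c<d. (B $$ (b, c))^2))"
proof -
 have sq: "((A e * B) $$ (a, c))^2 = (\<Sum>b<d. of_bool (ix a b = Some e) * (B $$ (b, c))^2)" if ac: "a < d" "c < d" for a c
 proof -
  have eq: "(A e * B) $$ (a, c) = (\<Sum>b<d. of_bool (ix a b = Some e) * B $$ (b, c))" using matsD[OF B] ac by (simp add: A_def scalar_prod_def lessThan_atLeast0)
  show ?thesis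
  proof (cases "\<exists>b<d. ix a b = Some e")
   case True
   then obtain b where b: "b < d" "ix a b = Some e" by blast
   hence iff: "b' < d \<Longrightarrow> ix a b' = Some e \<longleftrightarrow> b' = b" for b' using ix_inj[OF ac(1)] by auto
   show ?thesis unfolding eq using iff b by simp
  next
   case False
   thus ?thesis unfolding eq by simp
  qed
 qed
 have "(fro (A e * B))^2 = (\<Sum>a<d. \<Sum>c<d. ((A e * B) $$ (a, c))^2)"
  unfolding fro_sq using matsD[OF A(1)] matsD[OF B] by (subst sum.swap) simp
 also have "... = (\<Sum>a<d. \<Sum>c<d. \<Sum>b<d. of_bool (ix a b = Some e) * (B $$ (b, c))^2)" by (simp add: sq)
 also have "... = (\<Sum>a<d. \<Sum>b<d. of_bool (ix a b = Some e) * (\<Sum>c<d. (B $$ (b, c))^2))"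
  by (intro sum.cong refl trans[OF sum.swap]) (simp add: sum_distrib_left del: sum_mult_of_bool_eq sum_of_bool_mult_eq)
 finally show ?thesis .
qed

text \<open>A truncation that depends on the coordinates only through their squares and is therefore
  invariant under sign flips.\<close>

definition rows_bounded :: "real \<Rightarrow> ('i \<Rightarrow> real) \<Rightarrow> bool" where
 "rows_bounded v om \<longleftrightarrow> (\<forall>a<d. (\<Sum>b<d. (X om $$ (a, b))^2) \<le> v)"

lemma rows_bounded_measurable [measurable]: "Measurable.pred (N I) (rows_bounded v)"
proof -
 have [measurable]: "(\<lambda>om. X om $$ (a, b)) \<in> BM" if "a < d" "b < d" for a b
  using ae_bounded_X that unfolding ae_bounded_mat_def by (auto dest: ae_bounded_measurable)
 show ?thesis unfolding rows_bounded_def by measurable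
qed

text \<open>Multiplication by \<open>A e\<close> copies rows of \<open>B\<close>, so the sum
  regroups into the rows of \<open>B\<close>, each weighted by a squared row norm of
  \<open>X\<close>.\<close>

lemma sum_A_mult_sq_le:
 assumes B: "B \<in> mats d d" and v: "rows_bounded v om" shows "(\<Sum>e\<in>I. (om e)^2 * (fro (A e * B))^2) \<le> v * (fro B)^2"
proof -
 have sq: "(\<Sum>e\<in>I. (om e)^2 * of_bool (ix a b = Some e)) = (X om $$ (a, b))^2" if "a < d" "b < d" for a b
  using finite_I ix_I[OF that] that by (cases "ix a b") (auto simp: X_def sum.If_cases if_distrib of_bool_def cong: if_cong)
 have "(\<Sum>e\<in>I. (om e)^2 * (fro (A e * B))^2)
  = (\<Sum>e\<in>I. \<Sum>a<d. \<Sum>b<d. (om e)^2 * of_bool (ix a b = Some e) * (\<Sum>c<d. (B $$ (b, c))^2))"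
  by (simp add: A_mult_sq[OF B] sum_distrib_left mult.assoc del: sum_mult_of_bool_eq sum_of_bool_mult_eq)
 also have "... = (\<Sum>a<d. \<Sum>b<d. \<Sum>e\<in>I. (om e)^2 * of_bool (ix a b = Some e) * (\<Sum>c<d. (B $$ (b, c))^2))"
  by (subst sum.swap) (intro sum.cong refl, rule sum.swap)
 also have "... = (\<Sum>a<d. \<Sum>b<d. (X om $$ (a, b))^2 * (\<Sum>c<d. (B $$ (b, c))^2))"
  by (simp add: sq flip: sum_distrib_right)
 also have "... = (\<Sum>b<d. (\<Sum>a<d. (X om $$ (b, a))^2) * (\<Sum>c<d. (B $$ (b, c))^2))"
  by (subst sum.swap) (simp add: X_def ix_sym sum_distrib_right)
 also have "... \<le> (\<Sum>b<d. v * (\<Sum>c<d. (B $$ (b, c))^2))"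
  using v unfolding rows_bounded_def by (intro sum_mono mult_right_mono sum_nonneg) auto
 finally show ?thesis unfolding fro_sq sum_distrib_left[symmetric] using matsD[OF B] by (subst (2) sum.swap) simp
qed

lemma X_flip:
 assumes e: "e \<in> I" and s: "s = (\<lambda>i. if i = e then - 1 else 1)" shows "X om = X (flip s I om) + (2 * om e) \<cdot>\<^sub>m A e"
proof (rule eq_matI)
 fix a b assume "a < dim_row (X (flip s I om) + (2 * om e) \<cdot>\<^sub>m A e)" "b < dim_col (X (flip s I om) + (2 * om e) \<cdot>\<^sub>m A e)"
 hence ab: "a < d" "b < d" by (auto simp: A_def)
 thus "X om $$ (a, b) = (X (flip s I om) + (2 * om e) \<cdot>\<^sub>m A e) $$ (a, b)"
  using ix_I[OF ab] by (cases "ix a b") (auto simp: X_def A_def flip_def s)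
qed (auto simp: X_def A_def)

lemma rows_bounded_flip:
 assumes s: "\<And>i. s i \<in> {1, - 1}" shows "rows_bounded v (flip s I om) = rows_bounded v om"
proof -
 have "(X (flip s I om) $$ (a, b))^2 = (X om $$ (a, b))^2" if "a < d" "b < d" for a b
 proof (cases "ix a b")
  case (Some e)
  thus ?thesis using that ix_I[OF that Some] s[of e] by (auto simp: X_def flip_def)
 qed (simp add: X_def that)
 thus ?thesis unfolding rows_bounded_def by simp
qed

abbreviation "trunc v om \<equiv> of_bool (rows_bounded v om) :: real"

text \<open>The prefactor \<open>om e\<close> is odd, so averaging over the sign of coordinate
  \<open>e\<close> leaves only the difference between the odd powers of \<open>X\<close> and of its
  flip; this gains a second factor \<open>om e\<close>.\<close>

lemma moment_step_coord:
 assumes e: "e \<in> I" shows "(\<integral>om. trunc v om * (om e * mip (A e) (X om ^\<^sub>m (2 * k + 1))) \<partial>N I)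
  \<le> 2 * (2 * real k + 1) * (\<integral>om. trunc v om * ((om e)^2 * (fro (A e * X om ^\<^sub>m k))^2) \<partial>N I)"
proof -
 define s :: "'i \<Rightarrow> real" where "s = (\<lambda>i. if i = e then - 1 else 1)"
 have s: "s i \<in> {1, - 1}" for i by (simp add: s_def)
 define f where "f om = trunc v om * (om e * mip (A e) (X om ^\<^sub>m (2 * k + 1)))" for om
 define h where "h om = trunc v om * ((om e)^2 * (fro (A e * X om ^\<^sub>m k))^2)" for om
 have f: "ae_bounded f" unfolding f_def using e by (intro ae_bounded_mult ae_bounded_indicator ae_bounded_coord ae_bounded_mip[of d d]
    ae_bounded_mat_const ae_bounded_mat_pow ae_bounded_X A rows_bounded_measurable)
 have h: "ae_bounded h" unfolding h_def
  using e by (intro ae_bounded_mult ae_bounded_indicator ae_bounded_power ae_bounded_coord ae_bounded_fro_sq[of d d]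
    ae_bounded_mat_mult[of d d _ d] ae_bounded_mat_const ae_bounded_mat_pow ae_bounded_X A rows_bounded_measurable)
 note flip = integral_flip[OF finite_I s]
 have int_flip: "integrable (N I) (\<lambda>om. g (flip s I om))" if "ae_bounded g" for g :: "('i \<Rightarrow> real) \<Rightarrow> real"
  using integrable_distr[OF flip_measurable[of s I], of g] ae_bounded_integrable[OF that] distr_flip[OF finite_I s] by simp
 have fe: "flip s I om e = - om e" for om using e by (simp add: flip_def s_def)
 have le: "f om + f (flip s I om) \<le> 2 * (2 * real k + 1) * (h om + h (flip s I om))" for om
 proof (cases "rows_bounded v om")
  case True
  thus ?thesis using flip_trace_le[OF A(1) A(2) X(1) X(2) X(1) X(2) X_flip[OF e s_def], of om k]
   unfolding f_def h_def rows_bounded_flip[OF s] fe by (simp add: algebra_simps)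
 next
  case False
  thus ?thesis by (simp add: f_def h_def rows_bounded_flip[OF s])
 qed
 have "2 * (\<integral>om. f om \<partial>N I) = (\<integral>om. f om + f (flip s I om) \<partial>N I)"
  using flip[OF ae_bounded_measurable[OF f]] int_flip[OF f] ae_bounded_integrable[OF f] by simp
 also have "... \<le> (\<integral>om. 2 * (2 * real k + 1) * (h om + h (flip s I om)) \<partial>N I)"
  using int_flip[OF f] int_flip[OF h] ae_bounded_integrable[OF f] ae_bounded_integrable[OF h] by (intro integral_mono le) auto
 also have "... = 2 * (2 * real k + 1) * (2 * (\<integral>om. h om \<partial>N I))"
  using flip[OF ae_bounded_measurable[OF h]] int_flip[OF h] ae_bounded_integrable[OF h] by simp
 finally show ?thesis by (simp add: f_def h_def)
qed

text \<open>The squared norm of the power \<open>Suc k\<close> is the trace inner product of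
  \<open>X\<close> with its power \<open>2 * k + 1\<close>, hence a sum over \<open>e\<close> of
  \<open>om e\<close> times a trace form. After the sign averages the squares of the entries appear,
  and the truncated row norms replace them by \<open>v\<close>.\<close>

lemma moment_step:
 assumes v: "0 \<le> v" shows "(\<integral>om. trunc v om * (fro (X om ^\<^sub>m Suc k))^2 \<partial>N I)
  \<le> 2 * (2 * real k + 1) * v * (\<integral>om. trunc v om * (fro (X om ^\<^sub>m k))^2 \<partial>N I)"
proof -
 have bd1: "ae_bounded (\<lambda>om. trunc v om * (om e * mip (A e) (X om ^\<^sub>m (2 * k + 1))))" if "e \<in> I" for e
  using that by (intro ae_bounded_mult ae_bounded_indicator ae_bounded_coord ae_bounded_mip[of d d]
    ae_bounded_mat_const ae_bounded_mat_pow ae_bounded_X A rows_bounded_measurable)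
 have bd2: "ae_bounded (\<lambda>om. trunc v om * ((om e)^2 * (fro (A e * X om ^\<^sub>m k))^2))" if "e \<in> I" for e
  using that by (intro ae_bounded_mult ae_bounded_indicator ae_bounded_power ae_bounded_coord ae_bounded_fro_sq[of d d]
    ae_bounded_mat_mult[of d d _ d] ae_bounded_mat_const ae_bounded_mat_pow ae_bounded_X A rows_bounded_measurable)
 have bd3: "ae_bounded (\<lambda>om. trunc v om * (fro (X om ^\<^sub>m k))^2)"
  by (intro ae_bounded_mult ae_bounded_indicator ae_bounded_fro_sq[of d d] ae_bounded_mat_pow ae_bounded_X rows_bounded_measurable)
 have trace: "(fro (X om ^\<^sub>m Suc k))^2 = (\<Sum>e\<in>I. om e * mip (A e) (X om ^\<^sub>m (2 * k + 1)))" for om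
 proof -
  have "(fro (X om ^\<^sub>m Suc k))^2 = mip (X om * X om ^\<^sub>m k) (X om ^\<^sub>m Suc k)" by (simp only: fro_sq_mip pow_mat_Suc_left[OF X(1)])
  also have "... = mip (X om) (X om ^\<^sub>m Suc k * X om ^\<^sub>m k)"
   using mip_mult_right[OF X(1)[of om] X_pow[of om k] X_pow[of om "Suc k"]]
   by (simp only: pow_mat_transpose[OF X(1)] X(2) pow_mat_Suc_left[OF X(1)])
  also have "X om ^\<^sub>m Suc k * X om ^\<^sub>m k = X om ^\<^sub>m (2 * k + 1)"
   using pow_mat_add'[OF X(1), of om "Suc k" k] by (simp add: mult_2 del: pow_mat.simps)
  also have "mip (X om) (X om ^\<^sub>m (2 * k + 1)) = (\<Sum>a<d. \<Sum>b<d. \<Sum>e\<in>I. om e * A e $$ (a, b) * (X om ^\<^sub>m (2 * k + 1)) $$ (a, b))"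
   by (simp add: mip_eq_sum[OF X(1) X_pow] X_entry sum_distrib_right del: pow_mat.simps)
  also have "... = (\<Sum>a<d. \<Sum>e\<in>I. \<Sum>b<d. om e * A e $$ (a, b) * (X om ^\<^sub>m (2 * k + 1)) $$ (a, b))"
   by (intro sum.cong refl sum.swap)
  also have "... = (\<Sum>e\<in>I. \<Sum>a<d. \<Sum>b<d. om e * A e $$ (a, b) * (X om ^\<^sub>m (2 * k + 1)) $$ (a, b))" by (rule sum.swap)
  finally show ?thesis by (simp add: mip_eq_sum[OF A(1) X_pow] sum_distrib_left mult.assoc del: pow_mat.simps)
 qed
 have "(\<integral>om. trunc v om * (fro (X om ^\<^sub>m Suc k))^2 \<partial>N I)
  = (\<integral>om. (\<Sum>e\<in>I. trunc v om * (om e * mip (A e) (X om ^\<^sub>m (2 * k + 1)))) \<partial>N I)"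
  unfolding trace sum_distrib_left ..
 also have "... = (\<Sum>e\<in>I. \<integral>om. trunc v om * (om e * mip (A e) (X om ^\<^sub>m (2 * k + 1))) \<partial>N I)"
  by (intro Bochner_Integration.integral_sum ae_bounded_integrable bd1)
 also have "... \<le> (\<Sum>e\<in>I. 2 * (2 * real k + 1) * (\<integral>om. trunc v om * ((om e)^2 * (fro (A e * X om ^\<^sub>m k))^2) \<partial>N I))"
  by (intro sum_mono moment_step_coord)
 also have "... = 2 * (2 * real k + 1) * (\<integral>om. (\<Sum>e\<in>I. trunc v om * ((om e)^2 * (fro (A e * X om ^\<^sub>m k))^2)) \<partial>N I)"
  by (simp only: Bochner_Integration.integral_sum[OF ae_bounded_integrable[OF bd2]] sum_distrib_left)
 also have "... \<le> 2 * (2 * real k + 1) * (\<integral>om. v * (trunc v om * (fro (X om ^\<^sub>m k))^2) \<partial>N I)"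
 proof (intro mult_left_mono integral_mono)
  show "(\<Sum>e\<in>I. trunc v om * ((om e)^2 * (fro (A e * X om ^\<^sub>m k))^2)) \<le> v * (trunc v om * (fro (X om ^\<^sub>m k))^2)" for om
   using sum_A_mult_sq_le[OF X_pow, of v om om k] by simp
 qed (auto intro!: ae_bounded_integrable ae_bounded_sum bd2 bd3 ae_bounded_mult ae_bounded_const)
 finally show ?thesis by simp
qed

lemma moment_bound:
 assumes v: "0 \<le> v" and k: "k \<le> p"
 shows "(\<integral>om. trunc v om * (fro (X om ^\<^sub>m k))^2 \<partial>N I) \<le> (4 * real p * v) ^ k * real d" using k
proof (induction k)
 case 0
 have one: "(fro (1\<^sub>m d))^2 = real d"
 proof -
  have "(\<Sum>j<d. \<Sum>i<d. (1\<^sub>m d $$ (i, j))^2) = (\<Sum>j<d. \<Sum>i<d. if i = j then 1 else (0 :: real))" by (intro sum.cong) auto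
  thus ?thesis by (simp add: fro_sq)
 qed
 have "X om ^\<^sub>m 0 = 1\<^sub>m d" for om using matsD(1)[OF X(1)] by simp
 hence "(\<integral>om. trunc v om * (fro (X om ^\<^sub>m 0))^2 \<partial>N I) = (\<integral>om. trunc v om * real d \<partial>N I)" using one by metis
 also have "... \<le> (\<integral>om. real d \<partial>N I)"
  by (intro integral_mono ae_bounded_integrable ae_bounded_mult ae_bounded_indicator ae_bounded_const rows_bounded_measurable) auto
 finally show ?case using P.prob_space by simp
next
 case (Suc k)
 have "(\<integral>om. trunc v om * (fro (X om ^\<^sub>m Suc k))^2 \<partial>N I) \<le> 2 * (2 * real k + 1) * v * (\<integral>om. trunc v om * (fro (X om ^\<^sub>m k))^2 \<partial>N I)"
  by (rule moment_step[OF v])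
 also have "... \<le> (4 * real p * v) * ((4 * real p * v) ^ k * real d)"
 proof (rule mult_mono[OF _ Suc.IH])
  have "2 * (2 * real k + 1) \<le> 4 * real p" using Suc.prems by simp
  thus "2 * (2 * real k + 1) * v \<le> 4 * real p * v" using v by (rule mult_right_mono)
 qed (use Suc.prems v in \<open>auto intro!: integral_nonneg\<close>)
 finally show ?case by simp
qed

text \<open>Exponential Markov inequality with parameter \<open>1 / L^2\<close>: a row involves at
  most \<open>d\<close> distinct coordinates, and each adds at most \<open>2 * sg^2 / L^2\<close> to
  the exponent.\<close>

lemma rows_bounded_prob:
 assumes l: "0 \<le> l" shows "measure (N I) {om \<in> space (N I). \<not> rows_bounded (2 * real d * sg^2 + l * L^2) om} \<le> real d * exp (- l)"
proof -
 define v where "v = 2 * real d * sg^2 + l * L^2"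
 have mX [measurable]: "(\<lambda>om. X om $$ (a, b)) \<in> BM" if "a < d" "b < d" for a b
  using ae_bounded_X that unfolding ae_bounded_mat_def by (auto dest: ae_bounded_measurable)
 define S where "S a = {om \<in> space (N I). v < (\<Sum>b<d. (X om $$ (a, b))^2)}" for a
 have S: "S a \<in> sets (N I)" if "a < d" for a unfolding S_def using that by measurable
 have row: "prob (S a) \<le> exp (- l)" if a: "a < d" for a
 proof -
  define J where "J = {e \<in> I. \<exists>b<d. ix a b = Some e}"
  have J: "J \<subseteq> I" "finite J" using finite_I by (auto simp: J_def)
  have "card J \<le> card {..<d}"
  proof (rule card_inj_on_le[of "\<lambda>e. SOME b. b < d \<and> ix a b = Some e"])
   have P: "(SOME b. b < d \<and> ix a b = Some e) < d \<and> ix a (SOME b. b < d \<and> ix a b = Some e) = Some e" if "e \<in> J" for e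
    using that by (intro someI_ex[of "\<lambda>b. b < d \<and> ix a b = Some e"]) (auto simp: J_def)
   show "inj_on (\<lambda>e. SOME b. b < d \<and> ix a b = Some e) J" using P by (intro inj_onI) (metis option.inject)
   show "(\<lambda>e. SOME b. b < d \<and> ix a b = Some e) ` J \<subseteq> {..<d}" using P by auto
  qed simp
  hence cardJ: "real (card J) \<le> real d" by simp
  have row_eq: "(\<Sum>b<d. (X om $$ (a, b))^2) = (\<Sum>e\<in>I. if e \<in> J then (om e)\<^sup>2 else 0)" for om
  proof -
   have "(X om $$ (a, b))^2 = (\<Sum>e\<in>I. if ix a b = Some e then (om e)\<^sup>2 else 0)" if "b < d" for b
    using finite_I ix_I[OF a that] a that by (cases "ix a b") (auto simp: X_def)
   hence "(\<Sum>b<d. (X om $$ (a, b))^2) = (\<Sum>e\<in>I. \<Sum>b<d. if ix a b = Some e then (om e)\<^sup>2 else 0)"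
    by (subst sum.swap) simp
   also have "... = (\<Sum>e\<in>I. if e \<in> J then (om e)\<^sup>2 else 0)"
   proof (intro sum.cong refl)
    fix e assume e: "e \<in> I"
    show "(\<Sum>b<d. if ix a b = Some e then (om e)\<^sup>2 else 0) = (if e \<in> J then (om e)\<^sup>2 else 0)"
    proof (cases "e \<in> J")
     case True
     then obtain b where b: "b < d" "ix a b = Some e" by (auto simp: J_def)
     hence "(\<Sum>b'<d. if ix a b' = Some e then (om e)\<^sup>2 else 0) = (\<Sum>b'<d. if b = b' then (om e)\<^sup>2 else 0)"
      using ix_inj[OF a] by (intro sum.cong) auto
     thus ?thesis using True b by simp
    qed (use e in \<open>auto simp: J_def intro!: sum.neutral\<close>)
   qed
   finally show ?thesis .
  qed
  have "emeasure (N I) (S a) \<le> (\<integral>\<^sup>+om. ennreal (exp (- v / L^2)) * ennreal (exp (\<Sum>e\<in>I. if e \<in> J then (1 / L^2) * (om e)^2 else 0)) \<partial>N I)"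
  proof (subst nn_integral_indicator[OF S[OF a], symmetric], rule nn_integral_mono)
   fix om
   show "indicator (S a) om \<le> ennreal (exp (- v / L^2)) * ennreal (exp (\<Sum>e\<in>I. if e \<in> J then (1 / L^2) * (om e)^2 else 0))"
   proof (cases "om \<in> S a")
    case True
    have eq: "(\<Sum>e\<in>I. if e \<in> J then (1 / L^2) * (om e)^2 else 0) = (\<Sum>b<d. (X om $$ (a, b))^2) / L^2"
     unfolding row_eq sum_divide_distrib by (intro sum.cong) auto
    have "v / L^2 \<le> (\<Sum>b<d. (X om $$ (a, b))^2) / L^2" using True by (intro divide_right_mono) (auto simp: S_def)
    thus ?thesis using True unfolding ennreal_exp_mult unfolding eq by simp
   qed simp
  qed
  also have "... = ennreal (exp (- v / L^2)) * (\<integral>\<^sup>+om. ennreal (exp (\<Sum>e\<in>I. (if e \<in> J then (1 / L^2) * (om e)^2 else 0))) \<partial>N I)"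
   by (intro nn_integral_cmult) measurable
  also have "... \<le> ennreal (exp (- v / L^2)) * ennreal (exp (\<Sum>e\<in>I. if e \<in> J then 2 * (1 / L^2) * sg^2 else 0))"
  proof (intro mult_left_mono product_mgf[OF finite_I, where f = "\<lambda>e x. if e \<in> J then (1 / L^2) * x^2 else 0"])
   fix e assume "e \<in> I"
   show "(\<integral>\<^sup>+x. ennreal (exp (if e \<in> J then (1 / L^2) * x^2 else 0)) \<partial>mu e) \<le> ennreal (exp (if e \<in> J then 2 * (1 / L^2) * sg^2 else 0))"
    using mgf_square_mu[of "1 / L^2" e] by (cases "e \<in> J") (auto simp: prob_space.emeasure_space_1[OF prob_mu])
  qed auto
  also have "... = ennreal (exp (- v / L^2 + real (card J) * (2 * (1 / L^2) * sg^2)))"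
   using J finite_I unfolding ennreal_exp_mult by (simp add: sum.If_cases Int_absorb1)
  also have "... \<le> ennreal (exp (- l))"
  proof (intro ennreal_leI, unfold exp_le_cancel_iff)
   have "real (card J) * (2 * (1 / L^2) * sg^2) \<le> real d * (2 * (1 / L^2) * sg^2)" using cardJ by (intro mult_right_mono) auto
   moreover have "v / L^2 = real d * (2 * (1 / L^2) * sg^2) + l" using L by (simp add: v_def add_divide_distrib)
   ultimately show "- v / L^2 + real (card J) * (2 * (1 / L^2) * sg^2) \<le> - l" by simp
  qed
  finally show ?thesis by (simp add: emeasure_eq_measure)
 qed
 have "{om \<in> space (N I). \<not> rows_bounded v om} = (\<Union>a<d. S a)" by (auto simp: rows_bounded_def S_def)
 also have "prob (\<Union>a<d. S a) \<le> (\<Sum>a<d. prob (S a))" using S by (intro finite_measure_subadditive_finite) auto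
 also have "... \<le> (\<Sum>a<d. exp (- l))" using row by (intro sum_mono) auto
 finally show ?thesis by (simp add: v_def)
qed

text \<open>The truncated moment is at most \<open>(4 * p * v) ^ p * d\<close>, and Markov's
  inequality is applied at the level \<open>(16 * p * v) ^ p\<close>; the ratio \<open>4^-p\<close>
  is at most \<open>exp (- l)\<close> because \<open>l \<le> p\<close>. The event is phrased through
  the moment, so its measurability is clear, and \<open>opb\<close> follows on it.\<close>

theorem operator_norm_tail:
 assumes l: "0 < l" and p: "l \<le> real p"
 obtains E where "E \<in> sets (N I)" "measure (N I) (space (N I) - E) \<le> 2 * real d * exp (- l)"
  "\<And>om. om \<in> E \<Longrightarrow> opb (X om) (4 * sqrt (real p * (2 * real d * sg^2 + l * L^2)))"
proof (rule that)
 define v where "v = 2 * real d * sg^2 + l * L^2"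
 have v: "0 < v" unfolding v_def using l L by (intro add_nonneg_pos) auto
 define c where "c = 4 * sqrt (real p * v)"
 have p0: "0 < p" using l p by simp
 have c2: "c^2 = 16 * real p * v" using v by (simp add: c_def)
 have c: "0 < c" using p0 v by (simp add: c_def)
 define f where "f om = trunc v om * (fro (X om ^\<^sub>m p))^2" for om
 define E where "E = {om \<in> space (N I). rows_bounded v om \<and> f om \<le> c ^ (2 * p)}"
 have f: "ae_bounded f" unfolding f_def
  by (intro ae_bounded_mult ae_bounded_indicator ae_bounded_fro_sq[of d d] ae_bounded_mat_pow ae_bounded_X rows_bounded_measurable)
 note [measurable] = ae_bounded_measurable[OF f]
 show E: "E \<in> sets (N I)" unfolding E_def by measurable
 show "opb (X om) (4 * sqrt (real p * (2 * real d * sg^2 + l * L^2)))" if "om \<in> E" for om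
  using that c unfolding v_def[symmetric] c_def[symmetric] by (intro opb_from_power[OF X p0]) (auto simp: E_def f_def)
 let ?B = "{om \<in> space (N I). c ^ (2 * p) \<le> f om}"
 have "prob ?B \<le> (\<integral>om. f om \<partial>N I) / c ^ (2 * p)"
  using c by (intro integral_Markov_inequality_measure[where A = "{}"] ae_bounded_integrable[OF f]) (auto simp: f_def)
 also have "... \<le> (4 * real p * v) ^ p * real d / c ^ (2 * p)" unfolding f_def using v by (intro divide_right_mono moment_bound) auto
 also have "... = real d * (1 / 4) ^ p"
 proof -
  have "16 * real p * v = (4 * real p * v) * 4" by simp
  hence c: "c ^ (2 * p) = (4 * real p * v) ^ p * 4 ^ p" unfolding power_mult c2 by (simp only: power_mult_distrib)
  show ?thesis unfolding c power_one_over using v by simp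
 qed
 also have "... \<le> real d * exp (- l)"
 proof (rule mult_left_mono)
  have "(1 / 4 :: real) \<le> exp (- 1)" using exp_le by (simp add: exp_minus inverse_eq_divide)
  hence "(1 / 4 :: real) ^ p \<le> exp (- 1) ^ p" by (intro power_mono) auto
  also have "... \<le> exp (- l)" using p by (simp flip: exp_of_nat_mult)
  finally show "(1 / 4 :: real) ^ p \<le> exp (- l)" .
 qed simp
 finally have B: "prob ?B \<le> real d * exp (- l)" .
 have sets: "{om \<in> space (N I). \<not> rows_bounded v om} \<in> sets (N I)" "?B \<in> sets (N I)" by measurable
 have "space (N I) - E \<subseteq> {om \<in> space (N I). \<not> rows_bounded v om} \<union> ?B" by (auto simp: E_def)
 hence "prob (space (N I) - E) \<le> prob ({om \<in> space (N I). \<not> rows_bounded v om} \<union> ?B)"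
  by (intro finite_measure_mono sets.Un sets) auto
 also have "... \<le> prob {om \<in> space (N I). \<not> rows_bounded v om} + prob ?B" by (intro measure_Un_le sets)
 also have "... \<le> real d * exp (- l) + real d * exp (- l)" using rows_bounded_prob[of l] l B by (intro add_mono) (auto simp: v_def)
 finally show "prob (space (N I) - E) \<le> 2 * real d * exp (- l)" by simp
qed

end

section \<open>Resolvents revealed column by column\<close>

text \<open>\<open>column_resolvent n z H k\<close> is the inverse of \<open>z - H\<^sub>k\<close>, where \<open>H\<^sub>k\<close> consists of the first \<open>k\<close>
 columns of \<open>H\<close>, computed by rank-one (Sherman-Morrison) updates.\<close>

primrec column_resolvent :: "nat \<Rightarrow> complex \<Rightarrow> (nat \<Rightarrow> nat \<Rightarrow> real) \<Rightarrow> nat \<Rightarrow> nat \<Rightarrow> nat \<Rightarrow> complex" where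
 "column_resolvent n z H 0 = (\<lambda>i j. if i = j then 1 / z else 0)"
| "column_resolvent n z H (Suc k) = (\<lambda>i j. column_resolvent n z H k i j
  + (\<Sum>m<n. column_resolvent n z H k i m * H m k) * column_resolvent n z H k k j
   / (1 - (\<Sum>m<n. column_resolvent n z H k k m * H m k)))"

text \<open>The row vector \<open>a^T (z - H_k)^-1\<close>. Applied to the fresh column
  \<open>k\<close> it gives \<open>next_form\<close>, applied to a fixed vector \<open>b\<close> it
  gives \<open>resolvent_form\<close>.\<close>

definition resolvent_row :: "nat \<Rightarrow> complex \<Rightarrow> (nat \<Rightarrow> nat \<Rightarrow> real) \<Rightarrow> (nat \<Rightarrow> real) \<Rightarrow> nat \<Rightarrow> nat \<Rightarrow> complex" where
 "resolvent_row n z H a k j = (\<Sum>i<n. a i * column_resolvent n z H k i j)"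

definition next_form :: "nat \<Rightarrow> complex \<Rightarrow> (nat \<Rightarrow> nat \<Rightarrow> real) \<Rightarrow> (nat \<Rightarrow> real) \<Rightarrow> nat \<Rightarrow> complex" where
 "next_form n z H a k = (\<Sum>m<n. resolvent_row n z H a k m * H m k)"

definition resolvent_form ::
 "nat \<Rightarrow> complex \<Rightarrow> (nat \<Rightarrow> nat \<Rightarrow> real) \<Rightarrow> (nat \<Rightarrow> real) \<Rightarrow> (nat \<Rightarrow> real) \<Rightarrow> nat \<Rightarrow> complex" where
 "resolvent_form n z H b a k = (\<Sum>j<n. resolvent_row n z H a k j * b j)"

definition basis_fun :: "nat \<Rightarrow> nat \<Rightarrow> real" where "basis_fun k = (\<lambda>i. if i = k then 1 else 0)"

lemma sum_basis_fun: "k < n \<Longrightarrow> (\<Sum>i<n. cor (basis_fun k i) * f i) = f k"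
 by (simp add: basis_fun_def if_distrib if_distribR cong: if_cong)

lemma resolvent_row_basis: "k < n \<Longrightarrow> resolvent_row n z H (basis_fun k) m j = column_resolvent n z H m k j"
 by (simp add: resolvent_row_def sum_basis_fun)

lemma resolvent_row_0: "j < n \<Longrightarrow> resolvent_row n z H a 0 j = a j / z" by (simp add: resolvent_row_def if_distrib cong: if_cong)

lemma resolvent_form_0: "resolvent_form n z H b a 0 = (\<Sum>j<n. a j * b j) / z" by (simp add: resolvent_form_def resolvent_row_0 sum_divide_distrib)

lemma resolvent_row_Suc:
 assumes k: "k < n" shows "resolvent_row n z H a (Suc k) j = resolvent_row n z H a k j
  + next_form n z H a k * resolvent_row n z H (basis_fun k) k j / (1 - next_form n z H (basis_fun k) k)"
proof -
 have "next_form n z H a k = (\<Sum>i<n. a i * (\<Sum>m<n. column_resolvent n z H k i m * H m k))"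
  unfolding next_form_def resolvent_row_def sum_distrib_left sum_distrib_right mult.assoc by (rule sum.swap)
 moreover have "next_form n z H (basis_fun k) k = (\<Sum>m<n. column_resolvent n z H k k m * H m k)"
  unfolding next_form_def by (simp add: resolvent_row_basis[OF k])
 moreover have "(\<Sum>i<n. cor (a i) * (f i + u i * g / d)) = (\<Sum>i<n. a i * f i) + (\<Sum>i<n. a i * u i) * g / d"
  for f u :: "nat \<Rightarrow> complex" and g d by (simp add: distrib_left sum_distrib_right sum_divide_distrib mult.assoc)
 ultimately show ?thesis unfolding resolvent_row_basis[OF k] resolvent_row_def[of n z H a] by simp
qed

lemma resolvent_form_Suc:
 assumes k: "k < n" shows "resolvent_form n z H b a (Suc k) = resolvent_form n z H b a k
  + next_form n z H a k * resolvent_form n z H b (basis_fun k) k / (1 - next_form n z H (basis_fun k) k)"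
 unfolding resolvent_form_def resolvent_row_Suc[OF k] by (simp add: distrib_right sum_divide_distrib sum_distrib_left mult.assoc)

lemma column_resolvent_cong:
 assumes "\<And>i j. \<lbrakk>i < n; j < k\<rbrakk> \<Longrightarrow> H i j = H' i j" shows "column_resolvent n z H k = column_resolvent n z H' k"
 using assms
proof (induction k)
 case (Suc k)
 show ?case using Suc by simp
qed simp

lemma resolvent_row_cong:
 "(\<And>i j. \<lbrakk>i < n; j < k\<rbrakk> \<Longrightarrow> H i j = H' i j) \<Longrightarrow> resolvent_row n z H a k = resolvent_row n z H' a k"
 by (rule ext) (simp add: resolvent_row_def column_resolvent_cong[of n k H H'])

lemma resolvent_form_cong:
 "(\<And>i j. \<lbrakk>i < n; j < k\<rbrakk> \<Longrightarrow> H i j = H' i j) \<Longrightarrow> resolvent_form n z H b a k = resolvent_form n z H' b a k"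
 by (simp add: resolvent_form_def resolvent_row_cong[of n k H H'])

text \<open>The row solves \<open>p (z - H_k) = a\<close>. This is verified by induction along the
  rank-one updates instead of through matrix inversion; earlier columns, the new column and later
  columns behave differently, hence the three cases.\<close>

lemma resolvent_row_equation:
 assumes z: "z \<noteq> 0" and k: "k \<le> n" and ne: "\<And>j. j < k \<Longrightarrow> next_form n z H (basis_fun j) j \<noteq> 1" and j: "j < n"
 shows "z * resolvent_row n z H a k j - (if j < k then \<Sum>m<n. resolvent_row n z H a k m * H m j else 0) = a j" using k ne
proof (induction k arbitrary: a)
 case 0
 thus ?case using z j by (simp add: resolvent_row_0)
next
 case (Suc k)
 hence kn: "k < n" by simp
 let ?p = "\<lambda>a. resolvent_row n z H a k" and ?u = "next_form n z H a k" and ?w = "next_form n z H (basis_fun k) k"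
 have IH: "z * ?p a j = (if j < k then \<Sum>m<n. ?p a m * H m j else 0) + a j" for a using Suc.IH[of a] Suc.prems by (simp add: algebra_simps)
 have w: "1 - ?w \<noteq> 0" using Suc.prems(2)[of k] by simp
 have S: "(\<Sum>m<n. resolvent_row n z H a (Suc k) m * H m j)
  = (\<Sum>m<n. ?p a m * H m j) + ?u / (1 - ?w) * (\<Sum>m<n. ?p (basis_fun k) m * H m j)"
  unfolding resolvent_row_Suc[OF kn] by (simp add: distrib_right sum_distrib_left mult.assoc)
 have P: "resolvent_row n z H a (Suc k) j = ?p a j + ?u / (1 - ?w) * ?p (basis_fun k) j" unfolding resolvent_row_Suc[OF kn] by simp
 consider "j < k" | "j = k" | "k < j" by linarith
 thus ?case
 proof cases
  case 1
  thus ?thesis using IH[of a] IH[of "basis_fun k"] unfolding S P by (simp add: basis_fun_def algebra_simps)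
 next
  case 2
  have "z * (?p a k + t * ?p (basis_fun k) k) = a k + t" for t :: complex using IH[of a] IH[of "basis_fun k"] 2 by (simp add: algebra_simps basis_fun_def)
  from this[of "?u / (1 - ?w)"] have "z * (?p a k + ?u * ?p (basis_fun k) k / (1 - ?w)) = a k + ?u / (1 - ?w)" by simp
  moreover have "?u + ?u / (1 - ?w) * ?w = ?u / (1 - ?w)" using w by (simp add: field_simps)
  ultimately show ?thesis unfolding 2 unfolding S[unfolded 2] P[unfolded 2] by (simp add: next_form_def)
 next
  case 3
  show ?thesis using IH[of "basis_fun k"] z IH[of a] 3 unfolding P by (simp add: basis_fun_def)
 qed
qed

text \<open>The equation gives \<open>rh |p| \<le> |a| + rh / 8 |p|\<close>; dropping the columns
  from \<open>k\<close> on only shortens the second term. The norm bound is for real vectors, so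
  real and imaginary parts are treated separately.\<close>

lemma resolvent_row_norm:
 fixes H :: "nat \<Rightarrow> nat \<Rightarrow> real"
 assumes rh: "0 < rh" "cmod z = rh"
  and norm: "\<And>x :: nat \<Rightarrow> real. (\<Sum>j<n. (\<Sum>i<n. x i * H i j)^2) \<le> (rh / 8)^2 * (\<Sum>i<n. (x i)^2)"
  and a: "(\<Sum>i<n. (a i)^2) \<le> 1"
  and eq: "\<And>j. j < n \<Longrightarrow> z * p j - (if j < k then \<Sum>m<n. p m * H m j else 0) = cor (a j)"
 shows "(\<Sum>j<n. (cmod (p j))^2) \<le> (2 / rh)^2"
proof -
 define P where "P = L2_set (\<lambda>j. cmod (p j)) {..<n}"
 have P0: "0 \<le> P" by (simp add: P_def)
 have Psq: "(\<Sum>j<n. (cmod (p j))^2) = P^2" by (simp add: P_def L2_set_def sum_nonneg)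
 let ?c = "\<lambda>j. \<Sum>m<n. p m * cor (H m j)"
 have "L2_set (\<lambda>j. cmod (?c j)) {..<n} \<le> rh / 8 * P"
 proof (rule power2_le_imp_le)
  have "(L2_set (\<lambda>j. cmod (?c j)) {..<n})^2 = (\<Sum>j<n. (\<Sum>m<n. Re (p m) * H m j)^2) + (\<Sum>j<n. (\<Sum>m<n. Im (p m) * H m j)^2)"
   by (simp add: cmod_power2 L2_set_def sum_nonneg)
  also have "... \<le> (rh / 8)^2 * (\<Sum>i<n. (Re (p i))^2) + (rh / 8)^2 * (\<Sum>i<n. (Im (p i))^2)" by (intro add_mono norm)
  also have "... = (rh / 8)^2 * (\<Sum>i<n. (cmod (p i))^2)" by (simp add: cmod_power2 distrib_left)
  finally show "(L2_set (\<lambda>j. cmod (?c j)) {..<n})^2 \<le> (rh / 8 * P)^2" unfolding Psq by (simp add: power_mult_distrib power_divide)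
 qed (use rh P0 in simp)
 note c = this
 have "rh * P = L2_set (\<lambda>j. rh * cmod (p j)) {..<n}" using rh by (simp add: P_def L2_set_right_distrib)
 also have "... \<le> L2_set (\<lambda>j. \<bar>a j\<bar> + cmod (?c j)) {..<n}"
 proof (rule L2_set_mono)
  fix j assume "j \<in> {..<n}"
  hence "cmod (z * p j) = cmod (a j + (if j < k then ?c j else 0))" using eq[of j] by (simp add: algebra_simps split: if_splits)
  hence "rh * cmod (p j) = cmod (a j + (if j < k then ?c j else 0))" unfolding norm_mult rh(2) .
  also have "... \<le> \<bar>a j\<bar> + cmod (?c j)" using norm_triangle_ineq[of "cor (a j)" "if j < k then ?c j else 0"] by auto
  finally show "rh * cmod (p j) \<le> \<bar>a j\<bar> + cmod (?c j)" .
 qed (use rh in auto)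
 also have "... \<le> L2_set (\<lambda>j. \<bar>a j\<bar>) {..<n} + L2_set (\<lambda>j. cmod (?c j)) {..<n}" by (rule L2_set_triangle_ineq)
 also have "L2_set (\<lambda>j. \<bar>a j\<bar>) {..<n} \<le> 1" using a by (simp add: L2_set_def)
 finally have "P \<le> 2 / rh" using c rh by (simp add: field_simps)
 thus ?thesis unfolding Psq using P0 by (intro power_mono)
qed

text \<open>Writing \<open>1 / (1 - w)\<close> as \<open>1 + w / (1 - w)\<close> separates the part
  linear in the fresh column from a second-order rest.\<close>

lemma norm_increment_le:
 assumes w: "cmod w \<le> 1 / 2" and ze: "cmod ze = 1" shows "Re (ze * (u * v / (1 - w))) \<le> Re (ze * v * u) + 2 * (cmod v * cmod u * cmod w)"
proof -
 have ne: "1 - w \<noteq> 0" using w by auto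
 have inv: "1 / cmod (1 - w) \<le> 2" using norm_triangle_ineq2[of 1 w] w ne by (simp add: field_simps)
 have "cmod (ze * (u * v / (1 - w)) - ze * v * u) = (cmod v * cmod u * cmod w) * (1 / cmod (1 - w))"
  using ne by (simp add: norm_mult norm_divide ze field_simps)
 also have "... \<le> (cmod v * cmod u * cmod w) * 2" using inv by (intro mult_left_mono) auto
 finally show ?thesis using complex_Re_le_cmod[of "ze * (u * v / (1 - w)) - ze * v * u"] by simp
qed

text \<open>The inequality of arithmetic and geometric means decouples the two parts: the linear one
  keeps an exponential moment at twice the parameter, while for the second-order one
  \<open>exp R \<le> 1 + 2 R\<close> reduces everything to second moments.\<close>

lemma exp_increment_le:
 assumes w: "cmod w \<le> 1 / 2" and ze: "cmod ze = 1" and th: "0 \<le> th" and small: "4 * th * cmod v * (cmod u * cmod w) \<le> 1"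
 shows "exp (th * Re (ze * (u * v / (1 - w))))
  \<le> exp (2 * th * Re (ze * v * u)) / 2 + (1 + 4 * th * cmod v * ((cmod u)^2 + (cmod w)^2)) / 2"
proof -
 define R where "R = 4 * th * cmod v * (cmod u * cmod w)"
 have R: "0 \<le> R" "R \<le> 1" using th small by (auto simp: R_def)
 let ?x = "th * Re (ze * v * u)"
 have "th * Re (ze * (u * v / (1 - w))) \<le> th * (Re (ze * v * u) + 2 * (cmod v * cmod u * cmod w))"
  using norm_increment_le[OF w ze] th by (rule mult_left_mono)
 also have "... = ?x + R / 2" by (simp add: R_def algebra_simps)
 finally have "exp (th * Re (ze * (u * v / (1 - w)))) \<le> exp ?x * exp (R / 2)" by (simp flip: exp_add)
 also have "... \<le> ((exp ?x)^2 + (exp (R / 2))^2) / 2" using sum_squares_bound[of "exp ?x" "exp (R / 2)"] by simp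
 also have "... = exp (2 * ?x) / 2 + exp R / 2" using exp_double[of ?x] exp_double[of "R / 2"] by simp
 also have "exp R \<le> 1 + R + R^2" using R by (intro exp_le_quadratic) auto
 also have "R^2 \<le> R" using R by (simp add: power2_eq_square mult_left_le)
 also have "2 * R \<le> 4 * th * cmod v * ((cmod u)^2 + (cmod w)^2)"
 proof -
  have "4 * th * cmod v * (2 * cmod u * cmod w) \<le> 4 * th * cmod v * ((cmod u)^2 + (cmod w)^2)"
   using sum_squares_bound th by (intro mult_left_mono) auto
  thus ?thesis by (simp add: R_def)
 qed
 hence "exp (2 * ?x) / 2 + (1 + R + R) / 2 \<le> exp (2 * ?x) / 2 + (1 + 4 * th * cmod v * ((cmod u)^2 + (cmod w)^2)) / 2" by simp
 finally show ?thesis by (simp add: mult.assoc)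
qed

context symmetric_product
begin

text \<open>Mixed products integrate to zero by flipping a single sign.\<close>

lemma second_moment:
 fixes al :: "'i \<Rightarrow> real"
 assumes J: "J \<subseteq> I"
 shows "(\<integral>\<^sup>+y. ennreal ((\<Sum>i\<in>J. al i * y i)^2) \<partial>N J) \<le> ennreal (sg^2 * (\<Sum>i\<in>J. (al i)^2))"
proof -
 interpret prob_space "N J" by (rule prob_N)
 interpret PJ: product_prob_space mu J using prob_mu by (intro product_prob_spaceI)
 have fin: "finite J" using finite_I J finite_subset by blast
 have int: "integrable (N J) (\<lambda>y. y i * y j)" if ij: "i \<in> J" "j \<in> J" for i j
 proof (rule integrable_const_bound)
  show "AE y in N J. norm (y i * y j) \<le> L * L" using AE_bounded[OF J]
  proof eventually_elim
   case (elim y)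
   thus ?case using ij unfolding real_norm_def abs_mult by (intro mult_mono) auto
  qed
 qed (use ij in measurable)
 have off: "(\<integral>y. y i * y j \<partial>N J) = 0" if ij: "i \<in> J" "j \<in> J" "i \<noteq> j" for i j
  by (rule integral_odd_eq_0[OF fin, where s = "\<lambda>k. if k = i then - 1 else 1"])
   (use ij in \<open>auto simp: flip_def intro!: borel_measurable_times\<close>)
 have diag: "(\<integral>y. y i * y i \<partial>N J) \<le> sg^2" if i: "i \<in> J" for i
 proof -
  have "(\<integral>x. x^2 \<partial>mu i) = (\<integral>x. x^2 \<partial>distr (N J) (mu i) (\<lambda>y. y i))" using PJ.PiM_component[OF i] by simp
  also have "... = (\<integral>y. (y i)^2 \<partial>N J)"
   using i by (intro integral_distr) (auto simp: measurable_cong_sets[OF sets_mu refl])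
  finally show ?thesis using second_mu[of i] by (simp add: power2_eq_square)
 qed
 have sq: "(\<Sum>i\<in>J. al i * y i)^2 = (\<Sum>i\<in>J. \<Sum>j\<in>J. al i * al j * (y i * y j))" for y
  unfolding power2_eq_square sum_product by (intro sum.cong) auto
 have intsq: "integrable (N J) (\<lambda>y. (\<Sum>i\<in>J. al i * y i)^2)" unfolding sq
  by (intro Bochner_Integration.integrable_sum integrable_mult_right int)
 have "(\<integral>\<^sup>+y. ennreal ((\<Sum>i\<in>J. al i * y i)^2) \<partial>N J) = ennreal (\<integral>y. (\<Sum>i\<in>J. al i * y i)^2 \<partial>N J)"
  by (intro nn_integral_eq_integral intsq) auto
 also have "(\<integral>y. (\<Sum>i\<in>J. al i * y i)^2 \<partial>N J) = (\<Sum>i\<in>J. \<Sum>j\<in>J. al i * al j * (\<integral>y. y i * y j \<partial>N J))"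
 proof -
  have "(\<integral>y. (\<Sum>i\<in>J. \<Sum>j\<in>J. al i * al j * (y i * y j)) \<partial>N J) = (\<Sum>i\<in>J. \<integral>y. (\<Sum>j\<in>J. al i * al j * (y i * y j)) \<partial>N J)"
   by (intro Bochner_Integration.integral_sum Bochner_Integration.integrable_sum integrable_mult_right int)
  also have "... = (\<Sum>i\<in>J. \<Sum>j\<in>J. \<integral>y. al i * al j * (y i * y j) \<partial>N J)"
   by (intro sum.cong refl Bochner_Integration.integral_sum integrable_mult_right int)
  finally show ?thesis unfolding sq by simp
 qed
 also have "... = (\<Sum>i\<in>J. \<Sum>j\<in>J. if j = i then al i * al i * (\<integral>y. y i * y i \<partial>N J) else 0)"
  by (intro sum.cong refl) (auto simp: off)
 also have "... = (\<Sum>i\<in>J. (al i)^2 * (\<integral>y. y i * y i \<partial>N J))" using fin by (simp add: power2_eq_square)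
 also have "ennreal ... \<le> ennreal (sg^2 * (\<Sum>i\<in>J. (al i)^2))"
  unfolding sum_distrib_left mult.commute[of "sg^2"] by (intro ennreal_leI sum_mono mult_left_mono diag) auto
 finally show ?thesis .
qed

lemma second_moment_complex:
 fixes al :: "'i \<Rightarrow> complex"
 assumes J: "J \<subseteq> I"
 shows "(\<integral>\<^sup>+y. ennreal ((cmod (\<Sum>i\<in>J. al i * cor (y i)))^2) \<partial>N J) \<le> ennreal (sg^2 * (\<Sum>i\<in>J. (cmod (al i))^2))"
proof -
 have "(\<integral>\<^sup>+y. ennreal ((cmod (\<Sum>i\<in>J. al i * cor (y i)))^2) \<partial>N J)
  = (\<integral>\<^sup>+y. ennreal ((\<Sum>i\<in>J. Re (al i) * y i)^2) + ennreal ((\<Sum>i\<in>J. Im (al i) * y i)^2) \<partial>N J)"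
  by (intro nn_integral_cong) (simp add: cmod_power2 ennreal_plus[symmetric] del: ennreal_plus)
 also have "... = (\<integral>\<^sup>+y. ennreal ((\<Sum>i\<in>J. Re (al i) * y i)^2) \<partial>N J) + (\<integral>\<^sup>+y. ennreal ((\<Sum>i\<in>J. Im (al i) * y i)^2) \<partial>N J)"
  by (intro nn_integral_add) measurable
 also have "... \<le> ennreal (sg^2 * (\<Sum>i\<in>J. (Re (al i))^2)) + ennreal (sg^2 * (\<Sum>i\<in>J. (Im (al i))^2))"
  by (intro add_mono second_moment J)
 finally show ?thesis by (simp add: cmod_power2 sum.distrib distrib_left sum_nonneg flip: ennreal_plus)
qed

end

text \<open>A fixed point \<open>z\<close> on the circle of radius \<open>rh\<close>, a fixed right
  vector \<open>b\<close> and finitely many left vectors \<open>AA\<close>. The basis vectors belong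
  to \<open>AA\<close> because every rank-one update involves the resolvent row of the new
  index.\<close>

locale resolvent_process = symmetric_product I mu sg L for I :: "'i set" and mu sg L +
 fixes n :: nat and h :: "nat \<Rightarrow> nat \<Rightarrow> 'i" and b :: "nat \<Rightarrow> real" and AA :: "(nat \<Rightarrow> real) set"
  and z :: complex and rh l b0 :: real
 assumes h_I: "\<And>i j. \<lbrakk>i < n; j < n\<rbrakk> \<Longrightarrow> h i j \<in> I"
  and h_inj: "\<And>i j i' j'. \<lbrakk>i < n; j < n; i' < n; j' < n; h i j = h i' j'\<rbrakk> \<Longrightarrow> i = i' \<and> j = j'"
  and AA: "finite AA" "\<And>k. k < n \<Longrightarrow> basis_fun k \<in> AA" "\<And>a. a \<in> AA \<Longrightarrow> (\<Sum>i<n. (a i)^2) \<le> 1"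
  and b: "(\<Sum>i<n. (b i)^2) \<le> 1" "\<And>i. i < n \<Longrightarrow> \<bar>b i\<bar> \<le> b0" "0 \<le> b0"
  and z: "cmod z = rh" and l: "1 \<le> l" and rh_sg: "64 * sqrt (l * real n) * sg \<le> rh" and rh_L: "256 * l^2 * L \<le> rh"
begin

text \<open>\<open>T / rh^2\<close> is the deviation scale, and \<open>th\<close> is chosen so that
  reaching it is worth \<open>exp (2 * l)\<close>. \<open>\<tau>\<close> bounds the forms in the
  fresh column, \<open>bb k\<close> bounds the form whose left vector is the basis vector
  \<open>k\<close>, and \<open>inc k\<close> is the logarithmic growth allowed in step
  \<open>k\<close>.\<close>

definition "T = 32 * (sqrt l * sg + l * L * b0)"
definition "th = 2 * l * rh^2 / T"
definition "\<tau> = 16 * l * L / rh"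
definition "bb k = (\<bar>b k\<bar> + 2 * T / rh) / rh" for k :: nat
definition "inc k = 16 * th^2 * sg^2 * (bb k)^2 / rh^2 + 32 * th * bb k * sg^2 / rh^2" for k :: nat

lemma T: "0 < T" "32 * sqrt l * sg \<le> T" "32 * l * L * b0 \<le> T"
proof -
 have "0 < sqrt l * sg" "0 \<le> l * L * b0" using l sg b(3) by auto
 thus "0 < T" "32 * sqrt l * sg \<le> T" "32 * l * L * b0 \<le> T" by (auto simp: T_def)
qed

lemma rh: "0 < rh"
proof -
 have "0 < 256 * l^2 * L" using l L by simp
 thus ?thesis using rh_L by linarith
qed

lemma z0: "z \<noteq> 0" using z rh by auto

lemma th: "0 < th" using T rh l by (simp add: th_def)

lemma bb_nonneg: "0 \<le> bb k" using T rh by (simp add: bb_def)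

lemma lL_rh: "256 * l * L \<le> rh"
proof -
 have "256 * L * l \<le> 256 * L * l^2" using l L by (intro mult_left_mono) (auto simp: power2_eq_square)
 thus ?thesis using rh_L by (simp add: mult_ac)
qed

lemma bb_bound: "k < n \<Longrightarrow> 8 * l * L * bb k * rh \<le> T"
proof -
 assume k: "k < n"
 have "8 * l * L * bb k * rh = 8 * l * L * \<bar>b k\<bar> + (16 * l * L) * T / rh" using rh by (simp add: bb_def field_simps)
 also have "8 * l * L * \<bar>b k\<bar> \<le> 8 * l * L * b0" using l L b(2)[OF k] by simp
 also have "(16 * l * L) * T / rh \<le> (rh / 16) * T / rh" using lL_rh T rh by (intro divide_right_mono mult_right_mono) auto
 finally show ?thesis using rh T by simp
qed

lemma linear_small: "k < n \<Longrightarrow> 4 * th * bb k * L / rh \<le> 1"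
proof -
 assume k: "k < n"
 have "4 * th * bb k * L / rh = 8 * l * L * bb k * rh / T" by (simp add: th_def power2_eq_square)
 thus ?thesis using bb_bound[OF k] T(1) by simp
qed

lemma quadratic_small: "k < n \<Longrightarrow> 4 * th * bb k * \<tau>^2 \<le> 1"
proof -
 assume k: "k < n"
 have "4 * th * bb k * \<tau>^2 = (8 * l * L * bb k * rh / T) * (256 * l^2 * L / rh)" by (simp add: th_def \<tau>_def power2_eq_square)
 also have "... \<le> 1 * 1" using bb_bound[OF k] T(1) rh rh_L L by (intro mult_mono) auto
 finally show ?thesis by simp
qed

lemma \<tau>: "0 \<le> \<tau>" "\<tau> \<le> 1 / 2" using lL_rh l L rh by (simp_all add: \<tau>_def)

text \<open>The total growth is at most half of the exponent \<open>2 * l\<close> gained on exit.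
  The squares of \<open>bb\<close> are summed using the norm of \<open>b\<close>, their first powers
  by Cauchy-Schwarz, and the contributions of \<open>2 * T / rh\<close> are absorbed by
  \<open>rh_sg\<close>.\<close>

lemma sum_inc: "(\<Sum>k<n. inc k) \<le> l"
proof -
 define s where "s = sqrt (l * real n) * sg / rh"
 have s0: "0 \<le> s" using l sg rh by (simp add: s_def)
 have s: "s \<le> 1 / 64" using rh_sg rh by (simp add: s_def)
 have ssq: "s^2 = l * real n * sg^2 / rh^2" using l by (simp add: s_def power_mult_distrib power_divide)
 have s2: "s^2 \<le> 1 / 4096" using power_mono[OF s s0, of 2] by (simp add: power2_eq_square)
 have lT: "l * sg^2 / T^2 \<le> 1 / 1024"
 proof -
  have "(32 * sqrt l * sg)^2 \<le> T^2" using T l sg by simp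
  thus ?thesis using l T(1) by (simp add: field_simps)
 qed
 have sb: "(\<Sum>k<n. \<bar>b k\<bar>) \<le> sqrt (real n)"
 proof -
  have "(\<Sum>k<n. \<bar>b k\<bar> * \<bar>1\<bar>) \<le> L2_set b {..<n} * L2_set (\<lambda>_. 1) {..<n}" by (rule L2_set_mult_ineq)
  also have "... \<le> 1 * sqrt (real n)" using b(1) by (intro mult_mono) (auto simp: L2_set_def)
  finally show ?thesis by simp
 qed
 have lin: "(\<Sum>k<n. bb k) \<le> sqrt (real n) / rh + 2 * real n * T / rh^2"
 proof -
  have "(\<Sum>k<n. bb k) = (\<Sum>k<n. \<bar>b k\<bar>) / rh + 2 * real n * T / rh^2"
   by (simp add: bb_def add_divide_distrib sum_divide_distrib power2_eq_square)
  thus ?thesis using sb rh by (simp add: divide_right_mono)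
 qed
 have quad: "(\<Sum>k<n. (bb k)^2) \<le> (2 + 8 * real n * T^2 / rh^2) / rh^2"
 proof -
  have "(\<Sum>k<n. (bb k)^2) \<le> (\<Sum>k<n. (2 * (b k)^2 + 8 * T^2 / rh^2) / rh^2)"
  proof (rule sum_mono)
   fix k
   show "(bb k)^2 \<le> (2 * (b k)^2 + 8 * T^2 / rh^2) / rh^2"
    using sum_squares_bound[of "\<bar>b k\<bar>" "2 * T / rh"] by (simp add: bb_def power_divide divide_right_mono power2_sum)
  qed
  also have "... = (2 * (\<Sum>k<n. (b k)^2) + 8 * real n * T^2 / rh^2) / rh^2"
   by (simp add: sum_divide_distrib[symmetric] sum_distrib_left[symmetric])
  also have "... \<le> (2 + 8 * real n * T^2 / rh^2) / rh^2" using b(1) by (intro divide_right_mono) auto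
  finally show ?thesis .
 qed
 have "(\<Sum>k<n. inc k) = 16 * th^2 * sg^2 / rh^2 * (\<Sum>k<n. (bb k)^2) + 32 * th * sg^2 / rh^2 * (\<Sum>k<n. bb k)"
  by (simp add: inc_def sum_distrib_left sum_divide_distrib mult_ac)
 also have "... \<le> 16 * th^2 * sg^2 / rh^2 * ((2 + 8 * real n * T^2 / rh^2) / rh^2)
   + 32 * th * sg^2 / rh^2 * (sqrt (real n) / rh + 2 * real n * T / rh^2)" using th lin quad by (intro add_mono mult_left_mono) auto
 also have "16 * th^2 * sg^2 / rh^2 * ((2 + 8 * real n * T^2 / rh^2) / rh^2) = l * (128 * (l * sg^2 / T^2) + 512 * s^2)"
  unfolding ssq th_def using T(1) rh by (simp add: field_simps power2_eq_square)
 also have "... \<le> l * (1 / 4)"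
 proof (rule mult_left_mono)
  show "128 * (l * sg^2 / T^2) + 512 * s^2 \<le> 1 / 4" using lT s2 by linarith
 qed (use l in simp)
 also have "32 * th * sg^2 / rh^2 * (sqrt (real n) / rh + 2 * real n * T / rh^2)
   = 64 * (sqrt l * sg / T) * s + 128 * s^2"
 proof -
  have sl: "sqrt l * sqrt l = l" using l by simp
  have "64 * (sqrt l * sg / T) * s = 64 * (sqrt l * sqrt l) * sg^2 * sqrt (real n) / (T * rh)" by (simp add: s_def real_sqrt_mult power2_eq_square)
  hence e: "64 * (sqrt l * sg / T) * s = 64 * l * sg^2 * sqrt (real n) / (T * rh)" unfolding sl .
  show ?thesis unfolding e ssq th_def using T(1) by (simp add: field_simps)
 qed
 also have "64 * (sqrt l * sg / T) * s \<le> 64 * (1 / 32) * (1 / 64)" using T(1,2) s s0 l sg by (intro mult_mono) (auto simp: field_simps)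
 finally show ?thesis using s2 l by simp
qed

abbreviation "Hm om \<equiv> \<lambda>i j. om (h i j)" for om :: "'i \<Rightarrow> real"
abbreviation "rrow a k om \<equiv> resolvent_row n z (Hm om) a k"
abbreviation "ph a k om \<equiv> next_form n z (Hm om) a k"
abbreviation "f a k om \<equiv> resolvent_form n z (Hm om) b a k"

definition "ok k om \<longleftrightarrow> (\<forall>a\<in>AA. (\<Sum>j<n. (cmod (rrow a k om j))^2) \<le> (2 / rh)^2 \<and> cmod (f a k om - f a 0 om) \<le> 2 * T / rh^2)"
definition "small k om \<longleftrightarrow> (\<forall>a\<in>AA. cmod (ph a k om) \<le> \<tau>)"
text \<open>The history before column \<open>k\<close> is revealed. \<open>ok k\<close> involves
  only columns before \<open>k\<close>, whereas \<open>small k\<close> involves column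
  \<open>k\<close> itself; hence the different ranges.\<close>

definition "Q k om \<longleftrightarrow> (\<forall>j\<le>k. ok j om) \<and> (\<forall>j<k. small j om)"
definition "fresh k = (\<lambda>m. h m k) ` {..<n}"
text \<open>Coefficients are indexed by the coordinates of column \<open>k\<close> instead of by row
  numbers, to match the tail bounds on product spaces.\<close>

definition "coef a k i om = rrow a k om (the_inv_into {..<n} (\<lambda>m. h m k) i)"

lemma h_measurable [measurable]: "\<lbrakk>i < n; j < n\<rbrakk> \<Longrightarrow> (\<lambda>om. om (h i j)) \<in> BM" using h_I by simp

lemma h_measurable_complex: "\<lbrakk>i < n; j < n\<rbrakk> \<Longrightarrow> (\<lambda>om. cor (om (h i j))) \<in> BM" by simp

lemma resolvent_measurable: "\<lbrakk>k \<le> n; i < n\<rbrakk> \<Longrightarrow> (\<lambda>om. column_resolvent n z (Hm om) k i j) \<in> BM"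
proof (induction k arbitrary: i j)
 case (Suc k)
 have kn: "k < n" using Suc.prems by simp
 have G: "(\<lambda>om. column_resolvent n z (Hm om) k i j) \<in> BM" if "i < n" for i j using Suc that by simp
 have S: "(\<lambda>om. \<Sum>m<n. column_resolvent n z (Hm om) k i m * cor (om (h m k))) \<in> BM" if "i < n" for i
  using that kn by (intro borel_measurable_sum borel_measurable_times G h_measurable_complex) auto
 show ?case unfolding column_resolvent.simps
  by (intro borel_measurable_add borel_measurable_times borel_measurable_divide borel_measurable_diff borel_measurable_const G S kn Suc.prems)
qed simp

lemma row_measurable [measurable]: "k \<le> n \<Longrightarrow> (\<lambda>om. rrow a k om j) \<in> BM"
 unfolding resolvent_row_def by (intro borel_measurable_sum borel_measurable_times borel_measurable_const resolvent_measurable) auto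

lemma ph_measurable [measurable]: "k < n \<Longrightarrow> (\<lambda>om. ph a k om) \<in> BM" unfolding next_form_def by simp

lemma f_measurable [measurable]: "k \<le> n \<Longrightarrow> (\<lambda>om. f a k om) \<in> BM" unfolding resolvent_form_def by simp

lemma ok_measurable [measurable]: "k \<le> n \<Longrightarrow> Measurable.pred (N I) (ok k)" unfolding ok_def using AA(1) by measurable

lemma small_measurable [measurable]: "k < n \<Longrightarrow> Measurable.pred (N I) (small k)" unfolding small_def using AA(1) by measurable

lemma Q_measurable [measurable]: "k \<le> n \<Longrightarrow> Measurable.pred (N I) (Q k)"
proof -
 assume k: "k \<le> n"
 have Q_eq: "Q k = (\<lambda>om. (\<forall>j\<in>{..k}. ok j om) \<and> (\<forall>j\<in>{..<k}. small j om))" by (auto simp: Q_def)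
 then show ?thesis using k by simp
qed

lemma column_I: "k < n \<Longrightarrow> fresh k \<subseteq> I" using h_I by (auto simp: fresh_def)

lemma h_notin_column: "\<lbrakk>i < n; j < k; k < n\<rbrakk> \<Longrightarrow> h i j \<in> I - fresh k"
 using h_I[of i j] h_inj[of i j _ k] by (auto simp: fresh_def)

lemma agree: "\<lbrakk>k < n; \<And>i. i \<in> I - fresh k \<Longrightarrow> om i = om' i; i < n; j < k\<rbrakk> \<Longrightarrow> Hm om i j = Hm om' i j"
 using h_notin_column by blast

lemma row_depends: "\<lbrakk>k < n; j \<le> k\<rbrakk> \<Longrightarrow> depends_on (I - fresh k) (\<lambda>om. rrow a j om)"
 unfolding depends_on_def by (intro allI impI resolvent_row_cong) (meson agree less_le_trans)

lemma f_depends: "\<lbrakk>k < n; j \<le> k\<rbrakk> \<Longrightarrow> depends_on (I - fresh k) (\<lambda>om. f a j om)"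
 unfolding depends_on_def by (intro allI impI resolvent_form_cong) (meson agree less_le_trans)

lemma ph_depends: "\<lbrakk>k < n; j < k\<rbrakk> \<Longrightarrow> depends_on (I - fresh k) (\<lambda>om. ph a j om)"
 unfolding depends_on_def
proof (intro allI impI)
 fix om om' :: "'i \<Rightarrow> real" assume k: "k < n" "j < k" and e: "\<forall>i\<in>I - fresh k. om i = om' i"
 hence "rrow a j om = rrow a j om'" using row_depends[of k j a] by (auto simp: depends_on_def)
 moreover have "Hm om m j = Hm om' m j" if "m < n" for m using agree[of k om om' m j] k e that by blast
 ultimately show "ph a j om = ph a j om'" by (simp add: next_form_def)
qed

lemma Q_depends: "k < n \<Longrightarrow> depends_on (I - fresh k) (Q k)" unfolding depends_on_def
proof (intro allI impI)
 fix om om' :: "'i \<Rightarrow> real" assume k: "k < n" and e: "\<forall>i\<in>I - fresh k. om i = om' i"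
 have "rrow a j om = rrow a j om'" "f a j om = f a j om'" if "j \<le> k" for a j
  using row_depends[OF k that] f_depends[OF k that] e by (auto simp: depends_on_def)
 moreover have "ph a j om = ph a j om'" if "j < k" for a j using ph_depends[OF k that] e by (auto simp: depends_on_def)
 ultimately show "Q k om = Q k om'" unfolding Q_def ok_def small_def by simp
qed

lemma coef_depends: "k < n \<Longrightarrow> depends_on (I - fresh k) (coef a k i)" unfolding depends_on_def coef_def
proof (intro allI impI)
 fix om om' :: "'i \<Rightarrow> real" assume "k < n" "\<forall>i\<in>I - fresh k. om i = om' i"
 hence "rrow a k om = rrow a k om'" using row_depends[of k k a] by (auto simp: depends_on_def)
 thus "rrow a k om (the_inv_into {..<n} (\<lambda>m. h m k) i) = rrow a k om' (the_inv_into {..<n} (\<lambda>m. h m k) i)" by simp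
qed

lemma inj_column: "k < n \<Longrightarrow> inj_on (\<lambda>m. h m k) {..<n}" using h_inj by (auto intro: inj_onI)

lemma sum_column: "k < n \<Longrightarrow> (\<Sum>i\<in>fresh k. g (coef a k i om) i) = (\<Sum>m<n. g (rrow a k om m) (h m k))"
proof -
 assume k: "k < n"
 have "the_inv_into {..<n} (\<lambda>m. h m k) (h m k) = m" if "m < n" for m using the_inv_into_f_f[OF inj_column[OF k], of m] that by simp
 thus ?thesis unfolding fresh_def coef_def using inj_column[OF k] by (subst sum.reindex) auto
qed

lemma ph_eq: "k < n \<Longrightarrow> ph a k om = (\<Sum>i\<in>fresh k. coef a k i om * cor (om i))"
 using sum_column[of k "\<lambda>c i. c * cor (om i)" a om] by (simp add: next_form_def)

lemma coef_sq: "\<lbrakk>k < n; Q k om; a \<in> AA\<rbrakk> \<Longrightarrow> (\<Sum>i\<in>fresh k. (cmod (coef a k i om))^2) \<le> (2 / rh)^2"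
 using sum_column[of k "\<lambda>c i. (cmod c)^2" a om] by (simp add: Q_def ok_def)

lemma coef_le: "\<lbrakk>k < n; Q k om; a \<in> AA; i \<in> fresh k\<rbrakk> \<Longrightarrow> cmod (coef a k i om) \<le> 2 / rh"
proof -
 assume k: "k < n" and Q: "Q k om" and a: "a \<in> AA" and i: "i \<in> fresh k"
 have "finite (fresh k)" by (simp add: fresh_def)
 hence "(cmod (coef a k i om))^2 \<le> (\<Sum>i\<in>fresh k. (cmod (coef a k i om))^2)" using i by (intro member_le_sum) auto
 also have "... \<le> (2 / rh)^2" by (rule coef_sq[OF k Q a])
 finally show ?thesis using rh by simp
qed

text \<open>Bernstein's inequality with both coefficient bounds equal to \<open>2 / rh\<close>;
  since \<open>sg \<le> L\<close> and \<open>1 \<le> l\<close>, the part due to the range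
  dominates.\<close>

lemma small_tail:
 assumes a: "a \<in> AA" and k: "k < n" shows "measure (N I) {om \<in> space (N I). Q k om \<and> \<tau> < cmod (ph a k om)} \<le> 4 * exp (- l)"
proof -
 have "2 * bernstein l (2 / rh) (2 / rh) \<le> \<tau>"
 proof -
  have "sqrt l * sg \<le> l * L" using sg l real_sqrt_le_mono[of l "l * l"] by (intro mult_mono) (auto simp: mult_le_cancel_left1)
  hence "8 * (sqrt l * sg + l * L) \<le> 8 * (l * L + l * L)" by (intro mult_left_mono add_right_mono) simp_all
  also have "... = 16 * l * L" by simp
  finally have "8 * (sqrt l * sg + l * L) / rh \<le> 16 * l * L / rh" using rh by (intro divide_right_mono) auto
  thus ?thesis by (simp add: bernstein_def \<tau>_def add_divide_distrib)
 qed
 hence "prob {om \<in> space (N I). Q k om \<and> \<tau> < cmod (ph a k om)}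
  \<le> prob {om \<in> space (N I). Q k om \<and> 2 * bernstein l (2 / rh) (2 / rh) < cmod (\<Sum>i\<in>fresh k. coef a k i om * cor (om i))}"
  using k by (intro finite_measure_mono) (auto simp flip: ph_eq)
 also have "... \<le> 4 * exp (- l)"
 proof (rule linear_tail_complex[OF column_I[OF k]])
  show "coef a k i \<in> BM" for i unfolding coef_def using k by simp
 qed (use k l rh coef_sq[OF k _ a] coef_le[OF k _ a] Q_depends[OF k] coef_depends[OF k] in simp_all)
 finally show ?thesis .
qed

lemma bb_form: "\<lbrakk>k < n; Q k om\<rbrakk> \<Longrightarrow> cmod (f (basis_fun k) k om) \<le> bb k"
proof -
 assume k: "k < n" and Q: "Q k om"
 have "(\<Sum>j<n. cor (basis_fun k j) * cor (b j)) = b k" by (rule sum_basis_fun[OF k])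
 hence "cmod (f (basis_fun k) 0 om) = \<bar>b k\<bar> / rh" unfolding resolvent_form_0 by (simp add: norm_divide z)
 moreover have "cmod (f (basis_fun k) k om - f (basis_fun k) 0 om) \<le> 2 * T / rh^2" using Q AA(2)[OF k] by (auto simp: Q_def ok_def)
 ultimately show ?thesis using norm_triangle_ineq2[of "f (basis_fun k) k om" "f (basis_fun k) 0 om"] by (simp add: bb_def add_divide_distrib power2_eq_square)
qed

end

lemma indicator_measurable: "Measurable.pred M P \<Longrightarrow> (indicator {om. P om} :: _ \<Rightarrow> ennreal) \<in> borel_measurable M"
proof -
 assume P: "Measurable.pred M P"
 thus ?thesis by auto
qed

section \<open>The exponential supermartingale up to the first exit\<close>

context resolvent_process
begin

definition "gain ze a k om = exp (th * Re (ze * (f a k om - f a 0 om)))" for ze :: complex and om :: "'i \<Rightarrow> real"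
definition "jump a k om = ph a k om * f (basis_fun k) k om / (1 - ph (basis_fun k) k om)" for om :: "'i \<Rightarrow> real"

lemma gain_nonneg [simp]: "0 \<le> gain ze a k om" by (simp add: gain_def)

lemma gain_Suc: "k < n \<Longrightarrow> gain ze a (Suc k) om = gain ze a k om * exp (th * Re (ze * jump a k om))"
 unfolding gain_def resolvent_form_Suc jump_def exp_add[symmetric] by (simp add: algebra_simps)

lemma gain_measurable [measurable]: "k \<le> n \<Longrightarrow> gain ze a k \<in> BM"
proof -
 assume k: "k \<le> n"
 thus ?thesis unfolding gain_def[abs_def] by simp
qed

lemma jump_measurable: "k < n \<Longrightarrow> (\<lambda>om. exp (th * Re (ze * jump a k om))) \<in> BM"
proof -
 assume k: "k < n"
 thus ?thesis unfolding jump_def by simp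
qed

lemma jump_mgf:
 assumes a: "a \<in> AA" and ze: "cmod ze = 1" and k: "k < n" and x: "x \<in> space (N (I - fresh k))"
 shows "(\<integral>\<^sup>+y. (indicator {om. Q k om \<and> small k om} (merge (I - fresh k) (fresh k) (x, y)) *
   ennreal (exp (th * Re (ze * jump a k (merge (I - fresh k) (fresh k) (x, y)))))) \<partial>N (fresh k)) \<le> ennreal (exp (inc k))"
proof -
 define w where "w = merge (I - fresh k) (fresh k) (x, \<lambda>_. 0)"
 let ?m = "\<lambda>y. merge (I - fresh k) (fresh k) (x, y)"
 have same: "?m y i = w i" if "i \<in> I - fresh k" for y i using that by (simp add: w_def)
 have Q: "Q k (?m y) = Q k w" for y by (rule depends_onD[OF Q_depends[OF k]]) (rule same)
 have F: "f a' k (?m y) = f a' k w" for a' y by (rule depends_onD[OF f_depends[OF k order_refl]]) (rule same)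
 have C: "coef a' k i (?m y) = coef a' k i w" for a' i y by (rule depends_onD[OF coef_depends[OF k]]) (rule same)
 let ?S = "\<lambda>a' y. \<Sum>i\<in>fresh k. coef a' k i w * cor (y i)"
 have P: "ph a' k (?m y) = ?S a' y" for a' y unfolding ph_eq[OF k] C by simp
 let ?e = "basis_fun k"
 have e: "?e \<in> AA" by (rule AA(2)[OF k])
 define v where "v = f ?e k w"
 have J: "jump a k (?m y) = ?S a y * v / (1 - ?S ?e y)" for y by (simp add: jump_def P F v_def)
 have fin: "finite (fresh k)" by (simp add: fresh_def)
 interpret Nf: prob_space "N (fresh k)" by (rule prob_N)
 show ?thesis
 proof (cases "Q k w")
  case False
  thus ?thesis by (simp add: Q)
 next
  case True
  note sq = coef_sq[OF k True] and le = coef_le[OF k True]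
  have v: "cmod v \<le> bb k" unfolding v_def by (rule bb_form[OF k True])
  have v0: "0 \<le> th * cmod v" using th by simp
  have thv: "th * cmod v \<le> th * bb k" using v th by simp
  let ?lin = "\<lambda>y. \<Sum>i\<in>fresh k. (2 * th * Re (ze * v * coef a k i w)) * y i"
  have lin: "2 * th * Re (ze * v * ?S a y) = ?lin y" for y
  proof -
   have "ze * v * ?S a y = (\<Sum>i\<in>fresh k. (ze * v * coef a k i w) * cor (y i))" by (simp add: sum_distrib_left mult.assoc)
   moreover have "Re (c * cor t) = Re c * t" for c t by simp
   ultimately have "Re (ze * v * ?S a y) = (\<Sum>i\<in>fresh k. Re (ze * v * coef a k i w) * y i)" by simp
   thus ?thesis by (simp only: sum_distrib_left mult.assoc)
  qed
  have pointwise: "indicator {om. Q k om \<and> small k om} (?m y) * ennreal (exp (th * Re (ze * jump a k (?m y))))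
   \<le> ennreal (1 / 2) * ennreal (exp (?lin y)) + ennreal (1 / 2)
    + ennreal (2 * (th * cmod v)) * ennreal ((cmod (?S a y))^2) + ennreal (2 * (th * cmod v)) * ennreal ((cmod (?S ?e y))^2)" for y
  proof (cases "small k (?m y)")
   case True
   hence s: "cmod (?S a y) \<le> \<tau>" "cmod (?S ?e y) \<le> \<tau>" using a e by (auto simp: small_def P)
   have "4 * th * cmod v * (cmod (?S a y) * cmod (?S ?e y)) \<le> 4 * th * bb k * (\<tau> * \<tau>)"
    using s v th \<tau> bb_nonneg[of k] by (intro mult_mono) auto
   also have "... \<le> 1" using quadratic_small[OF k] by (simp add: power2_eq_square)
   finally have "exp (th * Re (ze * (?S a y * v / (1 - ?S ?e y))))
    \<le> exp (2 * th * Re (ze * v * ?S a y)) / 2 + (1 + 4 * th * cmod v * ((cmod (?S a y))^2 + (cmod (?S ?e y))^2)) / 2"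
    using s \<tau> ze th by (intro exp_increment_le) auto
   also have "... = 1 / 2 * exp (?lin y) + 1 / 2 + 2 * (th * cmod v) * (cmod (?S a y))^2 + 2 * (th * cmod v) * (cmod (?S ?e y))^2"
    unfolding lin by (simp add: algebra_simps)
   finally have "ennreal (exp (th * Re (ze * (?S a y * v / (1 - ?S ?e y)))))
    \<le> ennreal (1 / 2 * exp (?lin y) + 1 / 2 + 2 * (th * cmod v) * (cmod (?S a y))^2 + 2 * (th * cmod v) * (cmod (?S ?e y))^2)"
    by (rule ennreal_leI)
   also have "... = ennreal (1 / 2) * ennreal (exp (?lin y)) + ennreal (1 / 2)
    + ennreal (2 * (th * cmod v)) * ennreal ((cmod (?S a y))^2) + ennreal (2 * (th * cmod v)) * ennreal ((cmod (?S ?e y))^2)"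
    using v0 by (simp only: ennreal_mult'[symmetric] ennreal_plus[symmetric] add_nonneg_nonneg mult_nonneg_nonneg zero_le_power2 exp_ge_zero
      zero_le_divide_1_iff zero_le_numeral)
   finally show ?thesis by (simp add: J indicator_def)
  qed simp
  have "(\<integral>\<^sup>+y. (indicator {om. Q k om \<and> small k om} (?m y) * ennreal (exp (th * Re (ze * jump a k (?m y))))) \<partial>N (fresh k))
   \<le> (\<integral>\<^sup>+y. ennreal (1 / 2) * ennreal (exp (?lin y)) + ennreal (1 / 2)
    + ennreal (2 * (th * cmod v)) * ennreal ((cmod (?S a y))^2) + ennreal (2 * (th * cmod v)) * ennreal ((cmod (?S ?e y))^2) \<partial>N (fresh k))"
   by (intro nn_integral_mono pointwise)
  also have "... = ennreal (1 / 2) * (\<integral>\<^sup>+y. ennreal (exp (?lin y)) \<partial>N (fresh k)) + ennreal (1 / 2)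
    + ennreal (2 * (th * cmod v)) * (\<integral>\<^sup>+y. ennreal ((cmod (?S a y))^2) \<partial>N (fresh k))
    + ennreal (2 * (th * cmod v)) * (\<integral>\<^sup>+y. ennreal ((cmod (?S ?e y))^2) \<partial>N (fresh k))"
   by (simp add: nn_integral_add nn_integral_cmult Nf.emeasure_space_1)
  also have "... \<le> ennreal (1 / 2) * ennreal (exp (16 * th^2 * sg^2 * (bb k)^2 / rh^2)) + ennreal (1 / 2)
    + ennreal (2 * (th * cmod v)) * ennreal (sg^2 * (2 / rh)^2) + ennreal (2 * (th * cmod v)) * ennreal (sg^2 * (2 / rh)^2)"
  proof (intro add_mono mult_left_mono order_refl)
   have c: "\<bar>Re (ze * v * coef a k i w)\<bar> \<le> cmod v * cmod (coef a k i w)" for i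
    using abs_Re_le_cmod[of "ze * v * coef a k i w"] by (simp add: norm_mult ze)
   have "(\<integral>\<^sup>+y. ennreal (exp (?lin y)) \<partial>N (fresh k)) \<le> ennreal (exp (sg^2 * (\<Sum>i\<in>fresh k. (2 * th * Re (ze * v * coef a k i w))^2)))"
   proof (rule linear_mgf[OF fin])
    fix i assume i: "i \<in> fresh k"
    have "\<bar>2 * th * Re (ze * v * coef a k i w)\<bar> * L = 2 * th * \<bar>Re (ze * v * coef a k i w)\<bar> * L" using th by (simp add: abs_mult)
    also have "... \<le> 2 * th * (bb k * (2 / rh)) * L"
     using v le[OF a i] th L bb_nonneg[of k] by (intro mult_right_mono mult_left_mono order_trans[OF c] mult_mono) auto
    finally show "\<bar>2 * th * Re (ze * v * coef a k i w)\<bar> * L \<le> 1" using linear_small[OF k] by simp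
   qed
   also have "... \<le> ennreal (exp (16 * th^2 * sg^2 * (bb k)^2 / rh^2))"
   proof (intro ennreal_leI, unfold exp_le_cancel_iff)
    have "(\<Sum>i\<in>fresh k. (2 * th * Re (ze * v * coef a k i w))^2) \<le> (\<Sum>i\<in>fresh k. (2 * th)^2 * ((bb k)^2 * (cmod (coef a k i w))^2))"
    proof (rule sum_mono)
     fix i
     have "\<bar>Re (ze * v * coef a k i w)\<bar> \<le> bb k * cmod (coef a k i w)" using order_trans[OF c mult_right_mono[OF v norm_ge_zero]] .
     hence "(Re (ze * v * coef a k i w))^2 \<le> (bb k * cmod (coef a k i w))^2" by (rule power2_le_iff_abs_le[THEN iffD2, rotated]) (simp add: bb_nonneg)
     thus "(2 * th * Re (ze * v * coef a k i w))^2 \<le> (2 * th)^2 * ((bb k)^2 * (cmod (coef a k i w))^2)"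
      unfolding power_mult_distrib[of "2 * th"] by (intro mult_left_mono) (auto simp: power_mult_distrib)
    qed
    also have "... = (2 * th)^2 * (bb k)^2 * (\<Sum>i\<in>fresh k. (cmod (coef a k i w))^2)" by (simp add: sum_distrib_left mult.assoc)
    also have "... \<le> (2 * th)^2 * (bb k)^2 * (2 / rh)^2" by (intro mult_left_mono sq[OF a]) auto
    finally have "sg^2 * (\<Sum>i\<in>fresh k. (2 * th * Re (ze * v * coef a k i w))^2) \<le> sg^2 * ((2 * th)^2 * (bb k)^2 * (2 / rh)^2)"
     by (rule mult_left_mono) simp
    thus "sg^2 * (\<Sum>i\<in>fresh k. (2 * th * Re (ze * v * coef a k i w))^2) \<le> 16 * th^2 * sg^2 * (bb k)^2 / rh^2"
     by (simp add: power_divide mult_ac)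
   qed
   finally show "(\<integral>\<^sup>+y. ennreal (exp (?lin y)) \<partial>N (fresh k)) \<le> ennreal (exp (16 * th^2 * sg^2 * (bb k)^2 / rh^2))" .
   show "(\<integral>\<^sup>+y. ennreal ((cmod (?S a y))^2) \<partial>N (fresh k)) \<le> ennreal (sg^2 * (2 / rh)^2)"
    by (rule order_trans[OF second_moment_complex[OF column_I[OF k]] ennreal_leI[OF mult_left_mono[OF sq[OF a]]]]) simp
   show "(\<integral>\<^sup>+y. ennreal ((cmod (?S ?e y))^2) \<partial>N (fresh k)) \<le> ennreal (sg^2 * (2 / rh)^2)"
    by (rule order_trans[OF second_moment_complex[OF column_I[OF k]] ennreal_leI[OF mult_left_mono[OF sq[OF e]]]]) simp
  qed simp_all
  also have "... = ennreal (1 / 2 * exp (16 * th^2 * sg^2 * (bb k)^2 / rh^2) + 1 / 2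
    + 2 * (th * cmod v) * (sg^2 * (2 / rh)^2) + 2 * (th * cmod v) * (sg^2 * (2 / rh)^2))"
   using v0 by (simp only: ennreal_mult'[symmetric] ennreal_plus[symmetric] add_nonneg_nonneg mult_nonneg_nonneg zero_le_power2 exp_ge_zero
      zero_le_divide_1_iff zero_le_numeral)
  also have "... \<le> ennreal (exp (inc k))"
  proof (rule ennreal_leI)
   \<comment> \<open>\<open>A\<close> comes from the exponential moment of the linear part and
     \<open>B\<close> from the second moments; halving both and using
     \<open>1 + B \<le> exp B\<close> gives \<open>exp (A + B)\<close>, which is
     \<open>exp (inc k)\<close>.\<close>
   define A B where "A = 16 * th^2 * sg^2 * (bb k)^2 / rh^2" and "B = 32 * th * bb k * sg^2 / rh^2"
   have AB: "0 \<le> A" "0 \<le> B" using th bb_nonneg[of k] by (simp_all add: A_def B_def)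
   define D where "D = 2 * (th * cmod v) * (sg^2 * (2 / rh)^2)"
   have "D \<le> 2 * (th * bb k) * (sg^2 * (2 / rh)^2)" unfolding D_def using thv by (intro mult_right_mono) auto
   also have "... = B / 4" by (simp add: B_def power_divide)
   finally have "1 / 2 * exp A + 1 / 2 + D + D \<le> 1 / 2 * exp A + (1 + B) / 2" by simp
   also have "... \<le> 1 / 2 * exp A + exp B / 2" by (intro add_left_mono divide_right_mono) simp_all
   also have "... \<le> 1 / 2 * exp (A + B) + exp (A + B) / 2" using AB by (intro add_mono mult_left_mono divide_right_mono) auto
   also have "... = exp (inc k)" by (simp add: inc_def A_def B_def)
   finally show "1 / 2 * exp (16 * th^2 * sg^2 * (bb k)^2 / rh^2) + 1 / 2 + 2 * (th * cmod v) * (sg^2 * (2 / rh)^2)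
    + 2 * (th * cmod v) * (sg^2 * (2 / rh)^2) \<le> exp (inc k)" by (simp only: D_def A_def)
  qed
  finally show ?thesis .
 qed
qed

text \<open>The gain up to \<open>k\<close> is determined by the history, so it factors out and the
  jump contributes at most \<open>exp (inc k)\<close>.\<close>

lemma gain_step:
 assumes a: "a \<in> AA" and ze: "cmod ze = 1" and k: "k < n"
 shows "(\<integral>\<^sup>+om. indicator {om. Q k om \<and> small k om} om * ennreal (gain ze a (Suc k) om) \<partial>N I)
  \<le> ennreal (exp (inc k)) * (\<integral>\<^sup>+om. indicator {om. Q k om} om * ennreal (gain ze a k om) \<partial>N I)"
proof -
 have iQ: "(indicator {om. Q k om} :: _ \<Rightarrow> ennreal) \<in> BM"
  by (rule indicator_measurable[OF Q_measurable[OF less_imp_le[OF k]]])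
 have iS: "(indicator {om. Q k om \<and> small k om} :: _ \<Rightarrow> ennreal) \<in> BM"
  by (rule indicator_measurable[OF pred_intros_logic(3)[OF Q_measurable[OF less_imp_le[OF k]] small_measurable[OF k]]])
 have "(\<integral>\<^sup>+om. indicator {om. Q k om \<and> small k om} om * ennreal (gain ze a (Suc k) om) \<partial>N I)
  = (\<integral>\<^sup>+om. (indicator {om. Q k om} om * ennreal (gain ze a k om))
    * (indicator {om. Q k om \<and> small k om} om * ennreal (exp (th * Re (ze * jump a k om)))) \<partial>N I)"
  by (intro nn_integral_cong) (auto simp: gain_Suc[OF k] ennreal_mult' indicator_def)
 also have "... \<le> ennreal (exp (inc k)) * (\<integral>\<^sup>+om. indicator {om. Q k om} om * ennreal (gain ze a k om) \<partial>N I)"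
 proof (rule conditional_step[OF column_I[OF k] _ _ _ jump_mgf[OF a ze k]])
  show "depends_on (I - fresh k) (\<lambda>om. indicator {om. Q k om} om * ennreal (gain ze a k om))" unfolding depends_on_def
  proof (intro allI impI)
   fix om om' :: "'i \<Rightarrow> real" assume "\<forall>i\<in>I - fresh k. om i = om' i"
   hence "Q k om = Q k om'" "f a k om = f a k om'" "f a 0 om = f a 0 om'"
    using depends_onD[OF Q_depends[OF k]] depends_onD[OF f_depends[OF k order_refl]] depends_onD[OF f_depends[OF k le0]] by blast+
   thus "indicator {om. Q k om} om * ennreal (gain ze a k om) = indicator {om. Q k om} om' * ennreal (gain ze a k om')"
    by (simp add: gain_def indicator_def)
  qed
 qed (use iQ iS gain_measurable[OF less_imp_le[OF k]] jump_measurable[OF k] in \<open>auto intro!: borel_measurable_times_ennreal measurable_compose[OF _ measurable_ennreal]\<close>)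
 finally show ?thesis .
qed

lemma gain_bound:
 assumes a: "a \<in> AA" and ze: "cmod ze = 1"
 shows "k \<le> n \<Longrightarrow> (\<integral>\<^sup>+om. indicator {om. Q k om} om * ennreal (gain ze a k om) \<partial>N I) \<le> ennreal (exp (\<Sum>j<k. inc j))"
proof (induction k)
 case 0
 have "(\<integral>\<^sup>+om. indicator {om. Q 0 om} om * ennreal (gain ze a 0 om) \<partial>N I) \<le> (\<integral>\<^sup>+om. 1 \<partial>N I)"
  by (intro nn_integral_mono) (simp add: gain_def indicator_def)
 thus ?case by (simp add: emeasure_space_1)
next
 case (Suc k)
 hence k: "k < n" by simp
 have "(\<integral>\<^sup>+om. indicator {om. Q (Suc k) om} om * ennreal (gain ze a (Suc k) om) \<partial>N I)
  \<le> (\<integral>\<^sup>+om. indicator {om. Q k om \<and> small k om} om * ennreal (gain ze a (Suc k) om) \<partial>N I)"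
  by (intro nn_integral_mono mult_right_mono) (auto simp: Q_def indicator_def)
 also have "... \<le> ennreal (exp (inc k)) * (\<integral>\<^sup>+om. indicator {om. Q k om} om * ennreal (gain ze a k om) \<partial>N I)"
  by (rule gain_step[OF a ze k])
 also have "... \<le> ennreal (exp (inc k)) * ennreal (exp (\<Sum>j<k. inc j))" using Suc by (intro mult_left_mono) auto
 finally show ?case unfolding ennreal_exp_mult by (simp add: add.commute)
qed

text \<open>Exit in step \<open>k\<close> in direction \<open>ze\<close>. History and fresh column
  are still controlled, so the exponential moment is available at time \<open>Suc k\<close> although
  \<open>ok (Suc k)\<close> is not assumed.\<close>

definition "escapes ze a k = {om \<in> space (N I). (Q k om \<and> small k om) \<and> T / rh^2 \<le> Re (ze * (f a (Suc k) om - f a 0 om))}"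
 for ze :: complex

lemma escapes_sets: "k < n \<Longrightarrow> escapes ze a k \<in> sets (N I)"
proof -
 assume k: "k < n"
 have "(\<lambda>om. Re (ze * (f a (Suc k) om - f a 0 om))) \<in> BM"
  by (rule measurable_compose[OF _ borel_measurable_Re], intro borel_measurable_times borel_measurable_diff borel_measurable_const f_measurable Suc_leI k)
   simp
 hence "Measurable.pred (N I) (\<lambda>om. T / rh^2 \<le> Re (ze * (f a (Suc k) om - f a 0 om)))" by measurable
 from pred_intros_logic(3)[OF pred_intros_logic(3)[OF Q_measurable[OF less_imp_le[OF k]] small_measurable[OF k]] this]
 show ?thesis unfolding escapes_def pred_def .
qed

lemma escapes_prob:
 assumes a: "a \<in> AA" and ze: "cmod ze = 1" and k: "k < n" shows "measure (N I) (escapes ze a k) \<le> exp (- l)"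
proof -
 have "emeasure (N I) (escapes ze a k) = (\<integral>\<^sup>+om. indicator (escapes ze a k) om \<partial>N I)" using escapes_sets[OF k] by simp
 also have "... \<le> (\<integral>\<^sup>+om. ennreal (exp (- (2 * l))) * (indicator {om. Q k om \<and> small k om} om * ennreal (gain ze a (Suc k) om)) \<partial>N I)"
 proof (rule nn_integral_mono)
  fix om
  show "indicator (escapes ze a k) om \<le> ennreal (exp (- (2 * l))) * (indicator {om. Q k om \<and> small k om} om * ennreal (gain ze a (Suc k) om))"
  proof (cases "om \<in> escapes ze a k")
   case True
   hence "th * (T / rh^2) \<le> th * Re (ze * (f a (Suc k) om - f a 0 om))" using th by (intro mult_left_mono) (auto simp: escapes_def)
   hence "1 \<le> ennreal (exp (- (2 * l))) * ennreal (gain ze a (Suc k) om)" unfolding gain_def ennreal_exp_mult using T rh by (simp add: th_def)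
   thus ?thesis using True by (simp add: escapes_def)
  qed simp
 qed
 also have "... = ennreal (exp (- (2 * l))) * (\<integral>\<^sup>+om. indicator {om. Q k om \<and> small k om} om * ennreal (gain ze a (Suc k) om) \<partial>N I)"
 proof (rule nn_integral_cmult)
  show "(\<lambda>om. indicator {om. Q k om \<and> small k om} om * ennreal (gain ze a (Suc k) om)) \<in> BM" using k by simp
 qed
 also have "... \<le> ennreal (exp (- (2 * l))) * (ennreal (exp (inc k)) * ennreal (exp (\<Sum>j<k. inc j)))"
  by (rule mult_left_mono[OF order_trans[OF gain_step[OF a ze k] mult_left_mono[OF gain_bound[OF a ze less_imp_le[OF k]]]]]) simp_all
 also have "... = ennreal (exp (- (2 * l) + (\<Sum>j<Suc k. inc j)))" unfolding ennreal_exp_mult by simp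
 also have "... \<le> ennreal (exp (- l))"
 proof (intro ennreal_leI, unfold exp_le_cancel_iff)
  have "0 \<le> inc j" for j using th bb_nonneg[of j] by (simp add: inc_def)
  hence "(\<Sum>j<Suc k. inc j) \<le> (\<Sum>j<n. inc j)" using k by (intro sum_mono2) auto
  thus "- (2 * l) + (\<Sum>j<Suc k. inc j) \<le> - l" using sum_inc by linarith
 qed
 finally show ?thesis by (simp add: emeasure_eq_measure)
qed

text \<open>Four directions suffice because a modulus is at most the sum of the absolute real and
  imaginary parts; this is the factor 2 in \<open>2 * T / rh^2\<close>.\<close>

definition "bad = (\<Union>k<n. \<Union>a\<in>AA. {om \<in> space (N I). Q k om \<and> \<tau> < cmod (ph a k om)} \<union>
 (escapes 1 a k \<union> escapes (- 1) a k \<union> (escapes \<i> a k \<union> escapes (- \<i>) a k)))"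

lemma trunc_sets: "k < n \<Longrightarrow> {om \<in> space (N I). Q k om \<and> \<tau> < cmod (ph a k om)} \<in> sets (N I)"
proof -
 assume k: "k < n"
 hence "Measurable.pred (N I) (\<lambda>om. \<tau> < cmod (ph a k om))" by measurable
 from pred_intros_logic(3)[OF Q_measurable[OF less_imp_le[OF k]] this] show ?thesis unfolding pred_def .
qed

lemma bad_sets: "bad \<in> sets (N I)" unfolding bad_def using AA(1) by (intro sets.finite_UN sets.Un escapes_sets trunc_sets) auto

lemma bad_prob: "measure (N I) bad \<le> 8 * real n * real (card AA) * exp (- l)"
proof -
 interpret prob_space "N I" by (rule prob_N)
 let ?B = "\<lambda>k a. {om \<in> space (N I). Q k om \<and> \<tau> < cmod (ph a k om)} \<union>
  (escapes 1 a k \<union> escapes (- 1) a k \<union> (escapes \<i> a k \<union> escapes (- \<i>) a k))"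
 have B: "?B k a \<in> sets (N I)" if "k < n" for k a using that by (intro sets.Un escapes_sets trunc_sets)
 have one: "prob (?B k a) \<le> 8 * exp (- l)" if k: "k < n" and a: "a \<in> AA" for k a
 proof -
  note e = escapes_sets[OF k] and p = escapes_prob[OF a _ k]
  have "prob (escapes 1 a k \<union> escapes (- 1) a k) \<le> 2 * exp (- l)"
   using measure_Un_le[OF e[of 1 a] e[of "- 1" a]] p[of 1] p[of "- 1"] by simp
  moreover have "prob (escapes \<i> a k \<union> escapes (- \<i>) a k) \<le> 2 * exp (- l)"
   using measure_Un_le[OF e[of \<i> a] e[of "- \<i>" a]] p[of \<i>] p[of "- \<i>"] by simp
  ultimately have "prob (escapes 1 a k \<union> escapes (- 1) a k \<union> (escapes \<i> a k \<union> escapes (- \<i>) a k)) \<le> 4 * exp (- l)"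
   using measure_Un_le[OF sets.Un[OF e[of 1 a] e[of "- 1" a]] sets.Un[OF e[of \<i> a] e[of "- \<i>" a]]] by linarith
  thus ?thesis
   using measure_Un_le[OF trunc_sets[OF k, of a] sets.Un[OF sets.Un[OF e[of 1 a] e[of "- 1" a]] sets.Un[OF e[of \<i> a] e[of "- \<i>" a]]]]
    small_tail[OF a k] by linarith
 qed
 have "prob bad \<le> (\<Sum>k<n. prob (\<Union>a\<in>AA. ?B k a))" unfolding bad_def using AA(1) B by (intro finite_measure_subadditive_finite) auto
 also have "... \<le> (\<Sum>k<n. \<Sum>a\<in>AA. prob (?B k a))" using AA(1) B by (intro sum_mono finite_measure_subadditive_finite) auto
 also have "... \<le> (\<Sum>k<n. \<Sum>a\<in>AA. 8 * exp (- l))" using one by (intro sum_mono) auto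
 finally show ?thesis by simp
qed

text \<open>Outside \<open>bad\<close> the controls propagate from column to column. The row bound
  inside \<open>ok\<close> is deterministic, given the operator norm bound; the exceptional set
  concerns only the forms and the fresh columns.\<close>

lemma not_bad:
 assumes om: "om \<in> space (N I)" "om \<notin> bad"
  and norm: "\<And>x :: nat \<Rightarrow> real. (\<Sum>j<n. (\<Sum>i<n. x i * om (h i j))^2) \<le> (rh / 8)^2 * (\<Sum>i<n. (x i)^2)"
 shows "k \<le> n \<Longrightarrow> Q k om"
proof -
 have row_ok: "(\<Sum>j<n. (cmod (rrow a k om j))^2) \<le> (2 / rh)^2" if "k \<le> n" "a \<in> AA" "\<And>j. j < k \<Longrightarrow> small j om" for a k
 proof (rule resolvent_row_norm[OF rh z norm AA(3)[OF that(2)] resolvent_row_equation[OF z0 that(1)]])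
  fix j assume j: "j < k"
  hence "cmod (ph (basis_fun j) j om) \<le> \<tau>" using that AA(2)[of j] by (auto simp: small_def)
  thus "ph (basis_fun j) j om \<noteq> 1" using \<tau> by auto
 qed
 show "k \<le> n \<Longrightarrow> Q k om"
 proof (induction k)
  case 0
  thus ?case using row_ok[of 0] T by (auto simp: Q_def ok_def)
 next
  case (Suc k)
  hence k: "k < n" and Q: "Q k om" by auto
  have nb: "om \<notin> {om \<in> space (N I). Q k om \<and> \<tau> < cmod (ph a k om)}" "om \<notin> escapes 1 a k" "om \<notin> escapes (- 1) a k"
   "om \<notin> escapes \<i> a k" "om \<notin> escapes (- \<i>) a k" if "a \<in> AA" for a using om(2) k that unfolding bad_def by blast+
  have s: "small k om" using nb(1) Q om(1) by (auto simp: small_def not_less)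
  have sm: "small j om" if "j < Suc k" for j using that s Q by (auto simp: Q_def less_Suc_eq)
  have "cmod (f a (Suc k) om - f a 0 om) \<le> 2 * T / rh^2" if a: "a \<in> AA" for a
  proof -
   let ?d = "f a (Suc k) om - f a 0 om"
   show ?thesis using nb(2-5)[OF a] Q s om(1) cmod_le[of ?d] by (auto simp: escapes_def)
  qed
  thus ?case using row_ok[OF Suc.prems _ sm] Q sm by (auto simp: Q_def le_Suc_eq ok_def)
 qed
qed

theorem resolvent_deviation:
 assumes om: "om \<in> space (N I)" "om \<notin> bad"
  and norm: "\<And>x :: nat \<Rightarrow> real. (\<Sum>j<n. (\<Sum>i<n. x i * om (h i j))^2) \<le> (rh / 8)^2 * (\<Sum>i<n. (x i)^2)"
  and a: "a \<in> AA"
 obtains p :: "nat \<Rightarrow> complex" where "\<And>j. j < n \<Longrightarrow> z * p j - (\<Sum>m<n. p m * om (h m j)) = cor (a j)"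
  "(\<Sum>j<n. (cmod (p j))^2) \<le> (2 / rh)^2" "cmod ((\<Sum>j<n. p j * b j) - (\<Sum>j<n. a j * b j) / z) \<le> 2 * T / rh^2"
proof (rule that[of "rrow a n om"])
 have Q: "Q n om" using not_bad[OF om norm] by simp
 have ne: "ph (basis_fun j) j om \<noteq> 1" if j: "j < n" for j
 proof -
  have "cmod (ph (basis_fun j) j om) \<le> \<tau>" using Q AA(2)[OF j] j by (auto simp: Q_def small_def)
  thus ?thesis using \<tau> by auto
 qed
 show "z * rrow a n om j - (\<Sum>m<n. rrow a n om m * om (h m j)) = cor (a j)" if "j < n" for j
  using resolvent_row_equation[OF z0 order_refl ne that, of a] that by simp
 show "(\<Sum>j<n. (cmod (rrow a n om j))^2) \<le> (2 / rh)^2" using Q a by (auto simp: Q_def ok_def)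
 have "cmod (f a n om - f a 0 om) \<le> 2 * T / rh^2" using Q a by (auto simp: Q_def ok_def)
 thus "cmod ((\<Sum>j<n. rrow a n om j * b j) - (\<Sum>j<n. a j * b j) / z) \<le> 2 * T / rh^2"
  unfolding resolvent_form_0 by (simp add: resolvent_form_def)
qed

end

section \<open>Powers from resolvents\<close>

text \<open>Orthogonality of the roots of unity, with quotients so that all exponents stay natural
  numbers.\<close>

lemma sum_root_powers:
 fixes s t N :: nat
 assumes N: "0 < N" and s: "s < N" and t: "t < N"
 defines "w \<equiv> exp (2 * of_real pi * \<i> * of_nat 1 / of_nat N)"
 shows "(\<Sum>j<N. (w ^ j) ^ s / (w ^ j) ^ t) = (if s = t then of_nat N else 0)"
proof -
 have w0: "w \<noteq> 0" by (simp add: w_def)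
 have wk: "w ^ k = exp (2 * of_real pi * \<i> * of_nat k / of_nat N)" for k by (simp add: w_def exp_of_nat_mult[symmetric] field_simps)
 have wN: "w ^ N = 1" using N by (simp add: wk)
 have eq: "(w ^ j) ^ s / (w ^ j) ^ t = (w ^ s / w ^ t) ^ j" for j by (simp add: power_divide power_mult[symmetric] mult.commute)
 show ?thesis
 proof (cases "s = t")
  case True
  thus ?thesis using w0 by simp
 next
  case False
  hence q: "w ^ s / w ^ t \<noteq> 1" using complex_root_unity_eq[of N s t] s t by (simp add: wk)
  have "(w ^ s / w ^ t) ^ N = (w ^ N) ^ s / (w ^ N) ^ t" by (simp add: power_divide power_mult[symmetric] mult.commute)
  hence "(w ^ s / w ^ t) ^ N = 1" by (simp add: wN)
  thus ?thesis unfolding eq sum_gp_strict using q False by auto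
 qed
qed

text \<open>A finite Neumann expansion with exact remainder: each step uses the row equation once to
  pass from \<open>x M\<close> to \<open>x (Suc M)\<close>.\<close>

lemma resolvent_expansion:
 fixes H :: "nat \<Rightarrow> nat \<Rightarrow> real" and x :: "nat \<Rightarrow> nat \<Rightarrow> real" and a :: "nat \<Rightarrow> real" and p :: "nat \<Rightarrow> complex"
 assumes z: "z \<noteq> 0" and step: "\<And>s i. i < n \<Longrightarrow> x (Suc s) i = (\<Sum>j<n. H i j * x s j)"
  and eq: "\<And>j. j < n \<Longrightarrow> z * p j - (\<Sum>m<n. p m * H m j) = cor (a j)"
 shows "(\<Sum>j<n. p j * x 0 j) = (\<Sum>t<M. cor (\<Sum>j<n. a j * x t j) / z ^ Suc t) + (\<Sum>j<n. p j * x M j) / z ^ M"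
proof (induction M)
 case (Suc M)
 have "z * (\<Sum>j<n. p j * x M j) = (\<Sum>j<n. (z * p j) * x M j)" by (simp add: sum_distrib_left mult.assoc)
 also have "... = (\<Sum>j<n. (cor (a j) + (\<Sum>m<n. p m * H m j)) * x M j)" using eq by (intro sum.cong refl) (simp add: algebra_simps)
 also have "... = cor (\<Sum>j<n. a j * x M j) + (\<Sum>j<n. \<Sum>m<n. p m * H m j * x M j)" by (simp add: distrib_right sum_distrib_right)
 also have "(\<Sum>j<n. \<Sum>m<n. p m * H m j * x M j) = (\<Sum>m<n. p m * x (Suc M) m)"
  by (subst sum.swap) (simp add: step sum_distrib_left mult.assoc)
 finally show ?case using z Suc by (simp add: field_simps)
qed simp

text \<open>With \<open>x s = H^s x_0\<close>, the form in \<open>x s\<close> is the coefficient of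
  \<open>z^-(s+1)\<close> in the resolvent form, extracted by averaging over \<open>N\<close>
  equally spaced points of the circle. Exponents below \<open>N\<close> are separated exactly; the
  rest is the remainder. Subtracting the leading term does not affect this coefficient, since
  \<open>0 < s\<close>, and leaves only a deviation to be bounded.\<close>

lemma power_form_bound:
 fixes H :: "nat \<Rightarrow> nat \<Rightarrow> real" and x :: "nat \<Rightarrow> nat \<Rightarrow> real" and a :: "nat \<Rightarrow> real" and w :: "nat \<Rightarrow> complex"
 defines "w \<equiv> \<lambda>N::nat. (exp (2 * of_real pi * \<i> * of_nat 1 / of_nat N) :: complex)"
 assumes rh: "0 < rh" and step: "\<And>s i. i < n \<Longrightarrow> x (Suc s) i = (\<Sum>j<n. H i j * x s j)"
  and growth: "(\<Sum>i<n. (x N i)^2) \<le> ((rh / 8) ^ N)^2"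
  and ex: "\<And>j. j < N \<Longrightarrow> \<exists>p :: nat \<Rightarrow> complex. (\<forall>i<n. (rh * w N ^ j) * p i - (\<Sum>m<n. p m * H m i) = cor (a i)) \<and>
   (\<Sum>i<n. (cmod (p i))^2) \<le> (2 / rh)^2 \<and> cmod ((\<Sum>i<n. p i * x 0 i) - (\<Sum>i<n. a i * x 0 i) / (rh * w N ^ j)) \<le> D"
  and s: "0 < s" "s < N" shows "\<bar>\<Sum>i<n. a i * x s i\<bar> \<le> rh ^ Suc s * D + 2 * rh ^ s * (1 / 8) ^ N"
proof -
 have N: "0 < N" using s by simp
 define W where "W = w N"
 have W: "cmod W = 1" by (simp add: W_def w_def)
 hence W0: "W \<noteq> 0" by auto
 define z where "z j = cor rh * W ^ j" for j
 have z: "cmod (z j) = rh" "z j \<noteq> 0" for j using rh W W0 by (simp_all add: z_def norm_mult norm_power)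
 define P where "P j p \<longleftrightarrow> (\<forall>i<n. z j * p i - (\<Sum>m<n. p m * H m i) = cor (a i)) \<and>
   (\<Sum>i<n. (cmod (p i))^2) \<le> (2 / rh)^2 \<and> cmod ((\<Sum>i<n. p i * x 0 i) - (\<Sum>i<n. a i * x 0 i) / z j) \<le> D"
  for j and p :: "nat \<Rightarrow> complex"
 have "\<forall>j. \<exists>p. j < N \<longrightarrow> P j p" using ex unfolding P_def z_def W_def by blast
 from choice[OF this] obtain p where P: "\<And>j. j < N \<Longrightarrow> P j (p j)" by blast
 have p: "\<And>j i. \<lbrakk>j < N; i < n\<rbrakk> \<Longrightarrow> z j * p j i - (\<Sum>m<n. p j m * H m i) = cor (a i)"
  "\<And>j. j < N \<Longrightarrow> (\<Sum>i<n. (cmod (p j i))^2) \<le> (2 / rh)^2"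
  "\<And>j. j < N \<Longrightarrow> cmod ((\<Sum>i<n. p j i * x 0 i) - (\<Sum>i<n. a i * x 0 i) / z j) \<le> D" using P unfolding P_def by blast+
 define c where "c t = cor (\<Sum>i<n. a i * x t i)" for t
 define q where "q j = (\<Sum>i<n. p j i * x 0 i)" for j
 define e where "e j = (\<Sum>i<n. p j i * x N i) / z j ^ N" for j
 have expand: "q j = (\<Sum>t<N. c t / z j ^ Suc t) + e j" if "j < N" for j
  unfolding q_def c_def e_def by (rule resolvent_expansion[where z = "z j" and p = "p j" and a = a and x = x and H = H and n = n, OF z(2) step p(1)[OF that]])
 have zpow: "(\<Sum>j<N. z j ^ Suc s / z j ^ Suc t) = (if s = t then of_nat N else 0)" if t: "t < N" for t
 proof -
  have "z j ^ Suc s / z j ^ Suc t = cor rh ^ s / cor rh ^ t * ((W ^ j) ^ s / (W ^ j) ^ t)" for j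
   using z(2)[of j] by (simp add: z_def power_mult_distrib)
  hence "(\<Sum>j<N. z j ^ Suc s / z j ^ Suc t) = cor rh ^ s / cor rh ^ t * (\<Sum>j<N. (W ^ j) ^ s / (W ^ j) ^ t)" by (simp add: sum_distrib_left)
  also have "... = (if s = t then of_nat N else 0)" unfolding W_def w_def sum_root_powers[OF N s(2) t] using rh by simp
  finally show ?thesis .
 qed
 have "of_nat N * c s = (\<Sum>t<N. c t * (\<Sum>j<N. z j ^ Suc s / z j ^ Suc t))"
 proof -
  have "(\<Sum>t<N. c t * (\<Sum>j<N. z j ^ Suc s / z j ^ Suc t)) = (\<Sum>t<N. if s = t then of_nat N * c t else 0)"
   using zpow by (intro sum.cong refl) (simp only: lessThan_iff, simp)
  thus ?thesis using s by simp
 qed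
 also have "... = (\<Sum>j<N. z j ^ Suc s * (\<Sum>t<N. c t / z j ^ Suc t))"
  unfolding sum_distrib_left by (subst sum.swap) (intro sum.cong refl, simp only: times_divide_eq_right mult.commute)
 also have "... = (\<Sum>j<N. z j ^ Suc s * (q j - c 0 / z j) - z j ^ Suc s * e j + c 0 * (z j ^ Suc s / z j ^ Suc 0))"
  using expand by (intro sum.cong refl) (simp add: algebra_simps)
 also have "... = (\<Sum>j<N. z j ^ Suc s * (q j - c 0 / z j) - z j ^ Suc s * e j) + c 0 * (\<Sum>j<N. z j ^ Suc s / z j ^ Suc 0)"
  by (simp add: sum_distrib_left)
 finally have "cmod (of_nat N * c s) = cmod (\<Sum>j<N. z j ^ Suc s * (q j - c 0 / z j) - z j ^ Suc s * e j)" using zpow[OF N] s by simp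
 also have "... \<le> (\<Sum>j<N. cmod (z j ^ Suc s * (q j - c 0 / z j) - z j ^ Suc s * e j))" by (rule norm_sum)
 also have "... \<le> (\<Sum>j<N. rh ^ Suc s * D + 2 * rh ^ s * (1 / 8) ^ N)"
 proof (rule sum_mono)
  fix j assume "j \<in> {..<N}"
  hence j: "j < N" by simp
  have "cmod (\<Sum>i<n. p j i * x N i) \<le> (\<Sum>i<n. cmod (p j i) * \<bar>x N i\<bar>)"
   by (rule order_trans[OF norm_sum]) (simp add: norm_mult)
  also have "... \<le> L2_set (\<lambda>i. cmod (p j i)) {..<n} * L2_set (x N) {..<n}"
   using L2_set_mult_ineq[of "\<lambda>i. cmod (p j i)" "x N" "{..<n}"] by simp
  also have "... \<le> (2 / rh) * (rh / 8) ^ N"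
   using p(2)[OF j] growth rh unfolding L2_set_def by (intro mult_mono real_le_lsqrt) (auto simp: sum_nonneg)
  finally have "cmod (e j) \<le> (2 / rh) * (rh / 8) ^ N / rh ^ N"
   unfolding e_def norm_divide norm_power z using rh by (intro divide_right_mono) auto
  also have "... = 2 / rh * (1 / 8) ^ N" by (simp add: power_divide)
  finally have e: "cmod (e j) \<le> 2 / rh * (1 / 8) ^ N" .
  have "cmod (z j ^ Suc s * (q j - c 0 / z j) - z j ^ Suc s * e j) \<le> rh ^ Suc s * cmod (q j - c 0 / z j) + rh ^ Suc s * cmod (e j)"
   using norm_triangle_ineq4[of "z j ^ Suc s * (q j - c 0 / z j)" "z j ^ Suc s * e j"] by (simp only: norm_mult norm_power z)
  also have "... \<le> rh ^ Suc s * D + rh ^ Suc s * (2 / rh * (1 / 8) ^ N)"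
   using p(3)[OF j] e rh by (intro add_mono mult_left_mono) (auto simp: q_def c_def)
  finally show "cmod (z j ^ Suc s * (q j - c 0 / z j) - z j ^ Suc s * e j) \<le> rh ^ Suc s * D + 2 * rh ^ s * (1 / 8) ^ N" using rh by simp
 qed
 finally have "cmod (c s) \<le> rh ^ Suc s * D + 2 * rh ^ s * (1 / 8) ^ N" using N by (simp add: norm_mult)
 moreover have "cmod (c s) = \<bar>\<Sum>i<n. a i * x s i\<bar>" unfolding c_def by (rule norm_of_real)
 ultimately show ?thesis by simp
qed

section \<open>The noise sample\<close>

text \<open>The index \<open>(0, i, j)\<close> stands for the entry \<open>(i, j)\<close> of \<open>H\<close>, and \<open>(1, i, j)\<close>, \<open>(2, i, j)\<close>
 with \<open>i \<le> j\<close> for those of \<open>W\<^sub>1\<close>, \<open>W\<^sub>2\<close>.\<close>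

definition entry_index :: "nat \<Rightarrow> (nat \<times> nat \<times> nat) set" where
 "entry_index n = {0} \<times> ({..<n} \<times> {..<n}) \<union> {1, 2} \<times> {(i, j). i \<le> j \<and> j < n}"

lemma finite_entry_index: "finite (entry_index n)"
proof -
 have "{(i, j). i \<le> j \<and> j < n} \<subseteq> {..<n} \<times> {..<n}" by auto
 hence "finite {(i, j). i \<le> j \<and> j < n}" by (rule finite_subset) simp
 thus ?thesis by (simp add: entry_index_def)
qed

definition sample_H :: "nat \<Rightarrow> (nat \<times> nat \<times> nat \<Rightarrow> real) \<Rightarrow> real mat" where
 "sample_H n om = mat n n (\<lambda>(i, j). om (0, i, j))"

definition sample_W :: "nat \<Rightarrow> nat \<Rightarrow> (nat \<times> nat \<times> nat \<Rightarrow> real) \<Rightarrow> real mat" where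
 "sample_W n t om = mat n n (\<lambda>(i, j). om (t, min i j, max i j))"

lemma sample_H_carrier: "sample_H n om \<in> mats n n" by (simp add: sample_H_def)

lemma sample_W_carrier: "sample_W n t om \<in> mats n n" by (simp add: sample_W_def)

lemma sample_W_sym: "tr (sample_W n t om) = sample_W n t om" by (intro eq_matI) (auto simp: sample_W_def min.commute max.commute)

text \<open>\<open>l\<close> is the level of all tail bounds and \<open>p\<close> an integer above
  it, used as the exponent in the moment method. \<open>rh_tail\<close> ensures that cutting the
  expansions off at the power \<open>n\<close> costs at most \<open>sg\<close>.\<close>

locale noise_sample = symmetric_product "entry_index n" mu sg L
 for n :: nat and mu sg L +
 fixes r :: nat and Us :: "real mat" and b0 l rh :: real and p :: nat
 assumes n: "1 \<le> n" and r: "r \<le> n" and Us: "Us \<in> mats n r" "tr Us * Us = 1\<^sub>m r"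
  and b0: "\<And>i k. \<lbrakk>i < n; k < r\<rbrakk> \<Longrightarrow> \<bar>Us $$ (i, k)\<bar> \<le> b0" "0 \<le> b0"
  and l: "1 \<le> l" "l \<le> real p" and rh_sg: "64 * sqrt (l * real n) * sg \<le> rh" and rh_L: "256 * l^2 * L \<le> rh"
  and rh_norm: "32 * sqrt (real p * (4 * real n * sg^2 + l * L^2)) \<le> rh" and rh_tail: "2 * rh * (1 / 8) ^ n \<le> sg"
begin

abbreviation "I \<equiv> entry_index n"
abbreviation "Hs \<equiv> sample_H n"
abbreviation "Ws \<equiv> sample_W n"

lemma rh: "0 < rh"
proof -
 have "0 < 256 * l^2 * L" using l L by simp
 thus ?thesis using rh_L by linarith
qed

lemma l0: "0 < l" using l by simp

section \<open>Operator norms of the sampled noise matrices\<close>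

lemma W_norm:
 assumes t: "t \<in> {1, 2}"
 obtains E where "E \<in> sets (N I)" "measure (N I) (space (N I) - E) \<le> 2 * real n * exp (- l)" "\<And>om. om \<in> E \<Longrightarrow> opb (Ws t om) (rh / 8)"
proof -
 interpret W: random_symmetric_matrix "entry_index n" mu sg L n "\<lambda>a b. Some (t, min a b, max a b)"
 proof unfold_locales
  show "Some (t, min a b, max a b) = Some (t, min b a, max b a)" for a b :: nat by auto
  show "e \<in> I" if "a < n" "b < n" "Some (t, min a b, max a b) = Some e" for a b e using that t by (auto simp: entry_index_def)
  show "b = b'" if "Some (t, min a b, max a b) = Some e" "Some (t, min a b', max a b') = Some e" for a b b' e
   using that by (auto simp: min_def max_def split: if_splits)
 qed
 obtain E where E: "E \<in> sets (N I)" "measure (N I) (space (N I) - E) \<le> 2 * real n * exp (- l)"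
  "\<And>om. om \<in> E \<Longrightarrow> opb (W.X om) (4 * sqrt (real p * (2 * real n * sg^2 + l * L^2)))"
  by (rule W.operator_norm_tail[OF l0 l(2)]) (rule that)
 have X: "W.X om = Ws t om" for om by (simp add: W.X_def sample_W_def)
 have "real p * (2 * real n * sg^2 + l * L^2) \<le> real p * (4 * real n * sg^2 + l * L^2)"
  by (intro mult_left_mono add_right_mono mult_right_mono) auto
 hence "sqrt (real p * (2 * real n * sg^2 + l * L^2)) \<le> sqrt (real p * (4 * real n * sg^2 + l * L^2))" by simp
 hence le: "4 * sqrt (real p * (2 * real n * sg^2 + l * L^2)) \<le> rh / 8" using rh_norm by linarith
 have "opb (Ws t om) (rh / 8)" if "om \<in> E" for om by (rule opb_mono[OF E(3)[OF that, unfolded X] le])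
 thus ?thesis by (rule that[OF E(1,2)])
qed

text \<open>The dilation with off-diagonal blocks \<open>H\<close> and its transpose is a random
  symmetric matrix of size \<open>2 * n\<close>, hence the doubled dimension in the bounds. Vectors
  supported on the second half recover \<open>H\<close>.\<close>

lemma H_norm:
 obtains E where "E \<in> sets (N I)" "measure (N I) (space (N I) - E) \<le> 4 * real n * exp (- l)" "\<And>om. om \<in> E \<Longrightarrow> opb (Hs om) (rh / 8)"
proof -
 define ix :: "nat \<Rightarrow> nat \<Rightarrow> (nat \<times> nat \<times> nat) option" where
  "ix a b = (if a < n \<and> n \<le> b then Some (0, a, b - n) else if b < n \<and> n \<le> a then Some (0, b, a - n) else None)" for a b
 interpret D: random_symmetric_matrix "entry_index n" mu sg L "2 * n" ix
 proof unfold_locales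
  show "ix a b = ix b a" for a b by (auto simp: ix_def)
  show "e \<in> I" if "a < 2 * n" "b < 2 * n" "ix a b = Some e" for a b e using that by (auto simp: ix_def entry_index_def split: if_splits)
  show "b = b'" if "ix a b = Some e" "ix a b' = Some e" for a b b' e using that by (auto simp: ix_def split: if_splits)
 qed
 obtain E where E: "E \<in> sets (N I)" "measure (N I) (space (N I) - E) \<le> 2 * real (2 * n) * exp (- l)"
  "\<And>om. om \<in> E \<Longrightarrow> opb (D.X om) (4 * sqrt (real p * (2 * real (2 * n) * sg^2 + l * L^2)))"
  by (rule D.operator_norm_tail[OF l0 l(2)]) (rule that)
 have opb: "opb (Hs om) c" if X: "opb (D.X om) c" for om c
 proof (rule opbI[OF sample_H_carrier])
  fix v :: "real Matrix.vec" assume v: "v \<in> vecs n"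
  define x where "x = Matrix.vec (2 * n) (\<lambda>i. if i < n then 0 else v $ (i - n))"
  have split: "(\<Sum>i\<in>{0..<2 * n}. g i) = (\<Sum>i\<in>{0..<n}. g i) + (\<Sum>i\<in>{0..<n}. g (i + n))" for g :: "nat \<Rightarrow> real"
   using sum.atLeastLessThan_concat[of 0 n "2 * n" g] sum.shift_bounds_nat_ivl[of g 0 n n] by (simp add: mult_2)
  have "vec_l2 x = vec_l2 v" unfolding vec_l2_def scalar_prod_def using v by (simp add: x_def split)
  moreover have "vec_l2 (Hs om *\<^sub>v v) \<le> vec_l2 (D.X om *\<^sub>v x)"
  proof -
   have row: "(D.X om *\<^sub>v x) $ a = (Hs om *\<^sub>v v) $ a" if a: "a < n" for a
   proof -
    have "(Hs om *\<^sub>v v) $ a = (\<Sum>j\<in>{0..<n}. om (0, a, j) * v $ j)" using v a by (simp add: scalar_prod_def sample_H_def)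
    moreover have "(D.X om *\<^sub>v x) $ a = (\<Sum>j\<in>{0..<2 * n}. (case ix a j of None \<Rightarrow> 0 | Some e \<Rightarrow> om e) * x $ j)"
     using a by (simp add: scalar_prod_def D.X_def x_def)
    ultimately show ?thesis unfolding split using a by (simp add: ix_def x_def)
   qed
   have "(\<Sum>a\<in>{0..<n}. ((Hs om *\<^sub>v v) $ a)^2) = (\<Sum>a\<in>{0..<n}. ((D.X om *\<^sub>v x) $ a)^2)" using row by simp
   also have "... \<le> (\<Sum>a\<in>{0..<2 * n}. ((D.X om *\<^sub>v x) $ a)^2)" by (intro sum_mono2) auto
   finally show ?thesis unfolding vec_l2_def using matsD[OF sample_H_carrier] matsD[OF D.X(1)]
    by (simp add: scalar_prod_def power2_eq_square)
  qed
  moreover have "vec_l2 (D.X om *\<^sub>v x) \<le> c * vec_l2 x" by (rule opbD[OF X D.X(1)]) (simp add: x_def)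
  ultimately show "vec_l2 (Hs om *\<^sub>v v) \<le> c * vec_l2 v" by simp
 qed
 have le: "4 * sqrt (real p * (2 * real (2 * n) * sg^2 + l * L^2)) \<le> rh / 8" using rh_norm by simp
 have "opb (Hs om) (rh / 8)" if "om \<in> E" for om by (rule opb_mono[OF opb[OF E(3)[OF that]] le])
 moreover have "measure (N I) (space (N I) - E) \<le> 4 * real n * exp (- l)" using E(2) by simp
 ultimately show ?thesis by (intro that[OF E(1)])
qed

definition krylov :: "(nat \<times> nat \<times> nat \<Rightarrow> real) \<Rightarrow> nat \<Rightarrow> nat \<Rightarrow> nat \<Rightarrow> real" where
 "krylov om k s i = (Hs om ^\<^sub>m s * Us) $$ (i, k)"

lemma pow_H: "Hs om ^\<^sub>m s \<in> mats n n" using sample_H_carrier by simp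

lemma krylov_0: "\<lbrakk>i < n; k < r\<rbrakk> \<Longrightarrow> krylov om k 0 i = Us $$ (i, k)"
 using Us(1) matsD(1)[OF sample_H_carrier[of n om]] by (simp add: krylov_def)

lemma krylov_Suc: "\<lbrakk>i < n; k < r\<rbrakk> \<Longrightarrow> krylov om k (Suc s) i = (\<Sum>j<n. om (0, i, j) * krylov om k s j)"
proof -
 assume ik: "i < n" "k < r"
 note d = matsD[OF pow_H] matsD[OF Us(1)] matsD[OF sample_H_carrier]
 have "Hs om ^\<^sub>m Suc s * Us = Hs om * (Hs om ^\<^sub>m s * Us)" unfolding pow_mat_Suc_left[OF sample_H_carrier] by (simp add: mat_dim_assoc d)
 thus ?thesis using ik unfolding krylov_def by (simp add: d scalar_prod_def lessThan_atLeast0) (simp add: sample_H_def)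
qed

lemma krylov_measurable: "\<lbrakk>i < n; k < r\<rbrakk> \<Longrightarrow> (\<lambda>om. krylov om k s i) \<in> BM"
proof (induction s arbitrary: i)
 case (Suc s)
 have m: "(\<lambda>om. om (0, i, j)) \<in> BM" if "j \<in> {..<n}" for j
  by (rule measurable_coord) (use Suc.prems that in \<open>simp add: entry_index_def\<close>)
 have IH: "(\<lambda>om. krylov om k s j) \<in> BM" if "j \<in> {..<n}" for j by (rule Suc.IH) (use Suc.prems that in simp_all)
 show ?case unfolding krylov_Suc[OF Suc.prems] by (intro borel_measurable_sum borel_measurable_times m IH)
qed (simp add: krylov_0)

text \<open>These vectors are determined by the entries of \<open>H\<close>, so they act as fixed
  vectors for \<open>W1\<close> and \<open>W2\<close>.\<close>

lemma krylov_depends: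
 assumes k: "k < r" shows "i < n \<Longrightarrow> depends_on ({0} \<times> ({..<n} \<times> {..<n})) (\<lambda>om. krylov om k s i)"
proof (induction s arbitrary: i)
 case 0
 thus ?case using k by (simp add: krylov_0 depends_on_def)
next
 case (Suc s)
 show ?case unfolding depends_on_def
 proof (intro allI impI)
  fix om om' :: "nat \<times> nat \<times> nat \<Rightarrow> real" assume e: "\<forall>e\<in>{0} \<times> ({..<n} \<times> {..<n}). om e = om' e"
  have "krylov om k s j = krylov om' k s j" if "j < n" for j by (rule depends_onD[OF Suc.IH[OF that]]) (use e in blast)
  thus "krylov om k (Suc s) i = krylov om' k (Suc s) i" unfolding krylov_Suc[OF Suc.prems k] using e Suc.prems by simp
 qed
qed

lemma krylov_col: "k < r \<Longrightarrow> (\<Sum>i<n. (krylov om k s i)^2) = (vec_l2 (Hs om ^\<^sub>m s *\<^sub>v col Us k))^2"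
proof -
 assume k: "k < r"
 note d = matsD[OF pow_H[of om s]] matsD[OF Us(1)] matsD[OF sample_H_carrier[of n om]]
 have "krylov om k s i = (Hs om ^\<^sub>m s *\<^sub>v col Us k) $ i" if "i < n" for i using that k by (simp add: krylov_def d)
 thus ?thesis unfolding vec_l2_sq by (simp add: scalar_prod_def power2_eq_square d lessThan_atLeast0)
qed

lemma col_Us: "k < r \<Longrightarrow> vec_l2 (col Us k) = 1"
proof -
 assume k: "k < r"
 have "(tr Us * Us) $$ (k, k) = col Us k \<bullet> col Us k" using k Us(1) by simp
 thus ?thesis using k unfolding vec_l2_def Us(2) by simp
qed

lemma krylov_norm:
 assumes H: "opb (Hs om) (rh / 8)" and k: "k < r" shows "(\<Sum>i<n. (krylov om k s i)^2) \<le> ((rh / 8) ^ s)^2"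
proof -
 have c: "col Us k \<in> vecs n" using Us(1) by auto
 show ?thesis unfolding krylov_col[OF k] using opb_pow[OF H sample_H_carrier] rh opbD[OF _ pow_H c] col_Us[OF k] by simp
qed

end

lemma sum_upper_triangle:
 fixes g :: "nat \<Rightarrow> nat \<Rightarrow> real"
 shows "(\<Sum>i<n. \<Sum>j<n. g i j) = (\<Sum>(i, j)\<in>{(i, j). i \<le> j \<and> j < n}. if i = j then g i i else g i j + g j i)"
proof -
 let ?U = "{(i, j). i \<le> j \<and> j < n}" and ?S = "{(i, j). i < j \<and> j < n}" and ?L = "{(i, j). j < i \<and> i < n}"
 have fin: "finite ?U" "finite ?S" "finite ?L" by (rule finite_subset[of _ "{..<n} \<times> {..<n}"]; auto)+
 have "(\<Sum>i<n. \<Sum>j<n. g i j) = (\<Sum>(i, j)\<in>{..<n} \<times> {..<n}. g i j)" by (simp add: sum.cartesian_product)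
 also have "{..<n} \<times> {..<n} = ?U \<union> ?L" by auto
 also have "(\<Sum>(i, j)\<in>?U \<union> ?L. g i j) = (\<Sum>(i, j)\<in>?U. g i j) + (\<Sum>(i, j)\<in>?L. g i j)"
  using fin by (intro sum.union_disjoint) auto
 also have "(\<Sum>(i, j)\<in>?L. g i j) = (\<Sum>(i, j)\<in>?S. g j i)"
  by (rule sum.reindex_bij_witness[of _ "\<lambda>(i, j). (j, i)" "\<lambda>(i, j). (j, i)"]) auto
 also have "... = (\<Sum>e\<in>?U. case e of (i, j) \<Rightarrow> if i = j then 0 else g j i)"
  using fin by (intro sum.mono_neutral_cong_left) (auto split: if_splits)
 also have "(\<Sum>(i, j)\<in>?U. g i j) + ... = (\<Sum>(i, j)\<in>?U. if i = j then g i i else g i j + g j i)"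
  unfolding sum.distrib[symmetric] by (intro sum.cong refl) auto
 finally show ?thesis .
qed

context noise_sample
begin

definition T where "T = 32 * (sqrt l * sg + l * L * b0)"
text \<open>\<open>2 * T\<close> comes from the resolvent deviation, and \<open>sg\<close> pays for
  the truncation of the expansion.\<close>

definition e0 where "e0 = 2 * T + sg"

text \<open>Basis vectors yield the entrywise bounds, columns of \<open>Us\<close> the bilinear
  ones.\<close>

definition tests :: "(nat \<Rightarrow> real) set" where
 "tests = basis_fun ` {..<n} \<union> (\<lambda>m i. Us $$ (i, m)) ` {..<r}"

lemma Us_col_sq: "k < r \<Longrightarrow> (\<Sum>i<n. (Us $$ (i, k))^2) = 1"
proof -
 assume k: "k < r"
 have "(vec_l2 (col Us k))^2 = (\<Sum>i<n. (Us $$ (i, k))^2)"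
  unfolding vec_l2_sq using k Us(1) by (simp add: scalar_prod_def power2_eq_square lessThan_atLeast0)
 thus ?thesis using col_Us[OF k] by simp
qed

lemma card_tests: "card tests \<le> 2 * n"
proof -
 have "card tests \<le> card (basis_fun ` {..<n}) + card ((\<lambda>m i. Us $$ (i, m)) ` {..<r})" unfolding tests_def by (rule card_Un_le)
 also have "... \<le> n + r" using card_image_le[of "{..<n}" basis_fun] card_image_le[of "{..<r}" "\<lambda>m i. Us $$ (i, m)"] by simp
 finally show ?thesis using r by simp
qed

lemma column_norm:
 assumes H: "opb (Hs om) (rh / 8)" shows "(\<Sum>j<n. (\<Sum>i<n. x i * om (0, i, j))^2) \<le> (rh / 8)^2 * (\<Sum>i<n. (x i)^2)"
proof -
 define v where "v = Matrix.vec n x"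
 have "opb (tr (Hs om)) (rh / 8)" using opb_transpose[OF H sample_H_carrier] rh by simp
 hence "vec_l2 (tr (Hs om) *\<^sub>v v) \<le> rh / 8 * vec_l2 v" by (rule opbD[where n = n and m = n]) (simp_all add: v_def sample_H_def)
 hence "(vec_l2 (tr (Hs om) *\<^sub>v v))^2 \<le> (rh / 8 * vec_l2 v)^2" by (rule power_mono) simp
 hence "(vec_l2 (tr (Hs om) *\<^sub>v v))^2 \<le> (rh / 8)^2 * (vec_l2 v)^2" by (simp only: power_mult_distrib)
 thus ?thesis unfolding vec_l2_sq by (simp add: scalar_prod_def v_def sample_H_def power2_eq_square lessThan_atLeast0 mult.commute)
qed

lemma resolvent_event:
 fixes z :: complex
 assumes k: "k < r" and z: "cmod z = rh" shows "\<exists>B\<in>sets (N I). measure (N I) B \<le> 16 * (real n)^2 * exp (- l) \<and>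
  (\<forall>om\<in>space (N I) - B. opb (Hs om) (rh / 8) \<longrightarrow> (\<forall>a\<in>tests. \<exists>p :: nat \<Rightarrow> complex.
   (\<forall>j<n. z * p j - (\<Sum>m<n. p m * om (0, m, j)) = cor (a j)) \<and>
   (\<Sum>j<n. (cmod (p j))^2) \<le> (2 / rh)^2 \<and>
   cmod ((\<Sum>j<n. p j * Us $$ (j, k)) - (\<Sum>j<n. a j * Us $$ (j, k)) / z) \<le> 2 * T / rh^2))"
proof -
 interpret R: resolvent_process "entry_index n" mu sg L n "\<lambda>i j. (0, i, j)" "\<lambda>i. Us $$ (i, k)" tests z rh l b0
 proof unfold_locales
  show "(0, i, j) \<in> I" if "i < n" "j < n" for i j using that by (simp add: entry_index_def)
  show "finite tests" by (simp add: tests_def)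
  show "basis_fun i \<in> tests" if "i < n" for i using that by (simp add: tests_def)
  show "(\<Sum>i<n. (a i)^2) \<le> 1" if a: "a \<in> tests" for a
  proof -
   consider i where "i < n" "a = basis_fun i" | m where "m < r" "a = (\<lambda>i. Us $$ (i, m))" using a by (auto simp: tests_def)
   thus ?thesis
   proof cases
    case 1
    hence "(\<Sum>i<n. (a i)^2) = (\<Sum>j<n. if j = i then 1 else 0)" by (intro sum.cong) (auto simp: basis_fun_def)
    thus ?thesis by simp
   qed (simp add: Us_col_sq)
  qed
  show "\<bar>Us $$ (i, k)\<bar> \<le> b0" if "i < n" for i by (rule b0(1)[OF that k])
 qed (use Us_col_sq[OF k] b0(2) z l rh_sg rh_L in auto)
 have "measure (N I) R.bad \<le> 8 * real n * real (card tests) * exp (- l)" by (rule R.bad_prob)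
 also have "... \<le> 8 * real n * (2 * real n) * exp (- l)" using card_tests by (intro mult_right_mono mult_left_mono) auto
 finally have "measure (N I) R.bad \<le> 16 * (real n)^2 * exp (- l)" by (simp add: power2_eq_square)
 moreover have "\<exists>p :: nat \<Rightarrow> complex. (\<forall>j<n. z * p j - (\<Sum>m<n. p m * om (0, m, j)) = cor (a j)) \<and>
   (\<Sum>j<n. (cmod (p j))^2) \<le> (2 / rh)^2 \<and>
   cmod ((\<Sum>j<n. p j * Us $$ (j, k)) - (\<Sum>j<n. a j * Us $$ (j, k)) / z) \<le> 2 * T / rh^2"
  if "om \<in> space (N I) - R.bad" "opb (Hs om) (rh / 8)" "a \<in> tests" for om a
 proof -
  have om: "om \<in> space (N I)" "om \<notin> R.bad" using that by auto
  show ?thesis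
  proof (rule R.resolvent_deviation[OF om column_norm[OF that(2)] that(3)])
   fix p :: "nat \<Rightarrow> complex"
   assume "\<And>j. j < n \<Longrightarrow> z * p j - (\<Sum>m<n. p m * om (0, m, j)) = cor (a j)"
    "(\<Sum>j<n. (cmod (p j))^2) \<le> (2 / rh)^2"
    "cmod ((\<Sum>j<n. p j * Us $$ (j, k)) - (\<Sum>j<n. a j * Us $$ (j, k)) / z) \<le> 2 * R.T / rh^2"
   thus ?thesis unfolding R.T_def T_def by auto
  qed
 qed
 ultimately show ?thesis using R.bad_sets by auto
qed

lemma T_pos: "0 < T" unfolding T_def using l sg b0(2) by (intro mult_pos_pos add_pos_nonneg) auto

text \<open>One resolvent event for each column of \<open>Us\<close> and each of the
  \<open>n\<close> roots of unity; the union costs a factor \<open>r * n\<close>.\<close>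

lemma power_event:
 "\<exists>B\<in>sets (N I). measure (N I) B \<le> 16 * (real n) ^ 4 * exp (- l) \<and>
  (\<forall>om\<in>space (N I) - B. opb (Hs om) (rh / 8) \<longrightarrow>
   (\<forall>a\<in>tests. \<forall>k<r. \<forall>s. 0 < s \<and> s < n \<longrightarrow> \<bar>\<Sum>i<n. a i * krylov om k s i\<bar> \<le> e0 * rh ^ (s - 1)))"
proof -
 define w where "w = exp (2 * of_real pi * \<i> * of_nat 1 / of_nat n)"
 define z where "z j = cor rh * w ^ j" for j
 have z: "cmod (z j) = rh" for j using rh by (simp add: z_def norm_mult norm_power w_def)
 define P where "P k j B \<longleftrightarrow> B \<in> sets (N I) \<and> measure (N I) B \<le> 16 * (real n)^2 * exp (- l) \<and>
  (\<forall>om\<in>space (N I) - B. opb (Hs om) (rh / 8) \<longrightarrow> (\<forall>a\<in>tests. \<exists>p :: nat \<Rightarrow> complex.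
   (\<forall>i<n. z j * p i - (\<Sum>m<n. p m * om (0, m, i)) = cor (a i)) \<and>
   (\<Sum>i<n. (cmod (p i))^2) \<le> (2 / rh)^2 \<and>
   cmod ((\<Sum>i<n. p i * Us $$ (i, k)) - (\<Sum>i<n. a i * Us $$ (i, k)) / z j) \<le> 2 * T / rh^2))" for k j B
 have "\<exists>B. k < r \<longrightarrow> P k j B" for k j
 proof (cases "k < r")
  case True
  from resolvent_event[OF True z[of j]] obtain B where "P k j B" unfolding P_def by auto
  thus ?thesis by blast
 qed simp
 hence "\<forall>e. \<exists>B. fst e < r \<longrightarrow> P (fst e) (snd e) B" by blast
 from choice[OF this] obtain B where B: "\<And>k j. k < r \<Longrightarrow> P k j (B (k, j))" by auto
 define BB where "BB = (\<Union>k<r. \<Union>j<n. B (k, j))"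
 have sets: "B (k, j) \<in> sets (N I)" if "k < r" for k j using B[OF that] by (simp add: P_def)
 have "prob BB \<le> (\<Sum>k<r. prob (\<Union>j<n. B (k, j)))" unfolding BB_def using sets by (intro finite_measure_subadditive_finite) auto
 also have "... \<le> (\<Sum>k<r. \<Sum>j<n. prob (B (k, j)))" using sets by (intro sum_mono finite_measure_subadditive_finite) auto
 also have "... \<le> (\<Sum>k<r. \<Sum>j<n. 16 * (real n)^2 * exp (- l))" using B by (intro sum_mono) (auto simp: P_def)
 also have "... = real r * (16 * (real n) ^ 3 * exp (- l))" by (simp add: power3_eq_cube power2_eq_square)
 also have "... \<le> real n * (16 * (real n) ^ 3 * exp (- l))" using r by (intro mult_right_mono) auto
 finally have "prob BB \<le> 16 * (real n) ^ 4 * exp (- l)" by (simp add: power4_eq_xxxx power3_eq_cube)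
 moreover have "BB \<in> sets (N I)" unfolding BB_def using sets by simp
 moreover have "\<bar>\<Sum>i<n. a i * krylov om k s i\<bar> \<le> e0 * rh ^ (s - 1)"
  if om: "om \<in> space (N I) - BB" and H: "opb (Hs om) (rh / 8)" and a: "a \<in> tests" and k: "k < r" and s: "0 < s" "s < n" for om a k s
 proof -
  have omB: "om \<in> space (N I) - B (k, j)" if "j < n" for j using om that k by (auto simp: BB_def)
  have x0: "(\<Sum>i<n. c i * cor (krylov om k 0 i)) = (\<Sum>i<n. c i * cor (Us $$ (i, k)))"
   "(\<Sum>i<n. a i * krylov om k 0 i) = (\<Sum>i<n. a i * Us $$ (i, k))" for c using k by (auto intro!: sum.cong simp: krylov_0)
  have "\<bar>\<Sum>i<n. a i * krylov om k s i\<bar> \<le> rh ^ Suc s * (2 * T / rh^2) + 2 * rh ^ s * (1 / 8) ^ n"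
  proof (rule power_form_bound[OF rh krylov_Suc[OF _ k] krylov_norm[OF H k] _ s])
   fix j assume j: "j < n"
   have "\<exists>p :: nat \<Rightarrow> complex. (\<forall>i<n. z j * p i - (\<Sum>m<n. p m * om (0, m, i)) = cor (a i)) \<and>
    (\<Sum>i<n. (cmod (p i))^2) \<le> (2 / rh)^2 \<and>
    cmod ((\<Sum>i<n. p i * Us $$ (i, k)) - (\<Sum>i<n. a i * Us $$ (i, k)) / z j) \<le> 2 * T / rh^2"
    using B[OF k, of j] omB[OF j] H a unfolding P_def by blast
   thus "\<exists>p :: nat \<Rightarrow> complex. (\<forall>i<n. cor rh * exp (2 * of_real pi * \<i> * of_nat 1 / of_nat n) ^ j * p i
     - (\<Sum>m<n. p m * om (0, m, i)) = cor (a i)) \<and>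
    (\<Sum>i<n. (cmod (p i))^2) \<le> (2 / rh)^2 \<and>
    cmod ((\<Sum>i<n. p i * krylov om k 0 i) - (\<Sum>i<n. a i * krylov om k 0 i) / (cor rh * exp (2 * of_real pi * \<i> * of_nat 1 / of_nat n) ^ j))
     \<le> 2 * T / rh^2" unfolding z_def w_def x0 .
  qed
  also have "... = (2 * T + 2 * rh * (1 / 8) ^ n) * rh ^ (s - 1)"
  proof -
   obtain s' where s': "s = Suc s'" using s by (cases s) auto
   show ?thesis unfolding s' using rh by (simp add: power2_eq_square algebra_simps)
  qed
  also have "... \<le> e0 * rh ^ (s - 1)" unfolding e0_def using rh_tail rh by simp
  finally show ?thesis .
 qed
 ultimately show ?thesis by auto
qed

definition upper :: "nat \<Rightarrow> (nat \<times> nat \<times> nat) set" where "upper t = {t} \<times> {(i, j). i \<le> j \<and> j < n}"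

lemma upper_I: "t \<in> {1, 2} \<Longrightarrow> upper t \<subseteq> I" by (auto simp: upper_def entry_index_def)

lemma sum_upper: "(\<Sum>e\<in>upper t. F e) = (\<Sum>(i, j)\<in>{(i, j). i \<le> j \<and> j < n}. F (t, i, j))"
proof -
 have "upper t = Pair t ` {(i, j). i \<le> j \<and> j < n}" by (auto simp: upper_def)
 thus ?thesis by (simp add: sum.reindex inj_on_def)
qed

text \<open>The independent variables of a symmetric matrix sit on and above the diagonal, so the
  coefficients of mirrored entries are added.\<close>

lemma W_form:
 fixes x y :: "nat \<Rightarrow> real" shows "(\<Sum>i<n. \<Sum>j<n. x i * om (t, min i j, max i j) * y j)
 = (\<Sum>e\<in>upper t. (case e of (_, i, j) \<Rightarrow> if i = j then x i * y i else x i * y j + x j * y i) * om e)"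
proof -
 have "(\<Sum>e\<in>upper t. (case e of (_, i, j) \<Rightarrow> if i = j then x i * y i else x i * y j + x j * y i) * om e)
  = (\<Sum>(i, j)\<in>{(i, j). i \<le> j \<and> j < n}. (if i = j then x i * y i else x i * y j + x j * y i) * om (t, i, j))"
  unfolding sum_upper by simp
 also have "... = (\<Sum>(i, j)\<in>{(i, j). i \<le> j \<and> j < n}. if i = j then x i * om (t, min i i, max i i) * y i
   else x i * om (t, min i j, max i j) * y j + x j * om (t, min j i, max j i) * y i)" by (intro sum.cong refl) (auto simp: algebra_simps)
 finally show ?thesis by (simp only: sum_upper_triangle)
qed

lemma W_form_coeff_sq:
 "(\<Sum>e\<in>upper t. (case e of (_, i, j) \<Rightarrow> if i = j then x i * y i else x i * y j + x j * y i)^2)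
  \<le> 2 * ((\<Sum>i<n. (x i)^2) * (\<Sum>i<n. (y i)^2))" for x y :: "nat \<Rightarrow> real"
proof -
 have "(\<Sum>e\<in>upper t. (case e of (_, i, j) \<Rightarrow> if i = j then x i * y i else x i * y j + x j * y i)^2)
  = (\<Sum>(i, j)\<in>{(i, j). i \<le> j \<and> j < n}. (if i = j then x i * y i else x i * y j + x j * y i)^2)" unfolding sum_upper by simp
 also have "... \<le> (\<Sum>(i, j)\<in>{(i, j). i \<le> j \<and> j < n}. if i = j then 2 * ((x i)^2 * (y i)^2) else 2 * ((x i)^2 * (y j)^2) + 2 * ((x j)^2 * (y i)^2))"
 proof (rule sum_mono, clarsimp, intro conjI impI)
  fix i j :: nat
  show "(x j * y j)^2 \<le> 2 * ((x j)^2 * (y j)^2)" by (simp add: power_mult_distrib)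
  show "(x i * y j + x j * y i)^2 \<le> 2 * ((x i)^2 * (y j)^2) + 2 * ((x j)^2 * (y i)^2)"
   using sum_squares_bound[of "x i * y j" "x j * y i"] by (simp add: power2_sum power_mult_distrib)
 qed
 also have "... = (\<Sum>i<n. \<Sum>j<n. 2 * ((x i)^2 * (y j)^2))" by (simp only: sum_upper_triangle)
 finally show ?thesis by (simp only: sum_product sum_distrib_left[of 2])
qed

text \<open>Given everything outside the block of index \<open>t\<close>, the form is linear in
  independent entries. The bounds on \<open>x\<close> and \<open>y\<close> appear as premises on the
  sample point, since they are themselves only likely.\<close>

lemma W_form_tail:
 fixes x y :: "(nat \<times> nat \<times> nat \<Rightarrow> real) \<Rightarrow> nat \<Rightarrow> real"
 assumes t: "t \<in> {1, 2}" and A: "0 < A1" "0 < A2" and B: "0 \<le> B1" "0 \<le> B2"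
  and x: "\<And>i. i < n \<Longrightarrow> (\<lambda>om. x om i) \<in> BM" "\<And>i. i < n \<Longrightarrow> depends_on (I - upper t) (\<lambda>om. x om i)"
  and y: "\<And>i. i < n \<Longrightarrow> (\<lambda>om. y om i) \<in> BM" "\<And>i. i < n \<Longrightarrow> depends_on (I - upper t) (\<lambda>om. y om i)"
 shows "\<exists>E\<in>sets (N I). measure (N I) E \<le> 2 * exp (- l) \<and>
  (\<forall>om\<in>space (N I) - E. (\<Sum>i<n. (x om i)^2) \<le> A1^2 \<longrightarrow> (\<Sum>i<n. (y om i)^2) \<le> A2^2 \<longrightarrow>
   (\<forall>i<n. \<bar>x om i\<bar> \<le> B1) \<longrightarrow> (\<forall>i<n. \<bar>y om i\<bar> \<le> B2) \<longrightarrow>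
   \<bar>\<Sum>i<n. \<Sum>j<n. x om i * om (t, min i j, max i j) * y om j\<bar> \<le> bernstein l (2 * (A1 * A2)) (2 * (B1 * B2)))"
proof -
 define Q where "Q om \<longleftrightarrow> (\<Sum>i<n. (x om i)^2) \<le> A1^2 \<and> (\<Sum>i<n. (y om i)^2) \<le> A2^2 \<and>
  (\<forall>i\<in>{..<n}. \<bar>x om i\<bar> \<le> B1) \<and> (\<forall>i\<in>{..<n}. \<bar>y om i\<bar> \<le> B2)" for om
 define al where "al e om = (case e of (_, i, j) \<Rightarrow> if i = j then x om i * y om i else x om i * y om j + x om j * y om i)"
  for e :: "nat \<times> nat \<times> nat" and om
 have Qm: "Measurable.pred (N I) Q"
 proof -
  have "Measurable.pred (N I) (\<lambda>om. (\<Sum>i<n. (x om i)^2) \<le> A1^2)" "Measurable.pred (N I) (\<lambda>om. (\<Sum>i<n. (y om i)^2) \<le> A2^2)"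
   using x(1) y(1) by measurable
  moreover have "Measurable.pred (N I) (\<lambda>om. \<forall>i\<in>{..<n}. \<bar>x om i\<bar> \<le> B1)" "Measurable.pred (N I) (\<lambda>om. \<forall>i\<in>{..<n}. \<bar>y om i\<bar> \<le> B2)"
   using x(1) y(1) by auto
  ultimately show ?thesis unfolding Q_def[abs_def] by (intro pred_intros_logic(3))
 qed
 have mem: "i < n \<and> j < n" if "(t', i, j) \<in> upper t" for t' i j using that by (auto simp: upper_def)
 have alm: "al e \<in> BM" if "e \<in> upper t" for e
 proof -
  obtain t' i j where e: "e = (t', i, j)" by (cases e)
  have "i < n" "j < n" using mem that e by auto
  thus ?thesis unfolding al_def[abs_def] e using x(1) y(1) by simp
 qed
 have ald: "depends_on (I - upper t) (al e)" if "e \<in> upper t" for e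
 proof -
  obtain t' i j where e: "e = (t', i, j)" by (cases e)
  have ij: "i < n" "j < n" using mem that e by auto
  show ?thesis unfolding depends_on_def al_def e
  proof (intro allI impI)
   fix om om' :: "nat \<times> nat \<times> nat \<Rightarrow> real" assume "\<forall>i\<in>I - upper t. om i = om' i"
   hence "x om m = x om' m \<and> y om m = y om' m" if "m < n" for m using x(2)[OF that] y(2)[OF that] unfolding depends_on_def by blast
   thus "(case (t', i, j) of (_, i, j) \<Rightarrow> if i = j then x om i * y om i else x om i * y om j + x om j * y om i)
    = (case (t', i, j) of (_, i, j) \<Rightarrow> if i = j then x om' i * y om' i else x om' i * y om' j + x om' j * y om' i)" using ij by simp
  qed
 qed
 have Qd: "depends_on (I - upper t) Q" unfolding depends_on_def
 proof (intro allI impI)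
  fix om om' :: "nat \<times> nat \<times> nat \<Rightarrow> real" assume "\<forall>i\<in>I - upper t. om i = om' i"
  hence "x om m = x om' m \<and> y om m = y om' m" if "m < n" for m using x(2)[OF that] y(2)[OF that] unfolding depends_on_def by blast
  thus "Q om = Q om'" unfolding Q_def by simp
 qed
 have sq: "(\<Sum>e\<in>upper t. (al e om)^2) \<le> (2 * (A1 * A2))^2" if "Q om" for om
 proof -
  have "(\<Sum>e\<in>upper t. (al e om)^2) \<le> 2 * ((\<Sum>i<n. (x om i)^2) * (\<Sum>i<n. (y om i)^2))" unfolding al_def by (rule W_form_coeff_sq)
  also have "... \<le> 2 * (A1^2 * A2^2)" using that by (intro mult_left_mono mult_mono) (auto simp: Q_def sum_nonneg)
  also have "... \<le> (2 * (A1 * A2))^2" by (simp add: power_mult_distrib)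
  finally show ?thesis .
 qed
 have mx: "\<bar>al e om\<bar> \<le> 2 * (B1 * B2)" if Q: "Q om" and e: "e \<in> upper t" for om e
 proof -
  obtain t' i j where e': "e = (t', i, j)" by (cases e)
  have ij: "i < n" "j < n" using mem e e' by auto
  have p: "\<bar>x om a * y om c\<bar> \<le> B1 * B2" if "a < n" "c < n" for a c
   unfolding abs_mult using Q that by (intro mult_mono) (auto simp: Q_def)
  have "0 \<le> B1 * B2" using B by simp
  thus ?thesis using p[OF ij] p[OF ij(2,1)] unfolding e' al_def by auto
 qed
 let ?E = "{om \<in> space (N I). Q om \<and> bernstein l (2 * (A1 * A2)) (2 * (B1 * B2)) < \<bar>\<Sum>e\<in>upper t. al e om * om e\<bar>}"
 have "measure (N I) ?E \<le> 2 * exp (- l)" using A B by (intro linear_tail_abs[OF upper_I[OF t] l0] alm Qm ald Qd sq mx) auto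
 moreover have "?E \<in> sets (N I)"
 proof -
  have "(\<lambda>om. om e) \<in> BM" if "e \<in> upper t" for e using that upper_I[OF t] by auto
  hence "(\<lambda>om. \<Sum>e\<in>upper t. al e om * om e) \<in> BM" by (intro borel_measurable_sum borel_measurable_times alm)
  hence "Measurable.pred (N I) (\<lambda>om. bernstein l (2 * (A1 * A2)) (2 * (B1 * B2)) < \<bar>\<Sum>e\<in>upper t. al e om * om e\<bar>)"
   by measurable
  from pred_intros_logic(3)[OF Qm this] show ?thesis unfolding pred_def .
 qed
 moreover have "\<bar>\<Sum>i<n. \<Sum>j<n. x om i * om (t, min i j, max i j) * y om j\<bar> \<le> bernstein l (2 * (A1 * A2)) (2 * (B1 * B2))"
  if "om \<in> space (N I) - ?E" "Q om" for om using that unfolding W_form al_def by auto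
 ultimately show ?thesis by (intro bexI[of _ ?E] conjI ballI impI) (auto simp: Q_def)
qed

end

lemma (in prob_space) measure_Un6_le:
 assumes "A1 \<in> events" "A2 \<in> events" "A3 \<in> events" "A4 \<in> events" "A5 \<in> events" "A6 \<in> events"
 shows "prob (A1 \<union> A2 \<union> A3 \<union> A4 \<union> A5 \<union> A6) \<le> prob A1 + prob A2 + prob A3 + prob A4 + prob A5 + prob A6"
proof -
 have "prob (A1 \<union> A2 \<union> A3 \<union> A4 \<union> A5 \<union> A6) \<le> prob (A1 \<union> A2 \<union> A3 \<union> A4 \<union> A5) + prob A6"
  "prob (A1 \<union> A2 \<union> A3 \<union> A4 \<union> A5) \<le> prob (A1 \<union> A2 \<union> A3 \<union> A4) + prob A5"
  "prob (A1 \<union> A2 \<union> A3 \<union> A4) \<le> prob (A1 \<union> A2 \<union> A3) + prob A4"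
  "prob (A1 \<union> A2 \<union> A3) \<le> prob (A1 \<union> A2) + prob A3" "prob (A1 \<union> A2) \<le> prob A1 + prob A2"
  by (intro measure_Un_le sets.Un assms)+
 thus ?thesis by linarith
qed

lemma (in prob_space) finite_event_family:
 assumes K: "finite K" and ev: "\<And>ka. ka \<in> K \<Longrightarrow> \<exists>E\<in>sets M. measure M E \<le> c \<and> (\<forall>om\<in>space M - E. R ka om)"
 shows "\<exists>E\<in>sets M. measure M E \<le> real (card K) * c \<and> (\<forall>om\<in>space M - E. \<forall>ka\<in>K. R ka om)"
proof -
 have "\<forall>ka. \<exists>E. ka \<in> K \<longrightarrow> E \<in> sets M \<and> measure M E \<le> c \<and> (\<forall>om\<in>space M - E. R ka om)" using ev by blast
 from choice[OF this] obtain E where E: "\<And>ka. ka \<in> K \<Longrightarrow> E ka \<in> sets M" "\<And>ka. ka \<in> K \<Longrightarrow> measure M (E ka) \<le> c"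
  "\<And>ka om. \<lbrakk>ka \<in> K; om \<in> space M - E ka\<rbrakk> \<Longrightarrow> R ka om" by blast
 have "measure M (\<Union>ka\<in>K. E ka) \<le> (\<Sum>ka\<in>K. measure M (E ka))" using K E(1) by (intro finite_measure_subadditive_finite) auto
 also have "... \<le> (\<Sum>ka\<in>K. c)" using E(2) by (intro sum_mono)
 finally have "measure M (\<Union>ka\<in>K. E ka) \<le> real (card K) * c" by simp
 moreover have "(\<Union>ka\<in>K. E ka) \<in> sets M" using K E(1) by auto
 moreover have "R ka om" if "om \<in> space M - (\<Union>ka\<in>K. E ka)" "ka \<in> K" for om ka using E(3)[OF that(2), of om] that by blast
 ultimately show ?thesis by blast
qed

section \<open>The good event for all three noise matrices\<close>

context noise_sample
begin

lemma e0_pos: "0 < e0" unfolding e0_def using T_pos sg by linarith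

text \<open>For exponents from \<open>n\<close> on, the margin between \<open>rh / 8\<close> and
  \<open>rh\<close> outweighs the factor \<open>e0 / rh\<close>, so plain norm bounds are
  enough.\<close>

lemma small_power: "\<lbrakk>n \<le> M\<rbrakk> \<Longrightarrow> (rh / 8) ^ M \<le> e0 * rh ^ (M - 1)"
proof -
 assume M: "n \<le> M"
 obtain M' where M': "M = Suc M'" using M n by (cases M) auto
 have "rh * (1 / 8) ^ M \<le> rh * (1 / 8) ^ n" using M rh by simp
 also have "... \<le> e0" using rh_tail T_pos sg unfolding e0_def by linarith
 finally have "(rh * (1 / 8) ^ M) * rh ^ M' \<le> e0 * rh ^ M'" using rh by simp
 hence le: "(rh * (1 / 8) ^ M) * rh ^ M' \<le> e0 * rh ^ (M - 1)" by (simp only: M' diff_Suc_1)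
 have "(rh / 8) ^ M = (rh * (1 / 8) ^ M) * rh ^ M'"
 proof -
  have "(rh / 8) ^ M = rh ^ M * (1 / 8) ^ M" unfolding power_mult_distrib[symmetric] by simp
  thus ?thesis by (simp only: M' power_Suc mult_ac)
 qed
 thus ?thesis using le by simp
qed

lemma power_le: "(rh / 8) ^ s \<le> rh ^ s" using rh by (intro power_mono) auto

lemma entry_le_norm: "\<lbrakk>(\<Sum>i<n. (x i)^2) \<le> c\<^sup>2; 0 \<le> c; i < n\<rbrakk> \<Longrightarrow> \<bar>x i\<bar> \<le> (c :: real)"
proof -
 assume a: "(\<Sum>i<n. (x i)^2) \<le> c^2" "0 \<le> c" "i < n"
 have "(x i)^2 \<le> (\<Sum>i<n. (x i)^2)" using a by (intro member_le_sum) auto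
 hence "(x i)^2 \<le> c^2" using a by linarith
 thus ?thesis using a(2) by (simp add: power2_le_iff_abs_le)
qed

lemma inner_le_norm:
 assumes "(\<Sum>i<n. (x i)^2) \<le> c^2" "0 \<le> c" "(\<Sum>i<n. (y i)^2) \<le> d^2" "0 \<le> d"
 shows "\<bar>\<Sum>i<n. x i * y i\<bar> \<le> c * (d :: real)"
proof -
 have "\<bar>\<Sum>i<n. x i * y i\<bar> \<le> (\<Sum>i<n. \<bar>x i\<bar> * \<bar>y i\<bar>)" using sum_abs[of "\<lambda>i. x i * y i" "{..<n}"] by (simp add: abs_mult)
 also have "... \<le> L2_set x {..<n} * L2_set y {..<n}" by (rule L2_set_mult_ineq)
 also have "... \<le> c * d" using assms unfolding L2_set_def by (intro mult_mono real_le_lsqrt) (auto simp: sum_nonneg)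
 finally show ?thesis .
qed

definition applyW :: "nat \<Rightarrow> (nat \<times> nat \<times> nat \<Rightarrow> real) \<Rightarrow> (nat \<Rightarrow> real) \<Rightarrow> nat \<Rightarrow> real" where
 "applyW t om y i = (\<Sum>j<n. om (t, min i j, max i j) * y j)"

lemma applyW_norm:
 assumes W: "opb (Ws t om) (rh / 8)" and y: "(\<Sum>i<n. (y i)^2) \<le> c^2" "0 \<le> c"
 shows "(\<Sum>i<n. (applyW t om y i)^2) \<le> (rh / 8 * c)^2"
proof -
 define v where "v = Matrix.vec n y"
 have "vec_l2 (Ws t om *\<^sub>v v) \<le> rh / 8 * vec_l2 v" by (rule opbD[OF W sample_W_carrier]) (simp add: v_def)
 also have "... \<le> rh / 8 * c"
 proof (intro mult_left_mono)
  have "(vec_l2 v)^2 = (\<Sum>i<n. (y i)^2)" unfolding vec_l2_sq by (simp add: scalar_prod_def v_def power2_eq_square lessThan_atLeast0)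
  thus "vec_l2 v \<le> c" by (rule power2_le_imp_le[OF ord_eq_le_trans[OF _ y(1)] y(2)])
 qed (use rh in simp)
 finally have "(vec_l2 (Ws t om *\<^sub>v v))^2 \<le> (rh / 8 * c)^2" by (rule power_mono) simp
 thus ?thesis unfolding vec_l2_sq by (simp add: scalar_prod_def v_def sample_W_def applyW_def power2_eq_square lessThan_atLeast0)
qed

lemma form_applyW: "(\<Sum>i<n. \<Sum>j<n. x i * om (t, min i j, max i j) * y j) = (\<Sum>i<n. x i * applyW t om y i)"
 by (simp add: applyW_def sum_distrib_left mult.assoc)

lemma form_norm:
 assumes W: "opb (Ws t om) (rh / 8)" and x: "(\<Sum>i<n. (x i)^2) \<le> c^2" "0 \<le> c" and y: "(\<Sum>i<n. (y i)^2) \<le> d^2" "0 \<le> d"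
 shows "\<bar>\<Sum>i<n. \<Sum>j<n. x i * om (t, min i j, max i j) * y j\<bar> \<le> c * (rh / 8 * d)"
 unfolding form_applyW by (rule inner_le_norm[OF x applyW_norm[OF W y]]) (use rh y(2) in simp)

lemma upper_disjoint_H: "t \<in> {1, 2} \<Longrightarrow> {0} \<times> ({..<n} \<times> {..<n}) \<subseteq> I - upper t"
 by (auto simp: upper_def entry_index_def)

lemma krylov_depends_upper: "\<lbrakk>t \<in> {1, 2}; i < n; k < r\<rbrakk> \<Longrightarrow> depends_on (I - upper t) (\<lambda>om. krylov om k s i)"
 by (rule depends_on_mono[OF krylov_depends upper_disjoint_H])

lemma W2_measurable: "\<lbrakk>i < n; k < r\<rbrakk> \<Longrightarrow> (\<lambda>om. applyW 2 om (krylov om k s) i) \<in> BM"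
 unfolding applyW_def
proof (intro borel_measurable_sum borel_measurable_times)
 fix j assume ij: "i < n" "k < r" "j \<in> {..<n}"
 show "(\<lambda>om. om (2, min i j, max i j)) \<in> BM" by (rule measurable_coord) (use ij in \<open>auto simp: entry_index_def\<close>)
 show "(\<lambda>om. krylov om k s j) \<in> BM" using ij by (intro krylov_measurable) auto
qed

lemma W2_depends: "\<lbrakk>i < n; k < r\<rbrakk> \<Longrightarrow> depends_on (I - upper 1) (\<lambda>om. applyW 2 om (krylov om k s) i)"
 unfolding depends_on_def applyW_def
proof (intro allI impI sum.cong refl)
 fix om om' :: "nat \<times> nat \<times> nat \<Rightarrow> real" and j
 assume ik: "i < n" "k < r" and e: "\<forall>i\<in>I - upper 1. om i = om' i" and j: "j \<in> {..<n}"
 have "(2, min i j, max i j) \<in> I - upper 1" using ik j by (auto simp: entry_index_def upper_def)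
 moreover have "krylov om k s j = krylov om' k s j" by (rule depends_onD[OF krylov_depends_upper[of 1 j k s]]) (use ik j e in auto)
 ultimately show "om (2, min i j, max i j) * krylov om k s j = om' (2, min i j, max i j) * krylov om' k s j" using e by auto
qed

abbreviation "lin_form t om s m k \<equiv> \<Sum>i<n. \<Sum>j<n. krylov om m s i * om (t, min i j, max i j) * Us $$ (j, k)"
abbreviation "quad_form om s t m k \<equiv> \<Sum>i<n. \<Sum>j<n. krylov om m s i * om (1, min i j, max i j) * applyW 2 om (krylov om k t) j"

text \<open>All exponents are included, as the Neumann series require, although the probabilistic
  events treat only those below \<open>n\<close>.\<close>

definition good :: "(nat \<times> nat \<times> nat \<Rightarrow> real) \<Rightarrow> bool" where
 "good om \<longleftrightarrow> opb (Hs om) (rh / 8) \<and>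
  (\<forall>a\<in>tests. \<forall>k<r. \<forall>s. \<bar>\<Sum>i<n. a i * krylov om k (Suc s) i\<bar> \<le> e0 * rh ^ s) \<and>
  (\<forall>t\<in>{1, 2}. \<forall>m<r. \<forall>k<r. \<forall>s. \<bar>lin_form t om s m k\<bar> \<le> e0 * rh ^ s) \<and>
  (\<forall>m<r. \<forall>k<r. \<forall>s t. \<bar>quad_form om s t m k\<bar> \<le> e0 * rh ^ (s + t + 1))"

lemma tests_norm: "a \<in> tests \<Longrightarrow> (\<Sum>i<n. (a i)^2) \<le> 1\<^sup>2"
proof -
 assume "a \<in> tests"
 then consider i where "i < n" "a = basis_fun i" | m where "m < r" "a = (\<lambda>i. Us $$ (i, m))" by (auto simp: tests_def)
 thus ?thesis
 proof cases
  case 1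
  hence "(\<Sum>i<n. (a i)^2) = (\<Sum>j<n. if j = i then 1 else 0)" by (intro sum.cong) (auto simp: basis_fun_def)
  thus ?thesis by simp
 qed (simp add: Us_col_sq)
qed

lemma lL_e0: "l * L * e0 / rh \<le> e0 / 256"
proof -
 have "256 * L * l \<le> 256 * L * l^2" using l L by (intro mult_left_mono) (auto simp: power2_eq_square)
 thus ?thesis using rh_L e0_pos rh by (simp add: field_simps)
qed

lemma linear_event:
 "\<exists>E\<in>sets (N I). measure (N I) E \<le> 4 * (real n) ^ 3 * exp (- l) \<and>
  (\<forall>om\<in>space (N I) - E. opb (Hs om) (rh / 8) \<longrightarrow>
   (\<forall>t\<in>{1, 2}. \<forall>m<r. \<forall>k<r. \<forall>s<n. \<bar>lin_form t om s m k\<bar> \<le> e0 * rh ^ s))"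
proof -
 define K where "K = {1 :: nat, 2} \<times> ({..<r} \<times> ({..<r} \<times> {..<n}))"
 define R where "R ka om \<longleftrightarrow> (opb (Hs om) (rh / 8) \<longrightarrow> (case ka of (t, m, k, s) \<Rightarrow>
  \<bar>lin_form t om s m k\<bar> \<le> e0 * rh ^ s))"
  for ka :: "nat \<times> nat \<times> nat \<times> nat" and om
 have fin: "finite K" by (simp add: K_def)
 have ev: "\<exists>E\<in>events. prob E \<le> 2 * exp (- l) \<and> (\<forall>om\<in>space (N I) - E. R ka om)" if kaK: "ka \<in> K" for ka
 proof -
  obtain t m k s where ka: "ka = (t, m, k, s)" by (cases ka)
  have t: "t \<in> {1, 2}" and mk: "m < r" "k < r" "s < n" using kaK by (auto simp: K_def ka)
  have "\<exists>E\<in>events. prob E \<le> 2 * exp (- l) \<and> (\<forall>om\<in>space (N I) - E. (\<Sum>i<n. (krylov om m s i)^2) \<le> (rh ^ s)^2 \<longrightarrow>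
   (\<Sum>i<n. (Us $$ (i, k))^2) \<le> 1\<^sup>2 \<longrightarrow> (\<forall>i<n. \<bar>krylov om m s i\<bar> \<le> rh ^ s) \<longrightarrow> (\<forall>i<n. \<bar>Us $$ (i, k)\<bar> \<le> b0) \<longrightarrow>
   \<bar>lin_form t om s m k\<bar> \<le> bernstein l (2 * (rh ^ s * 1)) (2 * (rh ^ s * b0)))"
  proof (rule W_form_tail[OF t])
   show "(\<lambda>om. krylov om m s i) \<in> BM" if "i < n" for i by (rule krylov_measurable[OF that mk(1)])
   show "depends_on (I - upper t) (\<lambda>om. krylov om m s i)" if "i < n" for i by (rule krylov_depends_upper[OF t that mk(1)])
  qed (use rh b0(2) in \<open>simp_all add: depends_on_def\<close>)
  then obtain E where E: "E \<in> events" "prob E \<le> 2 * exp (- l)"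
   "\<And>om. \<lbrakk>om \<in> space (N I) - E; (\<Sum>i<n. (krylov om m s i)^2) \<le> (rh ^ s)\<^sup>2; (\<Sum>i<n. (Us $$ (i, k))^2) \<le> 1\<^sup>2;
    \<forall>i<n. \<bar>krylov om m s i\<bar> \<le> rh ^ s; \<forall>i<n. \<bar>Us $$ (i, k)\<bar> \<le> b0\<rbrakk> \<Longrightarrow>
    \<bar>lin_form t om s m k\<bar> \<le> bernstein l (2 * (rh ^ s * 1)) (2 * (rh ^ s * b0))" by blast
  have bern: "bernstein l (2 * (rh ^ s * 1)) (2 * (rh ^ s * b0)) \<le> e0 * rh ^ s"
  proof -
   have "bernstein l (2 * (rh ^ s * 1)) (2 * (rh ^ s * b0)) = (T / 8) * rh ^ s" by (simp add: bernstein_def T_def algebra_simps)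
   also have "... \<le> e0 * rh ^ s" using T_pos sg rh unfolding e0_def by simp
   finally show ?thesis .
  qed
  have "R ka om" if om: "om \<in> space (N I) - E" for om
  proof -
   have "\<bar>lin_form t om s m k\<bar> \<le> e0 * rh ^ s" if H: "opb (Hs om) (rh / 8)"
   proof -
    have "(\<Sum>i<n. (krylov om m s i)^2) \<le> ((rh / 8) ^ s)^2" by (rule krylov_norm[OF H mk(1)])
    also have "... \<le> (rh ^ s)^2" using power_le rh by simp
    finally have k: "(\<Sum>i<n. (krylov om m s i)^2) \<le> (rh ^ s)^2" .
    have "0 \<le> rh ^ s" using rh by simp
    hence kb: "\<forall>i<n. \<bar>krylov om m s i\<bar> \<le> rh ^ s" using entry_le_norm[OF k] by blast
    have u: "(\<Sum>i<n. (Us $$ (i, k))^2) \<le> 1\<^sup>2" using Us_col_sq[OF mk(2)] by simp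
    have ub: "\<forall>i<n. \<bar>Us $$ (i, k)\<bar> \<le> b0" using b0(1)[OF _ mk(2)] by blast
    show ?thesis by (rule order_trans[OF E(3)[OF om k u kb ub] bern])
   qed
   thus ?thesis unfolding R_def ka by blast
  qed
  thus ?thesis by (intro bexI[OF _ E(1)] conjI[OF E(2)] ballI)
 qed
 from finite_event_family[OF fin ev] obtain E where E0: "E \<in> events"
  "prob E \<le> real (card K) * (2 * exp (- l)) \<and> (\<forall>om\<in>space (N I) - E. \<forall>ka\<in>K. R ka om)" by (rule bexE)
 have E: "E \<in> events" "prob E \<le> real (card K) * (2 * exp (- l))" by (rule E0(1), rule conjunct1[OF E0(2)])
 have E3: "R ka om" if "om \<in> space (N I) - E" "ka \<in> K" for ka om by (rule bspec[OF bspec[OF conjunct2[OF E0(2)] that(1)] that(2)])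
 have "real (card K) = 2 * (real r * (real r * real n))" by (simp add: K_def)
 also have "... \<le> 2 * (real n * (real n * real n))" using r by (intro mult_left_mono mult_mono) auto
 finally have "real (card K) * (2 * exp (- l)) \<le> 2 * (real n * (real n * real n)) * (2 * exp (- l))" by simp
 also have "... = 4 * (real n) ^ 3 * exp (- l)" by (simp add: power3_eq_cube)
 finally have pE: "prob E \<le> 4 * (real n) ^ 3 * exp (- l)" using E(2) by linarith
 have P: "\<bar>lin_form t om s m k\<bar> \<le> e0 * rh ^ s"
  if "om \<in> space (N I) - E" "opb (Hs om) (rh / 8)" "t \<in> {1, 2}" "m < r" "k < r" "s < n" for om t m k s
 proof -
  have "(t, m, k, s) \<in> K" using that by (auto simp: K_def)
  from E3[OF that(1) this] show ?thesis using that(2) unfolding R_def by blast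
 qed
 show ?thesis by (rule bexI[OF _ E(1)], rule conjI[OF pE], intro ballI impI allI, rule P)
qed

text \<open>Given \<open>H\<close> and \<open>W2\<close>, the form is linear in \<open>W1\<close>,
  between a vector \<open>H^s u\<close> and a vector \<open>W2 H^t u'\<close>. Bernstein's
  inequality needs a bound on the entries of both: the first is delocalised up to
  \<open>e0 / rh\<close>, while for the second the Euclidean norm bound serves as well.\<close>

lemma quadratic_event:
 "\<exists>E\<in>sets (N I). measure (N I) E \<le> 2 * (real n) ^ 4 * exp (- l) \<and>
  (\<forall>om\<in>space (N I) - E. opb (Hs om) (rh / 8) \<longrightarrow> opb (Ws 2 om) (rh / 8) \<longrightarrow>
   (\<forall>m<r. \<forall>s<n. \<forall>i<n. \<bar>krylov om m s i\<bar> \<le> rh ^ s * (b0 + e0 / rh)) \<longrightarrow>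
   (\<forall>m<r. \<forall>k<r. \<forall>s<n. \<forall>t<n.
    \<bar>quad_form om s t m k\<bar> \<le> e0 * rh ^ (s + t + 1)))"
proof -
 define B where "B = b0 + e0 / rh"
 have B: "0 \<le> B" using b0(2) e0_pos rh by (simp add: B_def)
 define K where "K = {..<r} \<times> ({..<r} \<times> ({..<n} \<times> {..<n}))"
 define R where "R ka om \<longleftrightarrow> (opb (Hs om) (rh / 8) \<and> opb (Ws 2 om) (rh / 8) \<and>
   (\<forall>m<r. \<forall>s<n. \<forall>i<n. \<bar>krylov om m s i\<bar> \<le> rh ^ s * B) \<longrightarrow> (case ka of (m, k, s, t) \<Rightarrow>
  \<bar>quad_form om s t m k\<bar> \<le> e0 * rh ^ (s + t + 1)))"
  for ka :: "nat \<times> nat \<times> nat \<times> nat" and om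
 have one: "(1::nat) \<in> {1, 2}" by simp
 have fin: "finite K" by (simp add: K_def)
 have ev: "\<exists>E\<in>events. prob E \<le> 2 * exp (- l) \<and> (\<forall>om\<in>space (N I) - E. R ka om)" if kaK: "ka \<in> K" for ka
 proof -
  obtain m k s t where ka: "ka = (m, k, s, t)" by (cases ka)
  have mk: "m < r" "k < r" "s < n" "t < n" using kaK by (auto simp: K_def ka)
  define q where "q = rh ^ Suc t / 8"
  have q: "0 < q" using rh by (simp add: q_def)
  obtain E where E: "E \<in> events" "prob E \<le> 2 * exp (- l)"
   "\<And>om. \<lbrakk>om \<in> space (N I) - E; (\<Sum>i<n. (krylov om m s i)^2) \<le> (rh ^ s)\<^sup>2; (\<Sum>i<n. (applyW 2 om (krylov om k t) i)^2) \<le> q\<^sup>2;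
    \<forall>i<n. \<bar>krylov om m s i\<bar> \<le> rh ^ s * B; \<forall>i<n. \<bar>applyW 2 om (krylov om k t) i\<bar> \<le> q\<rbrakk> \<Longrightarrow>
    \<bar>quad_form om s t m k\<bar>
     \<le> bernstein l (2 * (rh ^ s * q)) (2 * (rh ^ s * B * q))"
   using W_form_tail[where x = "\<lambda>om. krylov om m s" and y = "\<lambda>om. applyW 2 om (krylov om k t)" and t = 1 and ?A1.0 = "rh ^ s"
     and ?A2.0 = q and ?B1.0 = "rh ^ s * B" and ?B2.0 = q, OF one zero_less_power[OF rh] q
     mult_nonneg_nonneg[OF less_imp_le[OF zero_less_power[OF rh]] B] less_imp_le[OF q]
     krylov_measurable[OF _ mk(1)] krylov_depends_upper[OF one _ mk(1)] W2_measurable[OF _ mk(2)] W2_depends[OF _ mk(2)]] by blast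
  have bern: "bernstein l (2 * (rh ^ s * q)) (2 * (rh ^ s * B * q)) \<le> e0 * rh ^ (s + t + 1)"
  proof -
   have "bernstein l (2 * (rh ^ s * q)) (2 * (rh ^ s * B * q)) = (4 * rh ^ s * q) * (sqrt l * sg + l * L * B)"
    by (simp add: bernstein_def algebra_simps)
   also have "sqrt l * sg + l * L * B = T / 32 + l * L * e0 / rh" by (simp add: T_def B_def algebra_simps)
   also have "4 * rh ^ s * q = rh ^ (s + t + 1) / 2" by (simp add: q_def power_add)
   also have "rh ^ (s + t + 1) / 2 * (T / 32 + l * L * e0 / rh) \<le> rh ^ (s + t + 1) / 2 * (2 * e0)"
   proof (rule mult_left_mono)
    have "T \<le> e0" unfolding e0_def using T_pos sg by linarith
    thus "T / 32 + l * L * e0 / rh \<le> 2 * e0" using lL_e0 e0_pos by linarith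
   qed (use rh in simp)
   also have "rh ^ (s + t + 1) / 2 * (2 * e0) = e0 * rh ^ (s + t + 1)" by simp
   finally show ?thesis .
  qed
  have "R ka om" if om: "om \<in> space (N I) - E" for om
  proof -
   have "\<bar>quad_form om s t m k\<bar> \<le> e0 * rh ^ (s + t + 1)"
    if H: "opb (Hs om) (rh / 8)" and W: "opb (Ws 2 om) (rh / 8)" and d: "\<forall>m<r. \<forall>s<n. \<forall>i<n. \<bar>krylov om m s i\<bar> \<le> rh ^ s * B"
   proof -
    have "(\<Sum>i<n. (krylov om m s i)^2) \<le> ((rh / 8) ^ s)^2" by (rule krylov_norm[OF H mk(1)])
    also have "... \<le> (rh ^ s)^2" using power_le rh by simp
    finally have x: "(\<Sum>i<n. (krylov om m s i)^2) \<le> (rh ^ s)^2" .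
    have "(\<Sum>i<n. (applyW 2 om (krylov om k t) i)^2) \<le> (rh / 8 * (rh / 8) ^ t)^2"
     by (rule applyW_norm[OF W krylov_norm[OF H mk(2)]]) (use rh in simp)
    also have "... \<le> q^2"
    proof (rule power_mono)
     show "rh / 8 * (rh / 8) ^ t \<le> q" using rh power_le by (simp add: q_def)
    qed (use rh in simp)
    finally have y: "(\<Sum>i<n. (applyW 2 om (krylov om k t) i)^2) \<le> q^2" .
    have "\<forall>i<n. \<bar>krylov om m s i\<bar> \<le> rh ^ s * B" using d mk by blast
    moreover have "\<forall>i<n. \<bar>applyW 2 om (krylov om k t) i\<bar> \<le> q" using entry_le_norm[OF y less_imp_le[OF q]] by blast
    ultimately show ?thesis by (rule order_trans[OF E(3)[OF om x y] bern])
   qed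
   thus ?thesis unfolding R_def ka by blast
  qed
  thus ?thesis by (intro bexI[OF _ E(1)] conjI[OF E(2)] ballI)
 qed
 from finite_event_family[OF fin ev] obtain E where E0: "E \<in> events"
  "prob E \<le> real (card K) * (2 * exp (- l)) \<and> (\<forall>om\<in>space (N I) - E. \<forall>ka\<in>K. R ka om)" by (rule bexE)
 have E: "E \<in> events" "prob E \<le> real (card K) * (2 * exp (- l))" by (rule E0(1), rule conjunct1[OF E0(2)])
 have E3: "R ka om" if "om \<in> space (N I) - E" "ka \<in> K" for ka om by (rule bspec[OF bspec[OF conjunct2[OF E0(2)] that(1)] that(2)])
 have "real (card K) = real r * (real r * (real n * real n))" by (simp add: K_def)
 also have "... \<le> real n * (real n * (real n * real n))" using r by (intro mult_mono) auto
 finally have "real (card K) * (2 * exp (- l)) \<le> real n * (real n * (real n * real n)) * (2 * exp (- l))" by simp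
 also have "... = 2 * (real n) ^ 4 * exp (- l)" by (simp add: power4_eq_xxxx)
 finally have pE: "prob E \<le> 2 * (real n) ^ 4 * exp (- l)" using E(2) by linarith
 have P: "\<bar>quad_form om s t m k\<bar> \<le> e0 * rh ^ (s + t + 1)"
  if "om \<in> space (N I) - E" "opb (Hs om) (rh / 8)" "opb (Ws 2 om) (rh / 8)" "\<forall>m<r. \<forall>s<n. \<forall>i<n. \<bar>krylov om m s i\<bar> \<le> rh ^ s * (b0 + e0 / rh)"
   "m < r" "k < r" "s < n" "t < n" for om t m k s
 proof -
  have "(m, k, s, t) \<in> K" using that by (auto simp: K_def)
  from E3[OF that(1) this] show ?thesis using that(2-4) unfolding R_def B_def by blast
 qed
 show ?thesis by (rule bexI[OF _ E(1)], rule conjI[OF pE], intro ballI impI allI, rule P)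
qed

text \<open>The forms with basis vectors in \<open>b1\<close> supply the delocalisation that
  \<open>b3\<close> presupposes; exponents from \<open>n\<close> on follow from the norm
  bounds.\<close>

lemma good_sample:
 assumes H: "opb (Hs om) (rh / 8)" and W1: "opb (Ws 1 om) (rh / 8)" and W2: "opb (Ws 2 om) (rh / 8)"
  and b1: "\<forall>a\<in>tests. \<forall>k<r. \<forall>s. 0 < s \<and> s < n \<longrightarrow> \<bar>\<Sum>i<n. a i * krylov om k s i\<bar> \<le> e0 * rh ^ (s - 1)"
  and b2: "\<forall>t\<in>{1, 2}. \<forall>m<r. \<forall>k<r. \<forall>s<n. \<bar>lin_form t om s m k\<bar> \<le> e0 * rh ^ s"
  and b3: "(\<forall>m<r. \<forall>s<n. \<forall>i<n. \<bar>krylov om m s i\<bar> \<le> rh ^ s * (b0 + e0 / rh)) \<longrightarrow> (\<forall>m<r. \<forall>k<r. \<forall>s<n. \<forall>t<n.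
   \<bar>quad_form om s t m k\<bar> \<le> e0 * rh ^ (s + t + 1))" shows "good om"
proof -
 have q0: "0 \<le> (rh / 8) ^ s" for s using rh by simp
 have lin: "\<bar>\<Sum>i<n. a i * krylov om k (Suc s) i\<bar> \<le> e0 * rh ^ s" if a: "a \<in> tests" and k: "k < r" for a k s
 proof (cases "Suc s < n")
  case True
  thus ?thesis using b1[rule_format, OF a k, of "Suc s"] by simp
 next
  case False
  have "\<bar>\<Sum>i<n. a i * krylov om k (Suc s) i\<bar> \<le> 1 * (rh / 8) ^ Suc s"
   by (rule inner_le_norm[OF tests_norm[OF a] _ krylov_norm[OF H k] q0]) simp
  also have "... \<le> e0 * rh ^ s"
  proof -
   have "n \<le> Suc s" using False by simp
   from small_power[OF this] show ?thesis by simp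
  qed
  finally show ?thesis .
 qed
 have entry: "\<bar>krylov om k (Suc s) i\<bar> \<le> e0 * rh ^ s" if "i < n" "k < r" for i k s
 proof -
  have "(\<Sum>j<n. basis_fun i j * krylov om k (Suc s) j) = (\<Sum>j<n. if j = i then krylov om k (Suc s) i else 0)"
   by (intro sum.cong) (auto simp: basis_fun_def)
  thus ?thesis using that lin[OF _ that(2), of "basis_fun i" s] by (simp add: tests_def)
 qed
 have deloc: "\<forall>m<r. \<forall>s<n. \<forall>i<n. \<bar>krylov om m s i\<bar> \<le> rh ^ s * (b0 + e0 / rh)"
 proof (intro allI impI)
  fix m s i assume mi: "m < r" "s < n" "i < n"
  show "\<bar>krylov om m s i\<bar> \<le> rh ^ s * (b0 + e0 / rh)"
  proof (cases s)
   case 0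
   have "0 \<le> e0 / rh" using e0_pos rh by simp
   thus ?thesis using b0(1)[OF mi(3,1)] krylov_0[OF mi(3,1)] 0 by simp
  next
   case (Suc s')
   have "\<bar>krylov om m s i\<bar> \<le> e0 * rh ^ s'" using entry[OF mi(3,1)] Suc by simp
   also have "... = rh ^ s * (e0 / rh)" using rh by (simp add: Suc)
   also have "... \<le> rh ^ s * (b0 + e0 / rh)" using rh b0(2) by (intro mult_left_mono) auto
   finally show ?thesis .
  qed
 qed
 have linW: "\<bar>lin_form t om s m k\<bar> \<le> e0 * rh ^ s"
  if t: "t \<in> {1, 2}" and mk: "m < r" "k < r" for t m k s
 proof (cases "s < n")
  case True
  thus ?thesis by (rule b2[rule_format, OF t mk])
 next
  case False
  have W: "opb (Ws t om) (rh / 8)" using t W1 W2 by auto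
  have u: "(\<Sum>i<n. (Us $$ (i, k))^2) \<le> 1\<^sup>2" using Us_col_sq[OF mk(2)] by simp
  have "\<bar>lin_form t om s m k\<bar> \<le> (rh / 8) ^ s * (rh / 8 * 1)" by (rule form_norm[OF W krylov_norm[OF H mk(1)] q0 u]) simp
  also have "... = (rh / 8) ^ Suc s" by simp
  also have "... \<le> e0 * rh ^ s"
  proof -
   have "n \<le> Suc s" using False by simp
   from small_power[OF this] show ?thesis by simp
  qed
  finally show ?thesis .
 qed
 have quadW: "\<bar>quad_form om s t m k\<bar> \<le> e0 * rh ^ (s + t + 1)"
  if mk: "m < r" "k < r" for m k s t
 proof (cases "s < n \<and> t < n")
  case True
  thus ?thesis using mp[OF b3 deloc, rule_format, OF mk] by blast
 next
  case False
  have q1: "0 \<le> rh / 8 * (rh / 8) ^ t" using rh by simp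
  have "\<bar>quad_form om s t m k\<bar>
   \<le> (rh / 8) ^ s * (rh / 8 * (rh / 8 * (rh / 8) ^ t))"
   by (rule form_norm[OF W1 krylov_norm[OF H mk(1)] q0 applyW_norm[OF W2 krylov_norm[OF H mk(2)] q0] q1])
  also have "... = (rh / 8) ^ (s + t + 2)" by (simp add: power_add)
  also have "... \<le> e0 * rh ^ (s + t + 1)"
  proof -
   have "n \<le> s + t + 2" "s + t + 2 - 1 = s + t + 1" using False by auto
   thus ?thesis using small_power[of "s + t + 2"] by simp
  qed
  finally show ?thesis .
 qed
 show ?thesis unfolding good_def by (intro conjI ballI allI impI H lin linW quadW)
qed

theorem good_event: "\<exists>E\<in>sets (N I). measure (N I) (space (N I) - E) \<le> 30 * (real n) ^ 4 * exp (- l) \<and> (\<forall>om\<in>E. good om)"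
proof -
 obtain EH where EH: "EH \<in> events" "prob (space (N I) - EH) \<le> 4 * real n * exp (- l)" "\<And>om. om \<in> EH \<Longrightarrow> opb (Hs om) (rh / 8)"
  by (rule H_norm) (rule that)
 obtain E1 where E1: "E1 \<in> events" "prob (space (N I) - E1) \<le> 2 * real n * exp (- l)" "\<And>om. om \<in> E1 \<Longrightarrow> opb (Ws 1 om) (rh / 8)"
  by (rule W_norm[of 1]) (simp, rule that)
 obtain E2 where E2: "E2 \<in> events" "prob (space (N I) - E2) \<le> 2 * real n * exp (- l)" "\<And>om. om \<in> E2 \<Longrightarrow> opb (Ws 2 om) (rh / 8)"
  by (rule W_norm[of 2]) (simp, rule that)
 from power_event obtain B1 where B1: "B1 \<in> events" and B1': "prob B1 \<le> 16 * (real n) ^ 4 * exp (- l) \<and>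
  (\<forall>om\<in>space (N I) - B1. opb (Hs om) (rh / 8) \<longrightarrow>
   (\<forall>a\<in>tests. \<forall>k<r. \<forall>s. 0 < s \<and> s < n \<longrightarrow> \<bar>\<Sum>i<n. a i * krylov om k s i\<bar> \<le> e0 * rh ^ (s - 1)))" by (rule bexE)
 from linear_event obtain B2 where B2: "B2 \<in> events" and B2': "prob B2 \<le> 4 * (real n) ^ 3 * exp (- l) \<and>
  (\<forall>om\<in>space (N I) - B2. opb (Hs om) (rh / 8) \<longrightarrow>
   (\<forall>t\<in>{1, 2}. \<forall>m<r. \<forall>k<r. \<forall>s<n. \<bar>lin_form t om s m k\<bar> \<le> e0 * rh ^ s))" by (rule bexE)
 from quadratic_event obtain B3 where B3: "B3 \<in> events" and B3': "prob B3 \<le> 2 * (real n) ^ 4 * exp (- l) \<and>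
  (\<forall>om\<in>space (N I) - B3. opb (Hs om) (rh / 8) \<longrightarrow> opb (Ws 2 om) (rh / 8) \<longrightarrow>
   (\<forall>m<r. \<forall>s<n. \<forall>i<n. \<bar>krylov om m s i\<bar> \<le> rh ^ s * (b0 + e0 / rh)) \<longrightarrow>
   (\<forall>m<r. \<forall>k<r. \<forall>s<n. \<forall>t<n.
    \<bar>quad_form om s t m k\<bar> \<le> e0 * rh ^ (s + t + 1)))" by (rule bexE)
 have c: "space (N I) - EH \<in> events" "space (N I) - E1 \<in> events" "space (N I) - E2 \<in> events" using EH(1) E1(1) E2(1) by auto
 define B where "B = (space (N I) - EH) \<union> (space (N I) - E1) \<union> (space (N I) - E2) \<union> B1 \<union> B2 \<union> B3"
 have sB: "B \<in> events" unfolding B_def by (intro sets.Un c B1 B2 B3)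
 define E where "E = space (N I) - B"
 have sE: "E \<in> events" unfolding E_def by (rule sets.compl_sets[OF sB])
 have "good om" if omE: "om \<in> E" for om
 proof -
  have om: "om \<in> space (N I) - B1" "om \<in> space (N I) - B2" "om \<in> space (N I) - B3"
   and "om \<in> EH" "om \<in> E1" "om \<in> E2" using omE unfolding E_def B_def by blast+
  hence H: "opb (Hs om) (rh / 8)" and W1: "opb (Ws 1 om) (rh / 8)" and W2: "opb (Ws 2 om) (rh / 8)" using EH(3) E1(3) E2(3) by blast+
  show ?thesis by (rule good_sample[OF H W1 W2 mp[OF bspec[OF conjunct2[OF B1'] om(1)] H] mp[OF bspec[OF conjunct2[OF B2'] om(2)] H]
     mp[OF mp[OF bspec[OF conjunct2[OF B3'] om(3)] H] W2]])
 qed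
 moreover have "prob (space (N I) - E) \<le> 30 * (real n) ^ 4 * exp (- l)"
 proof -
  define x where "x = exp (- l)"
  have x: "0 \<le> x" by (simp add: x_def)
  have "space (N I) - E = B" unfolding E_def using sets.sets_into_space[OF sB] by auto
  also have "prob B \<le> prob (space (N I) - EH) + prob (space (N I) - E1) + prob (space (N I) - E2) + prob B1 + prob B2 + prob B3"
   unfolding B_def by (rule measure_Un6_le[OF c B1 B2 B3])
  \<comment> \<open>Grouped by powers of \<open>n\<close>: 4 + 2 + 2 from the operator norms, 16 + 2
    from the powers and the quadratic forms, 4 from the linear forms.\<close>
  also have "... \<le> 8 * (real n * x) + 18 * ((real n) ^ 4 * x) + 4 * ((real n) ^ 3 * x)" using EH(2) E1(2) E2(2) conjunct1[OF B1'] conjunct1[OF B2'] conjunct1[OF B3'] by (simp_all only: x_def mult.assoc)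
  also have "... \<le> 8 * ((real n) ^ 4 * x) + 18 * ((real n) ^ 4 * x) + 4 * ((real n) ^ 4 * x)"
  proof -
   have "real n ^ 1 \<le> real n ^ 4" "real n ^ 3 \<le> real n ^ 4" using n by (intro power_increasing; simp)+
   from this[THEN mult_right_mono[OF _ x]] show ?thesis by (simp_all only: power_one_right)
  qed
  also have "... = 30 * (real n) ^ 4 * exp (- l)" by (simp add: x_def)
  finally show ?thesis .
 qed
 ultimately show ?thesis using sE by auto
qed

end

context noise_sample
begin

text \<open>The sums in \<open>good\<close> are rewritten as entries of matrix products, which is
  the form that the deterministic part expects.\<close>

lemma good_noise_event:
 assumes g: "good om" and r0: "0 < r"
  and ls: "\<And>k. k < r \<Longrightarrow> lmin \<le> \<bar>ls k\<bar>" "\<And>k. k < r \<Longrightarrow> \<bar>ls k\<bar> \<le> lmax"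
  and lmin: "64 * rh \<le> lmin" and small: "10000 * (lmax / lmin) * (real r * sqrt (real r)) * e0 \<le> lmin"
  and gap: "\<And>k m. \<lbrakk>k < r; m < r; k \<noteq> m\<rbrakk> \<Longrightarrow> \<delta> \<le> \<bar>ls k - ls m\<bar>"
  and \<delta>: "0 < \<delta>" "1000 * (lmax / lmin) * (real r * sqrt (real r)) * e0 \<le> \<delta>"
  and inc: "\<And>i. i < n \<Longrightarrow> vec_l2 (Matrix.row Us i) \<le> b"
 shows "noise_event n r Us (Hs om) ls rh e0 lmin lmax \<delta> (Ws 1 om) (Ws 2 om) b"
proof -
 have H: "opb (Hs om) (rh / 8)"
  and lin: "\<forall>a\<in>tests. \<forall>k<r. \<forall>s. \<bar>\<Sum>i<n. a i * krylov om k (Suc s) i\<bar> \<le> e0 * rh ^ s"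
  and linW: "\<forall>t\<in>{1, 2}. \<forall>m<r. \<forall>k<r. \<forall>s. \<bar>lin_form t om s m k\<bar> \<le> e0 * rh ^ s"
  and quadW: "\<forall>m<r. \<forall>k<r. \<forall>s t. \<bar>quad_form om s t m k\<bar> \<le> e0 * rh ^ (s + t + 1)"
  using g unfolding good_def by simp_all
 note Hp = pow_H[of om]
 define K where "K s = Hs om ^\<^sub>m s * Us" for s
 have K: "K s \<in> mats n r" for s unfolding K_def by (rule mult_carrier_mat[OF Hp Us(1)])
 have Kk: "K s $$ (i, k) = krylov om k s i" for s i k by (simp add: K_def krylov_def)
 have form: "(tr A * B) $$ (m, k) = (\<Sum>i<n. A $$ (i, m) * B $$ (i, k))"
  if "A \<in> mats n r" "B \<in> mats n r" "m < r" "k < r" for A B :: "real mat" and m k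
  using that by (simp add: scalar_prod_def lessThan_atLeast0)
 have app: "(Ws t om * B) $$ (i, k) = applyW t om (\<lambda>j. B $$ (j, k)) i" if "B \<in> mats n r" "i < n" "k < r" for B t i k
  using that by (simp add: scalar_prod_def sample_W_def applyW_def lessThan_atLeast0)
 have WB: "Ws t om * B \<in> mats n r" if "B \<in> mats n r" for B t by (rule mult_carrier_mat[OF sample_W_carrier that])
 have bil: "\<bar>(tr Us * Hs om ^\<^sub>m Suc s * Us) $$ (m, k)\<bar> \<le> e0 * rh ^ s" if "m < r" "k < r" for s m k
 proof -
  have "tr Us * Hs om ^\<^sub>m Suc s * Us = tr Us * K (Suc s)" unfolding K_def using Us(1) by (intro assoc_mult_mat[of _ r n _ n _ r] Hp) simp_all
  thus ?thesis using form[OF Us(1) K that] lin that unfolding Kk by (simp add: tests_def)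
 qed
 have ent: "\<bar>(Hs om ^\<^sub>m Suc s * Us) $$ (i, k)\<bar> \<le> e0 * rh ^ s" if ik: "i < n" "k < r" for s i k
 proof -
  have "(\<Sum>j<n. basis_fun i j * krylov om k (Suc s) j) = (\<Sum>j<n. if j = i then krylov om k (Suc s) i else 0)"
   by (intro sum.cong) (auto simp: basis_fun_def)
  hence "(\<Sum>j<n. basis_fun i j * krylov om k (Suc s) j) = krylov om k (Suc s) i" using ik by simp
  moreover have "basis_fun i \<in> tests" using ik by (simp add: tests_def)
  ultimately have "\<bar>krylov om k (Suc s) i\<bar> \<le> e0 * rh ^ s" using lin ik by metis
  thus ?thesis unfolding krylov_def .
 qed
 have linear: "\<bar>(tr (Hs om ^\<^sub>m s * Us) * Ws t om * Us) $$ (m, k)\<bar> \<le> e0 * rh ^ s"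
  if t: "t \<in> {1, 2}" and mk: "m < r" "k < r" for s m k t
 proof -
  have "tr (K s) * Ws t om * Us = tr (K s) * (Ws t om * Us)" using K[of s] Us(1) sample_W_carrier[of n t om] by simp
  also have "... $$ (m, k) = (\<Sum>i<n. krylov om m s i * applyW t om (\<lambda>j. Us $$ (j, k)) i)"
   unfolding form[OF K WB[OF Us(1)] mk] Kk using app[OF Us(1) _ mk(2)] by simp
  finally have "(tr (K s) * Ws t om * Us) $$ (m, k) = (lin_form t om s m k)"
   unfolding form_applyW[of "krylov om m s" om t "\<lambda>j. Us $$ (j, k)"] .
  thus ?thesis using linW[rule_format, OF t mk, of s] by (simp add: K_def)
 qed
 have quad: "\<bar>(tr (Hs om ^\<^sub>m s * Us) * Ws 1 om * Ws 2 om * (Hs om ^\<^sub>m t * Us)) $$ (m, k)\<bar> \<le> e0 * rh ^ (s + t + 1)"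
  if mk: "m < r" "k < r" for s t m k
 proof -
  have "tr (K s) * Ws 1 om * Ws 2 om * K t = tr (K s) * Ws 1 om * (Ws 2 om * K t)"
   using K sample_W_carrier[of n _ om] by (intro assoc_mult_mat[of _ r n _ n _ r]) (auto intro: mult_carrier_mat)
  also have "... = tr (K s) * (Ws 1 om * (Ws 2 om * K t))" using K sample_W_carrier[of n _ om] by (intro assoc_mult_mat[of _ r n _ n _ r]) auto
  also have "... $$ (m, k) = (\<Sum>i<n. krylov om m s i * applyW 1 om (applyW 2 om (krylov om k t)) i)"
  proof -
   have "applyW 1 om (\<lambda>j. (Ws 2 om * K t) $$ (j, k)) i = applyW 1 om (applyW 2 om (krylov om k t)) i" for i
    unfolding applyW_def[of 1] using app[OF K _ mk(2)] by (intro sum.cong refl) (simp add: Kk)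
   thus ?thesis unfolding form[OF K WB[OF WB[OF K]] mk] Kk using app[OF WB[OF K] _ mk(2)] by simp
  qed
  finally have "(tr (K s) * Ws 1 om * Ws 2 om * K t) $$ (m, k)
   = (quad_form om s t m k)" unfolding form_applyW[of "krylov om m s" om 1 "applyW 2 om (krylov om k t)"] .
  thus ?thesis using quadW[rule_format, OF mk, of s t] by (simp add: K_def)
 qed
 interpret B: noise_bounds n r Us "Hs om" ls rh e0 lmin lmax by (rule noise_bounds.intro[OF r0 Us sample_H_carrier ls rh lmin e0_pos H bil small])
 interpret G: gapped_noise_bounds n r Us "Hs om" ls rh e0 lmin lmax \<delta>
  by unfold_locales (use gap \<delta> in \<open>simp_all add: B.ka_def\<close>)
 have t: "(1 :: nat) \<in> {1, 2}" "(2 :: nat) \<in> {1, 2}" by auto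
 show ?thesis by unfold_locales (rule sample_W_carrier sample_W_sym ent quad inc linear[OF t(1)] linear[OF t(2)]; assumption)+
qed

end

section \<open>The joint law of the noise\<close>

definition noise_entry_of ::
 "('a \<Rightarrow> real mat) \<Rightarrow> ('a \<Rightarrow> real mat) \<Rightarrow> ('a \<Rightarrow> real mat) \<Rightarrow> nat \<times> nat \<times> nat \<Rightarrow> 'a \<Rightarrow> real" where
 "noise_entry_of H W1 W2 e om = ([H, W1, W2] ! fst e) om $$ snd e"

text \<open>The point mass at 0 is a default that satisfies the conditions of
  \<open>symmetric_product\<close> at indices without a noise entry.\<close>

definition entry_law ::
 "'a measure \<Rightarrow> nat \<Rightarrow> ('a \<Rightarrow> real mat) \<Rightarrow> ('a \<Rightarrow> real mat) \<Rightarrow> ('a \<Rightarrow> real mat) \<Rightarrow> nat \<times> nat \<times> nat \<Rightarrow> real measure" where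
 "entry_law P n H W1 W2 e = (if e \<in> entry_index n then distr P borel (noise_entry_of H W1 W2 e) else return borel 0)"

definition noise_vector ::
 "nat \<Rightarrow> ('a \<Rightarrow> real mat) \<Rightarrow> ('a \<Rightarrow> real mat) \<Rightarrow> ('a \<Rightarrow> real mat) \<Rightarrow> 'a \<Rightarrow> nat \<times> nat \<times> nat \<Rightarrow> real" where
 "noise_vector n H W1 W2 om = (\<lambda>e\<in>entry_index n. noise_entry_of H W1 W2 e om)"

lemma noise_entry_measure:
 assumes P: "prob_space P" and X: "noise_entry P sgmin sg L X"
 shows "prob_space (distr P borel X)" "distr (distr P borel X) borel uminus = distr P borel X"
  "AE x in distr P borel X. \<bar>x\<bar> \<le> L" "(\<integral>x. x^2 \<partial>distr P borel X) \<le> sg^2"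
proof -
 have m [measurable]: "X \<in> borel_measurable P" using X by (simp add: noise_entry_def)
 show "prob_space (distr P borel X)" by (rule prob_space.prob_space_distr[OF P m])
 have "distr (distr P borel X) borel uminus = distr P borel (uminus \<circ> X)" by (rule distr_distr) (use m in auto)
 thus "distr (distr P borel X) borel uminus = distr P borel X" using X by (simp add: noise_entry_def comp_def)
 have "AE x in P. \<bar>X x\<bar> \<le> L" using X by (simp add: noise_entry_def)
 thus "AE x in distr P borel X. \<bar>x\<bar> \<le> L" by (subst AE_distr_iff) auto
 have "(\<integral>x. x^2 \<partial>distr P borel X) = (\<integral>om. (X om)^2 \<partial>P)" by (intro integral_distr) auto
 thus "(\<integral>x. x^2 \<partial>distr P borel X) \<le> sg^2" using X by (simp add: noise_entry_def)
qed

context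
 fixes P :: "'a measure" and n :: nat and sgmin sg L :: real and H W1 W2 :: "'a \<Rightarrow> real mat"
 assumes P: "prob_space P" and n: "0 < n"
  and H: "asymmetric_noise P n sgmin sg L H" and W1: "symmetric_noise P n sgmin sg L W1" and W2: "symmetric_noise P n sgmin sg L W2"
  and indep: "independent_matrices P n [H, W1, W2]" and sg: "0 < sg" "sg \<le> L"
begin

lemma entry_noise: "e \<in> entry_index n \<Longrightarrow> noise_entry P sgmin sg L (noise_entry_of H W1 W2 e)"
 using H W1 W2 unfolding asymmetric_noise_def symmetric_noise_def entry_index_def noise_entry_of_def[abs_def] by auto

lemma symmetric_product_entry_law: "symmetric_product (entry_index n) (entry_law P n H W1 W2) sg L"
proof (rule symmetric_product.intro)
 show "finite (entry_index n)" by (rule finite_entry_index)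
 show "0 < sg" "sg \<le> L" by (rule sg)+
 fix e
 note entry = noise_entry_measure[OF P entry_noise]
 show "prob_space (entry_law P n H W1 W2 e)" unfolding entry_law_def using entry(1) by (simp add: prob_space_return)
 show "sets (entry_law P n H W1 W2 e) = sets borel" unfolding entry_law_def by simp
 show "distr (entry_law P n H W1 W2 e) borel uminus = entry_law P n H W1 W2 e" unfolding entry_law_def using entry(2) by (simp add: distr_return)
 show "AE x in entry_law P n H W1 W2 e. \<bar>x\<bar> \<le> L" unfolding entry_law_def using entry(3) sg by (simp add: AE_return)
 show "(\<integral>x. x^2 \<partial>entry_law P n H W1 W2 e) \<le> sg^2" unfolding entry_law_def using entry(4) by (simp add: integral_return)
qed

lemma noise_entry_of_measurable: "e \<in> entry_index n \<Longrightarrow> noise_entry_of H W1 W2 e \<in> borel_measurable P"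
 using entry_noise by (simp add: noise_entry_def)

lemma noise_vector_measurable: "noise_vector n H W1 W2 \<in> P \<rightarrow>\<^sub>M PiM (entry_index n) (entry_law P n H W1 W2)"
 unfolding noise_vector_def
proof (rule measurable_restrict)
 fix e assume "e \<in> entry_index n"
 thus "noise_entry_of H W1 W2 e \<in> P \<rightarrow>\<^sub>M entry_law P n H W1 W2 e" using noise_entry_of_measurable by (simp add: entry_law_def)
qed

text \<open>On a rectangle, the independence of the three matrices splits the probability into three
  factors, and the independence of the entries within each matrix splits these further. From
  \<open>W1\<close> and \<open>W2\<close> only the entries on and above the diagonal enter, which
  are the independent ones.\<close>

lemma distr_noise_vector:
 "distr P (PiM (entry_index n) (entry_law P n H W1 W2)) (noise_vector n H W1 W2) = PiM (entry_index n) (entry_law P n H W1 W2)"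
proof (rule product_sigma_finite.PiM_eqI)
 interpret prob_space P by (rule P)
 interpret S: symmetric_product "entry_index n" "entry_law P n H W1 W2" sg L by (rule symmetric_product_entry_law)
 show "product_sigma_finite (entry_law P n H W1 W2)" by (rule S.product_sigma_finite_axioms)
 show "finite (entry_index n)" by (rule finite_entry_index)
 show "sets (distr P (PiM (entry_index n) (entry_law P n H W1 W2)) (noise_vector n H W1 W2)) = sets (PiM (entry_index n) (entry_law P n H W1 W2))"
  by simp
 fix A assume A: "\<And>e. e \<in> entry_index n \<Longrightarrow> A e \<in> sets (entry_law P n H W1 W2 e)"
 hence Ab: "A e \<in> sets borel" if "e \<in> entry_index n" for e using that by (simp add: S.sets_mu)
 let ?Xs = "[H, W1, W2]"
 define S where "S k = (if k = 0 then {..<n} \<times> {..<n} else {(i, j). i \<le> j \<and> j < n})" for k :: nat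
 have Isum: "entry_index n = (SIGMA k:{..<3}. S k)" by (auto simp: entry_index_def S_def less_Suc_eq numeral_3_eq_3 split: if_splits)
 have finS: "finite (S k)" for k by (rule finite_subset[of _ "{..<n} \<times> {..<n}"]) (auto simp: S_def split: if_splits)
 have Ssub: "S k \<subseteq> {..<n} \<times> {..<n}" for k by (auto simp: S_def split: if_splits)
 have Sne: "S k \<noteq> {}" for k
 proof -
  have "(0, 0) \<in> S k" using n by (simp add: S_def)
  thus ?thesis by blast
 qed
 define F where "F k = {om \<in> space P. \<forall>p\<in>S k. (?Xs ! k) om $$ p \<in> A (k, p)}" for k
 define B where "B k = {y \<in> space (PiM ({..<n} \<times> {..<n}) (\<lambda>_. borel :: real measure)). \<forall>p\<in>S k. y p \<in> A (k, p)}" for k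
 have AS: "A (k, p) \<in> sets borel" if "k < 3" "p \<in> S k" for k p using that Ab Isum by auto
 have B: "B k \<in> sets (PiM ({..<n} \<times> {..<n}) (\<lambda>_. borel))" if k: "k < 3" for k
 proof -
  have "(\<lambda>y. y p) -` A (k, p) \<inter> space (PiM ({..<n} \<times> {..<n}) (\<lambda>_. borel :: real measure)) \<in> sets (PiM ({..<n} \<times> {..<n}) (\<lambda>_. borel))"
   if p: "p \<in> S k" for p
   by (rule measurable_sets[OF measurable_component_singleton[of p "{..<n} \<times> {..<n}" "\<lambda>_. borel"] AS[OF k p]]) (use p Ssub in auto)
  hence "(\<Inter>p\<in>S k. (\<lambda>y. y p) -` A (k, p) \<inter> space (PiM ({..<n} \<times> {..<n}) (\<lambda>_. borel :: real measure))) \<in> sets (PiM ({..<n} \<times> {..<n}) (\<lambda>_. borel))"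
   using Sne by blast
  also have "(\<Inter>p\<in>S k. (\<lambda>y. y p) -` A (k, p) \<inter> space (PiM ({..<n} \<times> {..<n}) (\<lambda>_. borel :: real measure))) = B k"
   using Sne unfolding B_def by blast
  finally show ?thesis .
 qed
 have pre: "(\<lambda>om. \<lambda>p\<in>{..<n} \<times> {..<n}. (?Xs ! k) om $$ p) -` B k \<inter> space P = F k" for k
  using Ssub[of k] unfolding B_def F_def by (fastforce simp: space_PiM)
 have "(0 :: nat) \<in> {..<3}" by simp
 hence ne3: "{..<3 :: nat} \<noteq> {}" by blast
 have "prob (\<Inter>k\<in>{..<3}. F k) = (\<Prod>k\<in>{..<3}. prob (F k))"
  using indep_varsD[OF indep[unfolded independent_matrices_def], of "{..<3}" B] B ne3 by (simp add: pre)
 moreover have "prob (F k) = (\<Prod>p\<in>S k. prob ((\<lambda>om. (?Xs ! k) om $$ p) -` A (k, p) \<inter> space P))" if k: "k < 3" for k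
 proof -
  have iv: "indep_vars (\<lambda>_. borel) (\<lambda>p om. (?Xs ! k) om $$ p) (S k)"
   using H W1 W2 k unfolding asymmetric_noise_def symmetric_noise_def S_def
   by (auto simp: less_Suc_eq numeral_3_eq_3 lessThan_def Sigma_def intro: indep_vars_subset)
  have "prob (\<Inter>p\<in>S k. (\<lambda>om. (?Xs ! k) om $$ p) -` A (k, p) \<inter> space P)
   = (\<Prod>p\<in>S k. prob ((\<lambda>om. (?Xs ! k) om $$ p) -` A (k, p) \<inter> space P))"
   by (rule indep_varsD[OF iv Sne finS order_refl]) (rule AS[OF k])
  also have "(\<Inter>p\<in>S k. (\<lambda>om. (?Xs ! k) om $$ p) -` A (k, p) \<inter> space P) = F k" using Sne unfolding F_def by blast
  finally show ?thesis .
 qed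
 ultimately have main: "prob (\<Inter>k\<in>{..<3}. F k) = (\<Prod>k\<in>{..<3}. \<Prod>p\<in>S k. prob ((\<lambda>om. (?Xs ! k) om $$ p) -` A (k, p) \<inter> space P))" by simp
 have "noise_vector n H W1 W2 -` (Pi\<^sub>E (entry_index n) A) \<inter> space P = (\<Inter>k\<in>{..<3}. F k)"
 proof -
  have "(0::nat) \<in> {..<3}" by simp
  thus ?thesis unfolding F_def Isum noise_vector_def noise_entry_of_def by (fastforce simp: Pi_def)
 qed
 hence "emeasure (distr P (PiM (entry_index n) (entry_law P n H W1 W2)) (noise_vector n H W1 W2)) (Pi\<^sub>E (entry_index n) A)
  = ennreal (prob (\<Inter>k\<in>{..<3}. F k))"
  using A by (subst emeasure_distr[OF noise_vector_measurable]) (auto simp: emeasure_eq_measure intro!: sets_PiM_I_finite finite_entry_index)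
 also have "... = ennreal (\<Prod>e\<in>entry_index n. prob (noise_entry_of H W1 W2 e -` A e \<inter> space P))"
  unfolding main Isum noise_entry_of_def[abs_def] using finS by (simp add: prod.Sigma case_prod_unfold)
 also have "... = (\<Prod>e\<in>entry_index n. emeasure (entry_law P n H W1 W2 e) (A e))"
 proof -
  have "emeasure (entry_law P n H W1 W2 e) (A e) = ennreal (prob (noise_entry_of H W1 W2 e -` A e \<inter> space P))" if "e \<in> entry_index n" for e
   using that Ab[OF that] noise_entry_of_measurable[OF that] by (simp add: entry_law_def emeasure_distr emeasure_eq_measure)
  thus ?thesis by (simp add: prod_ennreal)
 qed
 finally show "emeasure (distr P (PiM (entry_index n) (entry_law P n H W1 W2)) (noise_vector n H W1 W2)) (Pi\<^sub>E (entry_index n) A)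
  = (\<Prod>e\<in>entry_index n. emeasure (entry_law P n H W1 W2 e) (A e))" .
qed

lemma sample_H_noise_vector: "om \<in> space P \<Longrightarrow> sample_H n (noise_vector n H W1 W2 om) = H om" using H unfolding asymmetric_noise_def
 by (intro eq_matI) (auto simp: sample_H_def noise_vector_def noise_entry_of_def entry_index_def matsD)

lemma sample_W_noise_vector:
 assumes om: "om \<in> space P" shows "sample_W n 1 (noise_vector n H W1 W2 om) = W1 om" "sample_W n 2 (noise_vector n H W1 W2 om) = W2 om"
proof -
 have *: "sample_W n t (noise_vector n H W1 W2 om) = W"
  if W: "W \<in> mats n n" "tr W = W" and t: "t \<in> {1, 2}" "([H, W1, W2] ! t) om = W" for t W
 proof (rule eq_matI)
  fix i j assume "i < dim_row W" "j < dim_col W"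
  hence ij: "i < n" "j < n" using W by auto
  hence "W $$ (j, i) = tr W $$ (i, j)" using W(1) by simp
  hence sym: "W $$ (j, i) = W $$ (i, j)" by (simp add: W(2))
  show "sample_W n t (noise_vector n H W1 W2 om) $$ (i, j) = W $$ (i, j)"
   using ij sym t by (auto simp: sample_W_def noise_vector_def noise_entry_of_def entry_index_def)
 qed (use W in \<open>auto simp: sample_W_def matsD\<close>)
 show "sample_W n 1 (noise_vector n H W1 W2 om) = W1 om" "sample_W n 2 (noise_vector n H W1 W2 om) = W2 om"
  using *[of "W1 om" 1] *[of "W2 om" 2] W1 W2 om unfolding symmetric_noise_def by auto
qed

end

section \<open>Assembling the estimate\<close>

lemma row_norm_le_1:
 assumes Us: "Us \<in> mats n r" "tr Us * Us = 1\<^sub>m r" and i: "i < n" shows "(vec_l2 (Matrix.row Us i))^2 \<le> 1"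
proof -
 have "opb Us 1"
 proof (rule opbI[OF Us(1)])
  fix v :: "real Matrix.vec" assume v: "v \<in> vecs r"
  have Uv: "Us *\<^sub>v v \<in> vecs n" using Us(1) by simp
  show "vec_l2 (Us *\<^sub>v v) \<le> 1 * vec_l2 v" using Us v scalar_prod_mult_mat_vec[OF Us(1) Uv v] by (simp add: vec_l2_def assoc_mult_mat_vec[symmetric, of _ r n _ r])
 qed
 hence "opb (tr Us) 1" by (intro opb_transpose[OF _ Us(1)]) simp_all
 hence "vec_l2 (tr Us *\<^sub>v unit_vec n i) \<le> 1 * vec_l2 (unit_vec n i)" by (rule opbD[where n = r and m = n]) (use Us(1) in simp_all)
 hence "vec_l2 (Matrix.row Us i) \<le> 1" using i matsD[OF Us(1)] mat_mult_unit_vec[of i "tr Us"] by (simp add: vec_l2_def)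
 thus ?thesis using power_mono[of "vec_l2 (Matrix.row Us i)" 1 2] by simp
qed

lemma sum_row_norms:
 assumes Us: "Us \<in> mats n r" "tr Us * Us = 1\<^sub>m r" shows "(\<Sum>i<n. (vec_l2 (Matrix.row Us i))^2) = real r"
proof -
 note d = matsD[OF Us(1)]
 have "(\<Sum>i<n. (vec_l2 (Matrix.row Us i))^2) = (\<Sum>i<n. \<Sum>k<r. (Us $$ (i, k))^2)"
  unfolding vec_l2_sq by (simp add: scalar_prod_def d power2_eq_square lessThan_atLeast0)
 also have "... = (\<Sum>k<r. \<Sum>i<n. (Us $$ (i, k))^2)" by (rule sum.swap)
 also have "... = (\<Sum>k<r. (tr Us * Us) $$ (k, k))" by (intro sum.cong refl) (simp add: d scalar_prod_def power2_eq_square lessThan_atLeast0)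
 finally show ?thesis unfolding Us(2) by simp
qed

text \<open>The squared row norms sum to \<open>r\<close>, so their maximum is at least
  \<open>r / n\<close>; each of them is at most 1, so \<open>r \<le> n\<close>.\<close>

lemma incoherence_facts:
 assumes Us: "Us \<in> mats n r" "tr Us * Us = 1\<^sub>m r" and n: "0 < n" and r: "0 < r" shows "1 \<le> incoherence n r Us" "r \<le> n"
  "i < n \<Longrightarrow> vec_l2 (Matrix.row Us i) \<le> sqrt (incoherence n r Us * real r / real n)"
proof -
 let ?g = "\<lambda>i. (vec_l2 (Matrix.row Us i))^2"
 define m where "m = Max (?g ` {..<n})"
 have gm: "?g i \<le> m" if "i < n" for i unfolding m_def using that by simp
 have inc: "incoherence n r Us = real n / real r * m" by (simp add: incoherence_def m_def)
 have "real r = (\<Sum>i<n. ?g i)" by (rule sum_row_norms[OF Us, symmetric])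
 also have "... \<le> (\<Sum>i<n. m)" using gm by (intro sum_mono) simp
 finally show "1 \<le> incoherence n r Us" using r by (simp add: inc)
 have "real r \<le> (\<Sum>i<n. 1)" unfolding sum_row_norms[OF Us, symmetric] using row_norm_le_1[OF Us] by (intro sum_mono) simp
 thus "r \<le> n" by simp
 show "vec_l2 (Matrix.row Us i) \<le> sqrt (incoherence n r Us * real r / real n)" if "i < n"
  using gm[OF that] n r by (intro real_le_rsqrt) (simp add: inc)
qed

lemma mat_max_le:
 assumes "A \<in> mats n m" "0 < n" "0 < m" "\<And>i j. \<lbrakk>i < n; j < m\<rbrakk> \<Longrightarrow> \<bar>A $$ (i, j)\<bar> \<le> c"
 shows "mat_max A \<le> c"
proof -
 note d = matsD[OF assms(1)]
 have "elements_mat A = (\<lambda>(i, j). A $$ (i, j)) ` ({..<n} \<times> {..<m})" by (auto simp: d)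
 thus ?thesis unfolding mat_max_def using assms(2,3) assms(4) by (subst Max_le_iff) auto
qed

lemma eigengap_facts:
 assumes gap: "ereal g \<le> gap_min r ls" and r: "1 < r"
 shows "\<lbrakk>k < r; m < r; k \<noteq> m\<rbrakk> \<Longrightarrow> g \<le> \<bar>ls k - ls m\<bar>" and "0 < g \<Longrightarrow> 1 \<le> gap_ratio r ls"
proof -
 define h where "h l = Min ((\<lambda>k. \<bar>ls l - ls k\<bar>) ` ({..<r} - {l}))" for l
 have eg: "eigengap r ls l = ereal (h l)" for l using r by (simp add: eigengap_def h_def)
 have fin: "finite (eigengap r ls ` {..<r})" "eigengap r ls ` {..<r} \<noteq> {}" using r by auto
 have gh: "g \<le> h l" if "l < r" for l
 proof -
  have "gap_min r ls \<le> eigengap r ls l" unfolding gap_min_def using that by simp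
  hence "ereal g \<le> ereal (h l)" using gap unfolding eg by (rule order_trans[rotated])
  thus ?thesis by simp
 qed
 show "g \<le> \<bar>ls k - ls m\<bar>" if "k < r" "m < r" "k \<noteq> m"
 proof -
  have "h k \<le> \<bar>ls k - ls m\<bar>" unfolding h_def using that by simp
  thus ?thesis using gh[OF that(1)] by linarith
 qed
 assume g: "0 < g"
 have "gap_min r ls \<in> eigengap r ls ` {..<r}" unfolding gap_min_def by (rule Min_in[OF fin])
 then obtain a where a: "a < r" "gap_min r ls = ereal (h a)" by (auto simp: eg)
 have "gap_max r ls \<in> eigengap r ls ` {..<r}" unfolding gap_max_def by (rule Max_in[OF fin])
 then obtain c where c: "c < r" "gap_max r ls = ereal (h c)" by (auto simp: eg)
 have "eigengap r ls a \<le> gap_max r ls" unfolding gap_max_def using a by simp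
 thus "1 \<le> gap_ratio r ls" using gh[OF a(1)] g by (simp add: gap_ratio_def a c eg)
qed

abbreviation (input) error_within where
 "error_within n r Us ls H W1 W2 \<epsilon> om \<equiv> let Ms = low_rank_mat r Us ls; M = Ms + H om; M1 = Ms + W1 om; M2 = Ms + W2 om in
  (\<exists>U lam. leading_eigenpairs n r M U lam) \<and>
  (\<forall>U lam. leading_eigenpairs n r M U lam \<longrightarrow>
   (\<exists>\<Psi>. is_correction r U lam M1 M2 \<Psi>) \<and>
   (\<forall>\<Psi>. is_correction r U lam M1 M2 \<Psi> \<longrightarrow> mat_max (U * \<Psi> * diag r lam * tr \<Psi> * tr U - Ms) \<le> \<epsilon>))"

text \<open>The good event lives on the product space; its preimage under the noise vector is an
  event of \<open>P\<close> with the same probability. The separation \<open>\<delta>\<close> is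
  taken to be the least value that the deterministic part admits.\<close>

lemma estimator_event:
 fixes n r p :: nat and Us :: "real mat" and ls :: "nat \<Rightarrow> real" and sg L rh l :: real
 defines "b0 \<equiv> sqrt (incoherence n r Us * real r / real n)" and "ka \<equiv> cond_num r ls"
 defines "e0 \<equiv> 64 * (sqrt l * sg + l * L * b0) + sg"
 assumes om: "observation_model P n r sgmin sg L Us ls H W1 W2" and n: "0 < n" and sgL: "sg \<le> L" and l: "1 \<le> l" "l \<le> real p"
  and rh_sg: "64 * sqrt (l * real n) * sg \<le> rh" and rh_L: "256 * l^2 * L \<le> rh"
  and rh_norm: "32 * sqrt (real p * (4 * real n * sg^2 + l * L^2)) \<le> rh" and rh_tail: "2 * rh * (1 / 8) ^ n \<le> sg"
  and lmin: "64 * rh \<le> lam_min r ls" and small: "10000 * ka * (real r * sqrt (real r)) * e0 \<le> lam_min r ls"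
  and gap: "\<And>k m. \<lbrakk>k < r; m < r; k \<noteq> m\<rbrakk> \<Longrightarrow> 1000 * ka * (real r * sqrt (real r)) * e0 \<le> \<bar>ls k - ls m\<bar>"
 shows "\<exists>A \<in> sets P. measure P A \<ge> 1 - 30 * (real n) ^ 4 * exp (- l) \<and>
  (\<forall>om\<in>A. error_within n r Us ls H W1 W2 (400000 * (b0^2 * (ka * real r * e0) + b0 * (ka * sqrt (real r) * e0) + ka * real r * e0^2 / lam_min r ls)) om)"
proof -
 have P: "prob_space P" and lr: "low_rank_factors n r Us ls" and sg: "0 < sg"
  and H: "asymmetric_noise P n sgmin sg L H" and W1: "symmetric_noise P n sgmin sg L W1" and W2: "symmetric_noise P n sgmin sg L W2"
  and ind: "independent_matrices P n [H, W1, W2]" using om unfolding observation_model_def by simp_all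
 have r: "0 < r" and Us: "Us \<in> mats n r" "tr Us * Us = 1\<^sub>m r"
  and mono: "\<And>k m. \<lbrakk>k \<le> m; m < r\<rbrakk> \<Longrightarrow> \<bar>ls m\<bar> \<le> \<bar>ls k\<bar>" and pos: "0 < \<bar>ls (r - 1)\<bar>"
  using lr unfolding low_rank_factors_def by auto
 note ctx = P n H W1 W2 ind sg sgL
 let ?mu = "entry_law P n H W1 W2" and ?X = "noise_vector n H W1 W2"
 note inc = incoherence_facts[OF Us n r]
 have row: "vec_l2 (Matrix.row Us i) \<le> b0" if "i < n" for i unfolding b0_def by (rule inc(3)[OF that])
 have b0: "0 \<le> b0" using inc(1) by (simp add: b0_def)
 have entry: "\<bar>Us $$ (i, k)\<bar> \<le> b0" if "i < n" "k < r" for i k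
  using vec_index_le_l2[of k "Matrix.row Us i"] row[OF that(1)] that matsD[OF Us(1)] by simp
 interpret N: noise_sample n ?mu sg L r Us b0 l rh p
 proof (rule noise_sample.intro[OF symmetric_product_entry_law[OF ctx] noise_sample_axioms.intro])
  show "1 \<le> n" using n by simp
 qed (rule inc(2) Us entry b0 l rh_sg rh_L rh_norm rh_tail; assumption?)+
 have Ne0: "N.e0 = e0" unfolding N.e0_def N.T_def e0_def by simp
 let ?N = "PiM (entry_index n) ?mu"
 obtain E where E: "E \<in> sets ?N" and E': "measure ?N (space ?N - E) \<le> 30 * (real n) ^ 4 * exp (- l) \<and> (\<forall>om\<in>E. N.good om)"
  using N.good_event by (rule bexE)
 define A where "A = ?X -` E \<inter> space P"
 have Xm: "?X \<in> P \<rightarrow>\<^sub>M ?N" by (rule noise_vector_measurable[OF ctx])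
 have A: "A \<in> sets P" unfolding A_def by (rule measurable_sets[OF Xm E])
 have "measure P A = measure (distr P ?N ?X) E" unfolding A_def by (rule measure_distr[OF Xm E, symmetric])
 also have "... = measure ?N E" by (simp only: distr_noise_vector[OF ctx])
 finally have mA: "1 - 30 * (real n) ^ 4 * exp (- l) \<le> measure P A" using prob_space.prob_compl[OF N.prob_N E] conjunct1[OF E'] by linarith
 let ?lmin = "lam_min r ls" and ?lmax = "\<bar>ls 0\<bar>"
 have ka: "ka = ?lmax / ?lmin" by (simp add: ka_def cond_num_def lam_min_def)
 have lmin0: "0 < ?lmin" using pos by (simp add: lam_min_def)
 have ka1: "1 \<le> ka" using mono[of 0 "r - 1"] r lmin0 by (simp add: ka lam_min_def)
 have e0: "0 < e0" using N.e0_pos Ne0 by simp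
 have ev: "noise_event n r Us (H om) ls rh e0 ?lmin ?lmax (1000 * ka * (real r * sqrt (real r)) * e0) (W1 om) (W2 om) b0" if om: "om \<in> A" for om
 proof -
  have sp: "om \<in> space P" and g: "N.good (?X om)" using om conjunct2[OF E'] unfolding A_def by auto
  have "noise_event n r Us (sample_H n (?X om)) ls rh N.e0 ?lmin ?lmax (1000 * ka * (real r * sqrt (real r)) * e0)
   (sample_W n 1 (?X om)) (sample_W n 2 (?X om)) b0"
  proof (rule N.good_noise_event[OF g r])
   show "?lmin \<le> \<bar>ls k\<bar>" if "k < r" for k using mono[of k "r - 1"] that by (simp add: lam_min_def)
   show "\<bar>ls k\<bar> \<le> ?lmax" if "k < r" for k using mono[of 0 k] that by simp
   show "0 < 1000 * ka * (real r * sqrt (real r)) * e0" using ka1 r e0 by simp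
  qed (use lmin small gap row in \<open>simp_all add: Ne0 ka\<close>)
  thus ?thesis unfolding sample_H_noise_vector[OF ctx sp] sample_W_noise_vector[OF ctx sp] Ne0 .
 qed
 have "error_within n r Us ls H W1 W2 (400000 * (b0^2 * (ka * real r * e0) + b0 * (ka * sqrt (real r) * e0) + ka * real r * e0^2 / lam_min r ls)) om" if om: "om \<in> A" for om
 proof -
  interpret V: noise_event n r Us "H om" ls rh e0 ?lmin ?lmax "1000 * ka * (real r * sqrt (real r)) * e0" "W1 om" "W2 om" b0 by (rule ev[OF om])
  have Ms: "V.Ms = low_rank_mat r Us ls" by (simp add: V.Ms_def low_rank_mat_def)
  have Vka: "V.ka = ka" by (simp add: V.ka_def ka)
  have M: "V.M = low_rank_mat r Us ls + H om" by (simp add: V.M_def Ms)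
  have Msc: "low_rank_mat r Us ls \<in> mats n n" unfolding low_rank_mat_def using matsD[OF Us(1)] by simp
  show ?thesis unfolding Let_def
  proof (intro conjI allI impI)
   show "\<exists>U lam. leading_eigenpairs n r (low_rank_mat r Us ls + H om) U lam" using V.leading_eigenpairs_exist unfolding M .
   fix U lam assume lead: "leading_eigenpairs n r (low_rank_mat r Us ls + H om) U lam"
   note err = V.corrected_estimator_error[unfolded M, OF lead]
   show "\<exists>\<Psi>. is_correction r U lam (low_rank_mat r Us ls + W1 om) (low_rank_mat r Us ls + W2 om) \<Psi>" using err(1) unfolding Ms .
   fix \<Psi> assume \<Psi>: "is_correction r U lam (low_rank_mat r Us ls + W1 om) (low_rank_mat r Us ls + W2 om) \<Psi>"
   show "mat_max (U * \<Psi> * diag r lam * tr \<Psi> * tr U - low_rank_mat r Us ls)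
    \<le> 400000 * (b0^2 * (ka * real r * e0) + b0 * (ka * sqrt (real r) * e0) + ka * real r * e0^2 / lam_min r ls)"
   proof (rule mat_max_le[OF _ n n])
    show "U * \<Psi> * diag r lam * tr \<Psi> * tr U - low_rank_mat r Us ls \<in> mats n n" using Msc by simp
   qed (use err(2)[unfolded Ms Vka, OF \<Psi>] in blast)
  qed
 qed
 thus ?thesis using A mA by blast
qed

section \<open>Comparison of the parameters, with \<open>G\<close> for \<open>ln n\<close>,
  \<open>m\<close> for the incoherence and \<open>20 * G\<close> as the level\<close>

context
 fixes sg L C0 G m nn rr b0 e0 K1 :: real
 assumes sg: "0 < sg" and L: "0 \<le> L" and C0: "0 < C0" and G: "1 \<le> G" and m: "1 \<le> m" and nn: "1 \<le> nn" and rr: "1 \<le> rr"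
  and L_le: "L \<le> C0 * sg * sqrt (nn / (m * G))"
  and b0: "b0 = sqrt (m * rr / nn)" and e0: "e0 = 64 * (sqrt (20 * G) * sg + 20 * G * L * b0) + sg" and K1: "K1 = 400 + 1300 * C0"
begin

text \<open>The upper bound on \<open>L\<close> makes the range term comparable with the Gaussian
  one: \<open>G * L * b0\<close> is at most \<open>C0 * sg * sqrt (rr * G)\<close>. Rounding up the
  resulting constant gives \<open>K1\<close>.\<close>

lemma e0_bound: "e0 \<le> K1 * sg * sqrt (rr * G)"
proof -
 define S where "S = sqrt (rr * G)"
 have rG: "1 * 1 \<le> rr * G" using rr G by (intro mult_mono) auto
 hence S1: "1 \<le> S" by (simp add: S_def)
 have "sqrt (20 * G) \<le> sqrt (25 * (rr * G))" using rr G by simp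
 also have "... = 5 * S" by (simp add: S_def real_sqrt_mult[of 25])
 finally have s1: "sqrt (20 * G) * sg \<le> 5 * S * sg" using sg by simp
 have "L * b0 \<le> (C0 * sg * sqrt (nn / (m * G))) * b0" using L_le m rr nn by (intro mult_right_mono) (auto simp: b0)
 also have "... = C0 * sg * sqrt ((nn / (m * G)) * (m * rr / nn))" by (simp only: b0 real_sqrt_mult mult.assoc)
 finally have "G * (L * b0) \<le> G * (C0 * sg * sqrt (rr / G))" using nn m G by simp
 also have "... = C0 * sg * (G * sqrt (rr / G))" by simp
 also have "G * sqrt (rr / G) = S"
 proof -
  have "G = sqrt (G^2)" using G by simp
  hence "G * sqrt (rr / G) = sqrt (G^2 * (rr / G))" by (simp only: real_sqrt_mult)
  also have "G^2 * (rr / G) = rr * G" by (simp add: power2_eq_square)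
  finally show ?thesis by (simp add: S_def)
 qed
 finally have s2: "20 * G * L * b0 \<le> 20 * (C0 * sg * S)" by simp
 have s3: "sg \<le> sg * S" using S1 sg by simp
 have "e0 \<le> 320 * (sg * S) + 1280 * (C0 * (sg * S)) + sg * S" using s1 s2 s3 unfolding e0 by (simp add: algebra_simps)
 also have "... \<le> K1 * (sg * S)" unfolding K1 using C0 sg S1 by (simp add: algebra_simps)
 finally show ?thesis by (simp add: S_def)
qed

lemma b0_nonneg: "0 \<le> b0" using m rr nn by (simp add: b0)

lemma e0_pos: "0 < e0"
proof -
 have "0 \<le> sqrt (20 * G) * sg" "0 \<le> 20 * G * L * b0" using G sg L b0_nonneg by simp_all
 thus ?thesis unfolding e0 using sg by simp
qed

lemma K1_pos: "1 \<le> K1" using C0 by (simp add: K1)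

text \<open>The radius is \<open>102400 * Mx\<close>. The constant is \<open>256 * 20^2\<close>,
  from the condition that is quadratic in the level; the other conditions hold with room to
  spare.\<close>

lemma radius_bounds:
 defines "Mx \<equiv> max (sg * sqrt (nn * G ^ 3)) (L * G ^ 3)"
 assumes p: "p \<le> 20 * G + 1" "0 \<le> p" shows "64 * sqrt (20 * G * nn) * sg \<le> 102400 * Mx" "256 * (20 * G)^2 * L \<le> 102400 * Mx"
  "32 * sqrt (p * (4 * nn * sg^2 + 20 * G * L^2)) \<le> 102400 * Mx"
  "Mx \<le> (1 + C0) * sg * (sqrt nn * G ^ 3)" "0 < Mx" "sg * sqrt G \<le> Mx"
proof -
 have G3: "G \<le> G ^ 3" "G^2 \<le> G ^ 3" "1 \<le> G ^ 3" using power_increasing[of 1 3 G] power_increasing[of 2 3 G] G by simp_all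
 have M1: "sg * sqrt (nn * G ^ 3) \<le> Mx" and M2: "L * G ^ 3 \<le> Mx" by (simp_all add: Mx_def)
 have pos: "0 < sg * sqrt (nn * G ^ 3)" using sg nn G by simp
 thus M0: "0 < Mx" using M1 by linarith
 have "sqrt (20 * G * nn) \<le> sqrt (25 * (nn * G ^ 3))" using mult_right_mono[OF G3(1), of nn] nn G by simp
 also have "... = 5 * sqrt (nn * G ^ 3)" by (simp add: real_sqrt_mult[of 25])
 finally have "64 * (sqrt (20 * G * nn) * sg) \<le> 64 * (5 * sqrt (nn * G ^ 3) * sg)" using sg by simp
 thus "64 * sqrt (20 * G * nn) * sg \<le> 102400 * Mx" using M1 M0 by simp
 have "L * G^2 \<le> L * G ^ 3" using L G3 by (intro mult_left_mono) auto
 thus "256 * (20 * G)^2 * L \<le> 102400 * Mx" using M2 by (simp add: mult_ac)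
 have q1: "sg^2 * (nn * G ^ 3) \<le> Mx^2" using power_mono[OF M1 less_imp_le[OF pos], of 2] nn G by (simp add: power_mult_distrib)
 have q2: "L^2 * (G ^ 3)^2 \<le> Mx^2" using power_mono[OF M2, of 2] L G by (simp add: power_mult_distrib)
 have "p * (4 * nn * sg^2 + 20 * G * L^2) \<le> (21 * G) * (4 * nn * sg^2 + 20 * G * L^2)"
  using p G nn by (intro mult_right_mono add_nonneg_nonneg mult_nonneg_nonneg) auto
 also have "... = 84 * (sg^2 * (nn * G)) + 420 * (L^2 * G^2)" by (simp add: algebra_simps power2_eq_square)
 also have "... \<le> 84 * (sg^2 * (nn * G ^ 3)) + 420 * (L^2 * (G ^ 3)^2)" using G3 G nn by (intro add_mono mult_left_mono power_mono) auto
 also have "... \<le> 529 * Mx^2" using q1 q2 zero_le_power2[of Mx] by linarith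
 finally have "sqrt (p * (4 * nn * sg^2 + 20 * G * L^2)) \<le> sqrt (529 * Mx^2)" by simp
 also have "... = 23 * Mx" using M0 real_sqrt_abs[of "23 * Mx"] by simp
 finally show "32 * sqrt (p * (4 * nn * sg^2 + 20 * G * L^2)) \<le> 102400 * Mx" using M0 by simp
 have "sqrt (G ^ 3) \<le> G ^ 3"
 proof (rule real_le_lsqrt)
  show "G ^ 3 \<le> (G ^ 3)^2" using power_increasing[of 3 6 G] G by simp
 qed (use G in simp_all)
 hence "sg * sqrt (nn * G ^ 3) \<le> sg * (sqrt nn * G ^ 3)" unfolding real_sqrt_mult using sg nn by simp
 moreover have "L * G ^ 3 \<le> C0 * sg * (sqrt nn * G ^ 3)"
 proof -
  have "1 * 1 \<le> m * G" using m G by (intro mult_mono) auto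
  hence "C0 * sg * sqrt (nn / (m * G)) \<le> C0 * sg * sqrt nn" using nn C0 sg by (simp add: divide_le_eq)
  thus ?thesis using L_le G by simp
 qed
 moreover have "0 \<le> sg * (sqrt nn * G ^ 3)" "0 \<le> C0 * sg * (sqrt nn * G ^ 3)" using C0 sg nn G by simp_all
 ultimately show "Mx \<le> (1 + C0) * sg * (sqrt nn * G ^ 3)" unfolding Mx_def by (simp add: distrib_right)
 have "1 * G \<le> nn * G ^ 3" using nn G G3 by (intro mult_mono) auto
 hence "sg * sqrt G \<le> sg * sqrt (nn * G ^ 3)" using sg by simp
 thus "sg * sqrt G \<le> Mx" using M1 by linarith
qed

text \<open>The factor \<open>sqrt rr\<close> in the bound on \<open>e0\<close> raises the power 3/2
  of \<open>rr\<close> to the square that appears in the gap condition.\<close>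

lemma scaled_e0_bound:
 assumes ka: "1 \<le> ka" shows "ka * (rr * sqrt rr) * e0 \<le> K1 * (ka * rr^2 * sg * sqrt G)"
proof -
 have "ka * (rr * sqrt rr) * e0 \<le> ka * (rr * sqrt rr) * (K1 * sg * sqrt (rr * G))" using e0_bound ka rr by simp
 also have "... = K1 * (ka * (rr * (sqrt rr * sqrt rr)) * sg * sqrt G)" by (simp only: real_sqrt_mult mult_ac)
 also have "sqrt rr * sqrt rr = rr" using rr by simp
 finally show ?thesis by (simp only: power2_eq_square mult.assoc)
qed

text \<open>The term with \<open>b0^2\<close> goes into the second part of the bound, the other two
  into the first: the mixed one directly, the one with \<open>e0^2\<close> through the lower bound
  on \<open>lmin\<close>.\<close>

lemma final_error_bound:
 assumes ka: "1 \<le> ka" and g: "1 \<le> g" and lmin: "sg * sqrt (nn * G ^ 3) \<le> lmin"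
 shows "b0^2 * (ka * rr * e0) + b0 * (ka * sqrt rr * e0) + ka * rr * e0^2 / lmin
  \<le> (K1 + K1^2) * (sg * ka^2 * rr^2 * sqrt (m * G ^ 7 / nn) + m / nn * g * sg * ka ^ 3 * rr ^ 3 * sqrt (G ^ 7))"
proof -
 define X1 where "X1 = sg * ka^2 * rr^2 * sqrt (m * G ^ 7 / nn)"
 define X2 where "X2 = m / nn * g * sg * ka ^ 3 * rr ^ 3 * sqrt (G ^ 7)"
 have X0: "0 \<le> X1" "0 \<le> X2" using sg ka rr m nn g G by (simp_all add: X1_def X2_def)
 have K0: "0 \<le> K1" using K1_pos by simp
 have sr: "sqrt rr \<le> rr" using rr by (intro real_le_lsqrt) (auto simp: power2_eq_square)
 have sG: "sqrt G \<le> sqrt (G ^ 7)" using power_increasing[of 1 7 G] G by simp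
 have ka2: "ka \<le> ka^2" "ka \<le> ka ^ 3" using power_increasing[of 1 2 ka] power_increasing[of 1 3 ka] ka by simp_all
 have b02: "b0^2 = m / nn * rr" using m rr nn by (simp add: b0)
 have t1: "b0^2 * (ka * rr * e0) \<le> K1 * X2"
 proof -
  have "b0^2 * (ka * rr * e0) \<le> b0^2 * (ka * rr * (K1 * sg * sqrt (rr * G)))" using e0_bound ka rr by (intro mult_left_mono) auto
  also have "... = (K1 * sg * (m / nn) * rr^2) * (ka * (sqrt rr * sqrt G))" unfolding b02 by (simp add: real_sqrt_mult power2_eq_square)
  also have "... \<le> (K1 * sg * (m / nn) * rr^2) * (ka ^ 3 * (rr * sqrt (G ^ 7)))"
   using ka2 sr sG ka rr G K0 sg m nn by (intro mult_left_mono mult_mono) auto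
  also have "... = 1 * (K1 * (m / nn * sg * ka ^ 3 * rr ^ 3 * sqrt (G ^ 7)))" by (simp add: power2_eq_square power3_eq_cube)
  also have "... \<le> g * (K1 * (m / nn * sg * ka ^ 3 * rr ^ 3 * sqrt (G ^ 7)))" using g K0 sg ka rr m nn G by (intro mult_right_mono) auto
  finally show ?thesis by (simp add: X2_def mult_ac)
 qed
 have s7: "sqrt (m * G / nn) \<le> sqrt (m * G ^ 7 / nn)"
  using power_increasing[of 1 7 G] G m nn by (intro real_sqrt_le_mono divide_right_mono mult_left_mono) auto
 have t2: "b0 * (ka * sqrt rr * e0) \<le> K1 * X1"
 proof -
  have "b0 * (ka * sqrt rr * e0) \<le> b0 * (ka * sqrt rr * (K1 * sg * sqrt (rr * G)))"
   using e0_bound ka rr b0_nonneg by (intro mult_left_mono) auto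
  also have "... = K1 * sg * ka * (sqrt rr * sqrt rr) * (b0 * sqrt G)" by (simp add: real_sqrt_mult)
  also have "sqrt rr * sqrt rr = rr" using rr by simp
  also have "b0 * sqrt G = sqrt rr * sqrt (m * G / nn)" unfolding b0 real_sqrt_mult[symmetric] by simp
  also have "K1 * sg * ka * rr * (sqrt rr * sqrt (m * G / nn)) = (K1 * sg * rr) * (ka * (sqrt rr * sqrt (m * G / nn)))" by simp
  also have "... \<le> (K1 * sg * rr) * (ka^2 * (rr * sqrt (m * G ^ 7 / nn)))"
   using ka2 sr s7 rr G K0 sg m nn by (intro mult_left_mono mult_mono) auto
  finally show ?thesis by (simp add: X1_def power2_eq_square mult_ac)
 qed
 have t3: "ka * rr * e0^2 / lmin \<le> K1^2 * X1"
 proof -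
  have pos: "0 < sg * sqrt (nn * G ^ 3)" using sg nn G by simp
  have "e0^2 \<le> (K1 * sg * sqrt (rr * G))^2" using e0_bound e0_pos by simp
  also have "... = K1^2 * sg^2 * (rr * G)" using rr G by (simp add: power_mult_distrib)
  finally have "ka * rr * e0^2 / lmin \<le> ka * rr * (K1^2 * sg^2 * (rr * G)) / (sg * sqrt (nn * G ^ 3))"
   using lmin pos ka rr G by (intro frac_le mult_nonneg_nonneg) auto
  also have "... = K1^2 * sg * ka * rr^2 * (G / sqrt (nn * G ^ 3))" by (simp add: power2_eq_square)
  also have "... \<le> K1^2 * sg * ka^2 * rr^2 * sqrt (m * G ^ 7 / nn)"
  proof (intro mult_mono mult_left_mono mult_right_mono)
   have "G / sqrt (nn * G ^ 3) = sqrt (G^2 / (nn * G ^ 3))" using G by (simp add: real_sqrt_divide)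
   also have "... \<le> sqrt (m * G ^ 7 / nn)"
   proof (rule real_sqrt_le_mono)
    have "G^2 / (nn * G ^ 3) \<le> 1 / nn" using G nn power_increasing[of 2 3 G] by (simp add: field_simps)
    also have "1 * 1 \<le> m * G ^ 7" using m G by (intro mult_mono) auto
    hence "1 / nn \<le> m * G ^ 7 / nn" using nn by (intro divide_right_mono) auto
    finally show "G^2 / (nn * G ^ 3) \<le> m * G ^ 7 / nn" .
   qed
   finally show "G / sqrt (nn * G ^ 3) \<le> sqrt (m * G ^ 7 / nn)" .
  qed (use ka2 ka sg rr G nn in auto)
  finally show ?thesis by (simp add: X1_def)
 qed
 have "b0^2 * (ka * rr * e0) + b0 * (ka * sqrt rr * e0) + ka * rr * e0^2 / lmin \<le> K1 * X2 + K1 * X1 + K1^2 * X1 + K1^2 * X2"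
  using t1 t2 t3 X0 by (simp add: add_increasing2)
 also have "... = (K1 + K1^2) * (X1 + X2)" by (simp add: algebra_simps)
 finally show ?thesis unfolding X1_def X2_def .
qed

end

theorem theorem19:
  shows "\<forall>C0 > 0. \<forall>c_lo > 0. \<forall>c_hi > 0. \<exists>C > 0. \<exists>C1 > 0. \<exists>C2 > 0. \<exists>n0. \<forall>n \<ge> n0.
    \<forall>r \<sigma>min \<sigma> L Us ls (P :: 'a measure) H W1 W2.
      observation_model P n r \<sigma>min \<sigma> L Us ls H W1 W2 \<longrightarrow>
      c_lo \<le> \<sigma>\<^sup>2 / \<sigma>min\<^sup>2 \<longrightarrow> \<sigma>\<^sup>2 / \<sigma>min\<^sup>2 \<le> c_hi \<longrightarrow>
      \<sigma> \<le> L \<longrightarrow>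
      L \<le> C0 * \<sigma> * sqrt (real n / (incoherence n r Us * ln (real n))) \<longrightarrow>
      lam_min r ls \<ge> C * max (\<sigma> * sqrt (real n * ln (real n)^3)) (L * ln (real n)^3) \<longrightarrow>
      gap_min r ls \<ge> ereal (C * cond_num r ls^3 * real r^2 *
        max (incoherence n r Us * L * ln (real n)^5 / real n)
            (\<sigma> * ln (real n) powr (7/2))) \<longrightarrow>
      (\<exists>A \<in> sets P. measure P A \<ge> 1 - C2 / real n^16 \<and>
        (\<forall>\<omega>\<in>A. let Ms = low_rank_mat r Us ls; M = Ms + H \<omega>; M1 = Ms + W1 \<omega>; M2 = Ms + W2 \<omega> in
          (\<exists>U lam. leading_eigenpairs n r M U lam) \<and>
          (\<forall>U lam. leading_eigenpairs n r M U lam \<longrightarrow>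
            (\<exists>\<Psi>. is_correction r U lam M1 M2 \<Psi>) \<and>
            (\<forall>\<Psi>. is_correction r U lam M1 M2 \<Psi> \<longrightarrow>
              mat_max (U * \<Psi> * mat_diag r lam * transpose_mat \<Psi> * transpose_mat U - Ms)
                \<le> C1 * error_bound n r \<sigma> Us ls))))"
proof (intro allI impI)
 fix C0 c_lo c_hi :: real
 assume C0: "0 < C0"
 define K1 where "K1 = 400 + 1300 * C0"
 \<comment> \<open>\<open>6553600 = 64 * 102400\<close> makes the least eigenvalue at least 64 times
   the radius; \<open>20000 * K1\<close> serves both smallness conditions on \<open>e0\<close>, the
   one against \<open>lam_min\<close> and the one against the gaps.\<close>
 define C where "C = 6553600 + 20000 * K1"
 define C1 where "C1 = 400000 * (K1 + K1^2)"
 have K1: "1 \<le> K1" using C0 by (simp add: K1_def)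
 have C: "0 < C" "6553600 \<le> C" "20000 * K1 \<le> C" using K1 by (simp_all add: C_def)
 have C1: "0 < C1" using K1 by (simp add: C1_def add_pos_nonneg)
 \<comment> \<open>The truncation error of the expansions has to fall below \<open>sg\<close> for
   all admissible values of the other parameters at once; after division by \<open>sg\<close> only
   \<open>n\<close> and \<open>C0\<close> remain.\<close>
 have "eventually (\<lambda>n::nat. 204800 * ((1 + C0) * (sqrt (real n) * ln (real n) ^ 3)) * (1 / 8) ^ n \<le> 1) at_top" by real_asymp
 then obtain n1 where n1: "\<And>n. n1 \<le> n \<Longrightarrow> 204800 * ((1 + C0) * (sqrt (real n) * ln (real n) ^ 3)) * (1 / 8) ^ n \<le> 1"
  unfolding eventually_at_top_linorder by blast
 have main: "\<exists>A \<in> sets P. measure P A \<ge> 1 - 30 / real n^16 \<and>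
    (\<forall>om\<in>A. error_within n r Us ls H W1 W2 (C1 * error_bound n r sg Us ls) om)"
  if n: "max 3 n1 \<le> n" and om: "observation_model P n r sgmin sg L Us ls H W1 W2" and sgL: "sg \<le> L"
   and L_le: "L \<le> C0 * sg * sqrt (real n / (incoherence n r Us * ln (real n)))"
   and lmin: "lam_min r ls \<ge> C * max (sg * sqrt (real n * ln (real n)^3)) (L * ln (real n)^3)"
   and gapmin: "gap_min r ls \<ge> ereal (C * cond_num r ls^3 * real r^2 *
    max (incoherence n r Us * L * ln (real n)^5 / real n) (sg * ln (real n) powr (7/2)))"
  for n r sgmin sg L Us ls and P :: "'a measure" and H W1 W2
 proof -
  define G where "G = ln (real n)"
  define m where "m = incoherence n r Us"
  define ka where "ka = cond_num r ls"
  define b0 where "b0 = sqrt (m * real r / real n)"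
  define l where "l = 20 * G"
  define e0 where "e0 = 64 * (sqrt l * sg + l * L * b0) + sg"
  define Mx where "Mx = max (sg * sqrt (real n * G ^ 3)) (L * G ^ 3)"
  define p where "p = nat \<lceil>l\<rceil>"
  have sg: "0 < sg" and lr: "low_rank_factors n r Us ls" using om by (simp_all add: observation_model_def)
  have r: "0 < r" and Us: "Us \<in> carrier_mat n r" "tr Us * Us = 1\<^sub>m r"
   and mono: "\<And>k m. \<lbrakk>k \<le> m; m < r\<rbrakk> \<Longrightarrow> \<bar>ls m\<bar> \<le> \<bar>ls k\<bar>" and pos: "0 < \<bar>ls (r - 1)\<bar>"
   using lr unfolding low_rank_factors_def by auto
  have n3: "3 \<le> real n" "0 < n" using n by auto
  have G: "1 \<le> G"
  proof -
   have "ln (exp 1) \<le> ln (real n)" using exp_le n3 by (intro ln_mono) auto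
   thus ?thesis by (simp add: G_def)
  qed
  have m: "1 \<le> m" unfolding m_def by (rule incoherence_facts(1)[OF Us n3(2) r])
  have rr: "1 \<le> real r" and nn: "1 \<le> real n" using r n3 by simp_all
  have L: "0 \<le> L" using sg sgL by simp
  have lmin0: "0 < lam_min r ls" using pos by (simp add: lam_min_def)
  have ls0: "lam_min r ls \<le> \<bar>ls 0\<bar>" using mono[of 0 "r - 1"] r by (simp add: lam_min_def)
  have kal: "ka * lam_min r ls = \<bar>ls 0\<bar>" using lmin0 by (simp add: ka_def cond_num_def lam_min_def)
  have ka: "1 \<le> ka" using ls0 lmin0 by (simp add: ka_def cond_num_def lam_min_def)
  have L_le': "L \<le> C0 * sg * sqrt (real n / (m * G))" using L_le by (simp add: m_def G_def)
  note par = sg L C0 G m nn rr L_le' b0_def e0_def[unfolded l_def] K1_def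
  have pl: "real p \<le> 20 * G + 1" "0 \<le> real p" "l \<le> real p"
  proof -
   show "real p \<le> 20 * G + 1" "0 \<le> real p" "l \<le> real p" using G by (simp_all add: l_def p_def)
  qed
  note rad = radius_bounds[OF par pl(1,2), folded Mx_def]
  have lm: "C * Mx \<le> lam_min r ls" using lmin by (simp add: Mx_def G_def)
  have sc: "ka * (real r * sqrt (real r)) * e0 \<le> K1 * (ka * (real r)^2 * sg * sqrt G)" by (rule scaled_e0_bound[OF par ka])
  define Y where "Y = ka * (real r)^2 * sg * sqrt G"
  have Y0: "0 \<le> Y" using ka sg G by (simp add: Y_def)
  have sc': "1000 * ka * (real r * sqrt (real r)) * e0 \<le> 1000 * (K1 * Y)" "10000 * ka * (real r * sqrt (real r)) * e0 \<le> 10000 * (K1 * Y)"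
   using sc by (simp_all add: Y_def)
  have KC: "20000 * (K1 * Y) \<le> C * Y" using mult_right_mono[OF C(3) Y0] by simp
  have KY0: "0 \<le> K1 * Y" using K1 Y0 by simp
  have gapY: "ka * (C * Y) \<le> \<bar>ls k - ls q\<bar>" if "1 < r" "k < r" "q < r" "k \<noteq> q" for k q
  proof -
   have "sqrt G = G powr (1/2)" using G by (simp add: powr_half_sqrt)
   also have "... \<le> G powr (7/2)" using G by (intro powr_mono) auto
   finally have "sg * sqrt G \<le> sg * G powr (7/2)" using sg by simp
   hence le: "sg * sqrt G \<le> max (m * L * G ^ 5 / real n) (sg * G powr (7/2))" by simp
   have "C * ka^2 * (real r)^2 \<le> C * ka ^ 3 * (real r)^2" using power_increasing[of 2 3 ka] ka C(1) by (intro mult_right_mono mult_left_mono) auto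
   from this le have "(C * ka^2 * (real r)^2) * (sg * sqrt G) \<le> (C * ka ^ 3 * (real r)^2) * max (m * L * G ^ 5 / real n) (sg * G powr (7/2))"
    by (rule mult_mono) (use C(1) ka sg G in auto)
   also have "... \<le> \<bar>ls k - ls q\<bar>" by (rule eigengap_facts(1)[OF gapmin[folded m_def G_def ka_def] that])
   finally show ?thesis by (simp add: Y_def power2_eq_square mult_ac)
  qed
  \<comment> \<open>For \<open>1 < r\<close> any gap is at most twice the largest eigenvalue, hence
    at most \<open>2 * ka * lam_min r ls\<close>, so the gap condition also bounds \<open>e0\<close>
    against \<open>lam_min\<close>. For \<open>r = 1\<close> the gap is infinite and the condition
    on \<open>lam_min\<close> is used directly.\<close>
  have small: "10000 * ka * (real r * sqrt (real r)) * e0 \<le> lam_min r ls"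
  proof (cases "1 < r")
   case True
   have "ka * (C * Y) \<le> 2 * \<bar>ls 0\<bar>" using gapY[OF True, of 0 1] mono[of 0 1] True by linarith
   also have "... = ka * (2 * lam_min r ls)" using kal by simp
   finally have "C * Y \<le> 2 * lam_min r ls" using ka by simp
   thus ?thesis using sc'(2) KC by linarith
  next
   case False
   hence r1: "r = 1" using r by simp
   hence "C * Y \<le> C * Mx" using pos rad(6) C(1) by (simp add: Y_def ka_def cond_num_def)
   thus ?thesis using sc'(2) KC KY0 lm by linarith
  qed
  have gap: "1000 * ka * (real r * sqrt (real r)) * e0 \<le> \<bar>ls k - ls q\<bar>" if "k < r" "q < r" "k \<noteq> q" for k q
  proof -
   have "ka * (C * Y) \<le> \<bar>ls k - ls q\<bar>" by (rule gapY) (use that in auto)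
   moreover have "1 * (C * Y) \<le> ka * (C * Y)" using ka C(1) Y0 by (intro mult_right_mono) auto
   ultimately show ?thesis using sc'(1) KC by linarith
  qed
  have tail: "2 * (102400 * Mx) * (1 / 8) ^ n \<le> sg"
  proof -
   have "2 * (102400 * Mx) * (1 / 8) ^ n \<le> 2 * (102400 * ((1 + C0) * sg * (sqrt (real n) * G ^ 3))) * (1 / 8) ^ n" using rad(4) by simp
   also have "... = (204800 * ((1 + C0) * (sqrt (real n) * G ^ 3)) * (1 / 8) ^ n) * sg" by simp
   also have "... \<le> 1 * sg" using n1[of n] n sg by (intro mult_right_mono) (auto simp: G_def)
   finally show ?thesis by simp
  qed
  have l64: "64 * (102400 * Mx) \<le> lam_min r ls"
  proof -
   have "6553600 * Mx \<le> C * Mx" using C(2) rad(5) by simp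
   thus ?thesis using lm by linarith
  qed
  have lmin': "sg * sqrt (real n * G ^ 3) \<le> lam_min r ls" using l64 rad(5) by (simp add: Mx_def)
  have gr: "1 \<le> gap_ratio r ls"
  proof (cases "1 < r")
   case True
   have "0 < sg * G powr (7/2)" using sg G by simp
   hence "0 < C * ka ^ 3 * (real r)^2 * max (m * L * G ^ 5 / real n) (sg * G powr (7/2))" using C(1) ka r by simp
   thus ?thesis by (rule eigengap_facts(2)[OF gapmin[folded m_def G_def ka_def] True])
  qed (simp add: gap_ratio_def)
  have exp: "30 * (real n) ^ 4 * exp (- l) = 30 / real n ^ 16"
  proof -
   have "exp l = exp G ^ 20" unfolding l_def by (simp flip: exp_of_nat_mult)
   also have "exp G = real n" using n3 by (simp add: G_def)
   also have "real n ^ 20 = real n ^ 4 * real n ^ 16" by simp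
   finally have "exp (- l) = 1 / (real n ^ 4 * real n ^ 16)" by (simp only: exp_minus inverse_eq_divide)
   moreover have "real n ^ 4 \<noteq> 0" using n3 by simp
   ultimately show ?thesis by (simp only: times_divide_eq_right mult_1_right mult.commute[of 30] nonzero_mult_divide_mult_cancel_left not_False_eq_True)
  qed
  have l1: "1 \<le> l" using G by (simp add: l_def)
  have err: "400000 * (b0^2 * (ka * real r * e0) + b0 * (ka * sqrt (real r) * e0) + ka * real r * e0^2 / lam_min r ls)
   \<le> C1 * error_bound n r sg Us ls"
  proof -
   have "b0^2 * (ka * real r * e0) + b0 * (ka * sqrt (real r) * e0) + ka * real r * e0^2 / lam_min r ls
    \<le> (K1 + K1^2) * error_bound n r sg Us ls"
    using final_error_bound[OF par ka gr lmin'] unfolding error_bound_def Let_def m_def[symmetric] G_def[symmetric] ka_def[symmetric] .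
   thus ?thesis unfolding C1_def mult.assoc by simp
  qed
  have r64: "64 * sqrt (l * real n) * sg \<le> 102400 * Mx" "256 * l^2 * L \<le> 102400 * Mx"
   "32 * sqrt (real p * (4 * real n * sg^2 + l * L^2)) \<le> 102400 * Mx" unfolding l_def by (rule rad(1), rule rad(2), rule rad(3))
  from estimator_event[OF om n3(2) sgL l1 pl(3) r64 tail l64, folded m_def b0_def ka_def, folded b0_def, folded e0_def, OF small gap]
  obtain A where A: "A \<in> sets P" and A': "1 - 30 * (real n) ^ 4 * exp (- l) \<le> measure P A \<and>
    (\<forall>om\<in>A. error_within n r Us ls H W1 W2 (400000 * (b0^2 * (ka * real r * e0) + b0 * (ka * sqrt (real r) * e0) + ka * real r * e0^2 / lam_min r ls)) om)" by (rule bexE)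
  show ?thesis
  proof (rule bexI[OF _ A], intro conjI ballI)
   show "1 - 30 / real n ^ 16 \<le> measure P A" using conjunct1[OF A'] unfolding exp .
   fix om assume om: "om \<in> A"
   note res = bspec[OF conjunct2[OF A'] om, unfolded Let_def]
   show "error_within n r Us ls H W1 W2 (C1 * error_bound n r sg Us ls) om" unfolding Let_def
   proof (intro conjI allI impI)
    show "\<exists>U lam. leading_eigenpairs n r (low_rank_mat r Us ls + H om) U lam" by (rule conjunct1[OF res])
    fix U lam assume lead: "leading_eigenpairs n r (low_rank_mat r Us ls + H om) U lam"
    note res' = mp[OF spec[OF spec[OF conjunct2[OF res]]] lead]
    show "\<exists>\<Psi>. is_correction r U lam (low_rank_mat r Us ls + W1 om) (low_rank_mat r Us ls + W2 om) \<Psi>" by (rule conjunct1[OF res'])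
    fix \<Psi> assume "is_correction r U lam (low_rank_mat r Us ls + W1 om) (low_rank_mat r Us ls + W2 om) \<Psi>"
    from mp[OF spec[OF conjunct2[OF res']] this] err
    show "mat_max (U * \<Psi> * mat_diag r lam * tr \<Psi> * tr U - low_rank_mat r Us ls) \<le> C1 * error_bound n r sg Us ls"
     by simp
   qed
  qed
 qed
 show "\<exists>C > 0. \<exists>C1 > 0. \<exists>C2 > 0. \<exists>n0. \<forall>n \<ge> n0.
  \<forall>r sgmin sg L Us ls (P :: 'a measure) H W1 W2.
   observation_model P n r sgmin sg L Us ls H W1 W2 \<longrightarrow>
   c_lo \<le> sg^2 / sgmin^2 \<longrightarrow> sg\<^sup>2 / sgmin^2 \<le> c_hi \<longrightarrow>
   sg \<le> L \<longrightarrow>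
   L \<le> C0 * sg * sqrt (real n / (incoherence n r Us * ln (real n))) \<longrightarrow>
   lam_min r ls \<ge> C * max (sg * sqrt (real n * ln (real n)^3)) (L * ln (real n)^3) \<longrightarrow>
   gap_min r ls \<ge> ereal (C * cond_num r ls^3 * real r^2 *
    max (incoherence n r Us * L * ln (real n)^5 / real n)
      (sg * ln (real n) powr (7/2))) \<longrightarrow>
   (\<exists>A \<in> sets P. measure P A \<ge> 1 - C2 / real n^16 \<and>
    (\<forall>om\<in>A. error_within n r Us ls H W1 W2 (C1 * error_bound n r sg Us ls) om))"
  by (rule exI[of _ C], rule conjI[OF C(1)], rule exI[of _ C1], rule conjI[OF C1], rule exI[of _ 30], rule conjI, simp,
    rule exI[of _ "max 3 n1"], intro allI impI, rule main)
qed

end
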